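(* Let $F_1,F_2\subset\mathbb{Z}$ be any two infinite sets of integers. Then there are infinite subsets $Q\subset F_1$ and $P\subset F_2$ such that for some weakly mixing Poisson suspensions $T,T'$ the groups $H_P(T)$ and $H_Q(T')$ are ergodic, while the groups $H_P(T')$ and $H_Q(T)$ are trivial (equal to $\{I\}$). The same statement holds with "Gaussian suspensions" in place of "Poisson suspensions".
   Context: For an automorphism $T$ of a standard probability space $(X,\mu)$, let $G$ be the group of all automorphisms of $(X,\mu)$ (invertible bi-measurable $\mu$-preserving transformations, identified when equal $\mu$-a.e.), with identity $I$. For an infinite set $P\subset\mathbb{Z}$, $$H_P(T)=\{S\in G:\ T^{-n}ST^{n}\to I,\ n\in P,\ n\to\infty\},$$ where convergence is strong operator convergence of the associated operators on $L_2(X,\mu)$, i.e. $R_n\to I$ means $\mu(R_nA\,\triangle\,A)\to0$ for every measurable $A$, and the limit is taken along $P$ as $|n|\to\infty$. A subgroup $H\subset G$ is ergodic if every measurable $A$ with $\mu(SA\,\triangle\,A)=0$ for all $S\in H$ satisfies $\mu(A)\in\{0,1\}$. Poisson suspension: let $T_0$ be an automorphism (invertible measure-preserving transformation) of a standard non-atomic $\sigma$-finite infinite measure space $(Y,m)$. Let $Y_*$ be the space of countable subsets (configurations) of $Y$ that are finite on a fixed exhausting sequence of finite-measure sets, equipped with the Poisson probability measure $m_*$: for disjoint finite-measure sets $A_1,\dots,A_r$ the counts $\omega\mapsto|\omega\cap A_i|$ are independent Poisson random variables with means $m(A_i)$. The Poisson suspension of $T_0$ is the automorphism of $(Y_*,m_*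 )$ given by $\omega\mapsto T_0\omega=\{T_0y:y\in\omega\}$. Gaussian suspension: let $\gamma$ be the product of standard Gaussian measures on $\mathbb{R}^{\mathbb{N}}$, and for $h\in \ell_2$ (real) put $\xi_h(x)=\sum_i h_ix_i\in L_2(\gamma)$. For each orthogonal operator $U$ on real $\ell_2$ there is a unique (mod $0$) automorphism $T_U$ of $(\mathbb{R}^{\mathbb{N}},\gamma)$ with $\xi_h\circ T_U=\xi_{U^{-1}h}$ for all $h\in\ell_2$. Gaussian suspensions (Gaussian automorphisms) are the automorphisms $T_U$. *)

theory Defs
  imports "HOL-Probability.Probability"
begin

section \<open>Automorphisms\<close>

text \<open>
  Elements of the automorphism group of a measure space are represented by everywhere defined
  maps; two of them are the same group element iff they agree almost everywhere, and every notion
  below is invariant under this identification.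
\<close>

definition automorphism :: "'a measure \<Rightarrow> ('a \<Rightarrow> 'a) \<Rightarrow> bool" where
  "automorphism M T \<longleftrightarrow>
     T \<in> measurable M M \<and> bij_betw T (space M) (space M) \<and>
     inv_into (space M) T \<in> measurable M M \<and> distr M M T = M"

definition int_power :: "'a measure \<Rightarrow> ('a \<Rightarrow> 'a) \<Rightarrow> int \<Rightarrow> 'a \<Rightarrow> 'a" where
  "int_power M T n =
     (if 0 \<le> n then T ^^ nat n else inv_into (space M) T ^^ nat (- n))"

definition weakly_mixing :: "'a measure \<Rightarrow> ('a \<Rightarrow> 'a) \<Rightarrow> bool" where
  "weakly_mixing M T \<longleftrightarrow>
     (\<forall>A\<in>sets M. \<forall>B\<in>sets M.
        (\<lambda>N. (\<Sum>n<N. \<bar>measure M (((T ^^ n) -` A \<inter> space M) \<inter> B) - measure M A * measure M B\<bar>) / real N)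
          \<longlonglongrightarrow> 0)"

definition tends_to_identity ::
  "'a measure \<Rightarrow> (int \<Rightarrow> 'a \<Rightarrow> 'a) \<Rightarrow> int filter \<Rightarrow> bool" where
  "tends_to_identity M R F \<longleftrightarrow>
     (\<forall>A\<in>sets M. ((\<lambda>n. measure M (sym_diff (R n ` A) A)) \<longlongrightarrow> 0) F)"

definition infinity_along :: "int set \<Rightarrow> int filter" where
  "infinity_along P = inf (filtercomap (\<lambda>n. \<bar>n\<bar>) at_top) (principal P)"

definition H_group :: "'a measure \<Rightarrow> int set \<Rightarrow> ('a \<Rightarrow> 'a) \<Rightarrow> ('a \<Rightarrow> 'a) set" where
  "H_group M P T =
     {S. automorphism M S \<and>
         tends_to_identity M (\<lambda>n. int_power M T (- n) \<circ> S \<circ> int_power M T n) (infinity_along P)}"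

text \<open>All representatives of the identity, i.e. the subgroup \<open>{I}\<close> of the automorphism group.\<close>

definition identity_class :: "'a measure \<Rightarrow> ('a \<Rightarrow> 'a) set" where
  "identity_class M = {S. automorphism M S \<and> (AE x in M. S x = x)}"

definition ergodic_group :: "'a measure \<Rightarrow> ('a \<Rightarrow> 'a) set \<Rightarrow> bool" where
  "ergodic_group M H \<longleftrightarrow>
     (\<forall>A\<in>sets M. (\<forall>S\<in>H. measure M (sym_diff (S ` A) A) = 0) \<longrightarrow> measure M A \<in> {0, 1})"


section \<open>Poisson suspensions\<close>

text \<open>Standard Borel: Borel isomorphic to a Borel subset of the real line.\<close>

definition standard_borel_space :: "'a measure \<Rightarrow> bool" where
  "standard_borel_space M \<longleftrightarrow>
     (\<exists>B\<in>sets (borel :: real measure). \<exists>f.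
        f \<in> measurable M (restrict_space borel B) \<and> bij_betw f (space M) B \<and>
        inv_into (space M) f \<in> measurable (restrict_space borel B) M)"

definition non_atomic :: "'a measure \<Rightarrow> bool" where
  "non_atomic M \<longleftrightarrow>
     (\<forall>A\<in>sets M. 0 < emeasure M A \<longrightarrow>
        (\<exists>B\<in>sets M. B \<subseteq> A \<and> 0 < emeasure M B \<and> emeasure M B < emeasure M A))"

definition standard_infinite_measure :: "'a measure \<Rightarrow> bool" where
  "standard_infinite_measure m \<longleftrightarrow>
     standard_borel_space m \<and> sigma_finite_measure m \<and> non_atomic m \<and> emeasure m (space m) = \<infinity>"

definition exhausting :: "'a measure \<Rightarrow> (nat \<Rightarrow> 'a set) \<Rightarrow> bool" where
  "exhausting m E \<longleftrightarrow>
     range E \<subseteq> sets m \<and> incseq E \<and> (\<Union>k. E k) = space m \<and> (\<forall>k. emeasure m (E k) < \<infinity>)"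

definition configurations :: "'a measure \<Rightarrow> (nat \<Rightarrow> 'a set) \<Rightarrow> 'a set set" where
  "configurations m E = {\<omega>. \<omega> \<subseteq> space m \<and> countable \<omega> \<and> (\<forall>k. finite (\<omega> \<inter> E k))}"

text \<open>
  The sigma-algebra on configurations generated by the counts. Since \<open>card\<close> is 0 on
  infinite sets, finiteness of \<open>\<omega> \<inter> A\<close> is mentioned explicitly here and below: a set \<open>A\<close> of finite
  measure need not lie in any \<open>E k\<close>, so it is only almost surely hit finitely often.
\<close>

definition configuration_events :: "'a measure \<Rightarrow> (nat \<Rightarrow> 'a set) \<Rightarrow> 'a set set set" where
  "configuration_events m E =
     sigma_sets (configurations m E)
       {{\<omega> \<in> configurations m E. finite (\<omega> \<inter> A) \<and> card (\<omega> \<inter> A) = n} | A n.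
          A \<in> sets m \<and> emeasure m A < \<infinity>}"

definition is_poisson_measure ::
  "'a measure \<Rightarrow> (nat \<Rightarrow> 'a set) \<Rightarrow> 'a set measure \<Rightarrow> bool" where
  "is_poisson_measure m E M \<longleftrightarrow>
     prob_space M \<and> space M = configurations m E \<and> sets M = configuration_events m E \<and>
     (\<forall>A\<in>sets m. emeasure m A < \<infinity> \<longrightarrow>
        (AE \<omega> in M. finite (\<omega> \<inter> A)) \<and>
        (\<forall>n. measure M {\<omega> \<in> space M. card (\<omega> \<inter> A) = n} =
               measure m A ^ n / fact n * exp (- measure m A))) \<and>
     (\<forall>r. \<forall>A :: nat \<Rightarrow> 'a set.
        (\<forall>i<r. A i \<in> sets m \<and> emeasure m (A i) < \<infinity>) \<longrightarrow> disjoint_family_on A {..<r} \<longrightarrow>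
        prob_space.indep_vars M (\<lambda>_. count_space UNIV) (\<lambda>i \<omega>. card (\<omega> \<inter> A i)) {..<r})"

text \<open>
  The image of a configuration under \<open>T0\<close> is a configuration only for almost every
  configuration, so the suspension is determined up to equality almost everywhere.
\<close>

definition poisson_suspension :: "'a set measure \<Rightarrow> ('a set \<Rightarrow> 'a set) \<Rightarrow> bool" where
  "poisson_suspension M T \<longleftrightarrow>
     (\<exists>(m :: 'a measure) E T0.
        standard_infinite_measure m \<and> exhausting m E \<and> automorphism m T0 \<and>
        is_poisson_measure m E M \<and>
        automorphism M T \<and> (AE \<omega> in M. T \<omega> = T0 ` \<omega>))"


section \<open>Gaussian suspensions\<close>

definition gaussian_space :: "(nat \<Rightarrow> real) measure" where
  "gaussian_space = PiM UNIV (\<lambda>_. density lborel std_normal_density)"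

definition ell2 :: "(nat \<Rightarrow> real) set" where
  "ell2 = {h. summable (\<lambda>i. (h i)\<^sup>2)}"

definition orthogonal_operator :: "((nat \<Rightarrow> real) \<Rightarrow> (nat \<Rightarrow> real)) \<Rightarrow> bool" where
  "orthogonal_operator U \<longleftrightarrow>
     bij_betw U ell2 ell2 \<and>
     (\<forall>h\<in>ell2. \<forall>k\<in>ell2. \<forall>a b :: real.
        U (\<lambda>i. a * h i + b * k i) = (\<lambda>i. a * U h i + b * U k i)) \<and>
     (\<forall>h\<in>ell2. \<forall>k\<in>ell2. (\<Sum>i. U h i * U k i) = (\<Sum>i. h i * k i))"

text \<open>A representative of the sum of the \<open>L\<^sub>2\<close>-convergent series with terms \<open>h i * x i\<close>.\<close>

definition gaussian_form :: "(nat \<Rightarrow> real) \<Rightarrow> (nat \<Rightarrow> real) \<Rightarrow> real" where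
  "gaussian_form h =
     (SOME f. f \<in> borel_measurable gaussian_space \<and>
        (\<lambda>n. \<integral>\<^sup>+ x. ennreal ((f x - (\<Sum>i<n. h i * x i))\<^sup>2) \<partial>gaussian_space) \<longlonglongrightarrow> 0)"

definition gaussian_suspension :: "((nat \<Rightarrow> real) \<Rightarrow> (nat \<Rightarrow> real)) \<Rightarrow> bool" where
  "gaussian_suspension T \<longleftrightarrow>
     automorphism gaussian_space T \<and>
     (\<exists>U. orthogonal_operator U \<and>
        (\<forall>h\<in>ell2. AE x in gaussian_space.
           gaussian_form h (T x) = gaussian_form (inv_into ell2 U h) x))"

end

theory Submission
  imports Defs
begin

text \<open>
  Thin \<open>F1\<close> and \<open>F2\<close> to one interlaced sequence \<open>u 0, v 0, u 1, v 1, \<dots>\<close> whose absolute values grow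
  fast, and let \<open>Q\<close> and \<open>P\<close> consist of the \<open>u k\<close> and of the \<open>v k\<close>. Suppose that \<open>T\<close> is the suspension of a
  measure preserving map (in the Gaussian case: an orthogonal operator) \<open>U\<close> with \<open>U\<^sup>n \<rightarrow> I\<close> along \<open>Q\<close>, and
  such that along \<open>P\<close> the map \<open>U\<^sup>n\<close> moves every bounded set off itself (respectively: \<open>U\<^sup>n \<rightarrow> 0\<close> weakly).
  Then \<open>T\<^sup>n \<rightarrow> I\<close> along \<open>Q\<close>, so \<open>T\<^sup>-\<^sup>n S T\<^sup>n \<rightarrow> I\<close> forces \<open>S = I\<close>. Along \<open>P\<close>, conjugation by \<open>T\<^sup>n\<close> trivializes the
  suspension of every transformation that acts only on a bounded part of the half line (on finitely
  many coordinates); the exchanges of \<open>[0, n)\<close> with \<open>[n, 2n)\<close> are of this kind, and their suspensions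
  are mixing as \<open>n \<rightarrow> \<infinity>\<close>, which makes \<open>H\<^sub>P(T)\<close> ergodic. Dispersion along \<open>P\<close> also yields many almost
  disjoint (almost orthogonal) translates, hence weak mixing.

  In the Poisson case \<open>U\<close> is a rank-one map of the half line whose \<open>k\<close>-th tower has height \<open>\<bar>u k\<bar>\<close> and whose
  spacers absorb a displacement by \<open>\<bar>v k\<bar>\<close>. In the Gaussian case \<open>U\<close> is an infinite tensor product of plane
  rotations by angles \<open>\<theta> k\<close> such that \<open>v k * \<theta> k\<close> is nearly an odd multiple of \<open>\<pi> / 2\<close> and all \<open>u j * \<theta> k\<close>
  are nearly multiples of \<open>2 \<pi>\<close>. For \<open>T'\<close> the two sequences exchange their roles.
\<close>

section \<open>Automorphisms\<close>

text \<open>Rigidity at the times \<open>u k\<close> and dispersion at the times \<open>v k\<close>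
  are competing demands on \<open>U\<close>. Interlacing separates them: stage \<open>k\<close>
  decides one pair of times, and the growth puts the stages on such different scales that later
  choices do not spoil earlier ones. The factor \<open>4 ^ Suc k\<close> serves both cases: it
  exceeds the \<open>k + 2\<close> columns of a tower and makes the errors of the angles summable.
  Signs in \<open>F1\<close> and \<open>F2\<close> are harmless, since both demands at a time
  \<open>n\<close> are equivalent to those at \<open>- n\<close>.

  Measure theory on the two large spaces is reduced to pi-systems with explicit correlations, void
  events and orthants. There the defect of mixing is bounded by an overlap of sets of the half line
  or by matrix coefficients in \<open>l2\<close>; one extension lemma, applied to Cesaro means and
  to ordinary limits, then gives weak mixing and ergodicity. The Poisson process is controlled
  through void probabilities alone, and the Poisson counts demanded by its definition are recovered
  from them. \<open>Q\<close> finally starts with \<open>u 1\<close>, because the construction of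
  \<open>T'\<close> begins with the pair \<open>v 0\<close>, \<open>u 1\<close>.\<close>

lemma automorphismD:
  assumes "automorphism M T"
  shows "T \<in> measurable M M" "bij_betw T (space M) (space M)"
    "inv_into (space M) T \<in> measurable M M" "distr M M T = M"
  using assms by (auto simp: automorphism_def)

lemma automorphism_in_space:
  assumes "automorphism M T" "x \<in> space M"
  shows "T x \<in> space M"
  using automorphismD(1)[OF assms(1)] assms(2) by (auto dest: measurable_space)

lemma automorphism_inv_left:
  assumes "automorphism M T" "x \<in> space M"
  shows "inv_into (space M) T (T x) = x"
  using automorphismD(2)[OF assms(1)] assms(2) by (auto simp: bij_betw_def)

lemma automorphism_inv_right:
  assumes "automorphism M T" "x \<in> space M"
  shows "T (inv_into (space M) T x) = x"
  using automorphismD(2)[OF assms(1)] assms(2) by (simp add: bij_betw_inv_into_right)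

lemma automorphism_image_eq:
  assumes "automorphism M T" "A \<subseteq> space M"
  shows "T ` A = inv_into (space M) T -` A \<inter> space M"
proof (intro set_eqI iffI)
  fix x assume "x \<in> T ` A"
  then show "x \<in> inv_into (space M) T -` A \<inter> space M"
    using automorphism_inv_left[OF assms(1)] automorphism_in_space[OF assms(1)] assms(2) by auto
next
  fix x assume "x \<in> inv_into (space M) T -` A \<inter> space M"
  then show "x \<in> T ` A"
    using automorphism_inv_right[OF assms(1), of x] by (auto intro!: image_eqI[of _ _ "inv_into (space M) T x"])
qed

lemma automorphism_image_sets:
  assumes "automorphism M T" "A \<in> sets M"
  shows "T ` A \<in> sets M"
  using measurable_sets[OF automorphismD(3)[OF assms(1)] assms(2)]
    automorphism_image_eq[OF assms(1)] sets.sets_into_space[OF assms(2)] by simp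

lemma automorphism_vimage_image:
  assumes "automorphism M T" "A \<subseteq> space M"
  shows "T -` (T ` A) \<inter> space M = A"
  using automorphismD(2)[OF assms(1)] assms(2) unfolding bij_betw_def inj_on_def by blast

lemma automorphism_emeasure_vimage:
  assumes "automorphism M T" "A \<in> sets M"
  shows "emeasure M (T -` A \<inter> space M) = emeasure M A"
  using emeasure_distr[OF automorphismD(1)[OF assms(1)] assms(2)] automorphismD(4)[OF assms(1)] by simp

lemma automorphism_emeasure_image:
  assumes "automorphism M T" "A \<in> sets M"
  shows "emeasure M (T ` A) = emeasure M A"
  using automorphism_emeasure_vimage[OF assms(1) automorphism_image_sets[OF assms]]
    automorphism_vimage_image[OF assms(1) sets.sets_into_space[OF assms(2)]] by simp

lemma automorphism_measure_vimage:
  assumes "automorphism M T" "A \<in> sets M"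
  shows "measure M (T -` A \<inter> space M) = measure M A"
  using automorphism_emeasure_vimage[OF assms] by (simp add: measure_def)

lemma automorphism_measure_image:
  assumes "automorphism M T" "A \<in> sets M"
  shows "measure M (T ` A) = measure M A"
  using automorphism_emeasure_image[OF assms] by (simp add: measure_def)

lemma automorphism_image_Diff:
  assumes "automorphism M T" "A \<subseteq> space M" "B \<subseteq> space M"
  shows "T ` (A - B) = T ` A - T ` B"
  using inj_on_image_set_diff[of T "space M" A B] automorphismD(2)[OF assms(1)] assms(2,3)
  by (auto simp: bij_betw_def)

lemma automorphism_image_sym_diff:
  assumes "automorphism M T" "A \<subseteq> space M" "B \<subseteq> space M"
  shows "T ` (sym_diff A B) = sym_diff (T ` A) (T ` B)"
  using automorphism_image_Diff[OF assms] automorphism_image_Diff[OF assms(1,3,2)] by (auto simp: image_Un)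

lemma automorphismI:
  assumes "f \<in> measurable M M" "g \<in> measurable M M"
    "\<And>x. x \<in> space M \<Longrightarrow> g (f x) = x" "\<And>x. x \<in> space M \<Longrightarrow> f (g x) = x"
    "distr M M f = M"
  shows "automorphism M f"
proof -
  have sp: "f x \<in> space M" "g x \<in> space M" if "x \<in> space M" for x
    using assms(1,2) that by (auto dest: measurable_space)
  have bij: "bij_betw f (space M) (space M)"
    by (rule bij_betwI[where g=g]) (use assms sp in auto)
  have "inv_into (space M) f x = g x" if "x \<in> space M" for x
    using bij assms(4) sp that by (metis bij_betw_def inv_into_f_f)
  then have "inv_into (space M) f \<in> measurable M M"
    using assms(2) by (subst measurable_cong[where g=g]) auto
  with bij assms show ?thesis by (simp add: automorphism_def)
qed

lemma automorphism_inv_into_eq: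
  assumes "automorphism M f" "x \<in> space M" "g x \<in> space M" "f (g x) = x"
  shows "inv_into (space M) f x = g x"
  using automorphismD(2)[OF assms(1)] assms(3,4) by (metis bij_betw_def inv_into_f_f)

lemma automorphism_comp:
  assumes S: "automorphism M S" and T: "automorphism M T"
  shows "automorphism M (S \<circ> T)"
proof (rule automorphismI[where g="inv_into (space M) T \<circ> inv_into (space M) S"])
  note m = automorphismD(1,3)[OF S] automorphismD(1,3)[OF T]
  show "S \<circ> T \<in> measurable M M" "inv_into (space M) T \<circ> inv_into (space M) S \<in> measurable M M"
    using m by (auto intro: measurable_comp)
  have sp: "inv_into (space M) S x \<in> space M" if "x \<in> space M" for x
    using m(2) that by (auto dest: measurable_space)
  fix x assume x: "x \<in> space M"
  show "(inv_into (space M) T \<circ> inv_into (space M) S) ((S \<circ> T) x) = x"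
    using x automorphism_inv_left[OF S] automorphism_inv_left[OF T] automorphism_in_space[OF T] by simp
  show "(S \<circ> T) ((inv_into (space M) T \<circ> inv_into (space M) S) x) = x"
    using x sp automorphism_inv_right[OF S] automorphism_inv_right[OF T] by simp
next
  have "distr M M (S \<circ> T) = distr (distr M M T) M S"
    using distr_distr[OF automorphismD(1)[OF S] automorphismD(1)[OF T]] by simp
  then show "distr M M (S \<circ> T) = M"
    using automorphismD(4)[OF S] automorphismD(4)[OF T] by simp
qed

lemma automorphism_inv:
  assumes T: "automorphism M T"
  shows "automorphism M (inv_into (space M) T)"
proof (rule automorphismI[where g=T])
  note m = automorphismD(1,3)[OF T]
  show "inv_into (space M) T \<in> measurable M M" "T \<in> measurable M M" using m by auto
  show "\<And>x. x \<in> space M \<Longrightarrow> T (inv_into (space M) T x) = x" "\<And>x. x \<in> space M \<Longrightarrow> inv_into (space M) T (T x) = x"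
    using automorphism_inv_left[OF T] automorphism_inv_right[OF T] by auto
  have "distr M M (inv_into (space M) T) = distr (distr M M T) M (inv_into (space M) T)"
    using automorphismD(4)[OF T] by simp
  also have "\<dots> = distr M M (inv_into (space M) T \<circ> T)"
    using distr_distr m by blast
  also have "\<dots> = distr M M (\<lambda>x. x)"
    by (rule distr_cong) (auto simp: automorphism_inv_left[OF T])
  also have "\<dots> = M" by (simp add: distr_id)
  finally show "distr M M (inv_into (space M) T) = M" .
qed

lemma automorphism_id: "automorphism M (\<lambda>x. x)"
  by (rule automorphismI[where g="\<lambda>x. x"]) (auto simp: distr_id)

lemma automorphism_funpow:
  assumes "automorphism M T"
  shows "automorphism M (T ^^ n)"
proof (induction n)
  case 0
  show ?case using automorphism_id by (simp add: id_def)
next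
  case (Suc n)
  show ?case using automorphism_comp[OF assms Suc] by (simp add: comp_def)
qed

lemma automorphism_int_power:
  assumes "automorphism M T"
  shows "automorphism M (int_power M T n)"
  unfolding int_power_def
  using automorphism_funpow[OF assms] automorphism_funpow[OF automorphism_inv[OF assms]] by auto

lemma automorphism_conjugate:
  assumes "automorphism M T" "automorphism M S"
  shows "automorphism M (int_power M T (- n) \<circ> S \<circ> int_power M T n)"
  by (intro automorphism_comp automorphism_int_power assms)

lemma int_power_inverse:
  assumes T: "automorphism M T" and x: "x \<in> space M"
  shows "int_power M T (- n) (int_power M T n x) = x"
proof -
  let ?g = "inv_into (space M) T"
  have g: "automorphism M ?g" using automorphism_inv[OF T] .
  have 1: "(?g ^^ k) ((T ^^ k) x) = x" if "x \<in> space M" for k x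
    using that
  proof (induction k arbitrary: x)
    case (Suc k)
    have "(?g ^^ Suc k) ((T ^^ Suc k) x) = (?g ^^ k) (?g (T ((T ^^ k) x)))"
      by (simp add: funpow_swap1)
    then show ?case
      using Suc automorphism_inv_left[OF T automorphism_in_space[OF automorphism_funpow[OF T] Suc.prems]] by simp
  qed simp
  have 2: "(T ^^ k) ((?g ^^ k) x) = x" if "x \<in> space M" for k x
    using that
  proof (induction k arbitrary: x)
    case (Suc k)
    have "(T ^^ Suc k) ((?g ^^ Suc k) x) = (T ^^ k) (T (?g ((?g ^^ k) x)))"
      by (simp add: funpow_swap1)
    then show ?case
      using Suc automorphism_inv_right[OF T automorphism_in_space[OF automorphism_funpow[OF g] Suc.prems]] by simp
  qed simp
  show ?thesis using 1[OF x] 2[OF x] unfolding int_power_def by (cases "n = 0") auto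
qed

lemma automorphism_AE:
  assumes T: "automorphism M T" and P: "AE x in M. P x"
  shows "AE x in M. P (T x)"
proof -
  from P obtain N where N: "{x \<in> space M. \<not> P x} \<subseteq> N" "emeasure M N = 0" "N \<in> sets M"
    by (auto elim: AE_E)
  show ?thesis
  proof (rule AE_I)
    show "{x \<in> space M. \<not> P (T x)} \<subseteq> T -` N \<inter> space M"
      using N(1) automorphism_in_space[OF T] by auto
    show "emeasure M (T -` N \<inter> space M) = 0"
      using automorphism_emeasure_vimage[OF T N(3)] N(2) by simp
    show "T -` N \<inter> space M \<in> sets M"
      using measurable_sets[OF automorphismD(1)[OF T] N(3)] .
  qed
qed


subsection \<open>Convergence to the identity\<close>

lemma measure_sym_diff_triangle:
  assumes "A \<in> fmeasurable M" "B \<in> fmeasurable M" "C \<in> fmeasurable M"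
  shows "measure M (sym_diff A C) \<le> measure M (sym_diff A B) + measure M (sym_diff B C)"
proof -
  have "measure M (sym_diff A C) \<le> measure M (sym_diff A B \<union> sym_diff B C)"
    by (rule measure_mono_fmeasurable) (use assms in auto)
  also have "\<dots> \<le> measure M (sym_diff A B) + measure M (sym_diff B C)"
    by (rule measure_Un_le) (use assms in auto)
  finally show ?thesis .
qed

text \<open>The sets along which \<open>R n\<close> converges to the identity form a sigma-algebra
  on \<open>\<Omega>\<close>: the defect of a complement is at most the sum of two defects, and a
  countable union is approximated by finite ones with an error that does not depend on
  \<open>n\<close>, because each \<open>R n\<close> preserves the measure. The total set
  \<open>\<Omega>\<close> is any set of finite measure, so that the lemma serves the probability
  spaces as well as bounded pieces of the half line.\<close>

lemma tends_to_identity_sigma_sets: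
  fixes R :: "'i \<Rightarrow> 'a \<Rightarrow> 'a"
  assumes R: "\<And>n. automorphism M (R n)"
    and \<Omega>: "\<Omega> \<in> fmeasurable M"
    and \<Omega>0: "((\<lambda>n. measure M (sym_diff (R n ` \<Omega>) \<Omega>)) \<longlongrightarrow> 0) F"
    and G: "G \<subseteq> sets M" "G \<subseteq> Pow \<Omega>"
    and G0: "\<And>A. A \<in> G \<Longrightarrow> ((\<lambda>n. measure M (sym_diff (R n ` A) A)) \<longlongrightarrow> 0) F"
    and A: "A \<in> sigma_sets \<Omega> G"
  shows "A \<in> sets M \<and> A \<subseteq> \<Omega> \<and> ((\<lambda>n. measure M (sym_diff (R n ` A) A)) \<longlongrightarrow> 0) F"
  using A
proof (induction rule: sigma_sets.induct)
  case (Basic a)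
  then show ?case using G G0 by auto
next
  case Empty
  then show ?case by auto
next
  case (Compl a)
  have fm: "a \<in> fmeasurable M" using Compl \<Omega> by (auto intro: fmeasurableI2)
  have im: "R n ` B \<in> fmeasurable M" if "B \<in> fmeasurable M" for B n
    using automorphism_image_sets[OF R, of B n] automorphism_emeasure_image[OF R, of B n] that
    by (auto simp: fmeasurable_def)
  have spa: "\<Omega> \<subseteq> space M" "a \<subseteq> space M" using \<Omega> fm by (auto dest: fmeasurableD sets.sets_into_space)
  have le: "measure M (sym_diff (R n ` (\<Omega> - a)) (\<Omega> - a))
      \<le> measure M (sym_diff (R n ` \<Omega>) \<Omega>) + measure M (sym_diff (R n ` a) a)" for n
  proof -
    have d: "sym_diff (R n ` \<Omega>) \<Omega> \<in> fmeasurable M" "sym_diff (R n ` a) a \<in> fmeasurable M"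
      by (intro fmeasurable.Un fmeasurable.Diff im \<Omega> fm)+
    have "measure M (sym_diff (R n ` (\<Omega> - a)) (\<Omega> - a)) \<le> measure M (sym_diff (R n ` \<Omega>) \<Omega> \<union> sym_diff (R n ` a) a)"
    proof (rule measure_mono_fmeasurable)
      show "sym_diff (R n ` (\<Omega> - a)) (\<Omega> - a) \<subseteq> sym_diff (R n ` \<Omega>) \<Omega> \<union> sym_diff (R n ` a) a"
        unfolding automorphism_image_Diff[OF R spa] by auto
      show "sym_diff (R n ` (\<Omega> - a)) (\<Omega> - a) \<in> sets M"
        using im[of "\<Omega> - a" n] \<Omega> fm by (auto intro!: sets.Un sets.Diff dest: fmeasurableD)
    qed (intro fmeasurable.Un d)
    also have "\<dots> \<le> measure M (sym_diff (R n ` \<Omega>) \<Omega>) + measure M (sym_diff (R n ` a) a)"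
      by (rule measure_Un_le) (use im[OF \<Omega>] im[OF fm] \<Omega> fm in auto)
    finally show ?thesis .
  qed
  have "((\<lambda>n. measure M (sym_diff (R n ` \<Omega>) \<Omega>) + measure M (sym_diff (R n ` a) a)) \<longlongrightarrow> 0) F"
    using tendsto_add[OF \<Omega>0] Compl by fastforce
  then have "((\<lambda>n. measure M (sym_diff (R n ` (\<Omega> - a)) (\<Omega> - a))) \<longlongrightarrow> 0) F"
    by (rule Lim_null_comparison[rotated]) (use le in auto)
  then show ?case using fm \<Omega> by auto
next
  case (Union a)
  define U where "U = (\<Union>i. a i)"
  define V where "V k = (\<Union>i<k. a i)" for k :: nat
  have am: "a i \<in> sets M" "a i \<subseteq> \<Omega>" for i using Union.IH by auto
  have Us: "U \<in> sets M" "U \<subseteq> \<Omega>" using am by (auto simp: U_def)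
  have Ufm: "U \<in> fmeasurable M" using Us \<Omega> by (auto intro: fmeasurableI2)
  have afm: "a i \<in> fmeasurable M" for i using am \<Omega> by (auto intro: fmeasurableI2)
  have Vfm: "V k \<in> fmeasurable M" for k unfolding V_def using afm by (intro fmeasurable.finite_UN) auto
  have im: "R n ` B \<in> fmeasurable M" if "B \<in> fmeasurable M" for B n
    using automorphism_image_sets[OF R, of B n] automorphism_emeasure_image[OF R, of B n] that
    by (auto simp: fmeasurable_def)
  have VU: "V k \<subseteq> U" for k by (auto simp: V_def U_def)
  have lim: "(\<lambda>k. measure M (V k)) \<longlonglongrightarrow> measure M U"
  proof -
    have "(\<lambda>k. measure M (V k)) \<longlonglongrightarrow> measure M (\<Union>k. V k)"
    proof (rule Lim_measure_incseq)
      show "range V \<subseteq> sets M" using Vfm by auto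
      show "incseq V" unfolding incseq_def V_def by (intro allI impI UN_mono) auto
      have "(\<Union>k. V k) \<subseteq> U" using VU by auto
      then show "emeasure M (\<Union>k. V k) \<noteq> \<infinity>" using Ufm Vfm
        by (metis emeasure_mono fmeasurableD fmeasurableD2 infinity_ennreal_def top.extremum_uniqueI)
    qed
    also have "(\<Union>k. V k) = U" by (auto simp: V_def U_def)
    finally show ?thesis .
  qed
  have "((\<lambda>n. measure M (sym_diff (R n ` U) U)) \<longlongrightarrow> 0) F"
  proof (rule tendstoI)
    fix e :: real assume e: "0 < e"
    have "eventually (\<lambda>k. dist (measure M (V k)) (measure M U) < e/4) sequentially"
      using lim e by (intro tendstoD) auto
    then obtain k where k: "dist (measure M (V k)) (measure M U) < e/4"
      by (auto simp: eventually_sequentially)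
    \<comment> \<open>The remainder \<open>U - V k\<close> is counted twice below, once for itself
      and once for its image, and the finite part once: together less than three quarters of
      \<open>e\<close>.\<close>
    have d: "measure M (U - V k) < e/4"
      using measure_Diff[of M U "V k"] k Ufm Vfm[of k] VU[of k] fmeasurableD2[OF Ufm]
      by (simp add: dist_real_def fmeasurable_def) (smt (verit))
    have "((\<lambda>n. \<Sum>i<k. measure M (sym_diff (R n ` a i) (a i))) \<longlongrightarrow> (\<Sum>i<k. 0)) F"
      using Union.IH by (intro tendsto_sum) auto
    then have ev: "eventually (\<lambda>n. dist (\<Sum>i<k. measure M (sym_diff (R n ` a i) (a i))) 0 < e/4) F"
      using e by (intro tendstoD) auto
    show "eventually (\<lambda>n. dist (measure M (sym_diff (R n ` U) U)) 0 < e) F"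
      using ev
    proof eventually_elim
      case (elim n)
      have fmd: "U - V k \<in> fmeasurable M" using Ufm Vfm by auto
      let ?D = "\<Union>i<k. sym_diff (R n ` a i) (a i)"
      have Di: "sym_diff (R n ` a i) (a i) \<in> fmeasurable M" for i
        by (intro fmeasurable.Un fmeasurable.Diff im afm)
      have D: "?D \<in> fmeasurable M" by (intro fmeasurable.finite_UN Di) auto
      have E: "R n ` (U - V k) \<in> fmeasurable M" by (rule im[OF fmd])
      have sub: "sym_diff (R n ` U) U \<subseteq> ?D \<union> (R n ` (U - V k) \<union> (U - V k))"
      proof
        fix x assume "x \<in> sym_diff (R n ` U) U"
        then consider y where "x = R n y" "y \<in> U" "x \<notin> U" | "x \<in> U" "x \<notin> R n ` U" by blast
        then show "x \<in> ?D \<union> (R n ` (U - V k) \<union> (U - V k))"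
        proof cases
          case 1
          show ?thesis
          proof (cases "y \<in> V k")
            case True
            then obtain i where "i < k" "y \<in> a i" by (auto simp: V_def)
            then have "x \<in> sym_diff (R n ` a i) (a i)" using 1 by (auto simp: U_def)
            then show ?thesis using \<open>i < k\<close> by blast
          qed (use 1 in blast)
        next
          case 2
          show ?thesis
          proof (cases "x \<in> V k")
            case True
            then obtain i where "i < k" "x \<in> a i" by (auto simp: V_def)
            then have "x \<in> sym_diff (R n ` a i) (a i)" using 2 by (auto simp: U_def)
            then show ?thesis using \<open>i < k\<close> by blast
          qed (use 2 in blast)
        qed
      qed
      have "sym_diff (R n ` U) U \<in> fmeasurable M"
        by (intro fmeasurable.Un fmeasurable.Diff im Ufm)
      from measure_mono_fmeasurable[OF sub fmeasurableD[OF this]]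
      have "measure M (sym_diff (R n ` U) U) \<le> measure M (?D \<union> (R n ` (U - V k) \<union> (U - V k)))"
        by (simp add: fmeasurable.Un D E fmd)
      also have "\<dots> \<le> measure M ?D + measure M (R n ` (U - V k) \<union> (U - V k))"
        by (intro measure_Un_le fmeasurableD fmeasurable.Un D E fmd)
      also have "\<dots> \<le> (\<Sum>i<k. measure M (sym_diff (R n ` a i) (a i))) + (measure M (R n ` (U - V k)) + measure M (U - V k))"
        by (intro add_mono measure_UNION_le measure_Un_le fmeasurableD E fmd Di) simp
      also have "measure M (R n ` (U - V k)) = measure M (U - V k)"
        by (rule automorphism_measure_image[OF R fmeasurableD[OF fmd]])
      finally show ?case using d elim by (auto simp: dist_real_def)
    qed
  qed
  then show ?case using Us by (auto simp: U_def)
qed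

text \<open>If \<open>T\<^sup>n \<rightarrow> I\<close> and \<open>T\<^sup>-\<^sup>n S T\<^sup>n \<rightarrow> I\<close> then \<open>S A \<approx> S T\<^sup>n A \<approx> T\<^sup>n A \<approx> A\<close>.\<close>

lemma (in prob_space) H_group_trivial:
  assumes T: "automorphism M T"
    and rigid: "tends_to_identity M (int_power M T) (infinity_along Q)"
    and nt: "infinity_along Q \<noteq> bot"
    and \<C>: "countable \<C>" "\<C> \<subseteq> sets M"
      "\<And>x y. x \<in> space M \<Longrightarrow> y \<in> space M \<Longrightarrow> x \<noteq> y \<Longrightarrow> \<exists>A\<in>\<C>. (x \<in> A) \<noteq> (y \<in> A)"
  shows "H_group M Q T = identity_class M"
proof (intro set_eqI iffI)
  fix S assume "S \<in> H_group M Q T"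
  then have S: "automorphism M S"
    and lim: "tends_to_identity M (\<lambda>n. int_power M T (- n) \<circ> S \<circ> int_power M T n) (infinity_along Q)"
    by (auto simp: H_group_def)
  have fm: "A \<in> fmeasurable M" if "A \<in> sets M" for A using that by (simp add: fmeasurable_eq_sets)
  have Tn: "automorphism M (int_power M T n)" for n by (rule automorphism_int_power[OF T])
  have 0: "measure M (sym_diff (S ` A) A) = 0" if A: "A \<in> sets M" for A
  proof -
    have ssp: "A \<subseteq> space M" using sets.sets_into_space[OF A] .
    have le: "measure M (sym_diff (S ` A) A) \<le> 2 * measure M (sym_diff (int_power M T n ` A) A)
        + measure M (sym_diff ((int_power M T (- n) \<circ> S \<circ> int_power M T n) ` A) A)" for n
    proof -
      let ?T = "int_power M T n"
      have TA: "?T ` A \<in> sets M" using automorphism_image_sets[OF Tn A] .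
      have SA: "S ` A \<in> sets M" using automorphism_image_sets[OF S A] .
      have STA: "S ` ?T ` A \<in> sets M" using automorphism_image_sets[OF S TA] .
      have "measure M (sym_diff (S ` A) A) \<le> measure M (sym_diff (S ` A) (S ` ?T ` A)) + measure M (sym_diff (S ` ?T ` A) A)"
        by (intro measure_sym_diff_triangle fm A SA STA)
      also have "measure M (sym_diff (S ` ?T ` A) A) \<le> measure M (sym_diff (S ` ?T ` A) (?T ` A)) + measure M (sym_diff (?T ` A) A)"
        by (intro measure_sym_diff_triangle fm A TA STA)
      also have "sym_diff (S ` A) (S ` ?T ` A) = S ` sym_diff A (?T ` A)"
        using automorphism_image_sym_diff[OF S ssp sets.sets_into_space[OF TA]] by simp
      also have "measure M (S ` sym_diff A (?T ` A)) = measure M (sym_diff A (?T ` A))"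
        by (rule automorphism_measure_image[OF S]) (use A TA in auto)
      also have "measure M (sym_diff (S ` ?T ` A) (?T ` A)) = measure M (int_power M T (- n) ` sym_diff (S ` ?T ` A) (?T ` A))"
        by (rule automorphism_measure_image[OF Tn, symmetric]) (use TA STA in auto)
      also have "int_power M T (- n) ` sym_diff (S ` ?T ` A) (?T ` A)
          = sym_diff (int_power M T (- n) ` S ` ?T ` A) (int_power M T (- n) ` ?T ` A)"
        by (rule automorphism_image_sym_diff[OF Tn sets.sets_into_space[OF STA] sets.sets_into_space[OF TA]])
      also have "int_power M T (- n) ` ?T ` A = A"
        
      proof -
        have "int_power M T (- n) ` ?T ` A = (\<lambda>x. x) ` A"
          unfolding image_image by (rule image_cong) (use int_power_inverse[OF T] ssp in auto)
        then show ?thesis by simp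
      qed
      finally show ?thesis by (simp add: image_comp Un_commute)
    qed
    have "((\<lambda>n. 2 * measure M (sym_diff (int_power M T n ` A) A)
        + measure M (sym_diff ((int_power M T (- n) \<circ> S \<circ> int_power M T n) ` A) A)) \<longlongrightarrow> 2 * 0 + 0) (infinity_along Q)"
      using rigid lim A unfolding tends_to_identity_def by (intro tendsto_intros) auto
    then have "measure M (sym_diff (S ` A) A) \<le> 2 * 0 + 0"
      by (rule tendsto_lowerbound) (use le nt in auto)
    then show ?thesis by (simp add: measure_le_0_iff)
  qed
  \<comment> \<open>Every set of the countable separating family is invariant up to a null set;
    outside the union of these null sets no member of the family can separate \<open>S x\<close>
    from \<open>x\<close>.\<close>
  have "AE x in M. x \<notin> S -` sym_diff (S ` A) A \<inter> space M" if "A \<in> \<C>" for A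
  proof (rule AE_not_in, rule null_setsI)
    have A: "A \<in> sets M" using that \<C> by auto
    have sA: "sym_diff (S ` A) A \<in> sets M" using automorphism_image_sets[OF S A] A by auto
    show "S -` sym_diff (S ` A) A \<inter> space M \<in> sets M"
      using measurable_sets[OF automorphismD(1)[OF S] sA] .
    show "emeasure M (S -` sym_diff (S ` A) A \<inter> space M) = 0"
      using automorphism_emeasure_vimage[OF S sA] 0[OF A] by (simp add: emeasure_eq_measure)
  qed
  then have "AE x in M. \<forall>A\<in>\<C>. x \<notin> S -` sym_diff (S ` A) A \<inter> space M"
    by (subst AE_ball_countable[OF \<C>(1)]) auto
  moreover have "AE x in M. x \<in> space M" by (rule AE_space)
  ultimately have "AE x in M. S x = x"
  proof eventually_elim
    case (elim x)
    show ?case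
    proof (rule ccontr)
      assume "S x \<noteq> x"
      then obtain A where A: "A \<in> \<C>" "(S x \<in> A) \<noteq> (x \<in> A)"
        using \<C>(3)[of "S x" x] elim automorphism_in_space[OF S] by auto
      have "A \<subseteq> space M" using A(1) \<C>(2) sets.sets_into_space by auto
      then have "S x \<in> S ` A \<longleftrightarrow> x \<in> A"
        by (intro inj_on_image_mem_iff[of S "space M"])
          (use automorphismD(2)[OF S] elim in \<open>auto simp: bij_betw_def\<close>)
      then show False using elim A by auto
    qed
  qed
  then show "S \<in> identity_class M" using S by (simp add: identity_class_def)
next
  fix S assume "S \<in> identity_class M"
  then have S: "automorphism M S" and id: "AE x in M. S x = x" by (auto simp: identity_class_def)
  \<comment> \<open>Conversely, a conjugate of a map that is almost everywhere the identity is again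
    almost everywhere the identity, so the defect is zero for every \<open>n\<close>.\<close>
  have "measure M (sym_diff ((int_power M T (- n) \<circ> S \<circ> int_power M T n) ` A) A) = 0" if A: "A \<in> sets M" for A n
  proof -
    let ?R = "int_power M T (- n) \<circ> S \<circ> int_power M T n"
    have R: "automorphism M ?R" by (rule automorphism_conjugate[OF T S])
    have Rid: "AE x in M. ?R x = x"
      using automorphism_AE[OF automorphism_int_power[OF T, of n] id] AE_space
      by eventually_elim (simp add: int_power_inverse[OF T])
    have RA: "?R ` A \<in> sets M" using automorphism_image_sets[OF R A] .
    have "measure M (sym_diff (?R ` A) A) = measure M (?R -` sym_diff (?R ` A) A \<inter> space M)"
      by (rule automorphism_measure_vimage[OF R, symmetric]) (use RA A in auto)
    also have "\<dots> = 0"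
    proof -
      have "AE x in M. x \<notin> ?R -` sym_diff (?R ` A) A \<inter> space M"
        using Rid AE_space
      proof eventually_elim
        case (elim x)
        have "?R x \<in> ?R ` A \<longleftrightarrow> x \<in> A"
          by (rule inj_on_image_mem_iff[of ?R "space M"])
            (use automorphismD(2)[OF R] elim sets.sets_into_space[OF A] in \<open>auto simp: bij_betw_def simp del: comp_apply\<close>)
        then show ?case using elim by (auto simp del: comp_apply)
      qed
      then have "?R -` sym_diff (?R ` A) A \<inter> space M \<in> null_sets M"
        by (subst AE_iff_null_sets[OF measurable_sets[OF automorphismD(1)[OF R]]]) (use RA A in auto)
      then show ?thesis by (simp add: measure_eq_0_null_sets)
    qed
    finally show ?thesis .
  qed
  then show "S \<in> H_group M Q T"
    using S by (simp add: H_group_def tends_to_identity_def del: comp_apply)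
qed


lemma (in prob_space) tends_to_identityI:
  assumes R: "\<And>n. automorphism M (R n)"
    and G: "G \<subseteq> sets M" "sets M = sigma_sets (space M) G"
    and G0: "\<And>A. A \<in> G \<Longrightarrow> ((\<lambda>n. measure M (sym_diff (R n ` A) A)) \<longlongrightarrow> 0) F"
  shows "tends_to_identity M R F"
  unfolding tends_to_identity_def
proof
  fix A assume "A \<in> sets M"
  have "R n ` space M = space M" for n
    using automorphismD(2)[OF R] by (simp add: bij_betw_def)
  moreover have "G \<subseteq> Pow (space M)" using G(1) sets.space_closed[of M] by blast
  ultimately have "A \<in> sets M \<and> A \<subseteq> space M \<and> ((\<lambda>n. measure M (sym_diff (R n ` A) A)) \<longlongrightarrow> 0) F"
    using G G0 \<open>A \<in> sets M\<close> \<open>\<And>n. R n ` space M = space M\<close>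
    by (intro tends_to_identity_sigma_sets[where R=R and G=G, OF R]) (simp_all add: fmeasurable_eq_sets sigma_sets_top)
  then show "((\<lambda>n. measure M (sym_diff (R n ` A) A)) \<longlongrightarrow> 0) F" by simp
qed

section \<open>Limits along an infinite set of integers\<close>

lemma infinity_along_nontrivial:
  assumes "infinite P"
  shows "infinity_along P \<noteq> bot"
proof
  assume "infinity_along P = bot"
  then have "eventually (\<lambda>_. False) (infinity_along P)" by simp
  then have "eventually (\<lambda>n. n \<in> P \<longrightarrow> False) (filtercomap (\<lambda>n::int. \<bar>n\<bar>) at_top)"
    unfolding infinity_along_def eventually_inf_principal .
  then obtain N where N: "\<And>n. n \<in> P \<Longrightarrow> \<not> N \<le> \<bar>n\<bar>"
    by (auto simp: eventually_filtercomap eventually_at_top_linorder)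
  have "P \<subseteq> {- \<bar>N\<bar>..\<bar>N\<bar>}"
  proof
    fix n assume "n \<in> P"
    then show "n \<in> {- \<bar>N\<bar>..\<bar>N\<bar>}" using N[of n] by auto
  qed
  then show False using assms finite_subset by blast
qed

lemma eventually_infinity_along:
  "eventually Q (infinity_along P) \<longleftrightarrow> (\<exists>N. \<forall>n\<in>P. N \<le> \<bar>n\<bar> \<longrightarrow> Q n)"
  unfolding infinity_along_def
  by (subst eventually_inf_principal, subst eventually_filtercomap_at_top_linorder, intro ex_cong1) blast

lemma tendsto_infinity_along_range:
  fixes p :: "nat \<Rightarrow> int"
  assumes "(\<lambda>k. f (p k)) \<longlonglongrightarrow> l"
  shows "(f \<longlongrightarrow> l) (infinity_along (range p))"
proof (rule topological_tendstoI)
  fix S assume "open S" "l \<in> S"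
  then obtain K where K: "\<And>k. K \<le> k \<Longrightarrow> f (p k) \<in> S"
    using topological_tendstoD[OF assms] by (auto simp: eventually_sequentially)
  \<comment> \<open>A bound above the absolute value of every \<open>p k\<close> with
    \<open>k < K\<close>: an element of the range at least this large can only be attained at
    indices from \<open>K\<close> on.\<close>
  define N where "N = (\<Sum>k<K. \<bar>p k\<bar>) + 1"
  have small: "\<bar>p k\<bar> < N" if "k < K" for k
  proof -
    have "\<bar>p k\<bar> \<le> (\<Sum>k<K. \<bar>p k\<bar>)" using that by (intro member_le_sum) auto
    then show ?thesis by (simp add: N_def)
  qed
  have "f (p k) \<in> S" if "N \<le> \<bar>p k\<bar>" for k
    using that K[of k] small[of k] by (cases "K \<le> k") auto
  then have "\<forall>n\<in>range p. N \<le> \<bar>n\<bar> \<longrightarrow> f n \<in> S" by auto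
  then show "eventually (\<lambda>n. f n \<in> S) (infinity_along (range p))"
    unfolding eventually_infinity_along by blast
qed

subsection \<open>Mixing\<close>

text \<open>Ideals of null sequences: both convergence to 0 and Cesaro convergence to 0 are instances.\<close>

definition null_ideal :: "((nat \<Rightarrow> real) \<Rightarrow> bool) \<Rightarrow> bool" where
  "null_ideal Z \<longleftrightarrow> Z (\<lambda>_. 0) \<and> (\<forall>x y. Z x \<longrightarrow> Z y \<longrightarrow> Z (\<lambda>n. x n + y n)) \<and>
     (\<forall>x c. Z x \<longrightarrow> Z (\<lambda>n. c * x n)) \<and>
     (\<forall>y. (\<forall>n. 0 \<le> y n) \<longrightarrow> (\<forall>e>0. \<exists>x. Z x \<and> (\<forall>n. y n \<le> x n + e)) \<longrightarrow> Z y)"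

lemma null_idealD:
  assumes "null_ideal Z"
  shows "Z (\<lambda>_. 0)" "Z x \<Longrightarrow> Z y \<Longrightarrow> Z (\<lambda>n. x n + y n)" "Z x \<Longrightarrow> Z (\<lambda>n. c * x n)"
    "(\<And>n. 0 \<le> y n) \<Longrightarrow> (\<And>e. 0 < e \<Longrightarrow> \<exists>x. Z x \<and> (\<forall>n. y n \<le> x n + e)) \<Longrightarrow> Z y"
  using assms unfolding null_ideal_def by blast+

lemma null_ideal_mono:
  assumes "null_ideal Z" "Z x" "\<And>n. 0 \<le> y n" "\<And>n. y n \<le> x n"
  shows "Z y"
proof (rule null_idealD(4)[OF assms(1,3)])
  fix e :: real assume "0 < e"
  then have "y n \<le> x n + e" for n using assms(4)[of n] by linarith
  then show "\<exists>x. Z x \<and> (\<forall>n. y n \<le> x n + e)"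
    using assms(2) by (intro exI[of _ x]) auto
qed

lemma null_ideal_sum:
  assumes "null_ideal Z" "finite I" "\<And>i. i \<in> I \<Longrightarrow> Z (x i)"
  shows "Z (\<lambda>n. \<Sum>i\<in>I. x i n)"
  using assms(2,3)
proof (induction rule: finite_induct)
  case empty
  then show ?case using null_idealD(1)[OF assms(1)] by simp
next
  case (insert i I)
  then show ?case using null_idealD(2)[OF assms(1), of "x i" "\<lambda>n. \<Sum>i\<in>I. x i n"] by simp
qed

lemma null_ideal_tendsto: "null_ideal (\<lambda>x. x \<longlonglongrightarrow> 0)"
  unfolding null_ideal_def
proof (intro conjI allI impI)
  fix y :: "nat \<Rightarrow> real"
  assume y: "\<forall>n. 0 \<le> y n" "\<forall>e>0. \<exists>x. x \<longlonglongrightarrow> 0 \<and> (\<forall>n. y n \<le> x n + e)"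
  show "y \<longlonglongrightarrow> 0"
  proof (rule LIMSEQ_I)
    fix r :: real assume "0 < r"
    then obtain x where x: "x \<longlonglongrightarrow> 0" "\<And>n. y n \<le> x n + r/2" using y(2) half_gt_zero by blast
    obtain N where "\<And>n. n \<ge> N \<Longrightarrow> norm (x n - 0) < r/2" using LIMSEQ_D[OF x(1), of "r/2"] \<open>0 < r\<close> by auto
    then have "norm (y n - 0) < r" if "n \<ge> N" for n
      using x(2)[of n] y(1)[rule_format, of n] that by (smt (verit) field_sum_of_halves real_norm_def)
    then show "\<exists>no. \<forall>n\<ge>no. norm (y n - 0) < r" by blast
  qed
qed (auto intro: tendsto_eq_intros)

definition cesaro_null :: "(nat \<Rightarrow> real) \<Rightarrow> bool" where
  "cesaro_null x \<longleftrightarrow> (\<lambda>N. (\<Sum>n<N. x n) / real N) \<longlonglongrightarrow> 0"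

lemma null_ideal_cesaro: "null_ideal cesaro_null"
  unfolding null_ideal_def
proof (intro conjI allI impI)
  fix y :: "nat \<Rightarrow> real"
  assume y: "\<forall>n. 0 \<le> y n" "\<forall>e>0. \<exists>x. cesaro_null x \<and> (\<forall>n. y n \<le> x n + e)"
  have "(\<lambda>N. (\<Sum>n<N. y n) / real N) \<longlonglongrightarrow> 0"
  proof (rule null_idealD(4)[OF null_ideal_tendsto])
    show "0 \<le> (\<Sum>n<N. y n) / real N" for N using y(1) by (intro divide_nonneg_nonneg sum_nonneg) auto
    fix e :: real assume "0 < e"
    then obtain x where x: "cesaro_null x" "\<And>n. y n \<le> x n + e" using y(2) by blast
    have "(\<Sum>n<N. y n) / real N \<le> (\<Sum>n<N. x n) / real N + e" for N
    proof (cases "N = 0")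
      case False
      have "(\<Sum>n<N. y n) \<le> (\<Sum>n<N. x n + e)" by (intro sum_mono x(2))
      then show ?thesis using False by (simp add: sum.distrib field_simps)
    qed (use \<open>0 < e\<close> in simp)
    then show "\<exists>x. x \<longlonglongrightarrow> 0 \<and> (\<forall>n. (\<Sum>i<n. y i) / real n \<le> x n + e)"
      using x(1) unfolding cesaro_null_def by blast
  qed
  then show "cesaro_null y" by (simp add: cesaro_null_def)
next
  fix x y assume "cesaro_null x" "cesaro_null y"
  then show "cesaro_null (\<lambda>n. x n + y n)"
    unfolding cesaro_null_def sum.distrib add_divide_distrib by (rule tendsto_add_zero)
next
  fix x c assume "cesaro_null x"
  then show "cesaro_null (\<lambda>n. c * x n)"
    unfolding cesaro_null_def sum_distrib_left[symmetric] times_divide_eq_right[symmetric]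
    by (rule tendsto_mult_right_zero)
qed (auto simp: cesaro_null_def)

text \<open>A shift by \<open>t\<close> changes a partial sum by at most \<open>C\<close> times the
  absolute value of \<open>t\<close>, which vanishes in the mean. Hence the mean of \<open>a\<close>
  is asymptotically at most the mean of an average of \<open>L\<close> translates, and that average
  is at most \<open>C / L\<close>. This is how almost disjoint or almost orthogonal translates force
  Cesaro convergence to zero.\<close>

lemma cesaro_translates:
  fixes a :: "int \<Rightarrow> real"
  assumes a0: "\<And>n. 0 \<le> a n" and a1: "\<And>n. a n \<le> C"
    and tr: "\<And>L. \<exists>s :: nat \<Rightarrow> int. \<forall>n. (\<Sum>i<L. a (n - s i)) \<le> C"
  shows "cesaro_null (\<lambda>n. a (int n))"
proof -
  have C0: "0 \<le> C" using a0[of 0] a1[of 0] by simp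
  have shift: "(\<Sum>n<N. a (int n)) \<le> (\<Sum>n<N. a (int n - t)) + real (nat \<bar>t\<bar>) * C" for t and N :: nat
  proof -
    have 1: "(\<Sum>n\<in>{0..<int N}. a n) \<le> (\<Sum>n\<in>{- t..<int N - t}. a n) + real (nat \<bar>t\<bar>) * C"
    proof -
      have "(\<Sum>n\<in>{0..<int N}. a n) \<le> (\<Sum>n\<in>{- t..<int N - t} \<union> ({0..<int N} - {- t..<int N - t}). a n)"
        by (rule sum_mono2) (use a0 in auto)
      also have "\<dots> = (\<Sum>n\<in>{- t..<int N - t}. a n) + (\<Sum>n\<in>{0..<int N} - {- t..<int N - t}. a n)"
        by (rule sum.union_disjoint) auto
      also have "(\<Sum>n\<in>{0..<int N} - {- t..<int N - t}. a n) \<le> of_nat (card ({0..<int N} - {- t..<int N - t})) * C"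
        by (rule sum_bounded_above) (rule a1)
      also have "\<dots> \<le> real (nat \<bar>t\<bar>) * C"
      proof (intro mult_right_mono C0)
        have "card ({0..<int N} - {- t..<int N - t}) \<le> card (if 0 \<le> t then {int N - t..<int N} else {0..<- t})"
          by (rule card_mono) auto
        also have "\<dots> \<le> nat \<bar>t\<bar>" by auto
        finally show "real (card ({0..<int N} - {- t..<int N - t})) \<le> real (nat \<bar>t\<bar>)" by simp
      qed
      finally show ?thesis by simp
    qed
    have 2: "(\<Sum>n<N. a (int n - u)) = (\<Sum>n\<in>{- u..<int N - u}. a n)" for u
      by (rule sum.reindex_bij_witness[where i="\<lambda>n. nat (n + u)" and j="\<lambda>n. int n - u"]) auto
    show ?thesis using 1 2[of t] 2[of 0] by simp
  qed
  show ?thesis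
    unfolding cesaro_null_def
  proof (rule null_idealD(4)[OF null_ideal_tendsto])
    show "0 \<le> (\<Sum>n<N. a (int n)) / real N" for N using a0 by (intro divide_nonneg_nonneg sum_nonneg) auto
    fix e :: real assume e: "0 < e"
    \<comment> \<open>With this many translates the averaged bound \<open>C / L\<close> is below
      \<open>e\<close>; the boundary terms \<open>D\<close> are then fixed and disappear after
      division by \<open>N\<close>.\<close>
    obtain L where L: "C / e < real L" using reals_Archimedean2 by blast
    then have L0: "0 < real L" using C0 e by (smt (verit) divide_nonneg_pos)
    obtain s :: "nat \<Rightarrow> int" where s: "\<forall>n. (\<Sum>i<L. a (n - s i)) \<le> C" using tr[of L] ..
    define D where "D = (\<Sum>i<L. real (nat \<bar>s i\<bar>) * C)"
    have "(\<Sum>n<N. a (int n)) / real N \<le> D / real L / real N + e" for N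
    proof (cases "N = 0")
      case False
      have "real L * (\<Sum>n<N. a (int n)) = (\<Sum>i<L. \<Sum>n<N. a (int n))" by simp
      also have "\<dots> \<le> (\<Sum>i<L. (\<Sum>n<N. a (int n - s i)) + real (nat \<bar>s i\<bar>) * C)" by (intro sum_mono shift)
      also have "\<dots> = (\<Sum>n<N. \<Sum>i<L. a (int n - s i)) + D" unfolding D_def sum.distrib by (subst sum.swap) simp
      also have "(\<Sum>n<N. \<Sum>i<L. a (int n - s i)) \<le> (\<Sum>n<N. C)" by (intro sum_mono) (use s in simp)
      also have "(\<Sum>n<N. C) = real N * C" by simp
      also have "real N * C \<le> real N * (e * real L)"
        by (rule mult_left_mono) (use L e in \<open>simp_all add: field_simps\<close>)
      finally show ?thesis using False L0 by (simp add: field_simps)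
    qed (use e in simp)
    moreover have "(\<lambda>N. D / real L / real N) \<longlonglongrightarrow> 0" by (rule lim_const_over_n)
    ultimately show "\<exists>x. x \<longlonglongrightarrow> 0 \<and> (\<forall>N. (\<Sum>n<N. a (int n)) / real N \<le> x N + e)" by blast
  qed
qed

text \<open>For fixed \<open>B\<close> the defect of mixing is a signed measure in \<open>A\<close> dominated by \<open>\<mu>\<close>, uniformly in \<open>n\<close>.\<close>

lemma (in prob_space) null_ideal_signed_extend:
  fixes d :: "nat \<Rightarrow> 'a set \<Rightarrow> real"
  assumes Z: "null_ideal Z"
    and G: "Int_stable G" "G \<subseteq> Pow (space M)" "sets M = sigma_sets (space M) G"
    and d0: "\<And>n. d n (space M) = 0"
    and dU: "\<And>n A B. A \<in> sets M \<Longrightarrow> B \<in> sets M \<Longrightarrow> A \<inter> B = {} \<Longrightarrow> d n (A \<union> B) = d n A + d n B"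
    and dle: "\<And>n A. A \<in> sets M \<Longrightarrow> \<bar>d n A\<bar> \<le> prob A"
    and base: "\<And>A. A \<in> G \<Longrightarrow> Z (\<lambda>n. \<bar>d n A\<bar>)"
    and A: "A \<in> sets M"
  shows "Z (\<lambda>n. \<bar>d n A\<bar>)"
proof -
  have "A \<in> sigma_sets (space M) G" using A G(3) by simp
  with G(1,2) show ?thesis
  proof (induction rule: sigma_sets_induct_disjoint)
    case (basic A)
    then show ?case by (rule base)
  next
    case empty
    have "d n {} = 0" for n using dle[of "{}" n] by simp
    then show ?case using null_idealD(1)[OF Z] by simp
  next
    case (compl A)
    have As: "A \<in> sets M" using compl G(3) by simp
    have "d n (A \<union> (space M - A)) = d n A + d n (space M - A)" for n by (rule dU) (use As in auto)
    moreover have "A \<union> (space M - A) = space M" using sets.sets_into_space[OF As] by auto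
    ultimately have "\<bar>d n (space M - A)\<bar> = \<bar>d n A\<bar>" for n using d0[of n] by (simp add: abs_minus_commute)
    then show ?case using compl by simp
  next
    case (union A)
    have As: "A i \<in> sets M" for i using union(2) G(3) by auto
    have fin: "d n (\<Union>i<k. A i) = (\<Sum>i<k. d n (A i))" for n k
    proof (induction k)
      case 0
      show ?case using dle[of "{}" n] by simp
    next
      case (Suc k)
      have "d n ((\<Union>i<k. A i) \<union> A k) = d n (\<Union>i<k. A i) + d n (A k)"
        by (rule dU) (use As disjoint_family_onD[OF union(1), of _ k] in fastforce)+
      moreover have "(\<Union>i<Suc k. A i) = (\<Union>i<k. A i) \<union> A k" by (auto simp: less_Suc_eq)
      ultimately show ?case using Suc by simp
    qed
    have Us: "(\<Union>i. A i) \<in> sets M" using As by auto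
    have "(\<lambda>k. prob (\<Union>i<k. A i)) \<longlonglongrightarrow> prob (\<Union>k. \<Union>i<k. A i)"
      proof (rule finite_Lim_measure_incseq)
      show "incseq (\<lambda>k. \<Union>i<k. A i)" unfolding incseq_def by (intro allI impI UN_mono) auto
    qed (use As in auto)
    moreover have "(\<Union>k. \<Union>i<k. A i) = (\<Union>i. A i)" by auto
    ultimately have lim: "(\<lambda>k. prob (\<Union>i<k. A i)) \<longlonglongrightarrow> prob (\<Union>i. A i)" by simp
    show ?case
    proof (rule null_idealD(4)[OF Z])
      fix e :: real assume "0 < e"
      then obtain k where "norm (prob (\<Union>i<k. A i) - prob (\<Union>i. A i)) < e" using LIMSEQ_D[OF lim] by blast
      then have k: "prob ((\<Union>i. A i) - (\<Union>i<k. A i)) < e"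
        by (subst finite_measure_Diff) (use As in auto)
      have "\<bar>d n (\<Union>i. A i)\<bar> \<le> (\<Sum>i<k. \<bar>d n (A i)\<bar>) + e" for n
      proof -
        have "d n ((\<Union>i<k. A i) \<union> ((\<Union>i. A i) - (\<Union>i<k. A i))) = d n (\<Union>i<k. A i) + d n ((\<Union>i. A i) - (\<Union>i<k. A i))"
          by (rule dU) (use As in auto)
        moreover have "(\<Union>i<k. A i) \<union> ((\<Union>i. A i) - (\<Union>i<k. A i)) = (\<Union>i. A i)" by auto
        moreover have "\<bar>d n ((\<Union>i. A i) - (\<Union>i<k. A i))\<bar> \<le> prob ((\<Union>i. A i) - (\<Union>i<k. A i))"
          by (rule dle) (use As in auto)
        moreover have "\<bar>d n (\<Union>i<k. A i)\<bar> \<le> (\<Sum>i<k. \<bar>d n (A i)\<bar>)" unfolding fin by (rule sum_abs)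
        ultimately show ?thesis using k by simp
      qed
      moreover have "Z (\<lambda>n. \<Sum>i<k. \<bar>d n (A i)\<bar>)" by (rule null_ideal_sum[OF Z]) (use union in auto)
      ultimately show "\<exists>x. Z x \<and> (\<forall>n. \<bar>d n (\<Union>i. A i)\<bar> \<le> x n + e)" by blast
    qed auto
  qed
qed

text \<open>The defect is additive in each of the two sets separately and is bounded by the
  probability of either one, uniformly in \<open>n\<close> because \<open>S n\<close> preserves the
  measure. So the one-sided extension applies twice: in the first set with the second in
  \<open>G\<close>, and then in the second set with the first arbitrary.\<close>

lemma (in prob_space) null_ideal_mixing_extend:
  assumes Z: "null_ideal Z" and S: "\<And>n. automorphism M (S n)"
    and G: "Int_stable G" "G \<subseteq> Pow (space M)" "sets M = sigma_sets (space M) G"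
    and base: "\<And>A B. A \<in> G \<Longrightarrow> B \<in> G \<Longrightarrow> Z (\<lambda>n. \<bar>prob ((S n -` A \<inter> space M) \<inter> B) - prob A * prob B\<bar>)"
    and AB: "A \<in> sets M" "B \<in> sets M"
  shows "Z (\<lambda>n. \<bar>prob ((S n -` A \<inter> space M) \<inter> B) - prob A * prob B\<bar>)"
proof -
  have Gs: "C \<in> sets M" if "C \<in> G" for C using that G(3) by auto
  have pre: "S n -` C \<inter> space M \<in> sets M" if "C \<in> sets M" for C n
    using measurable_sets[OF automorphismD(1)[OF S] that] .
  have bound: "\<bar>prob (C \<inter> D) - prob C * prob D\<bar> \<le> prob D \<and> \<bar>prob (C \<inter> D) - prob C * prob D\<bar> \<le> prob C"
    if "C \<in> sets M" "D \<in> sets M" for C D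
  proof -
    have "prob (C \<inter> D) \<le> prob C" "prob (C \<inter> D) \<le> prob D"
      using that by (auto intro: finite_measure_mono)
    moreover have "prob C * prob D \<le> prob C" "prob C * prob D \<le> prob D"
      by (auto intro: mult_left_le mult_left_le_one_le)
    moreover have "0 \<le> prob C * prob D" "0 \<le> prob (C \<inter> D)" by auto
    ultimately show ?thesis by linarith
  qed
  have 1: "Z (\<lambda>n. \<bar>prob ((S n -` A \<inter> space M) \<inter> B) - prob A * prob B\<bar>)" if B: "B \<in> G" and A: "A \<in> sets M" for A B
  proof (rule null_ideal_signed_extend[OF Z G _ _ _ _ A])
    fix n
    show "prob ((S n -` space M \<inter> space M) \<inter> B) - prob (space M) * prob B = 0"
    proof -
      have "(S n -` space M \<inter> space M) \<inter> B = B"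
        using automorphism_in_space[OF S] sets.sets_into_space[OF Gs[OF B]] by auto
      then show ?thesis by (simp add: prob_space)
    qed
  next
    fix n A1 A2 assume A12: "A1 \<in> sets M" "A2 \<in> sets M" "A1 \<inter> A2 = {}"
    have "prob ((S n -` (A1 \<union> A2) \<inter> space M) \<inter> B) = prob (((S n -` A1 \<inter> space M) \<inter> B) \<union> ((S n -` A2 \<inter> space M) \<inter> B))"
      by (rule arg_cong[where f=prob]) auto
    also have "\<dots> = prob ((S n -` A1 \<inter> space M) \<inter> B) + prob ((S n -` A2 \<inter> space M) \<inter> B)"
      by (rule finite_measure_Union) (use pre A12 Gs[OF B] in auto)
    finally show "prob ((S n -` (A1 \<union> A2) \<inter> space M) \<inter> B) - prob (A1 \<union> A2) * prob B =
       prob ((S n -` A1 \<inter> space M) \<inter> B) - prob A1 * prob B + (prob ((S n -` A2 \<inter> space M) \<inter> B) - prob A2 * prob B)"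
      using finite_measure_Union[OF A12] by (simp add: algebra_simps)
  next
    fix n A assume A: "A \<in> sets M"
    show "\<bar>prob ((S n -` A \<inter> space M) \<inter> B) - prob A * prob B\<bar> \<le> prob A"
      using bound[OF pre[OF A, of n] Gs[OF B]] automorphism_measure_vimage[OF S A, of n] by simp
  qed (rule base, assumption, rule B)
  show ?thesis
  proof (rule null_ideal_signed_extend[OF Z G _ _ _ _ AB(2)])
    fix n
    show "prob ((S n -` A \<inter> space M) \<inter> space M) - prob A * prob (space M) = 0"
      using automorphism_measure_vimage[OF S AB(1), of n] by (simp add: prob_space Int_absorb2)
  next
    fix n B1 B2 assume B12: "B1 \<in> sets M" "B2 \<in> sets M" "B1 \<inter> B2 = {}"
    have "prob ((S n -` A \<inter> space M) \<inter> (B1 \<union> B2)) = prob (((S n -` A \<inter> space M) \<inter> B1) \<union> ((S n -` A \<inter> space M) \<inter> B2))"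
      by (rule arg_cong[where f=prob]) auto
    also have "\<dots> = prob ((S n -` A \<inter> space M) \<inter> B1) + prob ((S n -` A \<inter> space M) \<inter> B2)"
      by (rule finite_measure_Union) (use pre AB B12 in auto)
    finally show "prob ((S n -` A \<inter> space M) \<inter> (B1 \<union> B2)) - prob A * prob (B1 \<union> B2) =
       prob ((S n -` A \<inter> space M) \<inter> B1) - prob A * prob B1 + (prob ((S n -` A \<inter> space M) \<inter> B2) - prob A * prob B2)"
      using finite_measure_Union[OF B12] by (simp add: algebra_simps)
  next
    fix n B assume B: "B \<in> sets M"
    show "\<bar>prob ((S n -` A \<inter> space M) \<inter> B) - prob A * prob B\<bar> \<le> prob B"
      using bound[OF pre[OF AB(1), of n] B] automorphism_measure_vimage[OF S AB(1), of n] by simp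
  qed (rule 1, assumption, rule AB)
qed

lemma (in prob_space) weakly_mixingI:
  assumes T: "automorphism M T"
    and G: "Int_stable G" "G \<subseteq> Pow (space M)" "sets M = sigma_sets (space M) G"
    and base: "\<And>A B. A \<in> G \<Longrightarrow> B \<in> G \<Longrightarrow>
      cesaro_null (\<lambda>n. \<bar>prob (((T ^^ n) -` A \<inter> space M) \<inter> B) - prob A * prob B\<bar>)"
  shows "weakly_mixing M T"
  using null_ideal_mixing_extend[OF null_ideal_cesaro automorphism_funpow[OF T] G base]
  unfolding weakly_mixing_def cesaro_null_def by blast

text \<open>An invariant set \<open>A\<close> is contained in its preimage under each
  \<open>S n\<close> up to a null set, so its self-correlation is constantly \<open>prob A\<close>;
  mixing along \<open>S n\<close> makes it the square of \<open>prob A\<close>.\<close>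

lemma (in prob_space) ergodic_groupI:
  assumes S: "\<And>n. S n \<in> H" "\<And>n. automorphism M (S n)"
    and G: "Int_stable G" "G \<subseteq> Pow (space M)" "sets M = sigma_sets (space M) G"
    and base: "\<And>A B. A \<in> G \<Longrightarrow> B \<in> G \<Longrightarrow>
      (\<lambda>n. \<bar>prob ((S n -` A \<inter> space M) \<inter> B) - prob A * prob B\<bar>) \<longlonglongrightarrow> 0"
  shows "ergodic_group M H"
  unfolding ergodic_group_def
proof (intro ballI impI)
  fix A assume A: "A \<in> sets M" and inv: "\<forall>S\<in>H. measure M (sym_diff (S ` A) A) = 0"
  have "prob ((S n -` A \<inter> space M) \<inter> A) = prob A" for n
  proof -
    let ?B = "S n -` A \<inter> space M"
    have B: "?B \<in> sets M" using measurable_sets[OF automorphismD(1)[OF S(2)] A] .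
    have SA: "S n ` A \<in> sets M" using automorphism_image_sets[OF S(2) A] .
    have "prob (A - ?B) = prob (S n ` (A - ?B))"
      by (rule automorphism_measure_image[OF S(2), symmetric]) (use A B in auto)
    also have "\<dots> \<le> prob (sym_diff (S n ` A) A)"
      by (rule finite_measure_mono) (use A SA sets.sets_into_space[OF A] in auto)
    also have "\<dots> = 0" using inv S(1) by auto
    finally have "prob (A - ?B) = 0" by (simp add: measure_le_0_iff)
    moreover have "prob A = prob ((?B \<inter> A) \<union> (A - ?B))" by (rule arg_cong[where f=prob]) auto
    moreover have "\<dots> = prob (?B \<inter> A) + prob (A - ?B)" by (rule finite_measure_Union) (use A B in auto)
    ultimately show ?thesis by simp
  qed
  then have "(\<lambda>n. \<bar>prob A - prob A * prob A\<bar>) \<longlonglongrightarrow> 0"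
    using null_ideal_mixing_extend[OF null_ideal_tendsto S(2) G base A A] by simp
  then have "prob A - prob A * prob A = 0"
    using LIMSEQ_unique tendsto_const by fastforce
  then have "prob A * (1 - prob A) = 0" by (simp add: algebra_simps)
  then show "prob A \<in> {0, 1}" by auto
qed

section \<open>The Poisson process on the half line\<close>

definition half_line :: "real measure" where
  "half_line = restrict_space lborel {0..}"

definition windows :: "nat \<Rightarrow> real set" where
  "windows k = {0..<real k}"

abbreviation half_line_confs :: "real set set" where
  "half_line_confs \<equiv> configurations half_line windows"

text \<open>On bounded sets every configuration is finite, not just almost every one. Unbounded sets
  of finite measure are reached afterwards by exhaustion with \<open>windows\<close>.\<close>

definition bounded_borel :: "real set set" where
  "bounded_borel = {K \<in> sets borel. \<exists>k. K \<subseteq> windows k}"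

definition void :: "real set \<Rightarrow> real set set" where
  "void K = {\<omega> \<in> half_line_confs. \<omega> \<inter> K = {}}"

lemma space_half_line: "space half_line = {0..}"
  by (simp add: half_line_def space_restrict_space)

lemma sets_half_line: "A \<in> sets half_line \<longleftrightarrow> A \<in> sets borel \<and> A \<subseteq> {0..}"
proof -
  have "A \<in> sets half_line \<longleftrightarrow> A \<in> (\<inter>) {0..} ` sets borel"
    by (simp add: half_line_def sets_restrict_space)
  also have "\<dots> \<longleftrightarrow> A \<in> sets borel \<and> A \<subseteq> {0..}"
  proof
    assume "A \<in> (\<inter>) {0..} ` sets borel"
    then show "A \<in> sets borel \<and> A \<subseteq> {0..}" by auto
  next
    assume "A \<in> sets borel \<and> A \<subseteq> {0..}"
    then show "A \<in> (\<inter>) {0..} ` sets borel" by (intro image_eqI[of _ _ A]) auto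
  qed
  finally show ?thesis .
qed

lemma emeasure_half_line: "A \<subseteq> {0..} \<Longrightarrow> emeasure half_line A = emeasure lborel A"
  unfolding half_line_def by (rule emeasure_restrict_space) auto

lemma measure_half_line: "A \<subseteq> {0..} \<Longrightarrow> measure half_line A = measure lborel A"
  by (simp add: measure_def emeasure_half_line)

lemma windows_half_line: "windows k \<subseteq> {0..}" "windows k \<in> sets half_line"
  by (auto simp: windows_def sets_half_line)

lemma windows_mono: "j \<le> k \<Longrightarrow> windows j \<subseteq> windows k"
  by (auto simp: windows_def)

lemma bounded_borel_sets:
  assumes "K \<in> bounded_borel"
  shows "K \<in> sets borel" "K \<subseteq> {0..}" "K \<in> sets half_line" "emeasure half_line K < \<infinity>" "K \<in> fmeasurable half_line"
    "K \<in> fmeasurable lborel"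
proof -
  obtain k where k: "K \<subseteq> windows k" and b: "K \<in> sets borel" using assms by (auto simp: bounded_borel_def)
  show "K \<in> sets borel" by fact
  show 1: "K \<subseteq> {0..}" using k windows_half_line(1) by blast
  show 2: "K \<in> sets half_line" using b 1 by (simp add: sets_half_line)
  have "emeasure lborel K \<le> emeasure lborel {0..<real k}"
    by (rule emeasure_mono) (use k in \<open>auto simp: windows_def\<close>)
  also have "\<dots> < \<infinity>" by simp
  finally have 3: "emeasure lborel K < \<infinity>" .
  then show 4: "emeasure half_line K < \<infinity>" using emeasure_half_line[OF 1] by simp
  show "K \<in> fmeasurable half_line" using 2 4 by (auto simp: fmeasurable_def)
  show "K \<in> fmeasurable lborel" using b 3 by (auto simp: fmeasurable_def)
qed

lemma windows_bounded_borel: "windows k \<in> bounded_borel"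
  by (auto simp: bounded_borel_def windows_def)

lemma bounded_borel_subset:
  "K \<in> bounded_borel \<Longrightarrow> L \<in> sets borel \<Longrightarrow> L \<subseteq> K \<Longrightarrow> L \<in> bounded_borel"
  by (auto simp: bounded_borel_def)

lemma bounded_borel_Un: "K \<in> bounded_borel \<Longrightarrow> L \<in> bounded_borel \<Longrightarrow> K \<union> L \<in> bounded_borel"
proof -
  assume a: "K \<in> bounded_borel" "L \<in> bounded_borel"
  then obtain k l where "K \<subseteq> windows k" "L \<subseteq> windows l" by (auto simp: bounded_borel_def)
  then have "K \<union> L \<subseteq> windows (max k l)" using windows_mono[of k "max k l"] windows_mono[of l "max k l"] by auto
  then show ?thesis using a by (auto simp: bounded_borel_def)
qed

lemma bounded_borel_empty: "{} \<in> bounded_borel"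
  by (auto simp: bounded_borel_def)

lemma half_line_conf_iff:
  "\<omega> \<in> half_line_confs \<longleftrightarrow> \<omega> \<subseteq> {0..} \<and> (\<forall>k. finite (\<omega> \<inter> windows k))"
proof
  assume "\<omega> \<subseteq> {0..} \<and> (\<forall>k. finite (\<omega> \<inter> windows k))"
  then have sub: "\<omega> \<subseteq> {0..}" and fin: "\<And>k. finite (\<omega> \<inter> windows k)" by auto
  have "\<omega> = (\<Union>k. \<omega> \<inter> windows k)"
  proof (intro set_eqI iffI)
    fix x assume x: "x \<in> \<omega>"
    obtain k where "x < real k" using reals_Archimedean2 by blast
    then show "x \<in> (\<Union>k. \<omega> \<inter> windows k)" using x sub by (auto simp: windows_def)
  qed auto
  moreover have "countable (\<Union>k. \<omega> \<inter> windows k)"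
    using fin by (intro countable_UN) (auto intro: countable_finite)
  ultimately have "countable \<omega>" by simp
  then show "\<omega> \<in> half_line_confs" using sub fin by (auto simp: configurations_def space_half_line)
qed (auto simp: configurations_def space_half_line)

lemma half_line_conf_finite:
  assumes "\<omega> \<in> half_line_confs" "K \<in> bounded_borel"
  shows "finite (\<omega> \<inter> K)"
proof -
  obtain k where "K \<subseteq> windows k" using assms(2) by (auto simp: bounded_borel_def)
  then have "\<omega> \<inter> K \<subseteq> \<omega> \<inter> windows k" by auto
  then show ?thesis using assms(1) half_line_conf_iff finite_subset by blast
qed

lemma exhausting_windows: "exhausting half_line windows"
proof -
  have "(\<Union>k. windows k) = {0..}"
  proof (intro set_eqI iffI)
    fix x :: real assume x: "x \<in> {0..}"
    obtain k where "x < real k" using reals_Archimedean2 by blast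
    then show "x \<in> (\<Union>k. windows k)" using x by (auto simp: windows_def)
  qed (auto simp: windows_def)
  moreover have "emeasure half_line (windows k) < \<infinity>" for k
    using bounded_borel_sets(4)[OF windows_bounded_borel] .
  moreover have "incseq windows" using windows_mono by (auto simp: incseq_def)
  ultimately show ?thesis
    using windows_half_line(2) by (auto simp: exhausting_def space_half_line)
qed

lemma standard_infinite_half_line: "standard_infinite_measure half_line"
proof -
  have std: "standard_borel_space half_line"
    unfolding standard_borel_space_def
  proof (intro bexI exI conjI)
    show "(\<lambda>x. x) \<in> measurable half_line (restrict_space borel {0..})"
      by (simp add: half_line_def measurable_restrict_space2_iff measurable_restrict_space1 space_restrict_space)
    show "bij_betw (\<lambda>x. x) (space half_line) {0..}" by (simp add: space_half_line bij_betw_def)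
    have "inv_into (space half_line) (\<lambda>x. x) x = x" if "x \<in> {0..}" for x
      using inv_into_f_f[of "\<lambda>x. x" "space half_line" x] that by (simp add: space_half_line)
    moreover have "(\<lambda>x. x) \<in> measurable (restrict_space borel {0..}) half_line"
    proof (rule measurableI)
      fix A assume A: "A \<in> sets half_line"
      then have "(\<lambda>x. x) -` A \<inter> space (restrict_space borel {0..}) = {0..} \<inter> A"
        by (auto simp: space_restrict_space)
      then show "(\<lambda>x. x) -` A \<inter> space (restrict_space borel {0..}) \<in> sets (restrict_space borel {0..})"
        using A by (auto simp: sets_half_line sets_restrict_space)
    qed (simp add: space_restrict_space space_half_line)
    ultimately show "inv_into (space half_line) (\<lambda>x. x) \<in> measurable (restrict_space borel {0..}) half_line"
      by (subst measurable_cong[where g="\<lambda>x. x"]) (auto simp: space_restrict_space)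
  qed auto
  have sf: "sigma_finite_measure half_line"
    unfolding half_line_def by (intro sigma_finite_measure_restrict_space sigma_finite_lborel) auto
  have na: "non_atomic half_line"
    unfolding non_atomic_def
  proof (intro ballI impI)
    fix A assume A: "A \<in> sets half_line" and pos: "0 < emeasure half_line A"
    have Ab: "A \<in> sets borel" "A \<subseteq> {0..}" using A by (auto simp: sets_half_line)
    \<comment> \<open>Any length strictly below the measure of \<open>A\<close> will do: a slice of
      \<open>A\<close> of length \<open>d\<close> then has smaller measure than \<open>A\<close>,
      and one of the countably many slices has positive measure.\<close>
    obtain d :: real where d: "0 < d" "ennreal d < emeasure half_line A"
    proof (cases "emeasure half_line A" rule: ennreal_cases)
      case (real r)
      then have "0 < r" using pos by simp
      then show ?thesis using real by (intro that[of "r / 2"]) (auto simp: ennreal_less_iff)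
    next
      case top
      then show ?thesis by (intro that[of 1]) auto
    qed
    define B where "B i = A \<inter> {real i * d..<real (Suc i) * d}" for i
    have Bs: "B i \<in> sets half_line" for i using Ab by (auto simp: B_def sets_half_line)
    have un: "A = (\<Union>i. B i)"
    proof (intro set_eqI iffI)
      fix x assume x: "x \<in> A"
      then have x0: "0 \<le> x" using Ab by auto
      define i where "i = nat \<lfloor>x / d\<rfloor>"
      have i: "real i = of_int \<lfloor>x / d\<rfloor>" using x0 d by (simp add: i_def)
      have "real i \<le> x / d" "x / d < real i + 1" unfolding i by linarith+
      then have "x \<in> B i" using x d by (simp add: B_def field_simps)
      then show "x \<in> (\<Union>i. B i)" by blast
    qed (auto simp: B_def)
    have "\<exists>i. 0 < emeasure half_line (B i)"
    proof (rule ccontr)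
      assume "\<nexists>i. 0 < emeasure half_line (B i)"
      then have "emeasure half_line (B i) = 0" for i by (simp add: zero_less_iff_neq_zero)
      then have "emeasure half_line (\<Union>i. B i) = 0"
        by (intro emeasure_UN_eq_0) (use Bs in auto)
      then show False using pos un by simp
    qed
    then obtain i where i: "0 < emeasure half_line (B i)" ..
    have "emeasure half_line (B i) = emeasure lborel (B i)"
      by (rule emeasure_half_line) (use Ab in \<open>auto simp: B_def\<close>)
    also have "\<dots> \<le> emeasure lborel {real i * d..<real (Suc i) * d}"
      by (rule emeasure_mono) (auto simp: B_def)
    also have "\<dots> = ennreal d" using d by (simp add: algebra_simps)
    finally have "emeasure half_line (B i) < emeasure half_line A" using d by simp
    then show "\<exists>B\<in>sets half_line. B \<subseteq> A \<and> 0 < emeasure half_line B \<and> emeasure half_line B < emeasure half_line A"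
      using i Bs by (intro bexI[of _ "B i"]) (auto simp: B_def)
  qed
  have "emeasure lborel {0::real..} = \<infinity>"
  proof -
    have "ennreal (real n) \<le> emeasure lborel {0::real..}" for n
    proof -
      have "ennreal (real n) = emeasure lborel {0..real n}" by simp
      also have "\<dots> \<le> emeasure lborel {0::real..}" by (rule emeasure_mono) auto
      finally show ?thesis .
    qed
    note le = this
    show ?thesis
    proof (cases "emeasure lborel {0::real..}" rule: ennreal_cases)
      case (real r)
      obtain n where "r < real n" using reals_Archimedean2 by blast
      then show ?thesis using le[of n] real by simp
    qed simp
  qed
  then have "emeasure half_line (space half_line) = \<infinity>"
    by (simp add: emeasure_half_line space_half_line)
  with std sf na show ?thesis by (simp add: standard_infinite_measure_def)
qed

subsection \<open>Void events generate\<close>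

definition dyadic :: "nat \<Rightarrow> nat \<Rightarrow> real set" where
  "dyadic k i = {real i / 2 ^ k..<real (Suc i) / 2 ^ k}"

lemma mem_dyadic_iff:
  assumes "0 \<le> y"
  shows "y \<in> dyadic k i \<longleftrightarrow> i = nat \<lfloor>y * 2 ^ k\<rfloor>"
proof -
  have "y \<in> dyadic k i \<longleftrightarrow> real i \<le> y * 2 ^ k \<and> y * 2 ^ k < real i + 1"
    by (simp add: dyadic_def field_simps)
  also have "\<dots> \<longleftrightarrow> \<lfloor>y * 2 ^ k\<rfloor> = int i"
    by (simp add: floor_eq_iff)
  also have "\<dots> \<longleftrightarrow> i = nat \<lfloor>y * 2 ^ k\<rfloor>"
    using assms by (auto simp: zero_le_mult_iff)
  finally show ?thesis .
qed

lemma dyadic_bounded_borel: "dyadic k i \<in> bounded_borel"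
proof -
  have "real (Suc i) / 2 ^ k \<le> real (Suc i) / 1" by (rule divide_left_mono) auto
  then have "dyadic k i \<subseteq> windows (Suc i)"
    by (auto simp: dyadic_def windows_def intro: order_trans[rotated] divide_nonneg_nonneg)
  then show ?thesis by (auto simp: bounded_borel_def dyadic_def)
qed

lemma dyadic_disjoint: "i \<noteq> j \<Longrightarrow> dyadic k i \<inter> dyadic k j = {}"
proof -
  assume ij: "i \<noteq> j"
  have "y \<notin> dyadic k j" if y: "y \<in> dyadic k i" for y
  proof -
    have "0 \<le> real i / 2 ^ k" by simp
    also have "\<dots> \<le> y" using y by (simp add: dyadic_def)
    finally have "0 \<le> y" .
    then show ?thesis using mem_dyadic_iff[of y k i] mem_dyadic_iff[of y k j] y ij by simp
  qed
  then show ?thesis by blast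
qed

lemma finite_separated_by_dyadic:
  fixes F :: "real set"
  assumes "finite F"
  obtains k0 where "\<And>k. k0 \<le> k \<Longrightarrow> inj_on (\<lambda>y. \<lfloor>y * 2 ^ k\<rfloor>) F"
proof -
  let ?D = "(\<lambda>(x, y). \<bar>x - y\<bar>) ` {(x, y) \<in> F \<times> F. x \<noteq> y}"
  have "{(x, y) \<in> F \<times> F. x \<noteq> y} \<subseteq> F \<times> F" by auto
  then have "finite {(x, y) \<in> F \<times> F. x \<noteq> y}" using assms by (meson finite_SigmaI finite_subset)
  then have fin: "finite (insert 1 ?D)" by (intro finite.insertI finite_imageI)
  define d where "d = Min (insert 1 ?D)"
  have d0: "0 < d" unfolding d_def using fin by (subst Min_gr_iff) auto
  have d: "d \<le> \<bar>x - y\<bar>" if "x \<in> F" "y \<in> F" "x \<noteq> y" for x y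
    unfolding d_def by (rule Min_le[OF fin]) (use that in force)
  obtain k0 where k0: "1 / d < 2 ^ k0" using real_arch_pow[of 2 "1/d"] by auto
  show thesis
  proof (rule that, rule inj_onI, rule ccontr)
    fix k x y assume k: "k0 \<le> k" and xy: "x \<in> F" "y \<in> F" "\<lfloor>x * 2 ^ k\<rfloor> = \<lfloor>y * 2 ^ k\<rfloor>" "x \<noteq> y"
    have "\<bar>x * 2 ^ k - y * 2 ^ k\<bar> < 1" using xy(3) by linarith
    then have "\<bar>x - y\<bar> * 2 ^ k < 1" by (simp add: left_diff_distrib[symmetric] abs_mult)
    moreover have "(2::real) ^ k0 \<le> 2 ^ k" using k by (rule power_increasing) simp
    then have "1 / d < 2 ^ k" using k0 by linarith
    then have "1 < d * 2 ^ k" using d0 by (simp add: field_simps)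
    moreover have "d * 2 ^ k \<le> \<bar>x - y\<bar> * 2 ^ k" using d[OF xy(1,2,4)] by (intro mult_right_mono) auto
    ultimately show False by linarith
  qed
qed

lemma void_subset: "void K \<subseteq> half_line_confs"
  by (auto simp: void_def)

lemma void_Un: "void K \<inter> void L = void (K \<union> L)"
  by (auto simp: void_def)

lemma Int_stable_void: "Int_stable (void ` bounded_borel)"
  by (intro Int_stableI) (auto simp: void_Un intro!: imageI bounded_borel_Un)

lemma void_Pow: "void ` bounded_borel \<subseteq> Pow half_line_confs"
  using void_subset by auto

text \<open>Finitely many points are separated by a fine enough dyadic partition, and distinct cells
  contain distinct points. This expresses counts through countably many void events. The infinite
  case is listed separately because \<open>card\<close> is 0 there.\<close>

lemma atleast_points_iff:
  assumes \<omega>: "\<omega> \<subseteq> {0..}"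
  shows "(infinite (\<omega> \<inter> A) \<or> n \<le> card (\<omega> \<inter> A)) \<longleftrightarrow>
     (\<exists>k. \<exists>I. finite I \<and> card I = n \<and> (\<forall>i\<in>I. \<omega> \<inter> (A \<inter> dyadic k i) \<noteq> {}))"
    (is "?L \<longleftrightarrow> ?R")
proof
  assume ?L
  then obtain F where F: "F \<subseteq> \<omega> \<inter> A" "finite F" "card F = n"
  proof (cases "finite (\<omega> \<inter> A)")
    case True
    then have "n \<le> card (\<omega> \<inter> A)" using \<open>?L\<close> by simp
    then obtain F where "F \<subseteq> \<omega> \<inter> A" "card F = n" by (rule obtain_subset_with_card_n) blast
    then show ?thesis using True that finite_subset by blast
  next
    case False
    then obtain F where "finite F" "card F = n" "F \<subseteq> \<omega> \<inter> A" using infinite_arbitrarily_large by blast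
    then show ?thesis using that by blast
  qed
  obtain k where k: "inj_on (\<lambda>y. \<lfloor>y * 2 ^ k\<rfloor>) F"
    using finite_separated_by_dyadic[OF F(2)] by blast
  have F0: "0 \<le> y" if "y \<in> F" for y using that F \<omega> by auto
  have inj: "inj_on (\<lambda>y. nat \<lfloor>y * 2 ^ k\<rfloor>) F"
  proof (rule inj_onI)
    fix x y assume "x \<in> F" "y \<in> F" "nat \<lfloor>x * 2 ^ k\<rfloor> = nat \<lfloor>y * 2 ^ k\<rfloor>"
    moreover have "0 \<le> \<lfloor>x * 2 ^ k\<rfloor>" "0 \<le> \<lfloor>y * 2 ^ k\<rfloor>" using F0 calculation(1,2) by auto
    ultimately show "x = y" using inj_onD[OF k] by (metis eq_nat_nat_iff)
  qed
  show ?R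
  proof (intro exI conjI ballI)
    show "finite ((\<lambda>y. nat \<lfloor>y * 2 ^ k\<rfloor>) ` F)" using F by auto
    show "card ((\<lambda>y. nat \<lfloor>y * 2 ^ k\<rfloor>) ` F) = n" using card_image[OF inj] F by simp
    fix i assume "i \<in> (\<lambda>y. nat \<lfloor>y * 2 ^ k\<rfloor>) ` F"
    then obtain y where y: "y \<in> F" "i = nat \<lfloor>y * 2 ^ k\<rfloor>" by auto
    then have "y \<in> dyadic k i" using mem_dyadic_iff F0 by simp
    then show "\<omega> \<inter> (A \<inter> dyadic k i) \<noteq> {}" using y F by auto
  qed
next
  assume ?R
  then obtain k I where I: "finite I" "card I = n" "\<And>i. i \<in> I \<Longrightarrow> \<omega> \<inter> (A \<inter> dyadic k i) \<noteq> {}" by blast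
  define f where "f i = (SOME y. y \<in> \<omega> \<inter> (A \<inter> dyadic k i))" for i
  have f: "f i \<in> \<omega> \<inter> (A \<inter> dyadic k i)" if "i \<in> I" for i
    unfolding f_def by (rule someI_ex) (use I(3)[OF that] in blast)
  have inj: "inj_on f I"
  proof (rule inj_onI, rule ccontr)
    fix i j assume ij: "i \<in> I" "j \<in> I" "f i = f j" "i \<noteq> j"
    then have "f i \<in> dyadic k i \<inter> dyadic k j" using f[OF ij(1)] f[OF ij(2)] by auto
    then show False using dyadic_disjoint[OF ij(4)] by auto
  qed
  have sub: "f ` I \<subseteq> \<omega> \<inter> A" using f by auto
  show ?L
  proof (cases "finite (\<omega> \<inter> A)")
    case True
    then have "card (f ` I) \<le> card (\<omega> \<inter> A)" using sub by (rule card_mono)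
    then show ?thesis using card_image[OF inj] I by simp
  qed simp
qed

lemma countable_finite_nat_sets: "countable {I :: nat set. finite I}"
  using countable_Collect_finite by simp

text \<open>\<open>G\<close> is kept general: the same argument is used for the full sigma-algebra
  and, in the proof of independence, for the one generated by the void events inside a single
  set.\<close>

lemma atleast_points_sets:
  assumes G: "G \<subseteq> Pow half_line_confs" "\<And>k i. void (A \<inter> dyadic k i) \<in> G"
  shows "{\<omega> \<in> half_line_confs. infinite (\<omega> \<inter> A) \<or> n \<le> card (\<omega> \<inter> A)} \<in> sigma_sets half_line_confs G"
proof -
  interpret S: sigma_algebra half_line_confs "sigma_sets half_line_confs G"
    by (rule sigma_algebra_sigma_sets[OF G(1)])
  have hit: "half_line_confs - void (A \<inter> dyadic k i) \<in> sigma_sets half_line_confs G" for k i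
    by (intro S.compl_sets sigma_sets.Basic G(2))
  let ?\<I> = "{I :: nat set. finite I \<and> card I = n}"
  have cnt: "countable ?\<I>" by (rule countable_subset[OF _ countable_finite_nat_sets]) auto
  define H where "H k I = {\<omega> \<in> half_line_confs. \<forall>i\<in>I. \<omega> \<inter> (A \<inter> dyadic k i) \<noteq> {}}" for k I
  have H: "H k I \<in> sigma_sets half_line_confs G" if "I \<in> ?\<I>" for k I
  proof (cases "I = {}")
    case True
    then show ?thesis using S.top by (simp add: H_def)
  next
    case False
    then have eq: "H k I = (\<Inter>i\<in>I. half_line_confs - void (A \<inter> dyadic k i))" by (auto simp: H_def void_def)
    show ?thesis unfolding eq by (intro S.finite_INT hit) (use that False in auto)
  qed
  have "\<omega> \<in> half_line_confs \<and> (infinite (\<omega> \<inter> A) \<or> n \<le> card (\<omega> \<inter> A)) \<longleftrightarrow> (\<exists>k. \<exists>I\<in>?\<I>. \<omega> \<in> H k I)" for \<omega>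
  proof (cases "\<omega> \<in> half_line_confs")
    case True
    then have "\<omega> \<subseteq> {0..}" by (simp add: half_line_conf_iff)
    from atleast_points_iff[OF this, of A n] show ?thesis
      using True by (simp add: H_def Bex_def)
  qed (simp add: H_def)
  then have "{\<omega> \<in> half_line_confs. infinite (\<omega> \<inter> A) \<or> n \<le> card (\<omega> \<inter> A)} = (\<Union>k. \<Union>I\<in>?\<I>. H k I)"
    by blast
  also have "\<dots> \<in> sigma_sets half_line_confs G"
    by (intro S.countable_nat_UN S.countable_UN'' image_subsetI cnt H)
  finally show ?thesis .
qed

lemma card_points_sets:
  assumes G: "G \<subseteq> Pow half_line_confs" "\<And>k i. void (A \<inter> dyadic k i) \<in> G"
  shows "{\<omega> \<in> half_line_confs. finite (\<omega> \<inter> A) \<and> card (\<omega> \<inter> A) = n} \<in> sigma_sets half_line_confs G"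
    and "{\<omega> \<in> half_line_confs. card (\<omega> \<inter> A) \<in> N} \<in> sigma_sets half_line_confs G"
proof -
  interpret S: sigma_algebra half_line_confs "sigma_sets half_line_confs G"
    by (rule sigma_algebra_sigma_sets[OF G(1)])
  let ?a = "\<lambda>n. {\<omega> \<in> half_line_confs. infinite (\<omega> \<inter> A) \<or> n \<le> card (\<omega> \<inter> A)}"
  let ?c = "\<lambda>n. {\<omega> \<in> half_line_confs. finite (\<omega> \<inter> A) \<and> card (\<omega> \<inter> A) = n}"
  have a: "?a n \<in> sigma_sets half_line_confs G" for n by (rule atleast_points_sets[OF G])
  have "?c n = ?a n - ?a (Suc n)" for n by auto
  then show c: "?c n \<in> sigma_sets half_line_confs G" for n using S.Diff[OF a a] by simp
  have inf: "{\<omega> \<in> half_line_confs. infinite (\<omega> \<inter> A)} = (\<Inter>n. ?a n)"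
  proof (intro set_eqI iffI)
    fix \<omega> assume \<omega>: "\<omega> \<in> (\<Inter>n. ?a n)"
    then have "infinite (\<omega> \<inter> A) \<or> Suc (card (\<omega> \<inter> A)) \<le> card (\<omega> \<inter> A)" by blast
    then show "\<omega> \<in> {\<omega> \<in> half_line_confs. infinite (\<omega> \<inter> A)}" using \<omega> by auto
  qed auto
  have fin: "finite (\<omega> \<inter> A)" if "card (\<omega> \<inter> A) \<in> N" "0 \<notin> N" for \<omega>
    using that by (cases "finite (\<omega> \<inter> A)") auto
  \<comment> \<open>As \<open>card\<close> is 0 on infinite sets, the value 0 also collects the
    configurations with infinitely many points in \<open>A\<close>.\<close>
  have "{\<omega> \<in> half_line_confs. card (\<omega> \<inter> A) \<in> N} =
     (\<Union>n\<in>N. ?c n) \<union> (if 0 \<in> N then {\<omega> \<in> half_line_confs. infinite (\<omega> \<inter> A)} else {})"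
    by (auto dest: fin)
  also have "\<dots> \<in> sigma_sets half_line_confs G"
  proof (rule S.Un)
    show "(\<Union>n\<in>N. ?c n) \<in> sigma_sets half_line_confs G"
      by (rule S.countable_UN'') (use c in auto)
    have "(\<Inter>n. ?a n) \<in> sigma_sets half_line_confs G"
      by (rule S.countable_INT) (use a in auto)
    then show "(if 0 \<in> N then {\<omega> \<in> half_line_confs. infinite (\<omega> \<inter> A)} else {}) \<in> sigma_sets half_line_confs G"
      unfolding inf by simp
  qed
  finally show "{\<omega> \<in> half_line_confs. card (\<omega> \<inter> A) \<in> N} \<in> sigma_sets half_line_confs G" .
qed

lemma Int_dyadic_bounded_borel: "A \<in> sets borel \<Longrightarrow> A \<inter> dyadic k i \<in> bounded_borel"
  by (rule bounded_borel_subset[OF dyadic_bounded_borel]) (auto simp: dyadic_def)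

lemma void_Int_dyadic: "A \<in> sets borel \<Longrightarrow> void (A \<inter> dyadic k i) \<in> void ` bounded_borel"
  by (intro imageI Int_dyadic_bounded_borel)

lemma configuration_events_half_line:
  "configuration_events half_line windows = sigma_sets half_line_confs (void ` bounded_borel)"
  unfolding configuration_events_def
proof (rule sigma_sets_eqI)
  fix X assume "X \<in> {{\<omega> \<in> half_line_confs. finite (\<omega> \<inter> A) \<and> card (\<omega> \<inter> A) = n} |A n.
          A \<in> sets half_line \<and> emeasure half_line A < \<infinity>}"
  then obtain A n where X: "X = {\<omega> \<in> half_line_confs. finite (\<omega> \<inter> A) \<and> card (\<omega> \<inter> A) = n}"
    and A: "A \<in> sets borel" by (auto simp: sets_half_line)
  show "X \<in> sigma_sets half_line_confs (void ` bounded_borel)"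
    unfolding X by (rule card_points_sets(1)[OF void_Pow void_Int_dyadic[OF A]])
next
  fix X assume "X \<in> void ` bounded_borel"
  then obtain K where K: "K \<in> bounded_borel" "X = void K" by auto
  have "X = {\<omega> \<in> half_line_confs. finite (\<omega> \<inter> K) \<and> card (\<omega> \<inter> K) = 0}"
    unfolding K(2) void_def using half_line_conf_finite[OF _ K(1)] by auto
  then show "X \<in> sigma_sets half_line_confs {{\<omega> \<in> half_line_confs. finite (\<omega> \<inter> A) \<and> card (\<omega> \<inter> A) = n} |A n.
          A \<in> sets half_line \<and> emeasure half_line A < \<infinity>}"
    using bounded_borel_sets[OF K(1)] by (intro sigma_sets.Basic) blast
qed

subsection \<open>Existence\<close>

definition half_line_events :: "real set measure" where
  "half_line_events = sigma half_line_confs (void ` bounded_borel)"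

text \<open>Renyi's characterization: void probabilities determine the process. They are assumed on
  bounded sets, and the Poisson counts and their independence are derived.\<close>

locale half_line_poisson = prob_space M for M :: "real set measure" +
  assumes sets_M: "sets M = sets half_line_events"
    and prob_void: "\<And>K. K \<in> bounded_borel \<Longrightarrow> prob (void K) = exp (- measure lborel K)"

abbreviation cell :: "nat \<Rightarrow> real set" where
  "cell n \<equiv> {real n..<real n + 1}"

abbreviation cell_points :: "nat \<Rightarrow> (nat \<Rightarrow> real) measure" where
  "cell_points n \<equiv> PiM UNIV (\<lambda>_. uniform_measure lborel (cell n))"

text \<open>In each unit cell a Poisson number of points with mean 1 is thrown uniformly. An
  infinite supply of points is drawn and only the first \<open>fst z\<close> of them are used, which
  makes the sample space a plain product.\<close>

abbreviation cell_law :: "nat \<Rightarrow> (nat \<times> (nat \<Rightarrow> real)) measure" where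
  "cell_law n \<equiv> measure_pmf (poisson_pmf 1) \<Otimes>\<^sub>M cell_points n"

lemma prob_space_cell: "prob_space (uniform_measure lborel (cell n))"
  by (rule prob_space_uniform_measure) auto

lemma prob_space_cell_points: "prob_space (cell_points n)"
  by (intro prob_space_PiM prob_space_cell)

lemma prob_space_cell_law: "prob_space (cell_law n)"
proof -
  interpret A: prob_space "cell_points n" by (rule prob_space_cell_points)
  interpret P: pair_prob_space "measure_pmf (poisson_pmf 1)" "cell_points n" ..
  show ?thesis by unfold_locales
qed

lemma space_cell_points: "space (cell_points n) = UNIV"
  by (simp add: space_PiM)

text \<open>Given \<open>N\<close> points, all of them avoid \<open>B\<close> with probability
  \<open>(1 - a) ^ N\<close>, where \<open>a\<close> is the measure of \<open>B\<close>; the Poisson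
  average of this is \<open>exp (-1) * exp (1 - a)\<close>.\<close>

lemma cell_law_avoid:
  assumes B: "B \<in> sets borel" "B \<subseteq> cell n"
  shows "{z. \<forall>i<fst z. snd z i \<notin> B} \<in> sets (cell_law n)"
    and "emeasure (cell_law n) {z. \<forall>i<fst z. snd z i \<notin> B} = ennreal (exp (- measure lborel B))"
proof -
  interpret U: prob_space "uniform_measure lborel (cell n)" by (rule prob_space_cell)
  interpret PP: product_prob_space "\<lambda>_::nat. uniform_measure lborel (cell n)" UNIV by unfold_locales
  let ?D = "{z :: nat \<times> (nat \<Rightarrow> real). \<forall>i<fst z. snd z i \<notin> B}"
  let ?V = "\<lambda>N. {u :: nat \<Rightarrow> real. \<forall>i\<in>{..<N}. u i \<in> - B}"
  define a where "a = measure lborel B"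
  have fm: "emeasure lborel B \<le> 1"
  proof -
    have "emeasure lborel B \<le> emeasure lborel (cell n)" by (rule emeasure_mono) (use B in auto)
    then show ?thesis by simp
  qed
  then have eB: "emeasure lborel B = ennreal a"
    unfolding a_def by (intro emeasure_eq_ennreal_measure) (auto simp: top_unique)
  have a1: "a \<le> 1" using fm eB by (simp add: ennreal_le_1)
  have a0: "0 \<le> a" by (simp add: a_def)
  have V: "?V N \<in> sets (cell_points n)" for N
  proof -
    have "?V N = {u \<in> space (cell_points n). \<forall>i\<in>{..<N}. u i \<in> - B}" by (simp add: space_cell_points)
    also have "\<dots> \<in> sets (cell_points n)" using B by measurable
    finally show ?thesis .
  qed
  have eV: "emeasure (cell_points n) (?V N) = ennreal ((1 - a) ^ N)" for N
  proof -
    have "emeasure (cell_points n) {u \<in> space (cell_points n). \<forall>i\<in>{..<N}. u i \<in> - B}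
        = (\<Prod>i\<in>{..<N}. emeasure (uniform_measure lborel (cell n)) (- B))"
      by (rule PP.emeasure_PiM_Collect) (use B in auto)
    also have "emeasure (uniform_measure lborel (cell n)) (- B) = emeasure lborel (cell n - B)"
      using B by (simp add: emeasure_uniform_measure Diff_eq divide_ennreal_def)
    also have "emeasure lborel (cell n - B) = emeasure lborel (cell n) - emeasure lborel B"
      by (rule emeasure_Diff) (use B fm in \<open>auto simp: top_unique\<close>)
    also have "\<dots> = ennreal (1 - a)" using a0 by (simp add: eB ennreal_minus[symmetric])
    finally show ?thesis using a1 by (simp add: space_cell_points ennreal_power)
  qed
  have D: "?D = (\<Union>N. {N} \<times> ?V N)" by auto
  show "?D \<in> sets (cell_law n)"
    unfolding D by (intro sets.countable_UN'' pair_measureI V) auto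
  have "emeasure (cell_law n) ?D = (\<integral>\<^sup>+ N. emeasure (cell_points n) (Pair N -` ?D) \<partial>measure_pmf (poisson_pmf 1))"
    by (rule PP.P.emeasure_pair_measure_alt) fact
  also have "\<dots> = (\<integral>\<^sup>+ N. ennreal ((1 - a) ^ N) \<partial>measure_pmf (poisson_pmf 1))"
  proof (rule nn_integral_cong)
    fix N
    have "Pair N -` ?D = ?V N" by auto
    then show "emeasure (cell_points n) (Pair N -` ?D) = ennreal ((1 - a) ^ N)" using eV by simp
  qed
  also have "\<dots> = (\<Sum>N. ennreal (pmf (poisson_pmf 1) N) * ennreal ((1 - a) ^ N))"
    by (simp add: nn_integral_measure_pmf nn_integral_count_space_nat)
  also have "\<dots> = (\<Sum>N. ennreal (exp (-1) * ((1 - a) ^ N / fact N)))"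
    using a1 by (intro suminf_cong) (simp add: ennreal_mult[symmetric] pmf_poisson field_simps)
  also have "\<dots> = ennreal (exp (-1) * exp (1 - a))"
  proof (rule suminf_ennreal_eq)
    show "(\<lambda>N. exp (-1) * ((1 - a) ^ N / fact N)) sums (exp (-1) * exp (1 - a))"
      using exp_converges[of "1 - a"] by (intro sums_mult) (simp add: divide_inverse mult.commute)
  qed (use a1 in auto)
  also have "exp (-1) * exp (1 - a) = exp (- a)" by (simp add: exp_add[symmetric])
  finally show "emeasure (cell_law n) ?D = ennreal (exp (- measure lborel B))" by (simp add: a_def)
qed

text \<open>The intersection with the cell discards sample points outside it. Such points have
  probability zero, but thereby every sample without exception yields a locally finite
  configuration.\<close>

definition cell_configuration :: "(nat \<Rightarrow> nat \<times> (nat \<Rightarrow> real)) \<Rightarrow> real set" where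
  "cell_configuration x = (\<Union>n. {y \<in> cell n. \<exists>i<fst (x n). y = snd (x n) i})"

lemma cell_configuration_Int:
  assumes "K \<subseteq> windows k"
  shows "cell_configuration x \<inter> K = (\<Union>n<k. {y \<in> K \<inter> cell n. \<exists>i<fst (x n). y = snd (x n) i})"
proof (intro set_eqI iffI)
  fix y assume "y \<in> cell_configuration x \<inter> K"
  then obtain n i where y: "y \<in> cell n" "i < fst (x n)" "y = snd (x n) i" "y \<in> K"
    by (auto simp: cell_configuration_def)
  have "y < real k" using y(4) assms by (auto simp: windows_def)
  then have "n < k" using y(1) by auto
  then show "y \<in> (\<Union>n<k. {y \<in> K \<inter> cell n. \<exists>i<fst (x n). y = snd (x n) i})" using y by blast
qed (auto simp: cell_configuration_def)

lemma cell_configuration_conf: "cell_configuration x \<in> half_line_confs"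
  unfolding half_line_conf_iff
proof (intro conjI allI)
  show "cell_configuration x \<subseteq> {0..}"
    by (auto simp: cell_configuration_def intro: order_trans[rotated])
  fix k
  have "finite {y \<in> windows k \<inter> cell n. \<exists>i<fst (x n). y = snd (x n) i}" for n
  proof -
    have "finite (snd (x n) ` {..<fst (x n)})" by simp
    then show ?thesis by (rule finite_subset[rotated]) auto
  qed
  then show "finite (cell_configuration x \<inter> windows k)"
    unfolding cell_configuration_Int[OF order_refl] by blast
qed

lemma half_line_poisson_exists: "\<exists>M. half_line_poisson M"
proof -
  interpret C: prob_space "cell_law n" for n by (rule prob_space_cell_law)
  interpret PP: product_prob_space cell_law UNIV by unfold_locales
  let ?\<Omega> = "PiM UNIV cell_law"
  let ?D = "\<lambda>K n. {z. \<forall>i<fst z. snd z i \<notin> K \<inter> cell n}"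
  have spC: "space (cell_law n) = UNIV" for n by (simp add: space_pair_measure space_cell_points)
  have sp: "space ?\<Omega> = UNIV" by (simp add: space_PiM spC)
  have pre: "cell_configuration -` void K \<inter> space ?\<Omega> = {x \<in> space ?\<Omega>. \<forall>n\<in>{..<k}. x n \<in> ?D K n}"
    if "K \<subseteq> windows k" for K k
  proof -
    \<comment> \<open>A bounded set meets only finitely many cells, so its void event is a finite
      conjunction of conditions on independent coordinates, and the probabilities multiply.\<close>
    have "cell_configuration x \<in> void K \<longleftrightarrow> (\<forall>n<k. x n \<in> ?D K n)" for x
      unfolding void_def mem_Collect_eq cell_configuration_Int[OF that]
      using cell_configuration_conf[of x] by blast
    then show ?thesis by auto
  qed
  have Ks: "K \<inter> cell n \<in> sets borel" if "K \<in> bounded_borel" for K n using bounded_borel_sets(1)[OF that] by auto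
  have preS: "cell_configuration -` void K \<inter> space ?\<Omega> \<in> sets ?\<Omega>" if K: "K \<in> bounded_borel" for K
  proof -
    obtain k where k: "K \<subseteq> windows k" using K by (auto simp: bounded_borel_def)
    have D: "?D K n \<in> sets (cell_law n)" for n by (rule cell_law_avoid(1)[OF Ks[OF K]]) auto
    have "{x \<in> space ?\<Omega>. x n \<in> ?D K n} \<in> sets ?\<Omega>" for n
    proof -
      have "(\<lambda>x. x n) \<in> measurable ?\<Omega> (cell_law n)" by (rule measurable_component_singleton) simp
      from measurable_sets[OF this D[of n]] show ?thesis by (simp add: vimage_def Int_def conj_commute)
    qed
    from sets.sets_Collect_finite_All[OF this, of "{..<k}"] show ?thesis unfolding pre[OF k] by simp
  qed
  have meas: "cell_configuration \<in> measurable ?\<Omega> half_line_events"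
    unfolding half_line_events_def
    by (rule measurable_sigma_sets[where A="void ` bounded_borel" and \<Omega>="half_line_confs"])
      (use void_Pow cell_configuration_conf preS in \<open>auto simp: sets_measure_of\<close>)
  have em: "emeasure ?\<Omega> (cell_configuration -` void K \<inter> space ?\<Omega>) = ennreal (exp (- measure lborel K))"
    if K: "K \<in> bounded_borel" for K
  proof -
    obtain k where k: "K \<subseteq> windows k" using K by (auto simp: bounded_borel_def)
    have D: "?D K n \<in> sets (cell_law n)" "emeasure (cell_law n) (?D K n) = ennreal (exp (- measure lborel (K \<inter> cell n)))" for n
      by (rule cell_law_avoid[OF Ks[OF K]]; force)+
    have "emeasure ?\<Omega> {x \<in> space ?\<Omega>. \<forall>n\<in>{..<k}. x n \<in> ?D K n} = (\<Prod>n\<in>{..<k}. emeasure (cell_law n) (?D K n))"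
      by (rule PP.emeasure_PiM_Collect) (use D in auto)
    also have "\<dots> = ennreal (\<Prod>n<k. exp (- measure lborel (K \<inter> cell n)))"
      unfolding D by (rule prod_ennreal) auto
    also have "(\<Prod>n<k. exp (- measure lborel (K \<inter> cell n))) = exp (- (\<Sum>n<k. measure lborel (K \<inter> cell n)))"
      by (simp add: exp_sum sum_negf[symmetric])
    also have "(\<Sum>n<k. measure lborel (K \<inter> cell n)) = measure lborel (\<Union>n<k. K \<inter> cell n)"
    proof (rule measure_finite_Union[symmetric])
      show "disjoint_family_on (\<lambda>n. K \<inter> cell n) {..<k}"
        by (auto simp: disjoint_family_on_def)
      show "emeasure lborel (K \<inter> cell n) \<noteq> \<infinity>" for n
        using bounded_borel_sets(6)[OF bounded_borel_subset[OF K Ks[OF K], of n]] by (auto simp: fmeasurable_def)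
    qed (use Ks[OF K] in auto)
    also have "(\<Union>n<k. K \<inter> cell n) = K"
    proof (intro set_eqI iffI)
      fix y assume y: "y \<in> K"
      then have y': "0 \<le> y" "y < real k" using k by (auto simp: windows_def)
      define n where "n = nat \<lfloor>y\<rfloor>"
      have n: "real n = of_int \<lfloor>y\<rfloor>" using y' by (simp add: n_def)
      then have "y \<in> cell n" "real n \<le> y" by (auto; linarith)+
      then show "y \<in> (\<Union>n<k. K \<inter> cell n)" using y y' by force
    qed auto
    finally show ?thesis unfolding pre[OF k] .
  qed
  have "half_line_poisson (distr ?\<Omega> half_line_events cell_configuration)"
  proof (intro half_line_poisson.intro half_line_poisson_axioms.intro)
    show "prob_space (distr ?\<Omega> half_line_events cell_configuration)"
      by (rule PP.P.prob_space_distr[OF meas])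
    fix K assume K: "K \<in> bounded_borel"
    have "void K \<in> sets half_line_events"
      unfolding half_line_events_def using K void_Pow by (auto simp: sets_measure_of)
    then have "measure (distr ?\<Omega> half_line_events cell_configuration) (void K) = measure ?\<Omega> (cell_configuration -` void K \<inter> space ?\<Omega>)"
      by (rule measure_distr[OF meas])
    then show "measure (distr ?\<Omega> half_line_events cell_configuration) (void K) = exp (- measure lborel K)"
      using em[OF K] by (simp add: measure_def)
  qed simp
  then show ?thesis ..
qed

subsection \<open>Void probabilities determine the Poisson process\<close>

text \<open>The first coefficient that could be nonzero is isolated by dividing by
  \<open>s ^ n\<close>; the remaining terms contribute at most \<open>C * (s / (1 - s))\<close>,
  which tends to 0 as \<open>s\<close> decreases to 0. The lemma serves to compare two laws on the
  naturals through their generating functions.\<close>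

lemma power_series_zero_coeffs:
  fixes c :: "nat \<Rightarrow> real"
  assumes bnd: "\<And>n. \<bar>c n\<bar> \<le> C" and zero: "\<And>s. 0 < s \<Longrightarrow> s < 1 \<Longrightarrow> (\<lambda>n. c n * s ^ n) sums 0"
  shows "c n = 0"
proof (induction n rule: less_induct)
  case (less n)
  have le: "\<bar>c n\<bar> \<le> C * (s / (1 - s))" if s: "0 < s" "s < 1" for s
  proof -
    have "(\<lambda>m. c (m + n) * s ^ (m + n)) sums (0 - (\<Sum>i<n. c i * s ^ i))"
      using zero[OF s] by (rule sums_split_initial_segment)
    then have "(\<lambda>m. s ^ n * (c (m + n) * s ^ m)) sums 0" using less by (simp add: power_add mult_ac)
    then have "(\<lambda>m. inverse (s ^ n) * (s ^ n * (c (m + n) * s ^ m))) sums (inverse (s ^ n) * 0)" by (rule sums_mult)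
    then have "(\<lambda>m. c (m + n) * s ^ m) sums 0" using s by (simp add: mult.assoc[symmetric])
    then have "(\<lambda>m. c (Suc m + n) * s ^ Suc m) sums (0 - c n)"
      using sums_Suc_iff[of "\<lambda>m. c (m + n) * s ^ m" "- c n"] by simp
    then have S: "(\<lambda>m. c (Suc m + n) * s ^ Suc m) sums (- c n)" by simp
    have g: "(\<lambda>m. C * (s * s ^ m)) sums (C * (s * (1 / (1 - s))))"
      using s by (intro sums_mult geometric_sums) auto
    have b: "norm (c (Suc m + n) * s ^ Suc m) \<le> C * (s * s ^ m)" for m
      using mult_right_mono[OF bnd[of "Suc m + n"], of "s ^ Suc m"] s by (simp add: abs_mult)
    have "norm (\<Sum>m. c (Suc m + n) * s ^ Suc m) \<le> (\<Sum>m. C * (s * s ^ m))"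
      by (rule norm_suminf_le[OF b]) (use g in \<open>auto simp: sums_iff\<close>)
    then show ?thesis using S g by (simp add: sums_iff)
  qed
  have "((\<lambda>s. C * (s / (1 - s))) \<longlongrightarrow> C * (0 / (1 - 0))) (at_right 0)"
    by (intro tendsto_intros) auto
  moreover have "eventually (\<lambda>s. \<bar>c n\<bar> \<le> C * (s / (1 - s))) (at_right 0)"
    by (rule eventually_mono[OF eventually_at_right_real[of 0 1]]) (use le in simp_all)
  ultimately have "\<bar>c n\<bar> \<le> C * (0 / (1 - 0))"
    by (intro tendsto_lowerbound) auto
  then show ?case by simp
qed

context half_line_poisson
begin

lemma space_M: "space M = half_line_confs"
  using sets_eq_imp_space_eq[OF sets_M] void_Pow by (simp add: half_line_events_def space_measure_of)

lemma sets_M_eq: "sets M = sigma_sets half_line_confs (void ` bounded_borel)"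
  using sets_M void_Pow by (simp add: half_line_events_def sets_measure_of)

lemma atleast_sets: "A \<in> sets borel \<Longrightarrow> {\<omega> \<in> space M. infinite (\<omega> \<inter> A) \<or> n \<le> card (\<omega> \<inter> A)} \<in> sets M"
  unfolding sets_M_eq space_M by (rule atleast_points_sets[OF void_Pow void_Int_dyadic])

lemma card_sets: "A \<in> sets borel \<Longrightarrow> {\<omega> \<in> space M. card (\<omega> \<inter> A) \<in> N} \<in> sets M"
  unfolding sets_M_eq space_M by (rule card_points_sets(2)[OF void_Pow void_Int_dyadic])

text \<open>The generators of the sigma-algebra are void events of bounded sets; this identity makes
  the void event of an arbitrary Borel set measurable.\<close>

lemma void_eq: "void A = space M - {\<omega> \<in> space M. infinite (\<omega> \<inter> A) \<or> 1 \<le> card (\<omega> \<inter> A)}"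
proof -
  have "\<omega> \<inter> A = {} \<longleftrightarrow> \<not> (infinite (\<omega> \<inter> A) \<or> 1 \<le> card (\<omega> \<inter> A))" for \<omega>
    by (cases "finite (\<omega> \<inter> A)") (auto simp: Suc_le_eq card_gt_0_iff)
  then show ?thesis unfolding void_def space_M by auto
qed

lemma void_sets: "A \<in> sets borel \<Longrightarrow> void A \<in> sets M"
  unfolding void_eq by (intro sets.compl_sets atleast_sets)

lemma measure_windows_limit:
  assumes A: "A \<in> fmeasurable half_line"
  shows "(\<lambda>k. measure lborel (A \<inter> windows k)) \<longlonglongrightarrow> measure lborel A"
proof -
  have Ab: "A \<in> sets borel" "A \<subseteq> {0..}" using A by (auto simp: fmeasurable_def sets_half_line)
  have "(\<lambda>k. measure lborel (A \<inter> windows k)) \<longlonglongrightarrow> measure lborel (\<Union>k. A \<inter> windows k)"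
  proof (rule Lim_measure_incseq)
    show "range (\<lambda>k. A \<inter> windows k) \<subseteq> sets lborel" using Ab by (auto simp: windows_def)
    show "incseq (\<lambda>k. A \<inter> windows k)" using windows_mono by (auto simp: incseq_def)
    have "emeasure lborel (\<Union>k. A \<inter> windows k) \<le> emeasure lborel A"
      by (rule emeasure_mono) (use Ab in auto)
    also have "\<dots> < \<infinity>" using A emeasure_half_line[OF Ab(2)] by (simp add: fmeasurable_def)
    finally show "emeasure lborel (\<Union>k. A \<inter> windows k) \<noteq> \<infinity>" by simp
  qed
  also have "(\<Union>k. A \<inter> windows k) = A"
    using exhausting_windows Ab by (auto simp: exhausting_def space_half_line)
  finally show ?thesis .
qed

lemma fmeasurable_half_line:
  "A \<in> fmeasurable half_line \<longleftrightarrow> A \<in> sets borel \<and> A \<subseteq> {0..} \<and> emeasure lborel A < \<infinity>"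
  by (auto simp: fmeasurable_def sets_half_line emeasure_half_line)

lemma Int_windows_bounded_borel: "A \<in> sets borel \<Longrightarrow> A \<inter> windows k \<in> bounded_borel"
  by (rule bounded_borel_subset[OF windows_bounded_borel]) (auto simp: windows_def)

text \<open>The void event of \<open>A\<close> is the decreasing intersection of those of
  \<open>A \<inter> windows k\<close>, and the measures converge because \<open>A\<close> has finite
  measure.\<close>

lemma prob_void':
  assumes A: "A \<in> fmeasurable half_line"
  shows "prob (void A) = exp (- measure lborel A)"
proof -
  have Ab: "A \<in> sets borel" "A \<subseteq> {0..}" using A by (auto simp: fmeasurable_half_line)
  have "(\<lambda>k. prob (void (A \<inter> windows k))) \<longlonglongrightarrow> prob (\<Inter>k. void (A \<inter> windows k))"
  proof (rule finite_Lim_measure_decseq)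
    show "range (\<lambda>k. void (A \<inter> windows k)) \<subseteq> events"
      using void_sets bounded_borel_sets(1)[OF Int_windows_bounded_borel[OF Ab(1)]] by auto
    show "decseq (\<lambda>k. void (A \<inter> windows k))"
      using windows_mono by (fastforce simp: decseq_def void_def)
  qed
  also have "(\<Inter>k. void (A \<inter> windows k)) = void A"
  proof -
    have "A = (\<Union>k. A \<inter> windows k)"
      using exhausting_windows Ab by (auto simp: exhausting_def space_half_line)
    then show ?thesis unfolding void_def by blast
  qed
  finally have 1: "(\<lambda>k. prob (void (A \<inter> windows k))) \<longlonglongrightarrow> prob (void A)" .
  have "(\<lambda>k. exp (- measure lborel (A \<inter> windows k))) \<longlonglongrightarrow> exp (- measure lborel A)"
    by (intro tendsto_intros measure_windows_limit A)
  then have "(\<lambda>k. prob (void (A \<inter> windows k))) \<longlonglongrightarrow> exp (- measure lborel A)"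
    using prob_void[OF Int_windows_bounded_borel[OF Ab(1)]] by simp
  with 1 show ?thesis by (rule LIMSEQ_unique)
qed

text \<open>From \<open>1 - exp (- x) \<le> x\<close>. The estimates of how far void events move
  rest on this bound.\<close>

lemma prob_not_void_le:
  assumes A: "A \<in> fmeasurable half_line"
  shows "prob (space M - void A) \<le> measure lborel A"
proof -
  have "prob (space M - void A) = 1 - exp (- measure lborel A)"
    using prob_compl[OF void_sets] prob_void'[OF A] A by (simp add: fmeasurable_half_line)
  then show ?thesis using exp_ge_add_one_self[of "- measure lborel A"] by simp
qed

text \<open>A configuration is finite on each window, so infinitely many points in \<open>A\<close>
  leave at least one outside every window. By \<open>prob_not_void_le\<close> this has probability
  at most the measure of \<open>A\<close> beyond the window, which tends to 0.\<close>

lemma AE_finite_points: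
  assumes A: "A \<in> fmeasurable half_line"
  shows "AE \<omega> in M. finite (\<omega> \<inter> A)"
proof -
  have Ab: "A \<in> sets borel" "A \<subseteq> {0..}" using A by (auto simp: fmeasurable_half_line)
  let ?I = "{\<omega> \<in> space M. infinite (\<omega> \<inter> A)}"
  have "?I = (\<Inter>n. {\<omega> \<in> space M. infinite (\<omega> \<inter> A) \<or> n \<le> card (\<omega> \<inter> A)})"
  proof (intro set_eqI iffI)
    fix \<omega> assume \<omega>: "\<omega> \<in> (\<Inter>n. {\<omega> \<in> space M. infinite (\<omega> \<inter> A) \<or> n \<le> card (\<omega> \<inter> A)})"
    then have "infinite (\<omega> \<inter> A) \<or> Suc (card (\<omega> \<inter> A)) \<le> card (\<omega> \<inter> A)" by blast
    then show "\<omega> \<in> ?I" using \<omega> by auto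
  qed auto
  then have Is: "?I \<in> sets M" using atleast_sets[OF Ab(1)] by auto
  have "prob ?I \<le> measure lborel A - measure lborel (A \<inter> windows k)" for k
  proof -
    have fm: "A - windows k \<in> fmeasurable half_line"
      using A windows_half_line(2) by (intro fmeasurable.Diff) (auto intro: bounded_borel_sets(5)[OF windows_bounded_borel])
    have "?I \<subseteq> space M - void (A - windows k)"
    proof
      fix \<omega> assume \<omega>: "\<omega> \<in> ?I"
      then have "finite (\<omega> \<inter> windows k)" by (auto simp: space_M half_line_conf_iff)
      then have "\<omega> \<inter> (A - windows k) \<noteq> {}"
        using \<omega> finite_subset[of "\<omega> \<inter> A" "\<omega> \<inter> windows k"] by blast
      then show "\<omega> \<in> space M - void (A - windows k)" using \<omega> by (auto simp: void_def)
    qed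
    then have "prob ?I \<le> prob (space M - void (A - windows k))"
      using fm by (intro finite_measure_mono sets.compl_sets void_sets) (auto simp: fmeasurable_half_line)
    also have "\<dots> \<le> measure lborel (A - windows k)" by (rule prob_not_void_le[OF fm])
    also have "A - windows k = A - (A \<inter> windows k)" by auto
    also have "measure lborel (A - (A \<inter> windows k)) = measure lborel A - measure lborel (A \<inter> windows k)"
      using A Ab bounded_borel_sets(1)[OF windows_bounded_borel, of k]
      by (intro measure_Diff) (auto simp: fmeasurable_half_line)
    finally show ?thesis .
  qed
  moreover have "(\<lambda>k. measure lborel A - measure lborel (A \<inter> windows k)) \<longlonglongrightarrow> measure lborel A - measure lborel A"
    by (intro tendsto_intros measure_windows_limit A)
  ultimately have "prob ?I \<le> measure lborel A - measure lborel A"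
    by (intro tendsto_lowerbound[where F=sequentially]) auto
  then have "prob ?I = 0" by (simp add: measure_le_0_iff)
  then have "?I \<in> null_sets M" using Is by (simp add: null_sets_def emeasure_eq_measure)
  then show ?thesis by (rule AE_I') auto
qed

text \<open>Expanding the product, each term is the indicator of the void event of a union.\<close>

lemma expectation_prod_void:
  fixes a b :: "'i \<Rightarrow> real"
  assumes I: "finite I" and A: "\<And>i. i \<in> I \<Longrightarrow> A i \<in> fmeasurable half_line"
    and disj: "disjoint_family_on A I"
  shows "(\<integral>\<omega>. (\<Prod>i\<in>I. a i + b i * indicator (void (A i)) \<omega>) \<partial>M) = (\<Prod>i\<in>I. a i + b i * exp (- measure lborel (A i)))"
proof -
  have U: "(\<Union>i\<in>J. A i) \<in> fmeasurable half_line" if "J \<subseteq> I" for J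
    using that I A by (intro fmeasurable.finite_UN) (auto intro: finite_subset)
  have Us: "(\<Union>i\<in>J. A i) \<in> sets borel" if "J \<subseteq> I" for J
    using U[OF that] by (simp add: fmeasurable_half_line)
  have ind: "(\<Prod>i\<in>J. indicator (void (A i)) \<omega>) = (indicator (void (\<Union>i\<in>J. A i)) \<omega> :: real)"
    if J: "J \<subseteq> I" and sp: "\<omega> \<in> space M" for J \<omega>
  proof (cases "\<omega> \<in> void (\<Union>i\<in>J. A i)")
    case True
    then have "\<omega> \<in> void (A i)" if "i \<in> J" for i using that by (auto simp: void_def)
    then have "(\<Prod>i\<in>J. indicator (void (A i)) \<omega>) = (\<Prod>i\<in>J. 1::real)" by (intro prod.cong) auto
    then show ?thesis using True by simp
  next
    case False
    then obtain i where "i \<in> J" "\<omega> \<notin> void (A i)" using sp by (auto simp: void_def space_M)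
    moreover have "finite J" using J I by (rule finite_subset)
    ultimately have "(\<Prod>i\<in>J. indicator (void (A i)) \<omega>) = (0::real)"
      by (intro prod_zero bexI[of _ i]) auto
    then show ?thesis using False by simp
  qed
  have pv: "prob (void (\<Union>i\<in>J. A i)) = (\<Prod>i\<in>J. exp (- measure lborel (A i)))" if J: "J \<subseteq> I" for J
  proof -
    have finJ: "finite J" using J I by (rule finite_subset)
    have AJ: "A i \<in> sets lborel" "emeasure lborel (A i) \<noteq> \<infinity>" if "i \<in> J" for i
      using A[of i] J that by (auto simp: fmeasurable_half_line)
    have "measure lborel (\<Union>i\<in>J. A i) = (\<Sum>i\<in>J. measure lborel (A i))"
    proof (rule measure_finite_Union)
      show "disjoint_family_on A J" using disj J by (auto simp: disjoint_family_on_def)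
    qed (use finJ AJ in auto)
    then show ?thesis using prob_void'[OF U[OF J]] finJ by (simp add: exp_sum sum_negf[symmetric])
  qed
  have "(\<integral>\<omega>. (\<Prod>i\<in>I. a i + b i * indicator (void (A i)) \<omega>) \<partial>M)
      = (\<integral>\<omega>. (\<Sum>B\<in>Pow I. (prod a B * prod b (I - B)) * indicator (void (\<Union>i\<in>I - B. A i)) \<omega>) \<partial>M)"
  proof (rule Bochner_Integration.integral_cong)
    fix \<omega> assume \<omega>: "\<omega> \<in> space M"
    show "(\<Prod>i\<in>I. a i + b i * indicator (void (A i)) \<omega>)
      = (\<Sum>B\<in>Pow I. (prod a B * prod b (I - B)) * indicator (void (\<Union>i\<in>I - B. A i)) \<omega>)"
      unfolding prod_add[OF I]
      by (intro sum.cong refl) (simp only: prod.distrib mult.assoc ind[OF Diff_subset \<omega>])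
  qed simp
  also have "\<dots> = (\<Sum>B\<in>Pow I. (prod a B * prod b (I - B)) * prob (void (\<Union>i\<in>I - B. A i)))"
  proof -
    have "void (\<Union>i\<in>I - B. A i) \<in> sets M" for B by (rule void_sets[OF Us]) auto
    then show ?thesis by (subst Bochner_Integration.integral_sum) (auto simp: emeasure_eq_measure)
  qed
  also have "\<dots> = (\<Sum>B\<in>Pow I. prod a B * (\<Prod>i\<in>I - B. b i * exp (- measure lborel (A i))))"
    by (intro sum.cong refl) (simp only: pv[OF Diff_subset] prod.distrib mult.assoc)
  also have "\<dots> = (\<Prod>i\<in>I. a i + b i * exp (- measure lborel (A i)))"
    unfolding prod_add[OF I] ..
  finally show ?thesis .
qed

end

subsection \<open>Poisson counts\<close>

context half_line_poisson
begin

lemma card_measurable: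
  assumes "A \<in> sets borel"
  shows "(\<lambda>\<omega>. card (\<omega> \<inter> A)) \<in> measurable M (count_space UNIV)"
proof (subst measurable_count_space_eq2_countable, safe)
  fix n
  have "(\<lambda>\<omega>. card (\<omega> \<inter> A)) -` {n} \<inter> space M = {\<omega> \<in> space M. card (\<omega> \<inter> A) \<in> {n}}" by auto
  then show "(\<lambda>\<omega>. card (\<omega> \<inter> A)) -` {n} \<inter> space M \<in> sets M" using card_sets[OF assms, of "{n}"] by simp
qed auto

text \<open>A discretized number of points: \<open>4 ^ k\<close> cells of length
  \<open>1 / 2 ^ k\<close> fill \<open>[0, 2 ^ k)\<close>, so the mesh shrinks while the range
  grows. It involves only void events and eventually equals the true count if that is
  finite.\<close>

definition hit_count :: "real set \<Rightarrow> nat \<Rightarrow> real set \<Rightarrow> nat" where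
  "hit_count A k \<omega> = card {i. i < 4 ^ k \<and> \<omega> \<inter> (A \<inter> dyadic k i) \<noteq> {}}"

lemma hit_count_eventually:
  assumes \<omega>: "\<omega> \<in> space M" and fin: "finite (\<omega> \<inter> A)"
  shows "eventually (\<lambda>k. hit_count A k \<omega> = card (\<omega> \<inter> A)) sequentially"
proof -
  have pos: "0 \<le> y" if "y \<in> \<omega> \<inter> A" for y using that \<omega> by (auto simp: space_M half_line_conf_iff)
  obtain k0 where k0: "\<And>k. k0 \<le> k \<Longrightarrow> inj_on (\<lambda>y. \<lfloor>y * 2 ^ k\<rfloor>) (\<omega> \<inter> A)"
    using finite_separated_by_dyadic[OF fin] by blast
  obtain b where b: "\<And>y. y \<in> \<omega> \<inter> A \<Longrightarrow> y \<le> b" using bdd_above_finite[OF fin] by (auto simp: bdd_above_def)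
  obtain k1 where k1: "b < 2 ^ k1" using real_arch_pow[of 2 b] by auto
  have "hit_count A k \<omega> = card (\<omega> \<inter> A)" if k: "max k0 k1 \<le> k" for k
  proof -
    let ?f = "\<lambda>y. nat \<lfloor>y * 2 ^ k\<rfloor>"
    have inj: "inj_on ?f (\<omega> \<inter> A)"
    proof (rule inj_onI)
      fix x y assume xy: "x \<in> \<omega> \<inter> A" "y \<in> \<omega> \<inter> A" "?f x = ?f y"
      have "0 \<le> \<lfloor>x * 2 ^ k\<rfloor>" "0 \<le> \<lfloor>y * 2 ^ k\<rfloor>" using pos[OF xy(1)] pos[OF xy(2)] by auto
      then have "\<lfloor>x * 2 ^ k\<rfloor> = \<lfloor>y * 2 ^ k\<rfloor>" using xy(3) by (simp add: eq_nat_nat_iff)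
      then show "x = y" using inj_onD[OF k0[of k]] k xy by auto
    qed
    have "{i. i < 4 ^ k \<and> \<omega> \<inter> (A \<inter> dyadic k i) \<noteq> {}} = ?f ` (\<omega> \<inter> A)"
    proof (intro set_eqI iffI)
      fix i assume "i \<in> {i. i < 4 ^ k \<and> \<omega> \<inter> (A \<inter> dyadic k i) \<noteq> {}}"
      then obtain y where y: "y \<in> \<omega> \<inter> A" "y \<in> dyadic k i" by auto
      then show "i \<in> ?f ` (\<omega> \<inter> A)" using mem_dyadic_iff[OF pos[OF y(1)], of k i] by (intro image_eqI[of _ _ y]) auto
    next
      fix i assume "i \<in> ?f ` (\<omega> \<inter> A)"
      then obtain y where y: "y \<in> \<omega> \<inter> A" "i = ?f y" by auto
      have "y \<in> dyadic k i" using mem_dyadic_iff[OF pos[OF y(1)]] y(2) by simp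
      have "(2::real) ^ k1 \<le> 2 ^ k" using k by (intro power_increasing) auto
      then have "y < 2 ^ k" using b[OF y(1)] k1 by linarith
      then have "y * 2 ^ k < 2 ^ k * 2 ^ k" by (intro mult_strict_right_mono) auto
      also have "(2::real) ^ k * 2 ^ k = real (4 ^ k)" by (simp add: power_mult_distrib[symmetric])
      finally have "y * 2 ^ k < real (4 ^ k)" .
      moreover have "real i \<le> y * 2 ^ k" unfolding y(2) using pos[OF y(1)] by (simp add: of_nat_nat)
      ultimately have "real i < real (4 ^ k)" by linarith
      then have "i < 4 ^ k" by (simp only: of_nat_less_iff)
      then show "i \<in> {i. i < 4 ^ k \<and> \<omega> \<inter> (A \<inter> dyadic k i) \<noteq> {}}" using y(1) \<open>y \<in> dyadic k i\<close> by auto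
    qed
    then show ?thesis by (simp add: hit_count_def card_image[OF inj])
  qed
  then show ?thesis unfolding eventually_sequentially by blast
qed

text \<open>A hit cell contributes the factor \<open>s\<close> and a void one the factor 1; in this
  form \<open>expectation_prod_void\<close> gives the expectation.\<close>

lemma power_hit_count:
  fixes s :: real
  assumes "\<omega> \<in> space M"
  shows "s ^ hit_count A k \<omega> = (\<Prod>i<4 ^ k. s + (1 - s) * indicator (void (A \<inter> dyadic k i)) \<omega>)"
proof -
  let ?H = "{i. i < 4 ^ k \<and> \<omega> \<inter> (A \<inter> dyadic k i) \<noteq> {}}"
  have "(\<Prod>i<4 ^ k. s + (1 - s) * indicator (void (A \<inter> dyadic k i)) \<omega>) = (\<Prod>i<4 ^ k. if i \<in> ?H then s else 1)"
    using assms by (intro prod.cong) (auto simp: void_def space_M split: split_indicator)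
  also have "\<dots> = (\<Prod>i\<in>{..<4 ^ k} \<inter> ?H. s)" by (rule prod.inter_restrict[symmetric]) simp
  also have "{..<4 ^ k} \<inter> ?H = ?H" by auto
  finally show ?thesis by (simp add: hit_count_def)
qed

text \<open>The factor of one cell of measure \<open>x\<close> is squeezed between exponentials,
  whose product over all cells can be computed. The lower bound is convexity of \<open>exp\<close>;
  the upper one uses \<open>exp (- x) \<le> 1 - (1 - x) * x\<close> and then
  \<open>1 + y \<le> exp y\<close>. The loss factor \<open>1 - d\<close> tends to 1 with the mesh
  \<open>d\<close>.\<close>

lemma generating_factor_bounds:
  fixes s x d :: real
  assumes s: "0 \<le> s" "s \<le> 1" and x: "0 \<le> x" "x \<le> d"
  shows "exp (- (1 - s) * x) \<le> s + (1 - s) * exp (- x)"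
    "s + (1 - s) * exp (- x) \<le> exp (- (1 - s) * (1 - d) * x)"
proof -
  have "exp ((1 - (1 - s)) *\<^sub>R 0 + (1 - s) *\<^sub>R (- x)) \<le> (1 - (1 - s)) * exp 0 + (1 - s) * exp (- x)"
    using s by (intro convex_onD[OF exp_convex]) auto
  moreover have "(1 - (1 - s)) *\<^sub>R 0 + (1 - s) *\<^sub>R (- x) = - (1 - s) * x" by (simp add: algebra_simps)
  ultimately show "exp (- (1 - s) * x) \<le> s + (1 - s) * exp (- x)" by (simp only: exp_zero) simp
  have "exp (- x) \<le> 1 / (1 + x)"
    using exp_ge_add_one_self[of x] x by (simp add: exp_minus field_simps)
  also have "\<dots> \<le> 1 - (1 - x) * x"
  proof -
    have "0 \<le> x * (x * x)" using x by simp
    then show ?thesis using x by (simp add: field_simps)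
  qed
  also have "\<dots> \<le> 1 - (1 - d) * x"
    using x by (simp add: mult_right_mono)
  finally have "(1 - s) * exp (- x) \<le> (1 - s) * (1 - (1 - d) * x)"
    using s by (intro mult_left_mono) auto
  then have "s + (1 - s) * exp (- x) \<le> 1 + (- (1 - s) * (1 - d) * x)" by (simp add: algebra_simps)
  also have "\<dots> \<le> exp (- (1 - s) * (1 - d) * x)" by (rule exp_ge_add_one_self)
  finally show "s + (1 - s) * exp (- x) \<le> exp (- (1 - s) * (1 - d) * x)" .
qed

lemma dyadic_pieces:
  assumes A: "A \<in> fmeasurable half_line"
  shows "A \<inter> dyadic k i \<in> fmeasurable half_line" "measure lborel (A \<inter> dyadic k i) \<le> (1 / 2) ^ k"
    "(\<Sum>i<4 ^ k. measure lborel (A \<inter> dyadic k i)) = measure lborel (A \<inter> windows (2 ^ k))"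
proof -
  have Ab: "A \<in> sets borel" "A \<subseteq> {0..}" using A by (auto simp: fmeasurable_half_line)
  have b: "A \<inter> dyadic k i \<in> bounded_borel" for i
    by (rule bounded_borel_subset[OF dyadic_bounded_borel]) (use Ab bounded_borel_sets(1)[OF dyadic_bounded_borel] in auto)
  show "A \<inter> dyadic k i \<in> fmeasurable half_line" by (rule bounded_borel_sets(5)[OF b])
  have "measure lborel (A \<inter> dyadic k i) \<le> measure lborel (dyadic k i)"
    using bounded_borel_sets(1)[OF b] bounded_borel_sets(6)[OF dyadic_bounded_borel]
    by (intro measure_mono_fmeasurable) auto
  also have "\<dots> = (1 / 2) ^ k"
    unfolding dyadic_def by (subst measure_lborel_Ico) (auto simp: field_simps power_one_over)
  finally show "measure lborel (A \<inter> dyadic k i) \<le> (1 / 2) ^ k" .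
  have "(\<Sum>i<4 ^ k. measure lborel (A \<inter> dyadic k i)) = measure lborel (\<Union>i<4 ^ k. A \<inter> dyadic k i)"
  proof (rule measure_finite_Union[symmetric])
    show "disjoint_family_on (\<lambda>i. A \<inter> dyadic k i) {..<4 ^ k}"
      using dyadic_disjoint by (fastforce simp: disjoint_family_on_def)
    show "emeasure lborel (A \<inter> dyadic k i) \<noteq> \<infinity>" for i
      using bounded_borel_sets(6)[OF b, of i] by (auto simp: fmeasurable_def)
  qed (use bounded_borel_sets(1)[OF b] in auto)
  also have "(\<Union>i<4 ^ k. A \<inter> dyadic k i) = A \<inter> windows (2 ^ k)"
  proof (intro set_eqI iffI)
    fix y assume "y \<in> (\<Union>i<4 ^ k. A \<inter> dyadic k i)"
    then obtain i where i: "i < 4 ^ k" "y \<in> A" "y \<in> dyadic k i" by auto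
    have "y * 2 ^ k < real (Suc i)" using i(3) by (simp add: dyadic_def field_simps)
    also have "real (Suc i) \<le> real (4 ^ k)" using i(1) by (simp only: of_nat_le_iff Suc_leI)
    also have "real (4 ^ k) = 2 ^ k * 2 ^ k" by (simp add: power_mult_distrib[symmetric])
    finally have "y < 2 ^ k" by simp
    then show "y \<in> A \<inter> windows (2 ^ k)" using i Ab by (auto simp: windows_def)
  next
    fix y assume y: "y \<in> A \<inter> windows (2 ^ k)"
    then have y0: "0 \<le> y" "y < 2 ^ k" by (auto simp: windows_def)
    define i where "i = nat \<lfloor>y * 2 ^ k\<rfloor>"
    have "y \<in> dyadic k i" using mem_dyadic_iff[OF y0(1)] by (simp add: i_def)
    have "y * 2 ^ k < 2 ^ k * 2 ^ k" using y0 by (intro mult_strict_right_mono) auto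
    also have "(2::real) ^ k * 2 ^ k = real (4 ^ k)" by (simp add: power_mult_distrib[symmetric])
    finally have "y * 2 ^ k < real (4 ^ k)" .
    moreover have "real i \<le> y * 2 ^ k" unfolding i_def using y0(1) by (simp add: of_nat_nat)
    ultimately have "real i < real (4 ^ k)" by linarith
    then have "i < 4 ^ k" by (simp only: of_nat_less_iff)
    then show "y \<in> (\<Union>i<4 ^ k. A \<inter> dyadic k i)" using y \<open>y \<in> dyadic k i\<close> by blast
  qed
  finally show "(\<Sum>i<4 ^ k. measure lborel (A \<inter> dyadic k i)) = measure lborel (A \<inter> windows (2 ^ k))" .
qed

text \<open>The count is the almost sure limit of \<open>hit_count\<close>, so its generating
  function is the limit of finite products over cells, which the one-cell bounds pin down.\<close>

lemma generating_function:
  assumes A: "A \<in> fmeasurable half_line" and s: "0 \<le> s" "s \<le> 1"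
  shows "(\<integral>\<omega>. s ^ card (\<omega> \<inter> A) \<partial>M) = exp (- (1 - s) * measure lborel A)"
proof -
  have Ab: "A \<in> sets borel" using A by (simp add: fmeasurable_half_line)
  define g where "g k = (\<Prod>i<4 ^ k. s + (1 - s) * exp (- measure lborel (A \<inter> dyadic k i)))" for k
  have Eg: "(\<integral>\<omega>. s ^ hit_count A k \<omega> \<partial>M) = g k" for k
  proof -
    have "(\<integral>\<omega>. s ^ hit_count A k \<omega> \<partial>M) = (\<integral>\<omega>. (\<Prod>i<4 ^ k. s + (1 - s) * indicator (void (A \<inter> dyadic k i)) \<omega>) \<partial>M)"
      by (intro Bochner_Integration.integral_cong refl power_hit_count)
    also have "\<dots> = g k" unfolding g_def
      by (rule expectation_prod_void) (use dyadic_pieces(1)[OF A] dyadic_disjoint in \<open>fastforce simp: disjoint_family_on_def\<close>)+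
    finally show ?thesis .
  qed
  have lim1: "(\<lambda>k. \<integral>\<omega>. s ^ hit_count A k \<omega> \<partial>M) \<longlonglongrightarrow> (\<integral>\<omega>. s ^ card (\<omega> \<inter> A) \<partial>M)"
  proof (rule integral_dominated_convergence[where w="\<lambda>_. 1"])
    show "(\<lambda>\<omega>. s ^ card (\<omega> \<inter> A)) \<in> borel_measurable M"
      by (rule measurable_compose[OF card_measurable[OF Ab]]) simp
    show "(\<lambda>\<omega>. s ^ hit_count A k \<omega>) \<in> borel_measurable M" for k
    proof -
      have "void (A \<inter> dyadic k i) \<in> sets M" for i
        using dyadic_pieces(1)[OF A] by (intro void_sets) (simp add: fmeasurable_half_line)
      then have "(\<lambda>\<omega>. \<Prod>i<4 ^ k. s + (1 - s) * indicator (void (A \<inter> dyadic k i)) \<omega>) \<in> borel_measurable M"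
        by measurable
      then show ?thesis by (subst measurable_cong[OF power_hit_count])
    qed
    show "AE \<omega> in M. (\<lambda>k. s ^ hit_count A k \<omega>) \<longlonglongrightarrow> s ^ card (\<omega> \<inter> A)"
      using AE_finite_points[OF A] AE_space
    proof eventually_elim
      case (elim \<omega>)
      have "eventually (\<lambda>k. s ^ hit_count A k \<omega> = s ^ card (\<omega> \<inter> A)) sequentially"
        using hit_count_eventually[OF elim(2,1)] by eventually_elim simp
      then show ?case by (rule tendsto_eventually)
    qed
    show "AE \<omega> in M. norm (s ^ hit_count A k \<omega>) \<le> 1" for k
      using s by (simp add: power_le_one)
  qed simp
  have "g \<longlonglongrightarrow> exp (- (1 - s) * measure lborel A)"
  proof (rule tendsto_sandwich)
    let ?a = "\<lambda>k. measure lborel (A \<inter> windows (2 ^ k))"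
    have "filterlim (\<lambda>k::nat. (2::nat) ^ k) at_top sequentially"
      by (rule filterlim_subseq) (auto simp: strict_mono_def)
    then have a: "?a \<longlonglongrightarrow> measure lborel A"
      by (rule filterlim_compose[OF measure_windows_limit[OF A]])
    have "(\<lambda>k. exp (- (1 - s) * ?a k)) \<longlonglongrightarrow> exp (- (1 - s) * measure lborel A)"
      by (intro tendsto_intros a)
    then show "(\<lambda>k. exp (- (1 - s) * ?a k)) \<longlonglongrightarrow> exp (- (1 - s) * measure lborel A)" .
    have "(\<lambda>k. (1/2::real) ^ k) \<longlonglongrightarrow> 0" by (rule LIMSEQ_realpow_zero) auto
    note p = this
    have "(\<lambda>k. exp (- (1 - s) * (1 - (1 / 2) ^ k) * ?a k)) \<longlonglongrightarrow> exp (- (1 - s) * (1 - 0) * measure lborel A)"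
      by (rule tendsto_exp tendsto_mult tendsto_diff tendsto_const p a)+
    then show "(\<lambda>k. exp (- (1 - s) * (1 - (1 / 2) ^ k) * ?a k)) \<longlonglongrightarrow> exp (- (1 - s) * measure lborel A)" by simp
    have lo: "exp (- (1 - s) * ?a k) \<le> g k" for k
    proof -
      have "exp (- (1 - s) * ?a k) = (\<Prod>i<4 ^ k. exp (- (1 - s) * measure lborel (A \<inter> dyadic k i)))"
        by (simp add: dyadic_pieces(3)[OF A, symmetric] exp_sum sum_distrib_left)
      also have "\<dots> \<le> g k" unfolding g_def
        by (intro prod_mono conjI generating_factor_bounds(1)[OF s _ dyadic_pieces(2)[OF A]]) auto
      finally show ?thesis .
    qed
    have hi: "g k \<le> exp (- (1 - s) * (1 - (1 / 2) ^ k) * ?a k)" for k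
    proof -
      have "g k \<le> (\<Prod>i<4 ^ k. exp (- (1 - s) * (1 - (1 / 2) ^ k) * measure lborel (A \<inter> dyadic k i)))" unfolding g_def
        using s by (intro prod_mono conjI generating_factor_bounds(2)[OF s _ dyadic_pieces(2)[OF A]]) auto
      also have "\<dots> = exp (- (1 - s) * (1 - (1 / 2) ^ k) * ?a k)"
        by (simp add: dyadic_pieces(3)[OF A, symmetric] exp_sum sum_distrib_left)
      finally show ?thesis .
    qed
    show "eventually (\<lambda>k. exp (- (1 - s) * ?a k) \<le> g k) sequentially" using lo by simp
    show "eventually (\<lambda>k. g k \<le> exp (- (1 - s) * (1 - (1 / 2) ^ k) * ?a k)) sequentially" using hi by simp
  qed
  then show ?thesis using LIMSEQ_unique[OF lim1] unfolding Eg by blast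
qed

text \<open>For \<open>0 < s < 1\<close> the law of the count and the Poisson law have the same
  generating function \<open>exp (- (1 - s) * a)\<close>, hence the same probabilities by
  \<open>power_series_zero_coeffs\<close>.\<close>

lemma prob_card:
  assumes A: "A \<in> fmeasurable half_line"
  shows "prob {\<omega> \<in> space M. card (\<omega> \<inter> A) = n} = measure lborel A ^ n / fact n * exp (- measure lborel A)"
proof -
  have Ab: "A \<in> sets borel" using A by (simp add: fmeasurable_half_line)
  let ?a = "measure lborel A"
  let ?X = "\<lambda>n. {\<omega> \<in> space M. card (\<omega> \<inter> A) = n}"
  have X: "?X n \<in> sets M" for n using card_sets[OF Ab, of "{n}"] by simp
  have E1: "(\<lambda>n. s ^ n * prob (?X n)) sums exp (- (1 - s) * ?a)" if s: "0 < s" "s < 1" for s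
  proof -
    have ptw: "(\<lambda>n. s ^ n * indicator (?X n) \<omega>) sums s ^ card (\<omega> \<inter> A)" if "\<omega> \<in> space M" for \<omega>
    proof -
      have "(\<lambda>n. s ^ n * indicator (?X n) \<omega>) = (\<lambda>n. if n = card (\<omega> \<inter> A) then s ^ n else 0)"
        using that by (auto split: split_indicator)
      then show ?thesis using sums_single[of "card (\<omega> \<inter> A)" "\<lambda>n. s ^ n"] by simp
    qed
    have int: "integrable M (\<lambda>\<omega>. s ^ n * indicator (?X n) \<omega>)" for n
      using X by (auto simp: emeasure_eq_measure)
    have int_eq: "(\<integral>\<omega>. s ^ n * indicator (?X n) \<omega> \<partial>M) = s ^ n * prob (?X n)" for n
      using X by simp
    have "(\<lambda>n. \<integral>\<omega>. s ^ n * indicator (?X n) \<omega> \<partial>M) sums (\<integral>\<omega>. (\<Sum>n. s ^ n * indicator (?X n) \<omega>) \<partial>M)"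
    proof (rule sums_integral[OF int])
      show "AE \<omega> in M. summable (\<lambda>n. norm (s ^ n * indicator (?X n) \<omega>))"
        using s ptw by (intro AE_I2) (auto simp: sums_iff abs_mult)
      have "summable (\<lambda>n. s ^ n * prob (?X n))"
        by (rule summable_comparison_test'[OF summable_geometric[of s]]) (use s in \<open>auto simp: abs_mult mult_left_le\<close>)
      then show "summable (\<lambda>n. \<integral>\<omega>. norm (s ^ n * indicator (?X n) \<omega>) \<partial>M)"
        using s int_eq by (simp add: abs_mult)
    qed
    moreover have "(\<integral>\<omega>. (\<Sum>n. s ^ n * indicator (?X n) \<omega>) \<partial>M) = (\<integral>\<omega>. s ^ card (\<omega> \<inter> A) \<partial>M)"
      using ptw by (intro Bochner_Integration.integral_cong refl) (simp add: sums_iff)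
    ultimately show ?thesis using generating_function[OF A, of s] s int_eq by simp
  qed
  have E2: "(\<lambda>n. s ^ n * (?a ^ n / fact n * exp (- ?a))) sums exp (- (1 - s) * ?a)" for s
  proof -
    have "(\<lambda>n. exp (- ?a) * ((s * ?a) ^ n /\<^sub>R fact n)) sums (exp (- ?a) * exp (s * ?a))"
      by (intro sums_mult exp_converges)
    then show ?thesis by (simp add: exp_add[symmetric] power_mult_distrib field_simps)
  qed
  have pos: "0 \<le> ?a ^ n / fact n * exp (- ?a)" for n by simp
  have le1: "?a ^ n / fact n * exp (- ?a) \<le> 1" for n
  proof -
    have "(\<lambda>n. ?a ^ n / fact n * exp (- ?a)) sums 1" using E2[of 1] by simp
    then have "summable (\<lambda>n. ?a ^ n / fact n * exp (- ?a))" "(\<Sum>n. ?a ^ n / fact n * exp (- ?a)) = 1"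
      by (simp_all only: sums_iff)
    moreover have "(\<Sum>i\<in>{n}. ?a ^ i / fact i * exp (- ?a)) \<le> (\<Sum>n. ?a ^ n / fact n * exp (- ?a))"
      by (rule sum_le_suminf) (use calculation(1) pos in auto)
    ultimately show ?thesis by simp
  qed
  have "prob (?X n) - ?a ^ n / fact n * exp (- ?a) = 0"
  proof (rule power_series_zero_coeffs[where C=1 and c="\<lambda>n. prob (?X n) - ?a ^ n / fact n * exp (- ?a)"])
    fix n
    show "\<bar>prob (?X n) - ?a ^ n / fact n * exp (- ?a)\<bar> \<le> 1"
      using pos[of n] le1[of n] prob_le_1[of "?X n"] measure_nonneg[of M "?X n"] by linarith
  next
    fix s :: real assume "0 < s" "s < 1"
    from sums_diff[OF E1[OF this] E2[of s]]
    show "(\<lambda>n. (prob (?X n) - ?a ^ n / fact n * exp (- ?a)) * s ^ n) sums 0" by (simp add: algebra_simps)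
  qed
  then show ?thesis by simp
qed

end

context half_line_poisson
begin

lemma prob_INT_void:
  assumes I: "finite I" "I \<noteq> {}" and A: "\<And>i. i \<in> I \<Longrightarrow> A i \<in> fmeasurable half_line"
    and disj: "disjoint_family_on A I"
  shows "prob (\<Inter>i\<in>I. void (A i)) = (\<Prod>i\<in>I. prob (void (A i)))"
proof -
  have As: "A i \<in> sets lborel" "emeasure lborel (A i) \<noteq> \<infinity>" if "i \<in> I" for i
    using A[OF that] by (auto simp: fmeasurable_half_line)
  have U: "(\<Union>i\<in>I. A i) \<in> fmeasurable half_line" using I A by (intro fmeasurable.finite_UN) auto
  have "(\<Inter>i\<in>I. void (A i)) = void (\<Union>i\<in>I. A i)" using I by (auto simp: void_def)
  moreover have "measure lborel (\<Union>i\<in>I. A i) = (\<Sum>i\<in>I. measure lborel (A i))"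
    using I(1) As disj by (intro measure_finite_Union) auto
  ultimately show ?thesis using I(1) by (simp add: prob_void'[OF U] prob_void'[OF A] exp_sum sum_negf[symmetric])
qed

text \<open>The void events of subsets of \<open>A i\<close> form a pi-system that generates the
  count in \<open>A i\<close>. For disjoint sets these pi-systems are independent, since Lebesgue
  measure is additive and void probabilities are its exponentials.\<close>

lemma indep_counts:
  assumes A: "\<And>i. i < r \<Longrightarrow> A i \<in> fmeasurable half_line" and disj: "disjoint_family_on A {..<r}"
  shows "indep_vars (\<lambda>_. count_space UNIV) (\<lambda>i \<omega>. card (\<omega> \<inter> A i)) {..<r}"
proof -
  have Ab: "A i \<in> sets borel" if "i < r" for i using A[OF that] by (simp add: fmeasurable_half_line)
  define G where "G i = void ` {K \<in> fmeasurable half_line. K \<subseteq> A i}" for i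
  have GP: "G i \<subseteq> Pow half_line_confs" for i using void_subset by (auto simp: G_def)
  have "indep_sets G {..<r}"
  proof (rule indep_setsI)
    show "G i \<subseteq> events" for i by (auto simp: G_def fmeasurable_half_line void_sets)
    fix C J assume J: "J \<noteq> {}" "J \<subseteq> {..<r}" "finite J" and C: "\<forall>j\<in>J. C j \<in> G j"
    have "\<forall>j\<in>J. \<exists>K. K \<in> fmeasurable half_line \<and> K \<subseteq> A j \<and> C j = void K" using C by (auto simp: G_def)
    then obtain K where "\<forall>j\<in>J. K j \<in> fmeasurable half_line \<and> K j \<subseteq> A j \<and> C j = void (K j)"
      by (rule bchoice[THEN exE])
    then have K: "\<And>j. j \<in> J \<Longrightarrow> K j \<in> fmeasurable half_line" "\<And>j. j \<in> J \<Longrightarrow> K j \<subseteq> A j" "\<And>j. j \<in> J \<Longrightarrow> C j = void (K j)"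
      by simp_all
    have dJ: "disjoint_family_on K J"
      unfolding disjoint_family_on_def
    proof (intro ballI impI)
      fix m n assume mn: "m \<in> J" "n \<in> J" "m \<noteq> n"
      then have "A m \<inter> A n = {}" using disjoint_family_onD[OF disj, of m n] J(2) by blast
      then show "K m \<inter> K n = {}" using K(2)[OF mn(1)] K(2)[OF mn(2)] by blast
    qed
    have "(\<Inter>j\<in>J. C j) = (\<Inter>j\<in>J. void (K j))" using K(3) by simp
    then show "prob (\<Inter>j\<in>J. C j) = (\<Prod>j\<in>J. prob (C j))"
      using prob_INT_void[OF J(3,1) K(1) dJ] K(3) by simp
  qed
  then have "indep_sets (\<lambda>i. sigma_sets (space M) (G i)) {..<r}"
  proof (rule indep_sets_sigma)
    fix i
    show "Int_stable (G i)"
    proof (rule Int_stableI)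
      fix a b assume "a \<in> G i" "b \<in> G i"
      then obtain K L where KL: "K \<in> fmeasurable half_line" "L \<in> fmeasurable half_line" "K \<subseteq> A i" "L \<subseteq> A i" "a = void K" "b = void L"
        by (auto simp: G_def)
      have "a \<inter> b = void (K \<union> L)" using KL void_Un by simp
      then show "a \<inter> b \<in> G i" unfolding G_def using KL by (intro image_eqI[of _ _ "K \<union> L"]) auto
    qed
  qed
  moreover have "{(\<lambda>\<omega>. card (\<omega> \<inter> A i)) -` N \<inter> space M | N. N \<in> sets (count_space UNIV)} \<subseteq> sigma_sets (space M) (G i)"
    if i: "i \<in> {..<r}" for i
  proof safe
    fix N :: "nat set"
    have "void (A i \<inter> dyadic k l) \<in> G i" for k l
    proof -
      have "A i \<inter> dyadic k l \<in> fmeasurable half_line" using dyadic_pieces(1)[OF A] i by simp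
      then show ?thesis by (auto simp: G_def)
    qed
    from card_points_sets(2)[OF GP this, of N]
    show "(\<lambda>\<omega>. card (\<omega> \<inter> A i)) -` N \<inter> space M \<in> sigma_sets (space M) (G i)"
      by (simp add: space_M vimage_def Int_def conj_commute)
  qed
  ultimately have "indep_sets (\<lambda>i. {(\<lambda>\<omega>. card (\<omega> \<inter> A i)) -` N \<inter> space M | N. N \<in> sets (count_space UNIV)}) {..<r}"
    by (rule indep_sets_mono_sets)
  then show ?thesis
    unfolding indep_vars_def2 using card_measurable[OF Ab] by auto
qed

lemma is_poisson: "is_poisson_measure half_line windows M"
proof -
  have fm: "A \<in> fmeasurable half_line" if "A \<in> sets half_line" "emeasure half_line A < \<infinity>" for A
    using that by (auto simp: fmeasurable_def)
  show ?thesis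
    unfolding is_poisson_measure_def
  proof (intro conjI allI ballI impI)
    show "prob_space M" by unfold_locales
    show "space M = half_line_confs" by (rule space_M)
    show "sets M = configuration_events half_line windows" by (simp add: configuration_events_half_line sets_M_eq)
  next
    fix A n assume A: "A \<in> sets half_line" "emeasure half_line A < \<infinity>"
    show "AE \<omega> in M. finite (\<omega> \<inter> A)" by (rule AE_finite_points[OF fm[OF A]])
    show "measure M {\<omega> \<in> space M. card (\<omega> \<inter> A) = n} = measure half_line A ^ n / fact n * exp (- measure half_line A)"
      using prob_card[OF fm[OF A], of n] measure_half_line[of A] A(1) by (simp add: sets_half_line)
  next
    fix r and A :: "nat \<Rightarrow> real set"
    assume A: "\<forall>i<r. A i \<in> sets half_line \<and> emeasure half_line (A i) < \<infinity>" "disjoint_family_on A {..<r}"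
    have "A i \<in> fmeasurable half_line" if "i < r" for i using A(1) that fm[of "A i"] by simp
    from indep_counts[OF this A(2)]
    show "indep_vars (\<lambda>_. count_space UNIV) (\<lambda>i \<omega>. card (\<omega> \<inter> A i)) {..<r}" .
  qed
qed

end

subsection \<open>Suspensions of actions by bounded motions\<close>

text \<open>An invertible map of the half line that preserves Lebesgue measure and boundedness acts on
  all configurations, not just on almost all of them.\<close>

definition motion :: "(real \<Rightarrow> real) \<Rightarrow> (real \<Rightarrow> real) \<Rightarrow> bool" where
  "motion f g \<longleftrightarrow> (\<forall>x\<ge>0. f x \<ge> 0 \<and> g x \<ge> 0 \<and> g (f x) = x \<and> f (g x) = x) \<and>
     (\<forall>K\<in>bounded_borel. f ` K \<in> bounded_borel \<and> g ` K \<in> bounded_borel \<and> measure lborel (f ` K) = measure lborel K)"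

lemma motionD:
  assumes "motion f g"
  shows "0 \<le> x \<Longrightarrow> 0 \<le> f x" "0 \<le> x \<Longrightarrow> 0 \<le> g x" "0 \<le> x \<Longrightarrow> g (f x) = x" "0 \<le> x \<Longrightarrow> f (g x) = x"
    "K \<in> bounded_borel \<Longrightarrow> f ` K \<in> bounded_borel" "K \<in> bounded_borel \<Longrightarrow> g ` K \<in> bounded_borel"
    "K \<in> bounded_borel \<Longrightarrow> measure lborel (f ` K) = measure lborel K"
  using assms unfolding motion_def by blast+

lemma motion_image_cancel:
  assumes "motion f g" "K \<subseteq> {0..}"
  shows "f ` g ` K = K" "g ` f ` K = K"
proof -
  have "f (g x) = x" "g (f x) = x" if "x \<in> K" for x
    using assms(2) that motionD(3,4)[OF assms(1), of x] by auto
  then show "f ` g ` K = K" "g ` f ` K = K" by (force simp: image_image)+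
qed

lemma motion_sym:
  assumes "motion f g"
  shows "motion g f"
  unfolding motion_def
proof (intro conjI ballI)
  show "\<forall>x\<ge>0. g x \<ge> 0 \<and> f x \<ge> 0 \<and> f (g x) = x \<and> g (f x) = x" using motionD[OF assms] by blast
  fix K assume K: "K \<in> bounded_borel"
  show "g ` K \<in> bounded_borel" "f ` K \<in> bounded_borel" using motionD(5,6)[OF assms] K by auto
  show "measure lborel (g ` K) = measure lborel K"
    using motionD(7)[OF assms motionD(6)[OF assms K]] motion_image_cancel(1)[OF assms bounded_borel_sets(2)[OF K]] by simp
qed

lemma motion_comp:
  assumes f: "motion f f'" and g: "motion g g'"
  shows "motion (\<lambda>x. f (g x)) (\<lambda>x. g' (f' x))"
  unfolding motion_def
proof (intro conjI ballI allI impI)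
  fix x :: real assume x: "0 \<le> x"
  show "0 \<le> f (g x)" "0 \<le> g' (f' x)" "g' (f' (f (g x))) = x" "f (g (g' (f' x))) = x"
    using x motionD(1-4)[OF f] motionD(1-4)[OF g] by auto
next
  fix K assume K: "K \<in> bounded_borel"
  have "(\<lambda>x. f (g x)) ` K = f ` g ` K" "(\<lambda>x. g' (f' x)) ` K = g' ` f' ` K" by auto
  then show "(\<lambda>x. f (g x)) ` K \<in> bounded_borel" "(\<lambda>x. g' (f' x)) ` K \<in> bounded_borel"
    "measure lborel ((\<lambda>x. f (g x)) ` K) = measure lborel K"
    using K motionD(5-7)[OF f] motionD(5-7)[OF g] by auto
qed

lemma motion_vimage:
  assumes "motion f g" "K \<subseteq> {0..}"
  shows "f -` K \<inter> {0..} = g ` K"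
proof (intro set_eqI iffI)
  fix x assume "x \<in> f -` K \<inter> {0..}"
  then show "x \<in> g ` K" using motionD(3)[OF assms(1), of x] by (intro image_eqI[of _ _ "f x"]) auto
next
  fix x assume "x \<in> g ` K"
  then obtain y where y: "y \<in> K" "x = g y" by auto
  then have "0 \<le> y" using assms(2) by auto
  then show "x \<in> f -` K \<inter> {0..}" using y motionD(2,4)[OF assms(1), of y] by auto
qed

lemma motion_measurable:
  assumes "motion f g"
  shows "f \<in> measurable half_line half_line"
proof (rule measurableI)
  fix x assume "x \<in> space half_line"
  then show "f x \<in> space half_line" using motionD(1)[OF assms] by (simp add: space_half_line)
next
  fix A assume A: "A \<in> sets half_line"
  then have Ab: "A \<in> sets borel" "A \<subseteq> {0..}" by (auto simp: sets_half_line)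
  have "A = (\<Union>k. A \<inter> windows k)"
    using exhausting_windows Ab by (auto simp: exhausting_def space_half_line)
  then have "g ` A = (\<Union>k. g ` (A \<inter> windows k))" by blast
  also have "\<dots> \<in> sets half_line"
  proof (intro sets.countable_UN image_subsetI)
    fix k
    have "A \<inter> windows k \<in> bounded_borel"
      by (rule bounded_borel_subset[OF windows_bounded_borel]) (use Ab in \<open>auto simp: windows_def\<close>)
    then show "g ` (A \<inter> windows k) \<in> sets half_line" by (intro bounded_borel_sets(3) motionD(6)[OF assms])
  qed
  finally show "f -` A \<inter> space half_line \<in> sets half_line"
    unfolding space_half_line motion_vimage[OF assms Ab(2)] .
qed

lemma motion_automorphism:
  assumes m: "motion f g"
  shows "automorphism half_line f"
proof (rule automorphismI)
  show "f \<in> measurable half_line half_line" "g \<in> measurable half_line half_line"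
    using motion_measurable[OF m] motion_measurable[OF motion_sym[OF m]] by auto
  show "g (f x) = x" "f (g x) = x" if "x \<in> space half_line" for x
    using that motionD(3,4)[OF m] by (auto simp: space_half_line)
  show "distr half_line half_line f = half_line"
  proof (rule measure_eqI)
    fix A assume "A \<in> sets (distr half_line half_line f)"
    then have A: "A \<in> sets half_line" by simp
    then have Ab: "A \<in> sets borel" "A \<subseteq> {0..}" by (auto simp: sets_half_line)
    have b: "A \<inter> windows k \<in> bounded_borel" for k
      by (rule bounded_borel_subset[OF windows_bounded_borel]) (use Ab in \<open>auto simp: windows_def\<close>)
    have un: "A = (\<Union>k. A \<inter> windows k)"
      using exhausting_windows Ab by (auto simp: exhausting_def space_half_line)
    then have gun: "g ` A = (\<Union>k. g ` (A \<inter> windows k))" by blast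
    have e: "emeasure half_line (g ` (A \<inter> windows k)) = emeasure half_line (A \<inter> windows k)" for k
    proof -
      have "measure half_line (g ` (A \<inter> windows k)) = measure half_line (A \<inter> windows k)"
        using motionD(7)[OF motion_sym[OF m] b] bounded_borel_sets(2)[OF b] bounded_borel_sets(2)[OF motionD(6)[OF m b]]
        by (simp add: measure_half_line)
      then show ?thesis
        using bounded_borel_sets(5)[OF b] bounded_borel_sets(5)[OF motionD(6)[OF m b]]
        by (simp add: emeasure_eq_measure2)
    qed
    have inc: "incseq (\<lambda>k. A \<inter> windows k)" using windows_mono by (auto simp: incseq_def)
    have "emeasure (distr half_line half_line f) A = emeasure half_line (g ` A)"
      using emeasure_distr[OF motion_measurable[OF m] A] motion_vimage[OF m Ab(2)] by (simp add: space_half_line)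
    also have "\<dots> = (SUP k. emeasure half_line (g ` (A \<inter> windows k)))"
      unfolding gun
    proof (rule SUP_emeasure_incseq[symmetric])
      show "range (\<lambda>k. g ` (A \<inter> windows k)) \<subseteq> sets half_line"
        using bounded_borel_sets(3)[OF motionD(6)[OF m b]] by auto
      show "incseq (\<lambda>k. g ` (A \<inter> windows k))" using inc unfolding incseq_def by (blast intro: image_mono)
    qed
    also have "\<dots> = (SUP k. emeasure half_line (A \<inter> windows k))" by (simp only: e)
    also have "\<dots> = emeasure half_line (\<Union>k. A \<inter> windows k)"
      by (rule SUP_emeasure_incseq[OF _ inc]) (use bounded_borel_sets(3)[OF b] in auto)
    finally show "emeasure (distr half_line half_line f) A = emeasure half_line A" using un by simp
  qed simp
qed

lemma motion_image_conf:
  assumes m: "motion f g" and \<omega>: "\<omega> \<in> half_line_confs"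
  shows "f ` \<omega> \<in> half_line_confs"
  unfolding half_line_conf_iff
proof (intro conjI allI)
  have sub: "\<omega> \<subseteq> {0..}" using \<omega> by (simp add: half_line_conf_iff)
  then show "f ` \<omega> \<subseteq> {0..}" using motionD(1)[OF m] by auto
  fix k
  have "f ` \<omega> \<inter> windows k \<subseteq> f ` (\<omega> \<inter> g ` windows k)"
  proof
    fix y assume "y \<in> f ` \<omega> \<inter> windows k"
    then obtain x where x: "x \<in> \<omega>" "y = f x" "f x \<in> windows k" by auto
    have "x = g (f x)" using sub x(1) motionD(3)[OF m, of x] by auto
    then show "y \<in> f ` (\<omega> \<inter> g ` windows k)" using x by blast
  qed
  moreover have "finite (\<omega> \<inter> g ` windows k)"
    by (rule half_line_conf_finite[OF \<omega> motionD(6)[OF m windows_bounded_borel]])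
  ultimately show "finite (f ` \<omega> \<inter> windows k)" by (meson finite_imageI finite_subset)
qed

lemma motion_void_vimage:
  assumes m: "motion f g" and K: "K \<subseteq> {0..}"
  shows "(\<lambda>\<omega>. f ` \<omega>) -` void K \<inter> half_line_confs = void (g ` K)"
proof (rule set_eqI)
  fix \<omega>
  show "\<omega> \<in> (\<lambda>\<omega>. f ` \<omega>) -` void K \<inter> half_line_confs \<longleftrightarrow> \<omega> \<in> void (g ` K)"
  proof (cases "\<omega> \<in> half_line_confs")
    case True
    then have sub: "\<omega> \<subseteq> {0..}" by (simp add: half_line_conf_iff)
    have "f ` \<omega> \<inter> K = {} \<longleftrightarrow> \<omega> \<inter> (f -` K \<inter> {0..}) = {}" using sub by blast
    also have "f -` K \<inter> {0..} = g ` K" by (rule motion_vimage[OF m K])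
    finally show ?thesis using True motion_image_conf[OF m True] by (auto simp: void_def)
  qed (auto simp: void_def)
qed

context half_line_poisson
begin

text \<open>Preimages of void events are void events of sets of the same measure, and the void
  events are a generating pi-system.\<close>

lemma suspension_automorphism:
  assumes m: "motion f g"
  shows "automorphism M (\<lambda>\<omega>. f ` \<omega>)"
proof (rule automorphismI[where g="\<lambda>\<omega>. g ` \<omega>"])
  have meas: "(\<lambda>\<omega>. f ` \<omega>) \<in> measurable M M" if m: "motion f g" for f g
  proof (rule measurable_sigma_sets[OF sets_M_eq void_Pow])
    show "(\<lambda>\<omega>. f ` \<omega>) \<in> space M \<rightarrow> half_line_confs" using motion_image_conf[OF m] by (auto simp: space_M)
    fix y assume "y \<in> void ` bounded_borel"
    then obtain K where K: "K \<in> bounded_borel" "y = void K" by auto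
    have "(\<lambda>\<omega>. f ` \<omega>) -` y \<inter> space M = void (g ` K)"
      unfolding K(2) space_M by (rule motion_void_vimage[OF m bounded_borel_sets(2)[OF K(1)]])
    then show "(\<lambda>\<omega>. f ` \<omega>) -` y \<inter> space M \<in> sets M"
      using void_sets[OF bounded_borel_sets(1)[OF motionD(6)[OF m K(1)]]] by simp
  qed
  show mf: "(\<lambda>\<omega>. f ` \<omega>) \<in> measurable M M" by (rule meas[OF m])
  show "(\<lambda>\<omega>. g ` \<omega>) \<in> measurable M M" by (rule meas[OF motion_sym[OF m]])
  show "g ` f ` \<omega> = \<omega>" "f ` g ` \<omega> = \<omega>" if "\<omega> \<in> space M" for \<omega>
  proof -
    have "\<omega> \<subseteq> {0..}" using that by (simp add: space_M half_line_conf_iff)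
    then show "g ` f ` \<omega> = \<omega>" "f ` g ` \<omega> = \<omega>" using motion_image_cancel[OF m] by auto
  qed
  show "distr M M (\<lambda>\<omega>. f ` \<omega>) = M"
  proof (rule measure_eqI_generator_eq[OF Int_stable_void void_Pow, where A="\<lambda>_. void {}"])
    show "sets (distr M M ((`) f)) = sigma_sets half_line_confs (void ` bounded_borel)" by (simp add: sets_M_eq)
    show "sets M = sigma_sets half_line_confs (void ` bounded_borel)" by (rule sets_M_eq)
    show "range (\<lambda>_. void {}) \<subseteq> void ` bounded_borel" using bounded_borel_empty by auto
    show "(\<Union>i. void {}) = half_line_confs" by (auto simp: void_def)
    fix X assume "X \<in> void ` bounded_borel"
    then obtain K where K: "K \<in> bounded_borel" "X = void K" by auto
    have "emeasure (distr M M ((`) f)) X = emeasure M (void (g ` K))"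
      unfolding K(2) using emeasure_distr[OF mf void_sets[OF bounded_borel_sets(1)[OF K(1)]]]
        motion_void_vimage[OF m bounded_borel_sets(2)[OF K(1)]] by (simp add: space_M)
    also have "\<dots> = emeasure M X"
      using prob_void[OF K(1)] prob_void[OF motionD(6)[OF m K(1)]] motionD(7)[OF motion_sym[OF m] K(1)] K(2)
      by (simp add: emeasure_eq_measure)
    finally show "emeasure (distr M M ((`) f)) X = emeasure M X" .
  qed (simp add: emeasure_distr[OF mf void_sets] emeasure_eq_measure)
qed

lemma suspension_image_void:
  assumes m: "motion f g" and K: "K \<in> bounded_borel"
  shows "(\<lambda>\<omega>. f ` \<omega>) ` void K = void (f ` K)"
proof (intro set_eqI iffI)
  note vg = motion_void_vimage[OF motion_sym[OF m] bounded_borel_sets(2)[OF K]]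
  fix \<omega> assume "\<omega> \<in> void (f ` K)"
  then have \<omega>: "g ` \<omega> \<in> void K" "\<omega> \<in> half_line_confs" unfolding vg[symmetric] by auto
  then have "f ` g ` \<omega> = \<omega>" using motion_image_cancel[OF m] by (simp add: half_line_conf_iff)
  then show "\<omega> \<in> (\<lambda>\<omega>. f ` \<omega>) ` void K" using \<omega>(1) by (intro image_eqI[of _ _ "g ` \<omega>"]) auto
next
  note vg = motion_void_vimage[OF motion_sym[OF m] bounded_borel_sets(2)[OF K]]
  fix \<omega> assume "\<omega> \<in> (\<lambda>\<omega>. f ` \<omega>) ` void K"
  then obtain \<eta> where \<eta>: "\<eta> \<in> void K" "\<omega> = f ` \<eta>" by auto
  have \<eta>c: "\<eta> \<in> half_line_confs" using \<eta>(1) void_subset by auto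
  then have "g ` f ` \<eta> = \<eta>" using motion_image_cancel[OF m] by (simp add: half_line_conf_iff)
  then show "\<omega> \<in> void (f ` K)" unfolding vg[symmetric] using \<eta> motion_image_conf[OF m \<eta>c] by simp
qed

lemma prob_sym_diff_void:
  assumes "K \<in> bounded_borel" "L \<in> bounded_borel"
  shows "prob (sym_diff (void K) (void L)) \<le> measure lborel (sym_diff K L)"
proof -
  have b: "sym_diff K L \<in> bounded_borel"
    using assms by (intro bounded_borel_subset[OF bounded_borel_Un[OF assms]]) (auto dest: bounded_borel_sets(1))
  have "prob (sym_diff (void K) (void L)) \<le> prob (space M - void (sym_diff K L))"
  proof (rule finite_measure_mono)
    show "space M - void (sym_diff K L) \<in> sets M"
      by (intro sets.compl_sets void_sets bounded_borel_sets(1)[OF b])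
  qed (auto simp: void_def space_M)
  also have "\<dots> \<le> measure lborel (sym_diff K L)"
    by (rule prob_not_void_le[OF bounded_borel_sets(5)[OF b]])
  finally show ?thesis .
qed

text \<open>A configuration in the symmetric difference of two void events has a point in the
  symmetric difference of the sets, so convergence of bounded sets in measure carries over to the
  generators. \<open>R\<close> is tied to the suspension on configurations alone, because the powers
  formed by \<open>int_power\<close> are identified with it only there.\<close>

lemma tends_to_identity_suspension:
  assumes m: "\<And>n. motion (f n) (g n)"
    and R: "\<And>n \<omega>. \<omega> \<in> space M \<Longrightarrow> R n \<omega> = f n ` \<omega>" and Ra: "\<And>n. automorphism M (R n)"
    and lim: "\<And>K. K \<in> bounded_borel \<Longrightarrow> ((\<lambda>n. measure lborel (sym_diff (f n ` K) K)) \<longlongrightarrow> 0) F"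
  shows "tends_to_identity M R F"
proof (rule tends_to_identityI[OF Ra, where G="void ` bounded_borel"])
  show "void ` bounded_borel \<subseteq> sets M" using void_sets bounded_borel_sets(1) by auto
  show "sets M = sigma_sets (space M) (void ` bounded_borel)" by (simp add: sets_M_eq space_M)
  fix A assume "A \<in> void ` bounded_borel"
  then obtain K where K: "K \<in> bounded_borel" "A = void K" by auto
  have "R n ` A = void (f n ` K)" for n
  proof -
    have "R n ` A = (\<lambda>\<omega>. f n ` \<omega>) ` A" using R void_subset[of K] K(2) by (intro image_cong) (auto simp: space_M)
    then show ?thesis using suspension_image_void[OF m K(1)] K(2) by simp
  qed
  then have "prob (sym_diff (R n ` A) A) \<le> measure lborel (sym_diff (f n ` K) K)" for n
    using prob_sym_diff_void[OF motionD(5)[OF m K(1)] K(1)] K(2) by simp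
  then show "((\<lambda>n. prob (sym_diff (R n ` A) A)) \<longlongrightarrow> 0) F"
    by (intro Lim_null_comparison[OF _ lim[OF K(1)]]) simp
qed

text \<open>A point of one configuration that is missing in the other has a small dyadic cell free
  of points of the other, by local finiteness.\<close>

lemma separating_void_events:
  "\<exists>\<C>. countable \<C> \<and> \<C> \<subseteq> sets M \<and>
     (\<forall>x\<in>space M. \<forall>y\<in>space M. x \<noteq> y \<longrightarrow> (\<exists>A\<in>\<C>. (x \<in> A) \<noteq> (y \<in> A)))"
proof (intro exI[of _ "range (\<lambda>(k, i). void (dyadic k i))"] conjI ballI impI)
  show "countable (range (\<lambda>(k, i). void (dyadic k i)))" by (intro countable_image) auto
  show "range (\<lambda>(k, i). void (dyadic k i)) \<subseteq> sets M"
    using void_sets bounded_borel_sets(1)[OF dyadic_bounded_borel] by auto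
  have sep: "\<exists>k i. dyadic k i \<inter> x \<noteq> {} \<and> dyadic k i \<inter> y = {}"
    if xy: "x \<in> space M" "y \<in> space M" "p \<in> x" "p \<notin> y" for x y p
  proof -
    have p0: "0 \<le> p" using xy by (auto simp: space_M half_line_conf_iff)
    \<comment> \<open>The margin 1 bounds the length of a dyadic cell, so the whole cell around
      \<open>p\<close> lies in \<open>windows j\<close>.\<close>
    obtain j where j: "p + 1 < real j" using reals_Archimedean2 by blast
    have fin: "finite (insert p (y \<inter> windows j))" using xy(2) by (auto simp: space_M half_line_conf_iff)
    obtain k where "\<And>k'. k \<le> k' \<Longrightarrow> inj_on (\<lambda>z. \<lfloor>z * 2 ^ k'\<rfloor>) (insert p (y \<inter> windows j))"
      by (rule finite_separated_by_dyadic[OF fin]) (rule that, simp)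
    note k = this[OF order_refl]
    define i where "i = nat \<lfloor>p * 2 ^ k\<rfloor>"
    have pi: "p \<in> dyadic k i" using mem_dyadic_iff[OF p0] by (simp add: i_def)
    have "z \<notin> y" if z: "z \<in> dyadic k i" for z
    proof
      assume zy: "z \<in> y"
      have z0: "0 \<le> z" using zy xy(2) by (auto simp: space_M half_line_conf_iff)
      have "(1::real) \<le> 2 ^ k" by simp
      then have "1 / 2 ^ k \<le> (1::real)" by (simp add: field_simps)
      moreover have "z < p + 1 / 2 ^ k" using z pi by (simp add: dyadic_def add_divide_distrib)
      ultimately have "z < real j" using j by linarith
      then have "z \<in> windows j" using z0 by (simp add: windows_def)
      moreover have "nat \<lfloor>z * 2 ^ k\<rfloor> = nat \<lfloor>p * 2 ^ k\<rfloor>" using mem_dyadic_iff[OF z0, of k i] z by (simp add: i_def)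
      then have "\<lfloor>z * 2 ^ k\<rfloor> = \<lfloor>p * 2 ^ k\<rfloor>" using p0 z0 by (subst (asm) eq_nat_nat_iff) auto
      ultimately have "z = p" using inj_onD[OF k] zy by auto
      then show False using zy xy(4) by simp
    qed
    then show ?thesis using pi xy(3) by blast
  qed
  fix x y assume xy: "x \<in> space M" "y \<in> space M" "x \<noteq> y"
  then consider p where "p \<in> x" "p \<notin> y" | p where "p \<in> y" "p \<notin> x" by blast
  then have "\<exists>k i. (x \<in> void (dyadic k i)) \<noteq> (y \<in> void (dyadic k i))"
  proof cases
    case 1
    from sep[OF xy(1,2) 1] obtain k i where "dyadic k i \<inter> x \<noteq> {}" "dyadic k i \<inter> y = {}" by blast
    then show ?thesis using xy by (intro exI[of _ k] exI[of _ i]) (auto simp: void_def space_M)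
  next
    case 2
    from sep[OF xy(2,1) 2] obtain k i where "dyadic k i \<inter> y \<noteq> {}" "dyadic k i \<inter> x = {}" by blast
    then show ?thesis using xy by (intro exI[of _ k] exI[of _ i]) (auto simp: void_def space_M)
  qed
  then show "\<exists>A\<in>range (\<lambda>(k, i). void (dyadic k i)). (x \<in> A) \<noteq> (y \<in> A)" by auto
qed

text \<open>The joint event is the void event of a union, whose measure falls short of the sum by
  the overlap \<open>c\<close>. Thus the defect is
  \<open>exp (- (a + b - c)) - exp (- (a + b))\<close>, which lies between 0 and
  \<open>c\<close>.\<close>

lemma mixing_void_events:
  assumes m: "motion f g" and K: "K \<in> bounded_borel" and L: "L \<in> bounded_borel"
  shows "\<bar>prob (((\<lambda>\<omega>. f ` \<omega>) -` void K \<inter> space M) \<inter> void L) - prob (void K) * prob (void L)\<bar>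
     \<le> measure lborel (g ` K \<inter> L)"
proof -
  let ?K = "g ` K"
  have K': "?K \<in> bounded_borel" "measure lborel ?K = measure lborel K"
    using motionD(6)[OF m K] motionD(7)[OF motion_sym[OF m] K] by auto
  have fm: "?K \<in> fmeasurable lborel" "L \<in> fmeasurable lborel" using bounded_borel_sets(6) K' L by auto
  define a b c where "a = measure lborel K" and "b = measure lborel L" and "c = measure lborel (?K \<inter> L)"
  have "measure lborel (?K \<union> L) = a + b - c"
    using measure_Un3[OF fm] K'(2) by (simp add: a_def b_def c_def)
  then have eq: "prob (((\<lambda>\<omega>. f ` \<omega>) -` void K \<inter> space M) \<inter> void L) = exp (- (a + b - c))"
    using motion_void_vimage[OF m bounded_borel_sets(2)[OF K]] prob_void[OF bounded_borel_Un[OF K'(1) L]]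
    by (simp add: space_M void_Un)
  have eq2: "prob (void K) * prob (void L) = exp (- (a + b))"
    using prob_void K L by (simp add: a_def b_def exp_add[symmetric])
  have c: "0 \<le> c" "c \<le> a + b - c"
  proof -
    show "0 \<le> c" by (simp add: c_def)
    have "c \<le> measure lborel (?K \<union> L)" unfolding c_def
      by (rule measure_mono_fmeasurable) (use fm in auto)
    then show "c \<le> a + b - c" using \<open>measure lborel (?K \<union> L) = a + b - c\<close> by simp
  qed
  have "exp (- (a + b)) = exp (- (a + b - c)) * exp (- c)" by (simp add: exp_add[symmetric])
  then have "exp (- (a + b - c)) - exp (- (a + b)) = exp (- (a + b - c)) * (1 - exp (- c))" by (simp add: algebra_simps)
  also have "\<dots> \<le> 1 * c"
    using c exp_ge_add_one_self[of "- c"] by (intro mult_mono) auto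
  finally have "exp (- (a + b - c)) - exp (- (a + b)) \<le> c" by simp
  moreover have "exp (- (a + b)) \<le> exp (- (a + b - c))" using c by simp
  ultimately show ?thesis unfolding eq eq2 c_def[symmetric] by simp
qed

end

section \<open>Exchanges of two blocks of the half line\<close>

definition swap_blocks :: "nat \<Rightarrow> real \<Rightarrow> real" where
  "swap_blocks n x = (if x < real n then x + real n else if x < 2 * real n then x - real n else x)"

lemma swap_blocks_motion: "motion (swap_blocks n) (swap_blocks n)"
  unfolding motion_def
proof (intro conjI allI impI ballI)
  fix x :: real assume "0 \<le> x"
  then show "0 \<le> swap_blocks n x" "0 \<le> swap_blocks n x" "swap_blocks n (swap_blocks n x) = x" "swap_blocks n (swap_blocks n x) = x"
    by (auto simp: swap_blocks_def)
next
  fix K assume K: "K \<in> bounded_borel"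
  define r where "r = real n"
  have r0: "0 \<le> r" by (simp add: r_def)
  have Ks: "K \<in> sets borel" "K \<subseteq> {0..}" using bounded_borel_sets[OF K] by auto
  let ?K1 = "K \<inter> {0..<r}" and ?K2 = "K \<inter> {r..<2 * r}" and ?K3 = "K \<inter> {2 * r..}"
  have tr: "(+) t ` X \<in> sets borel \<and> measure lborel ((+) t ` X) = measure lborel X" if "X \<in> sets borel" for t :: real and X
  proof -
    have "(+) t ` X = (\<lambda>x. x - t) -` X"
    proof (intro set_eqI iffI)
      fix x assume "x \<in> (\<lambda>x. x - t) -` X"
      then show "x \<in> (+) t ` X" by (intro image_eqI[of _ _ "x - t"]) auto
    qed auto
    moreover have "(\<lambda>x. x - t) -` X \<inter> space borel \<in> sets borel"
      by (rule measurable_sets[OF _ that]) simp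
    ultimately show ?thesis using measure_translation[of t X] that by (simp add: measure_completion)
  qed
  have im: "swap_blocks n ` K = (+) r ` ?K1 \<union> (+) (- r) ` ?K2 \<union> ?K3"
  proof (intro set_eqI iffI)
    fix y assume "y \<in> swap_blocks n ` K"
    then obtain x where "x \<in> K" "y = swap_blocks n x" by auto
    then show "y \<in> (+) r ` ?K1 \<union> (+) (- r) ` ?K2 \<union> ?K3"
      using Ks(2) r0 by (cases "x < r"; cases "x < 2 * r") (auto simp: swap_blocks_def r_def image_iff)
  next
    fix y assume "y \<in> (+) r ` ?K1 \<union> (+) (- r) ` ?K2 \<union> ?K3"
    then consider x where "x \<in> ?K1" "y = r + x" | x where "x \<in> ?K2" "y = - r + x" | "y \<in> ?K3" by blast
    then show "y \<in> swap_blocks n ` K"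
    proof cases
      case 1 then show ?thesis by (intro image_eqI[of _ _ x]) (auto simp: swap_blocks_def r_def)
    next
      case 2 then show ?thesis by (intro image_eqI[of _ _ x]) (auto simp: swap_blocks_def r_def)
    next
      case 3 then show ?thesis using r0 by (intro image_eqI[of _ _ y]) (auto simp: swap_blocks_def r_def)
    qed
  qed
  have s: "?K1 \<in> sets borel" "?K2 \<in> sets borel" "?K3 \<in> sets borel" using Ks by auto
  have sb: "swap_blocks n ` K \<in> sets borel" unfolding im using tr[OF s(1), of r] tr[OF s(2), of "- r"] s by auto
  obtain k where k: "K \<subseteq> windows k" using K by (auto simp: bounded_borel_def)
  have "swap_blocks n ` K \<subseteq> windows (k + n)"
  proof
    fix y assume "y \<in> swap_blocks n ` K"
    then obtain x where "x \<in> K" "y = swap_blocks n x" by auto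
    then show "y \<in> windows (k + n)" using k by (auto simp: windows_def swap_blocks_def split: if_splits)
  qed
  with sb show b: "swap_blocks n ` K \<in> bounded_borel" "swap_blocks n ` K \<in> bounded_borel"
    by (auto simp: bounded_borel_def)
  have fK: "X \<in> fmeasurable lborel" if "X \<in> sets borel" "X \<subseteq> K" for X
    using bounded_borel_sets(6)[OF bounded_borel_subset[OF K that]] .
  have fS: "X \<in> fmeasurable lborel" if "X \<in> sets borel" "X \<subseteq> swap_blocks n ` K" for X
    using bounded_borel_sets(6)[OF bounded_borel_subset[OF b(1) that]] .
  have "measure lborel (swap_blocks n ` K) = measure lborel ((+) r ` ?K1 \<union> (+) (- r) ` ?K2) + measure lborel ?K3"
    unfolding im
  proof (rule measure_Un3[THEN trans])
    show "(+) r ` ?K1 \<union> (+) (- r) ` ?K2 \<in> fmeasurable lborel" "?K3 \<in> fmeasurable lborel"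
      by (rule fS; use tr[OF s(1), of r] tr[OF s(2), of "- r"] s im in auto)+
    have "((+) r ` ?K1 \<union> (+) (- r) ` ?K2) \<inter> ?K3 = {}" using r0 by auto
    then show "measure lborel ((+) r ` ?K1 \<union> (+) (- r) ` ?K2) + measure lborel ?K3 - measure lborel (((+) r ` ?K1 \<union> (+) (- r) ` ?K2) \<inter> ?K3)
      = measure lborel ((+) r ` ?K1 \<union> (+) (- r) ` ?K2) + measure lborel ?K3" by simp
  qed
  also have "measure lborel ((+) r ` ?K1 \<union> (+) (- r) ` ?K2) = measure lborel ((+) r ` ?K1) + measure lborel ((+) (- r) ` ?K2)"
  proof (rule measure_Un3[THEN trans])
    show "(+) r ` ?K1 \<in> fmeasurable lborel" "(+) (- r) ` ?K2 \<in> fmeasurable lborel"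
      by (rule fS; use tr[OF s(1), of r] tr[OF s(2), of "- r"] s im in auto)+
    have "(+) r ` ?K1 \<inter> (+) (- r) ` ?K2 = {}" using r0 by auto
    then show "measure lborel ((+) r ` ?K1) + measure lborel ((+) (- r) ` ?K2) - measure lborel ((+) r ` ?K1 \<inter> (+) (- r) ` ?K2)
      = measure lborel ((+) r ` ?K1) + measure lborel ((+) (- r) ` ?K2)" by simp
  qed
  also have "\<dots> = measure lborel ?K1 + measure lborel ?K2" using tr[OF s(1), of r] tr[OF s(2), of "- r"] by simp
  also have "\<dots> = measure lborel (?K1 \<union> ?K2)"
  proof -
    have "?K1 \<inter> ?K2 = {}" by auto
    then show ?thesis using measure_Un3[OF fK[OF s(1)] fK[OF s(2)]] by simp
  qed
  also have "\<dots> + measure lborel ?K3 = measure lborel (?K1 \<union> ?K2 \<union> ?K3)"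
  proof -
    have "(?K1 \<union> ?K2) \<inter> ?K3 = {}" using r0 by auto
    then show ?thesis using measure_Un3[OF fK[of "?K1 \<union> ?K2"] fK[OF s(3)]] s by simp
  qed
  also have "?K1 \<union> ?K2 \<union> ?K3 = K" using Ks(2) by auto
  finally show "measure lborel (swap_blocks n ` K) = measure lborel K" .
qed

section \<open>Actions of the integers by bounded motions, and dispersion\<close>

locale bounded_action =
  fixes act :: "int \<Rightarrow> real \<Rightarrow> real"
  assumes act_motion: "\<And>n. motion (act n) (act (- n))"
    and act_zero: "\<And>x. 0 \<le> x \<Longrightarrow> act 0 x = x"
    and act_add: "\<And>m n x. 0 \<le> x \<Longrightarrow> act m (act n x) = act (m + n) x"
begin

lemma act_image_add:
  assumes "A \<subseteq> {0..}"
  shows "act m ` act n ` A = act (m + n) ` A"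
  unfolding image_image by (rule image_cong) (use act_add assms in auto)

lemma act_image_zero:
  assumes "A \<subseteq> {0..}"
  shows "act 0 ` A = A"
proof -
  have "act 0 ` A = (\<lambda>x. x) ` A" by (rule image_cong) (use act_zero assms in auto)
  then show ?thesis by simp
qed

lemma act_image_Int:
  assumes "A \<subseteq> {0..}" "B \<subseteq> {0..}"
  shows "act n ` (A \<inter> B) = act n ` A \<inter> act n ` B"
proof (rule inj_on_image_Int)
  show "inj_on (act n) {0..}"
    by (rule inj_on_inverseI[where g="act (- n)"]) (use motionD(3)[OF act_motion] in auto)
qed (use assms in auto)

lemma act_bounded: "K \<in> bounded_borel \<Longrightarrow> act n ` K \<in> bounded_borel"
  by (rule motionD(5)[OF act_motion])

lemma act_measure: "K \<in> bounded_borel \<Longrightarrow> measure lborel (act n ` K) = measure lborel K"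
  by (rule motionD(7)[OF act_motion])

lemma windows_0: "windows j \<subseteq> {0..}"
  by (auto simp: windows_def)

lemma bounded_borel_Int: "K \<in> bounded_borel \<Longrightarrow> L \<in> bounded_borel \<Longrightarrow> K \<inter> L \<in> bounded_borel"
  by (rule bounded_borel_subset) (auto dest: bounded_borel_sets(1))

lemma bounded_borel_windows:
  assumes "K \<in> bounded_borel"
  obtains j where "K \<subseteq> windows j"
  using assms by (auto simp: bounded_borel_def)

end

locale dispersing_action = bounded_action +
  fixes p :: "nat \<Rightarrow> int"
  assumes disperse: "\<And>j. eventually (\<lambda>k. act (p k) ` windows j \<inter> windows j = {}) sequentially"
begin

text \<open>Induction: the translates found so far and the window itself lie in a common window
  \<open>windows J\<close>, and some \<open>p k\<close> carries this larger window off itself; the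
  next translate is taken at that time.\<close>

lemma disjoint_translates:
  "\<exists>s :: nat \<Rightarrow> int. \<forall>i<L. \<forall>l<i. act (s i) ` windows j \<inter> act (s l) ` windows j = {}"
proof (induction L)
  case (Suc L)
  then obtain s :: "nat \<Rightarrow> int" where "\<forall>i<L. \<forall>l<i. act (s i) ` windows j \<inter> act (s l) ` windows j = {}" ..
  then have s: "act (s i) ` windows j \<inter> act (s l) ` windows j = {}" if "i < L" "l < i" for i l
    using that by simp
  have b: "(\<Union>l<N. act (s l) ` windows j) \<in> bounded_borel" for N
  proof (induction N)
    case 0
    then show ?case by (simp add: bounded_borel_empty)
  next
    case (Suc n)
    have "(\<Union>l<Suc n. act (s l) ` windows j) = (\<Union>l<n. act (s l) ` windows j) \<union> act (s n) ` windows j"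
      by (simp add: lessThan_Suc Un_commute)
    then show ?case using bounded_borel_Un[OF Suc act_bounded[OF windows_bounded_borel]] by simp
  qed
  obtain J where J: "(\<Union>l<L. act (s l) ` windows j) \<union> windows j \<subseteq> windows J"
    by (rule bounded_borel_windows[OF bounded_borel_Un[OF b[of L] windows_bounded_borel[of j]]])
  obtain k where k: "act (p k) ` windows J \<inter> windows J = {}"
    using disperse[of J] by (auto simp: eventually_sequentially)
  define s' where "s' = s(L := p k)"
  have "act (s' i) ` windows j \<inter> act (s' l) ` windows j = {}" if il: "i < Suc L" "l < i" for i l
  proof (cases "i = L")
    case True
    have "act (p k) ` windows j \<subseteq> act (p k) ` windows J" using J by (intro image_mono) blast
    moreover have "act (s l) ` windows j \<subseteq> windows J" using J il True by blast
    ultimately show ?thesis using k il True unfolding s'_def by auto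
  next
    case False
    then show ?thesis using s[of i l] il by (simp add: s'_def)
  qed
  then show ?case by (intro exI[of _ s']) simp
qed simp

text \<open>With \<open>L\<close> disjoint translates of \<open>A\<close>, the overlaps of \<open>A\<close> with its images average to at most \<open>m(A)/L\<close>.\<close>

lemma cesaro_overlap: "cesaro_null (\<lambda>n. measure lborel (act (- int n) ` windows j \<inter> windows j))"
proof -
  let ?A = "windows j"
  define a where "a n = measure lborel (act (- n) ` ?A \<inter> ?A)" for n :: int
  define \<mu> where "\<mu> = measure lborel ?A"
  have Ab: "?A \<in> bounded_borel" by (rule windows_bounded_borel)
  have fm: "act n ` ?A \<inter> ?A \<in> fmeasurable lborel" for n
    by (intro bounded_borel_sets(6) bounded_borel_Int act_bounded Ab)
  have a0: "0 \<le> a n" for n by (simp add: a_def)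
  have a1: "a n \<le> \<mu>" for n unfolding a_def \<mu>_def
    by (rule measure_mono_fmeasurable[OF Int_lower2 fmeasurableD[OF fm] bounded_borel_sets(6)[OF Ab]])
  have disj: "(\<Sum>i<L. a (n - s i)) \<le> \<mu>"
    if s: "\<And>i l. i < L \<Longrightarrow> l < i \<Longrightarrow> act (s i) ` ?A \<inter> act (s l) ` ?A = {}" for L :: nat and s n
  proof -
    let ?B = "\<lambda>i. act (s i - n) ` ?A \<inter> ?A"
    have "(\<Sum>i<L. a (n - s i)) = (\<Sum>i<L. measure lborel (?B i))" by (simp add: a_def)
    also have "\<dots> = measure lborel (\<Union>i<L. ?B i)"
    proof (rule measure_finite_Union[symmetric])
      show "?B ` {..<L} \<subseteq> sets lborel" by (intro image_subsetI fmeasurableD fm)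
      show "emeasure lborel (?B i) \<noteq> \<infinity>" for i using fm[of "s i - n"] by (auto simp: fmeasurable_def)
      have dd: "?B i \<inter> ?B l = {}" if "i < L" "l < i" for i l
      proof -
        have "act (- n) ` (act (s i) ` ?A \<inter> act (s l) ` ?A) = act (- n) ` act (s i) ` ?A \<inter> act (- n) ` act (s l) ` ?A"
          by (rule act_image_Int) (use act_bounded[OF Ab] bounded_borel_sets(2) in auto)
        then have "act (s i - n) ` ?A \<inter> act (s l - n) ` ?A = {}"
          using s[OF that] by (simp add: act_image_add[OF windows_0])
        then show ?thesis by blast
      qed
      show "disjoint_family_on ?B {..<L}"
        unfolding disjoint_family_on_def
      proof (intro ballI impI)
        fix i l assume "i \<in> {..<L}" "l \<in> {..<L}" "i \<noteq> l"
        then show "?B i \<inter> ?B l = {}" using dd[of i l] dd[of l i] by (cases "l < i") auto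
      qed
    qed simp
    also have "\<dots> \<le> \<mu>" unfolding \<mu>_def
      by (rule measure_mono_fmeasurable[OF _ _ bounded_borel_sets(6)[OF Ab]])
        (blast, intro sets.finite_UN finite_lessThan fmeasurableD fm)
    finally show ?thesis .
  qed
  have "\<exists>s :: nat \<Rightarrow> int. \<forall>n. (\<Sum>i<L. a (n - s i)) \<le> \<mu>" for L
  proof -
    obtain s :: "nat \<Rightarrow> int" where s: "\<forall>i<L. \<forall>l<i. act (s i) ` ?A \<inter> act (s l) ` ?A = {}"
      using disjoint_translates[of L j] ..
    have "(\<Sum>i<L. a (n - s i)) \<le> \<mu>" for n by (rule disj) (use s in simp)
    then show ?thesis by blast
  qed
  then have "cesaro_null (\<lambda>n. a (int n))" by (rule cesaro_translates[OF a0 a1])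
  then show ?thesis by (simp add: a_def)
qed

end

section \<open>The suspension of an action\<close>

locale poisson_action = half_line_poisson M + bounded_action act for M act
begin

abbreviation susp :: "int \<Rightarrow> real set \<Rightarrow> real set" where
  "susp n \<equiv> \<lambda>\<omega>. act n ` \<omega>"

lemma susp_automorphism: "automorphism M (susp n)"
  by (rule suspension_automorphism[OF act_motion])

lemma space_M_subset: "\<omega> \<in> space M \<Longrightarrow> \<omega> \<subseteq> {0..}"
  by (simp add: space_M half_line_conf_iff)

lemma susp_space: "\<omega> \<in> space M \<Longrightarrow> susp n \<omega> \<in> space M"
  using automorphism_in_space[OF susp_automorphism] .

lemma susp_funpow: "\<omega> \<in> space M \<Longrightarrow> (susp 1 ^^ n) \<omega> = susp (int n) \<omega>"
proof (induction n)
  case 0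
  then show ?case using act_image_zero[OF space_M_subset] by simp
next
  case (Suc n)
  then show ?case using act_image_add[OF space_M_subset[OF Suc.prems], of 1 "int n"] by simp
qed

lemma susp_int_power: "\<omega> \<in> space M \<Longrightarrow> int_power M (susp 1) n \<omega> = susp n \<omega>"
proof (cases "0 \<le> n")
  case True
  then show "\<omega> \<in> space M \<Longrightarrow> int_power M (susp 1) n \<omega> = susp n \<omega>" by (simp add: int_power_def susp_funpow)
next
  case False
  have inv: "inv_into (space M) (susp 1) \<omega> = susp (- 1) \<omega>" if "\<omega> \<in> space M" for \<omega>
  proof (rule automorphism_inv_into_eq[OF susp_automorphism that])
    show "susp (- 1) \<omega> \<in> space M" by (rule susp_space[OF that])
    show "susp 1 (susp (- 1) \<omega>) = \<omega>"
      using act_image_add[OF space_M_subset[OF that], of 1 "- 1"] act_image_zero[OF space_M_subset[OF that]] by simp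
  qed
  have "(inv_into (space M) (susp 1) ^^ k) \<omega> = susp (- int k) \<omega>" if "\<omega> \<in> space M" for k \<omega>
  proof (induction k)
    case 0
    then show ?case using act_image_zero[OF space_M_subset[OF that]] by simp
  next
    case (Suc k)
    have "(inv_into (space M) (susp 1) ^^ Suc k) \<omega> = susp (- 1) (susp (- int k) \<omega>)"
      using Suc inv[OF susp_space[OF that, of "- int k"]] by simp
    also have "\<dots> = susp (- int (Suc k)) \<omega>"
      using act_image_add[OF space_M_subset[OF that], of "- 1" "- int k"] by simp
    finally show ?case .
  qed
  then show "\<omega> \<in> space M \<Longrightarrow> int_power M (susp 1) n \<omega> = susp n \<omega>" using False by (simp add: int_power_def)
qed

lemma susp_poisson_suspension: "poisson_suspension M (susp 1)"
  unfolding poisson_suspension_def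
  using standard_infinite_half_line exhausting_windows motion_automorphism[OF act_motion] is_poisson susp_automorphism
  by (intro exI[of _ half_line] exI[of _ windows] exI[of _ "act 1"]) auto

lemma H_group_rigid:
  assumes q: "\<And>K. K \<in> bounded_borel \<Longrightarrow> (\<lambda>k. measure lborel (sym_diff (act (q k) ` K) K)) \<longlonglongrightarrow> 0"
    and inf: "infinite (range q)"
  shows "H_group M (range q) (susp 1) = identity_class M"
proof -
  obtain \<C> where \<C>: "countable \<C>" "\<C> \<subseteq> sets M"
    and sep: "\<forall>x\<in>space M. \<forall>y\<in>space M. x \<noteq> y \<longrightarrow> (\<exists>A\<in>\<C>. (x \<in> A) \<noteq> (y \<in> A))"
    using separating_void_events by auto
  show ?thesis
  proof (rule H_group_trivial[OF susp_automorphism _ infinity_along_nontrivial[OF inf] \<C>])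
    show "\<exists>A\<in>\<C>. (x \<in> A) \<noteq> (y \<in> A)" if "x \<in> space M" "y \<in> space M" "x \<noteq> y" for x y
      using sep that by simp
    show "tends_to_identity M (int_power M (susp 1)) (infinity_along (range q))"
      by (rule tends_to_identity_suspension[OF act_motion susp_int_power automorphism_int_power[OF susp_automorphism]])
        (auto intro!: tendsto_infinity_along_range q)
  qed
qed

end

locale poisson_dispersing = poisson_action M act + dispersing_action act p for M act p
begin

lemma bounded_cover:
  assumes "K \<in> bounded_borel" "L \<in> bounded_borel"
  obtains j where "K \<subseteq> windows j" "L \<subseteq> windows j"
proof (rule bounded_borel_windows[OF bounded_borel_Un[OF assms]])
  fix j assume "K \<union> L \<subseteq> windows j"
  then show thesis by (intro that[of j]) auto
qed

lemma void_vimage_susp: "(susp 1 ^^ n) -` void K \<inter> space M = susp (int n) -` void K \<inter> space M"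
  using susp_funpow by auto

lemma susp_weakly_mixing: "weakly_mixing M (susp 1)"
proof (rule weakly_mixingI[OF susp_automorphism, where G="void ` bounded_borel"])
  show "Int_stable (void ` bounded_borel)" by (rule Int_stable_void)
  show "void ` bounded_borel \<subseteq> Pow (space M)" using void_Pow by (simp add: space_M)
  show "sets M = sigma_sets (space M) (void ` bounded_borel)" by (simp add: sets_M_eq space_M)
  fix A B assume "A \<in> void ` bounded_borel" "B \<in> void ` bounded_borel"
  then obtain K L where KL: "K \<in> bounded_borel" "L \<in> bounded_borel" "A = void K" "B = void L" by auto
  obtain j where j: "K \<subseteq> windows j" "L \<subseteq> windows j" using bounded_cover[OF KL(1,2)] .
  show "cesaro_null (\<lambda>n. \<bar>prob (((susp 1 ^^ n) -` A \<inter> space M) \<inter> B) - prob A * prob B\<bar>)"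
  proof (rule null_ideal_mono[OF null_ideal_cesaro cesaro_overlap[of j]])
    fix n
    have "\<bar>prob (((susp 1 ^^ n) -` A \<inter> space M) \<inter> B) - prob A * prob B\<bar> \<le> measure lborel (act (- int n) ` K \<inter> L)"
      unfolding KL(3,4) void_vimage_susp by (rule mixing_void_events[OF act_motion KL(1,2)])
    also have "\<dots> \<le> measure lborel (act (- int n) ` windows j \<inter> windows j)"
    proof (rule measure_mono_fmeasurable)
      show "act (- int n) ` K \<inter> L \<subseteq> act (- int n) ` windows j \<inter> windows j" using j by blast
      show "act (- int n) ` K \<inter> L \<in> sets lborel"
        using bounded_borel_sets(1)[OF bounded_borel_Int[OF act_bounded[OF KL(1)] KL(2)]] by simp
      show "act (- int n) ` windows j \<inter> windows j \<in> fmeasurable lborel"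
        by (intro bounded_borel_sets(6) bounded_borel_Int act_bounded windows_bounded_borel)
    qed
    finally show "\<bar>prob (((susp 1 ^^ n) -` A \<inter> space M) \<inter> B) - prob A * prob B\<bar> \<le> measure lborel (act (- int n) ` windows j \<inter> windows j)" .
  qed simp
qed

text \<open>A motion supported in a bounded set is conjugated by \<open>act (p k)\<close> to one supported far away.\<close>

lemma swap_in_H_group: "(\<lambda>\<omega>. swap_blocks n ` \<omega>) \<in> H_group M (range p) (susp 1)"
proof -
  let ?S = "\<lambda>\<omega>. swap_blocks n ` \<omega>"
  have S: "automorphism M ?S" by (rule suspension_automorphism[OF swap_blocks_motion])
  define f where "f t x = act (- t) (swap_blocks n (act t x))" for t x
  have fm: "motion (f t) (f t)" for t
    using motion_comp[OF motion_comp[OF act_motion[of "- t"] swap_blocks_motion[of n]] act_motion[of t]]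
    by (simp add: f_def[abs_def])
  let ?R = "\<lambda>t. int_power M (susp 1) (- t) \<circ> ?S \<circ> int_power M (susp 1) t"
  have R: "?R t \<omega> = f t ` \<omega>" if "\<omega> \<in> space M" for t \<omega>
  proof -
    have "?R t \<omega> = act (- t) ` swap_blocks n ` act t ` \<omega>"
      using susp_int_power susp_space that automorphism_in_space[OF S] by simp
    then show ?thesis by (simp add: f_def image_image)
  qed
  have "tends_to_identity M ?R (infinity_along (range p))"
  proof (rule tends_to_identity_suspension[OF fm R automorphism_conjugate[OF susp_automorphism S]])
    fix K assume K: "K \<in> bounded_borel"
    obtain j where j: "K \<subseteq> windows j" using bounded_borel_windows[OF K] .
    \<comment> \<open>The window has to contain both \<open>K\<close> and the support
      \<open>[0, 2 * n)\<close> of the exchange.\<close>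
    let ?J = "max j (2 * n)"
    have "eventually (\<lambda>k. f (p k) ` K = K) sequentially"
      using disperse[of ?J]
    proof eventually_elim
      case (elim k)
      have "f (p k) x = x" if x: "x \<in> K" for x
      proof -
        have "x \<in> windows j" using x j by blast
        then have x0: "0 \<le> x" "x \<in> windows ?J"
          using windows_0 windows_mono[of j ?J] by auto
        then have "act (p k) x \<notin> windows ?J" using elim by blast
        moreover have "0 \<le> act (p k) x" using motionD(1)[OF act_motion x0(1)] .
        ultimately have "2 * real n \<le> act (p k) x" by (auto simp: windows_def max_def split: if_splits)
        then have "swap_blocks n (act (p k) x) = act (p k) x" by (auto simp: swap_blocks_def)
        then show ?thesis using motionD(3)[OF act_motion x0(1)] by (simp add: f_def)
      qed
      then show ?case by (force simp: image_def)
    qed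
    then have "eventually (\<lambda>k. measure lborel (sym_diff (f (p k) ` K) K) = 0) sequentially"
      by eventually_elim simp
    then show "((\<lambda>t. measure lborel (sym_diff (f t ` K) K)) \<longlongrightarrow> 0) (infinity_along (range p))"
      by (intro tendsto_infinity_along_range tendsto_eventually)
  qed
  then show ?thesis using S by (simp add: H_group_def)
qed

text \<open>For \<open>n\<close> beyond a window that contains both sets, the exchange moves the
  first set off the second, and the void events are then exactly independent.\<close>

lemma H_group_ergodic: "ergodic_group M (H_group M (range p) (susp 1))"
proof (rule ergodic_groupI[where S="\<lambda>n \<omega>. swap_blocks n ` \<omega>" and G="void ` bounded_borel"])
  show "(\<lambda>\<omega>. swap_blocks n ` \<omega>) \<in> H_group M (range p) (susp 1)" for n by (rule swap_in_H_group)
  show "automorphism M (\<lambda>\<omega>. swap_blocks n ` \<omega>)" for n by (rule suspension_automorphism[OF swap_blocks_motion])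
  show "Int_stable (void ` bounded_borel)" by (rule Int_stable_void)
  show "void ` bounded_borel \<subseteq> Pow (space M)" using void_Pow by (simp add: space_M)
  show "sets M = sigma_sets (space M) (void ` bounded_borel)" by (simp add: sets_M_eq space_M)
  fix A B assume "A \<in> void ` bounded_borel" "B \<in> void ` bounded_borel"
  then obtain K L where KL: "K \<in> bounded_borel" "L \<in> bounded_borel" "A = void K" "B = void L" by auto
  obtain j where j: "K \<subseteq> windows j" "L \<subseteq> windows j" using bounded_cover[OF KL(1,2)] .
  have "\<bar>prob (((\<lambda>\<omega>. swap_blocks n ` \<omega>) -` A \<inter> space M) \<inter> B) - prob A * prob B\<bar> = 0" if n: "j \<le> n" for n
  proof -
    have "swap_blocks n ` K \<inter> L = {}"
    proof -
      have "swap_blocks n x \<notin> L" if "x \<in> K" for x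
      proof -
        have "0 \<le> x" "x < real n" using that j n by (auto simp: windows_def)
        then have "real n \<le> swap_blocks n x" by (simp add: swap_blocks_def)
        then show ?thesis using j(2) n by (auto simp: windows_def)
      qed
      then show ?thesis by blast
    qed
    then show ?thesis
      using mixing_void_events[OF swap_blocks_motion KL(1,2), of n] KL(3,4) by simp
  qed
  then show "(\<lambda>n. \<bar>prob (((\<lambda>\<omega>. swap_blocks n ` \<omega>) -` A \<inter> space M) \<inter> B) - prob A * prob B\<bar>) \<longlonglongrightarrow> 0"
    by (intro tendsto_eventually) (auto simp: eventually_sequentially)
qed

end

section \<open>A rank-one map of the half line\<close>

text \<open>Tower \<open>k\<close> has \<open>h k\<close> levels of width \<open>1 / pieces k\<close>; its levels partition an initial segment of
  the half line. It is cut into \<open>cols k\<close> columns which are stacked; one spacer goes below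
  the stack and \<open>h (Suc k) - cols k * h k - 1\<close> spacers go above it.\<close>

definition cols :: "nat \<Rightarrow> nat" where "cols k = k + 2"

definition pieces :: "nat \<Rightarrow> nat" where "pieces k = (\<Prod>i<k. cols i)"

lemma cols_pos: "0 < cols k" by (simp add: cols_def)

lemma pieces_pos: "0 < pieces k" by (simp add: pieces_def cols_pos prod_pos)

lemma pieces_Suc: "pieces (Suc k) = pieces k * cols k" by (simp add: pieces_def)

text \<open>The half line is cut into intervals of length \<open>1 / pieces k\<close>, numbered from
  0; those with number below \<open>h k\<close> make up tower \<open>k\<close>.\<close>

definition idx :: "nat \<Rightarrow> real \<Rightarrow> nat" where
  "idx k x = nat \<lfloor>x * real (pieces k)\<rfloor>"

lemma idx_eq_iff:
  assumes "0 \<le> x"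
  shows "idx k x = s \<longleftrightarrow> real s \<le> x * real (pieces k) \<and> x * real (pieces k) < real s + 1"
proof -
  have "0 \<le> \<lfloor>x * real (pieces k)\<rfloor>" using assms by simp
  then have "idx k x = s \<longleftrightarrow> \<lfloor>x * real (pieces k)\<rfloor> = int s" unfolding idx_def by auto
  also have "\<dots> \<longleftrightarrow> real s \<le> x * real (pieces k) \<and> x * real (pieces k) < real s + 1"
    by (simp add: floor_eq_iff)
  finally show ?thesis .
qed

lemma idx_le_iff:
  assumes "0 \<le> x"
  shows "idx k x < s \<longleftrightarrow> x * real (pieces k) < real s"
proof -
  have "0 \<le> \<lfloor>x * real (pieces k)\<rfloor>" using assms by simp
  then have "idx k x < s \<longleftrightarrow> \<lfloor>x * real (pieces k)\<rfloor> < int s" unfolding idx_def by (rule nat_less_iff)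
  also have "\<dots> \<longleftrightarrow> x * real (pieces k) < real s" by (simp add: floor_less_iff)
  finally show ?thesis .
qed

lemma idx_Suc_div:
  assumes "0 \<le> x"
  shows "idx (Suc k) x div cols k = idx k x"
proof -
  have "\<lfloor>x * real (pieces k)\<rfloor> = \<lfloor>x * real (pieces (Suc k)) / real_of_int (int (cols k))\<rfloor>"
    using cols_pos[of k] by (simp add: pieces_Suc)
  also have "\<dots> = \<lfloor>x * real (pieces (Suc k))\<rfloor> div int (cols k)"
    by (rule floor_divide_real_eq_div) simp
  finally show ?thesis using assms by (simp add: idx_def nat_div_distrib)
qed

lemma idx_Suc:
  assumes "0 \<le> x"
  shows "idx (Suc k) x = cols k * idx k x + idx (Suc k) x mod cols k"
  using idx_Suc_div[OF assms, of k] mult_div_mod_eq[of "cols k" "idx (Suc k) x"] by simp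

text \<open>\<open>b_low\<close> makes a displacement by \<open>b k\<close> longer than the stack of
  columns, so that it leads out of tower \<open>k\<close>; \<open>b_high\<close> keeps it inside
  tower \<open>Suc k\<close>.\<close>

locale tower =
  fixes h b :: "nat \<Rightarrow> nat"
  assumes h0: "0 < h 0"
    and b_low: "\<And>k. cols k * h k < b k"
    and b_high: "\<And>k. b k + cols k * h k < h (Suc k)"
begin

lemma h_Suc: "2 * (cols k * h k) + 2 \<le> h (Suc k)"
  using b_low[of k] b_high[of k] by linarith

lemma h_pos: "0 < h k"
  using h0 h_Suc by (induction k) (auto intro: less_le_trans[OF _ h_Suc])

text \<open>Position in tower \<open>k\<close>, from the bottom, of the interval with a given
  number. Interval \<open>s\<close> of stage \<open>Suc k\<close> is piece
  \<open>s mod cols k\<close> of the old interval \<open>s div cols k\<close>, and the pieces with a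
  fixed remainder form one column. The first interval beyond the old tower, number
  \<open>cols k * h k\<close>, becomes the spacer at the bottom, whence the offset 1 of the columns;
  all further spacers keep their number as their height. \<open>level\<close> is the
  inverse.\<close>

fun height :: "nat \<Rightarrow> nat \<Rightarrow> nat" where
  "height 0 s = s"
| "height (Suc k) s =
    (if s < cols k * h k then 1 + (s mod cols k) * h k + height k (s div cols k)
     else if s = cols k * h k then 0 else s)"

fun level :: "nat \<Rightarrow> nat \<Rightarrow> nat" where
  "level 0 t = t"
| "level (Suc k) t =
    (if t = 0 then cols k * h k
     else if t \<le> cols k * h k then cols k * level k ((t - 1) mod h k) + (t - 1) div h k else t)"

lemma column_height:
  assumes "c < cols k" "i < h k"
  shows "1 + c * h k + i \<le> cols k * h k"
proof -
  have "(c + 1) * h k \<le> cols k * h k" using assms(1) by (intro mult_right_mono) auto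
  then show ?thesis using assms(2) by simp
qed

lemma height_less: "s < h k \<Longrightarrow> height k s < h k"
  and level_height: "s < h k \<Longrightarrow> level k (height k s) = s"
proof (induction k arbitrary: s)
  case (Suc k)
  {
    case 1
    show ?case
    proof (cases "s < cols k * h k")
      case True
      then have "s div cols k < h k" using cols_pos[of k] by (simp add: div_less_iff_less_mult mult.commute)
      then have "1 + (s mod cols k) * h k + height k (s div cols k) \<le> cols k * h k"
        using Suc(1) cols_pos[of k] by (intro column_height) auto
      then show ?thesis using True h_Suc[of k] by simp
    qed (use 1 h_pos[of "Suc k"] in auto)
  next
    case 2
    show ?case
    proof (cases "s < cols k * h k")
      case True
      let ?c = "s mod cols k" and ?i = "height k (s div cols k)"
      have d: "s div cols k < h k" using True cols_pos[of k] by (simp add: div_less_iff_less_mult mult.commute)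
      then have i: "?i < h k" by (rule Suc(1))
      have le: "1 + ?c * h k + ?i \<le> cols k * h k" using i cols_pos[of k] by (intro column_height) auto
      have "height (Suc k) s = 1 + ?c * h k + ?i" using True by simp
      moreover have "(?c * h k + ?i) mod h k = ?i" "(?c * h k + ?i) div h k = ?c" using i by auto
      ultimately have "level (Suc k) (height (Suc k) s) = cols k * level k ?i + ?c"
        using le by simp
      then show ?thesis by (simp only: Suc(2)[OF d] mult_div_mod_eq)
    qed auto
  }
qed auto

lemma level_column:
  assumes less: "\<And>t. t < h k \<Longrightarrow> level k t < h k" and t: "t \<noteq> 0" "t \<le> cols k * h k"
  shows "(t - 1) div h k < cols k" "cols k * level k ((t - 1) mod h k) + (t - 1) div h k < cols k * h k"
proof -
  have 1: "level k ((t - 1) mod h k) < h k" by (rule less) (simp add: h_pos)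
  show 2: "(t - 1) div h k < cols k" using t h_pos[of k] by (simp add: div_less_iff_less_mult)
  have "cols k * (level k ((t - 1) mod h k) + 1) \<le> cols k * h k" using 1 by (intro mult_left_mono) auto
  then show "cols k * level k ((t - 1) mod h k) + (t - 1) div h k < cols k * h k" using 2 by simp
qed

lemma level_less: "t < h k \<Longrightarrow> level k t < h k"
proof (induction k arbitrary: t)
  case (Suc k)
  show ?case
  proof (cases "t \<noteq> 0 \<and> t \<le> cols k * h k")
    case True
    then show ?thesis using level_column(2)[OF Suc.IH, where t=t] h_Suc[of k] by simp
  next
    case False
    then show ?thesis using h_Suc[of k] Suc.prems by auto
  qed
qed simp

lemma height_level: "t < h k \<Longrightarrow> height k (level k t) = t"
proof (induction k arbitrary: t)
  case (Suc k)
  show ?case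
  proof (cases "t \<noteq> 0 \<and> t \<le> cols k * h k")
    case True
    define i c where "i = (t - 1) mod h k" and "c = (t - 1) div h k"
    have s: "level (Suc k) t = cols k * level k i + c" using True by (simp add: i_def c_def)
    have c: "c < cols k" "cols k * level k i + c < cols k * h k"
      using level_column[OF level_less, where t=t and k=k] True by (auto simp: i_def c_def)
    have "(cols k * level k i + c) mod cols k = c" "(cols k * level k i + c) div cols k = level k i"
      using c(1) by auto
    then have "height (Suc k) (level (Suc k) t) = 1 + c * h k + height k (level k i)" using s c(2) by simp
    moreover have "height k (level k i) = i" by (rule Suc.IH) (simp add: i_def h_pos)
    moreover have "c * h k + i = t - 1" unfolding i_def c_def by (rule div_mult_mod_eq)
    moreover have "0 < t" using True by simp
    ultimately show ?thesis by simp
  next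
    case False
    then show ?thesis by auto
  qed
qed simp

text \<open>Tower \<open>k\<close> already decides where \<open>n\<close> steps lead from
  \<open>x\<close>.\<close>

definition good :: "nat \<Rightarrow> int \<Rightarrow> real \<Rightarrow> bool" where
  "good k n x \<longleftrightarrow> 0 \<le> x \<and> idx k x < h k \<and> 0 \<le> int (height k (idx k x)) + n \<and> int (height k (idx k x)) + n < int (h k)"

definition target :: "nat \<Rightarrow> int \<Rightarrow> real \<Rightarrow> nat" where
  "target k n x = level k (nat (int (height k (idx k x)) + n))"

definition shift :: "nat \<Rightarrow> int \<Rightarrow> real \<Rightarrow> real" where
  "shift k n x = x + (real (target k n x) - real (idx k x)) / real (pieces k)"

text \<open>All good stages give the same value by \<open>good_mono\<close>; the least one merely
  fixes a choice.\<close>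

definition act :: "int \<Rightarrow> real \<Rightarrow> real" where
  "act n x = shift (LEAST k. good k n x) n x"

lemma shift_props:
  assumes g: "good k n x"
  shows "0 \<le> shift k n x" "idx k (shift k n x) = target k n x" "target k n x < h k"
    "int (height k (idx k (shift k n x))) = int (height k (idx k x)) + n"
proof -
  have x: "0 \<le> x" using g by (simp add: good_def)
  have sc: "0 < real (pieces k)" using pieces_pos by simp
  have i: "real (idx k x) \<le> x * real (pieces k)" "x * real (pieces k) < real (idx k x) + 1"
    using idx_eq_iff[OF x, of k "idx k x"] by auto
  have eq: "shift k n x * real (pieces k) = x * real (pieces k) + real (target k n x) - real (idx k x)"
    using sc by (simp add: shift_def field_simps)
  have "0 \<le> shift k n x * real (pieces k)" unfolding eq using i by simp
  then show s0: "0 \<le> shift k n x" using sc by (simp add: zero_le_mult_iff)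
  show id: "idx k (shift k n x) = target k n x"
    unfolding idx_eq_iff[OF s0] eq using i by auto
  have t: "nat (int (height k (idx k x)) + n) < h k" using g by (auto simp: good_def)
  show "target k n x < h k" unfolding target_def by (rule level_less[OF t])
  show "int (height k (idx k (shift k n x))) = int (height k (idx k x)) + n"
    unfolding id target_def height_level[OF t] using g by (simp add: good_def)
qed

lemma height_Suc_idx:
  assumes "0 \<le> x" "idx k x < h k"
  shows "idx (Suc k) x < cols k * h k"
    "height (Suc k) (idx (Suc k) x) = 1 + (idx (Suc k) x mod cols k) * h k + height k (idx k x)"
proof -
  have "cols k * (idx k x + 1) \<le> cols k * h k" using assms(2) by (intro mult_left_mono) auto
  moreover have "idx (Suc k) x mod cols k < cols k" using cols_pos by simp
  ultimately show 1: "idx (Suc k) x < cols k * h k" using idx_Suc[OF assms(1), of k] by simp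
  then show "height (Suc k) (idx (Suc k) x) = 1 + (idx (Suc k) x mod cols k) * h k + height k (idx k x)"
    using idx_Suc_div[OF assms(1)] by simp
qed

text \<open>Inside one column of tower \<open>Suc k\<close> the levels follow each other as in tower
  \<open>k\<close>, and a column meets every level in a piece with the same offset. So the later
  tower realizes the displacement by the same translation.\<close>

lemma good_Suc:
  assumes g: "good k n x"
  shows "good (Suc k) n x" "shift (Suc k) n x = shift k n x"
proof -
  have x: "0 \<le> x" "idx k x < h k" using g by (auto simp: good_def)
  let ?c = "idx (Suc k) x mod cols k"
  define i where "i = nat (int (height k (idx k x)) + n)"
  have i: "i < h k" "int i = int (height k (idx k x)) + n" using g by (auto simp: good_def i_def)
  have c: "?c < cols k" using cols_pos by simp
  have H: "int (height (Suc k) (idx (Suc k) x)) + n = int (1 + ?c * h k + i)"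
    using height_Suc_idx(2)[OF x] i by simp
  have le: "1 + ?c * h k + i \<le> cols k * h k" using c i by (intro column_height)
  have "idx (Suc k) x < h (Suc k)" using height_Suc_idx(1)[OF x] h_Suc[of k] by simp
  moreover have "0 \<le> int (height (Suc k) (idx (Suc k) x)) + n \<and> int (height (Suc k) (idx (Suc k) x)) + n < int (h (Suc k))"
    unfolding H using le h_Suc[of k] by linarith
  ultimately show "good (Suc k) n x" using x by (simp add: good_def)
  have "(?c * h k + i) mod h k = i" "(?c * h k + i) div h k = ?c" using i by auto
  then have "level (Suc k) (1 + ?c * h k + i) = cols k * level k i + ?c"
    using le by simp
  then have t: "target (Suc k) n x = cols k * target k n x + ?c"
    unfolding target_def H nat_int i_def[symmetric] .
  have "shift (Suc k) n x = x + (real (cols k * target k n x + ?c) - real (cols k * idx k x + ?c)) / real (pieces k * cols k)"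
    unfolding shift_def t by (subst (2) idx_Suc[OF x(1)]) (simp add: pieces_Suc)
  also have "\<dots> = shift k n x"
    using cols_pos[of k] pieces_pos[of k] by (simp add: shift_def field_simps)
  finally show "shift (Suc k) n x = shift k n x" .
qed

lemma good_mono:
  assumes "good k n x" "k \<le> k'"
  shows "good k' n x \<and> shift k' n x = shift k n x"
  using assms(2,1) by (induction rule: dec_induct) (auto simp: good_Suc)

lemma act_eq:
  assumes "good k n x"
  shows "act n x = shift k n x"
  unfolding act_def using good_mono[OF LeastI[of "\<lambda>k. good k n x", OF assms] Least_le[of "\<lambda>k. good k n x", OF assms]] by simp

text \<open>The spacer below and the spacers above raise the distances to the bottom and to the top
  by at least 1 at each stage. Hence every displacement, forward or backward, is eventually possible
  from every point, without an exceptional null set.\<close>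

lemma in_tower_Suc:
  assumes "0 \<le> x" "idx k x < h k"
  shows "idx (Suc k) x < h (Suc k)"
    "height k (idx k x) + 1 \<le> height (Suc k) (idx (Suc k) x)"
    "height (Suc k) (idx (Suc k) x) + (h k - height k (idx k x)) + 1 \<le> h (Suc k)"
proof -
  show "idx (Suc k) x < h (Suc k)" using height_Suc_idx(1)[OF assms] h_Suc[of k] by simp
  show "height k (idx k x) + 1 \<le> height (Suc k) (idx (Suc k) x)" using height_Suc_idx(2)[OF assms] by simp
  have hl: "height k (idx k x) < h k" by (rule height_less[OF assms(2)])
  have c: "idx (Suc k) x mod cols k < cols k" using cols_pos by simp
  have "1 + (idx (Suc k) x mod cols k) * h k + (h k - 1) \<le> cols k * h k" using c h_pos[of k] by (intro column_height) auto
  then show "height (Suc k) (idx (Suc k) x) + (h k - height k (idx k x)) + 1 \<le> h (Suc k)"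
    using height_Suc_idx(2)[OF assms] hl h_Suc[of k] by linarith
qed

lemma in_tower_add:
  assumes "0 \<le> x" "idx k x < h k"
  shows "idx (k + m) x < h (k + m) \<and> m \<le> height (k + m) (idx (k + m) x) \<and> height (k + m) (idx (k + m) x) + m < h (k + m)"
proof (induction m)
  case 0
  then show ?case using assms height_less by simp
next
  case (Suc m)
  then show ?case using in_tower_Suc[OF assms(1), of "k + m"] by auto
qed

lemma in_tower_mono:
  assumes "0 \<le> x" "idx k x < h k" "k \<le> k'"
  shows "idx k' x < h k'"
  using in_tower_add[OF assms(1,2), of "k' - k"] assms(3) by simp

lemma good_from_tower:
  assumes "0 \<le> x" "idx k x < h k"
  shows "good (k + nat \<bar>n\<bar>) n x"
proof -
  let ?k = "k + nat \<bar>n\<bar>"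
  let ?H = "height ?k (idx ?k x)"
  note t = in_tower_add[OF assms, of "nat \<bar>n\<bar>"]
  have "int (nat \<bar>n\<bar>) = \<bar>n\<bar>" by simp
  then have "\<bar>n\<bar> \<le> int ?H" "int ?H + \<bar>n\<bar> < int (h ?k)" using t by linarith+
  then have "0 \<le> int ?H + n" "int ?H + n < int (h ?k)" by linarith+
  then show ?thesis using t assms(1) by (simp add: good_def)
qed

text \<open>The spacers at least double the length at each stage, so \<open>h k\<close> is at least
  \<open>2 ^ k * pieces k\<close> and tower \<open>k\<close> contains
  \<open>[0, 2 ^ k)\<close>.\<close>

lemma tower_covers: "\<exists>k. \<forall>x. 0 \<le> x \<longrightarrow> x < real j \<longrightarrow> idx k x < h k"
proof -
  have grow: "2 ^ k * pieces k \<le> h k" for k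
  proof (induction k)
    case 0
    show ?case using h0 by (simp add: pieces_def)
  next
    case (Suc k)
    have "2 ^ Suc k * pieces (Suc k) = 2 * (cols k * (2 ^ k * pieces k))" by (simp add: pieces_Suc)
    also have "\<dots> \<le> 2 * (cols k * h k)" using Suc by (intro mult_left_mono) auto
    also have "\<dots> \<le> h (Suc k)" using h_Suc[of k] by linarith
    finally show ?case .
  qed
  have "idx j x < h j" if x: "0 \<le> x" "x < real j" for x
  proof -
    have "real j \<le> 2 ^ j" using less_exp[of j] by (metis less_imp_le of_nat_le_iff of_nat_numeral of_nat_power)
    then have "x < 2 ^ j" using x by linarith
    then have "x * real (pieces j) < 2 ^ j * real (pieces j)" using pieces_pos[of j] by (intro mult_strict_right_mono) auto
    also have "\<dots> = real (2 ^ j * pieces j)" by simp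
    also have "\<dots> \<le> real (h j)" using grow[of j] by (simp only: of_nat_le_iff)
    finally show ?thesis using idx_le_iff[OF x(1)] by simp
  qed
  then show ?thesis by blast
qed

lemma ex_good:
  assumes "0 \<le> x"
  obtains k0 where "\<And>k. k0 \<le> k \<Longrightarrow> good k n x"
proof -
  obtain j where "x < real j" using reals_Archimedean2 by blast
  then obtain k where "idx k x < h k" using tower_covers[of j] assms by auto
  from good_from_tower[OF assms this, of n] show thesis
    using that[of "k + nat \<bar>n\<bar>"] good_mono by simp
qed

lemma act_nonneg:
  assumes "0 \<le> x"
  shows "0 \<le> act n x"
proof (rule ex_good[OF assms, of n])
  fix k0 assume "\<And>k. k0 \<le> k \<Longrightarrow> good k n x"
  then have "good k0 n x" by simp
  then show ?thesis using act_eq shift_props(1) by simp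
qed

lemma act_zero:
  assumes "0 \<le> x"
  shows "act 0 x = x"
proof (rule ex_good[OF assms, of 0])
  fix k0 assume "\<And>k. k0 \<le> k \<Longrightarrow> good k 0 x"
  then have g: "good k0 0 x" by simp
  then have "target k0 0 x = idx k0 x" by (simp add: target_def good_def level_height)
  then show ?thesis using act_eq[OF g] by (simp add: shift_def)
qed

lemma act_add:
  assumes x: "0 \<le> x"
  shows "act m (act n x) = act (m + n) x"
proof (rule ex_good[OF x, of n])
  fix k0 assume k0: "\<And>k. k0 \<le> k \<Longrightarrow> good k n x"
  show ?thesis
  proof (rule ex_good[OF x, of "m + n"])
    fix k1 assume k1: "\<And>k. k1 \<le> k \<Longrightarrow> good k (m + n) x"
    define k where "k = max k0 k1"
    have g: "good k n x" "good k (m + n) x" using k0 k1 by (auto simp: k_def)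
    let ?y = "shift k n x"
    note y = shift_props[OF g(1)]
    have gy: "good k m ?y" using g(2) y unfolding good_def by (simp add: algebra_simps)
    have "target k m ?y = target k (m + n) x" unfolding target_def y(4) by (simp add: algebra_simps)
    then have "shift k m ?y = shift k (m + n) x"
      by (simp add: shift_def[of k m] y(2)) (simp add: shift_def diff_divide_distrib)
    then show ?thesis using act_eq[OF g(1)] act_eq[OF g(2)] act_eq[OF gy] by simp
  qed
qed

end

section \<open>Piecewise translations and Lebesgue measure\<close>

lemma lborel_translation_image:
  fixes t :: real
  assumes "X \<in> sets borel"
  shows "(+) t ` X \<in> sets borel" "measure lborel ((+) t ` X) = measure lborel X"
proof -
  have "(+) t ` X = (\<lambda>x. x - t) -` X"
  proof (intro set_eqI iffI)
    fix x assume "x \<in> (\<lambda>x. x - t) -` X"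
    then show "x \<in> (+) t ` X" by (intro image_eqI[of _ _ "x - t"]) auto
  qed auto
  moreover have "(\<lambda>x. x - t) -` X \<inter> space borel \<in> sets borel"
    by (rule measurable_sets[OF _ assms]) simp
  ultimately show b: "(+) t ` X \<in> sets borel" by simp
  show "measure lborel ((+) t ` X) = measure lborel X"
    using measure_translation[of t X] b assms by (simp add: measure_completion)
qed

lemma piecewise_translation_image:
  fixes f :: "real \<Rightarrow> real"
  assumes K: "K \<in> bounded_borel" and I: "finite I"
    and L: "\<And>i. i \<in> I \<Longrightarrow> L i \<in> sets borel" "disjoint_family_on L I" "K \<subseteq> (\<Union>i\<in>I. L i)"
    and f: "\<And>i x. i \<in> I \<Longrightarrow> x \<in> K \<Longrightarrow> x \<in> L i \<Longrightarrow> f x = t i + x" and inj: "inj_on f K"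
    and W: "f ` K \<subseteq> windows k"
  shows "f ` K \<in> bounded_borel" "measure lborel (f ` K) = measure lborel K"
proof -
  let ?P = "\<lambda>i. K \<inter> L i"
  have P: "?P i \<in> sets borel" if "i \<in> I" for i using bounded_borel_sets(1)[OF K] L(1)[OF that] by auto
  have fP: "f ` ?P i = (+) (t i) ` ?P i" if "i \<in> I" for i using f[OF that] by (intro image_cong) auto
  have un: "K = (\<Union>i\<in>I. ?P i)" using L(3) by auto
  then have fKun: "f ` K = (\<Union>i\<in>I. f ` ?P i)" by blast
  have fs: "f ` ?P i \<in> sets borel" "measure lborel (f ` ?P i) = measure lborel (?P i)" if "i \<in> I" for i
    using lborel_translation_image[OF P[OF that], of "t i"] fP[OF that] by auto
  have "f ` K \<in> sets borel" unfolding fKun by (intro sets.finite_UN I fs)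
  then show b: "f ` K \<in> bounded_borel" using W by (auto simp: bounded_borel_def)
  have "measure lborel (f ` K) = (\<Sum>i\<in>I. measure lborel (f ` ?P i))"
    unfolding fKun
  proof (rule measure_finite_Union[OF I])
    show "(\<lambda>i. f ` ?P i) ` I \<subseteq> sets lborel" using fs(1) by auto
    show "disjoint_family_on (\<lambda>i. f ` ?P i) I"
      unfolding disjoint_family_on_def
    proof (intro ballI impI)
      fix i j assume ij: "i \<in> I" "j \<in> I" "i \<noteq> j"
      have "f ` ?P i \<inter> f ` ?P j = f ` (?P i \<inter> ?P j)" by (rule inj_on_image_Int[OF inj, symmetric]) auto
      also have "?P i \<inter> ?P j = {}" using disjoint_family_onD[OF L(2) ij] by blast
      finally show "f ` ?P i \<inter> f ` ?P j = {}" by simp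
    qed
    fix i assume i: "i \<in> I"
    have "f ` ?P i \<in> bounded_borel" by (rule bounded_borel_subset[OF b fs(1)[OF i]]) auto
    from bounded_borel_sets(6)[OF this] show "emeasure lborel (f ` ?P i) \<noteq> \<infinity>" by (simp add: fmeasurable_def less_top)
  qed
  also have "\<dots> = (\<Sum>i\<in>I. measure lborel (?P i))" using fs(2) by simp
  also have "\<dots> = measure lborel (\<Union>i\<in>I. ?P i)"
  proof (rule measure_finite_Union[OF I, symmetric])
    show "(\<lambda>i. ?P i) ` I \<subseteq> sets lborel" using P by auto
    show "disjoint_family_on ?P I" using L(2) by (auto simp: disjoint_family_on_def)
    fix i assume i: "i \<in> I"
    have "?P i \<in> bounded_borel" by (rule bounded_borel_subset[OF K P[OF i]]) auto
    from bounded_borel_sets(6)[OF this] show "emeasure lborel (?P i) \<noteq> \<infinity>" by (simp add: fmeasurable_def less_top)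
  qed
  finally show "measure lborel (f ` K) = measure lborel K" using un by simp
qed

section \<open>The tower map as a measure preserving action: dispersion and rigidity\<close>

context tower
begin

definition level_set :: "nat \<Rightarrow> nat \<Rightarrow> real set" where
  "level_set k s = {real s / real (pieces k)..<(real s + 1) / real (pieces k)}"

lemma mem_level_set: "0 \<le> x \<Longrightarrow> x \<in> level_set k s \<longleftrightarrow> idx k x = s"
  using idx_eq_iff[of x k s] pieces_pos[of k] by (simp add: level_set_def field_simps)

lemma level_set_nonneg: "x \<in> level_set k s \<Longrightarrow> 0 \<le> x"
proof -
  assume "x \<in> level_set k s"
  then have "real s / real (pieces k) \<le> x" by (simp add: level_set_def)
  moreover have "0 \<le> real s / real (pieces k)" by simp
  ultimately show ?thesis by linarith
qed

lemma level_set_fmeasurable: "level_set k s \<in> fmeasurable lborel"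
proof -
  have "real s / real (pieces k) \<le> (real s + 1) / real (pieces k)" by (rule divide_right_mono) auto
  then show ?thesis by (simp add: level_set_def fmeasurable_def)
qed

lemma act_inverse: "0 \<le> x \<Longrightarrow> act (- n) (act n x) = x"
  using act_add[of x "- n" n] act_zero[of x] by simp

lemma act_inj: "inj_on (act n) {0..}"
  by (rule inj_on_inverseI[where g="act (- n)"]) (simp add: act_inverse)

text \<open>A bounded set lies in a single tower, and finitely many stages later the displacement by
  \<open>n\<close> is good for all its points at once; there \<open>act n\<close> is one translation
  on each of finitely many levels.\<close>

lemma act_image_bounded:
  assumes K: "K \<in> bounded_borel"
  shows "act n ` K \<in> bounded_borel" "measure lborel (act n ` K) = measure lborel K"
proof -
  obtain j where j: "K \<subseteq> windows j" using K by (auto simp: bounded_borel_def)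
  obtain k0 where k0: "\<forall>x. 0 \<le> x \<longrightarrow> x < real j \<longrightarrow> idx k0 x < h k0" using tower_covers[of j] ..
  define k where "k = k0 + nat \<bar>n\<bar>"
  have x0: "0 \<le> x \<and> x < real j" if "x \<in> K" for x using that j by (auto simp: windows_def)
  have g: "good k n x" if "x \<in> K" for x
    unfolding k_def by (rule good_from_tower) (use x0[OF that] k0 in auto)
  have 1: "K \<subseteq> (\<Union>s\<in>{..<h k}. level_set k s)"
  proof
    fix x assume x: "x \<in> K"
    then have "x \<in> level_set k (idx k x)" using mem_level_set x0 by simp
    moreover have "idx k x < h k" using g[OF x] by (simp add: good_def)
    ultimately show "x \<in> (\<Union>s\<in>{..<h k}. level_set k s)" by blast
  qed
  have 2: "disjoint_family_on (level_set k) {..<h k}"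
    unfolding disjoint_family_on_def
  proof (intro ballI impI)
    fix s t :: nat assume "s \<noteq> t"
    have "x \<notin> level_set k t" if "x \<in> level_set k s" for x
      using that mem_level_set[OF level_set_nonneg[OF that]] \<open>s \<noteq> t\<close> by simp
    then show "level_set k s \<inter> level_set k t = {}" by blast
  qed
  define tr where "tr s = (real (level k (nat (int (height k s) + n))) - real s) / real (pieces k)" for s
  have 3: "act n x = tr s + x" if "x \<in> K" "x \<in> level_set k s" for s x
  proof -
    have "idx k x = s" using that mem_level_set x0 by simp
    then show ?thesis using act_eq[OF g[OF that(1)]] by (simp add: shift_def target_def tr_def)
  qed
  have 4: "act n ` K \<subseteq> windows (h k)"
  proof
    fix y assume "y \<in> act n ` K"
    then obtain x where x: "x \<in> K" "y = act n x" by auto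
    have y: "0 \<le> y" "idx k y < h k" using shift_props[OF g[OF x(1)]] act_eq[OF g[OF x(1)]] x(2) by auto
    have "1 \<le> real (pieces k)" using pieces_pos[of k] by simp
    then have "y * 1 \<le> y * real (pieces k)" using y(1) by (intro mult_left_mono) auto
    then have "y < real (h k)" using idx_le_iff[OF y(1), of k "h k"] y(2) by linarith
    then show "y \<in> windows (h k)" using y(1) by (simp add: windows_def)
  qed
  have 5: "inj_on (act n) K" by (rule inj_on_subset[OF act_inj]) (use bounded_borel_sets(2)[OF K] in auto)
  have 6: "level_set k s \<in> sets borel" for s by (simp add: level_set_def)
  show "act n ` K \<in> bounded_borel" "measure lborel (act n ` K) = measure lborel K"
    using piecewise_translation_image[OF K finite_lessThan 6 2 1 3 5 4] by auto
qed

sublocale bounded_action act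
proof
  show "motion (act n) (act (- n))" for n
    unfolding motion_def using act_nonneg act_inverse[of _ n] act_inverse[of _ "- n"] act_image_bounded by auto
qed (auto simp: act_zero act_add)

text \<open>A displacement by \<open>b k\<close> takes tower \<open>k\<close> into the spacers of tower \<open>Suc k\<close>.\<close>

lemma act_b_leaves:
  assumes x: "0 \<le> x" "idx k x < h k"
  shows "h k \<le> idx k (act (int (b k)) x)"
proof (rule ccontr)
  let ?y = "act (int (b k)) x"
  assume "\<not> h k \<le> idx k ?y"
  then have y: "idx k ?y < h k" by simp
  have le: "height (Suc k) (idx (Suc k) z) \<le> cols k * h k" if "0 \<le> z" "idx k z < h k" for z
    unfolding height_Suc_idx(2)[OF that] using height_less[OF that(2)] cols_pos by (intro column_height) auto
  have g: "good (Suc k) (int (b k)) x"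
    using le[OF x] b_high[of k] in_tower_Suc(1)[OF x] x(1) unfolding good_def by linarith
  have "int (height (Suc k) (idx (Suc k) ?y)) = int (height (Suc k) (idx (Suc k) x)) + int (b k)"
    using shift_props(4)[OF g] act_eq[OF g] by simp
  moreover have "height (Suc k) (idx (Suc k) ?y) \<le> cols k * h k" by (rule le[OF act_nonneg[OF x(1)] y])
  ultimately show False using b_low[of k] by linarith
qed

lemma windows_in_tower: "eventually (\<lambda>k. \<forall>x\<in>windows j. 0 \<le> x \<and> idx k x < h k) sequentially"
proof -
  obtain k0 where k0: "\<forall>x. 0 \<le> x \<longrightarrow> x < real j \<longrightarrow> idx k0 x < h k0" using tower_covers[of j] ..
  have "\<forall>x\<in>windows j. 0 \<le> x \<and> idx k x < h k" if "k0 \<le> k" for k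
    using k0 in_tower_mono[OF _ _ that] by (auto simp: windows_def)
  then show ?thesis unfolding eventually_sequentially by blast
qed

text \<open>For negative \<open>p k\<close> a point and its image exchange roles: the displacement
  by \<open>b k\<close> leads from the image back to the point, so again they cannot both lie in
  tower \<open>k\<close>.\<close>

lemma disperse_b:
  assumes p: "\<And>k. \<bar>p k\<bar> = int (b k)"
  shows "eventually (\<lambda>k. act (p k) ` windows j \<inter> windows j = {}) sequentially"
  using windows_in_tower[of j]
proof eventually_elim
  case (elim k)
  have "act (p k) x \<notin> windows j" if x: "x \<in> windows j" for x
  proof
    assume y: "act (p k) x \<in> windows j"
    have tx: "0 \<le> x" "idx k x < h k" "0 \<le> act (p k) x" "idx k (act (p k) x) < h k" using elim x y by auto
    show False
    proof (cases "0 \<le> p k")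
      case True
      then have "p k = int (b k)" using p[of k] by simp
      then show False using act_b_leaves[OF tx(1,2)] tx(4) by simp
    next
      case False
      then have "p k = - int (b k)" using p[of k] by simp
      then have "act (int (b k)) (act (p k) x) = x" using act_inverse[OF tx(1), of "p k"] by simp
      then show False using act_b_leaves[OF tx(3,4)] tx(2) by simp
    qed
  qed
  then show ?case by blast
qed

text \<open>A displacement by \<open>h k\<close> moves every column of tower \<open>k\<close> but the last one to its neighbour.\<close>

lemma act_h_column:
  assumes x: "0 \<le> x" "idx k x < h k" and c: "Suc (idx (Suc k) x mod cols k) < cols k"
  shows "idx k (act (int (h k)) x) = idx k x"
proof -
  let ?c = "idx (Suc k) x mod cols k" and ?i = "height k (idx k x)"
  have i: "?i < h k" by (rule height_less[OF x(2)])
  have H: "height (Suc k) (idx (Suc k) x) = 1 + ?c * h k + ?i" by (rule height_Suc_idx(2)[OF x])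
  have le: "1 + Suc ?c * h k + ?i \<le> cols k * h k" using c i by (intro column_height)
  have "1 + ?c * h k + ?i + h k < h (Suc k)" using le h_Suc[of k] by simp
  then have lt: "int (1 + ?c * h k + ?i) + int (h k) < int (h (Suc k))"
    by (simp only: of_nat_add[symmetric] of_nat_less_iff)
  have g: "good (Suc k) (int (h k)) x"
    unfolding good_def
  proof (intro conjI)
    show "int (height (Suc k) (idx (Suc k) x)) + int (h k) < int (h (Suc k))" unfolding H by (rule lt)
  qed (use in_tower_Suc(1)[OF x] x(1) in simp_all)
  have "nat (int (height (Suc k) (idx (Suc k) x)) + int (h k)) = 1 + (Suc ?c * h k + ?i)"
    unfolding H of_nat_add[symmetric] nat_int by simp
  then have "target (Suc k) (int (h k)) x = level (Suc k) (1 + (Suc ?c * h k + ?i))" by (simp only: target_def)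
  moreover have "level (Suc k) (1 + (Suc ?c * h k + ?i)) = cols k * level k ((Suc ?c * h k + ?i) mod h k) + (Suc ?c * h k + ?i) div h k"
    using le by simp
  moreover have "(Suc ?c * h k + ?i) mod h k = ?i" using i by (simp only: mod_mult_self3 mod_less)
  moreover have "(Suc ?c * h k + ?i) div h k = Suc ?c" using i h_pos[of k] by (simp only: div_mult_self3 div_less add_0_right)
  ultimately have "target (Suc k) (int (h k)) x = cols k * idx k x + Suc ?c"
    by (simp only: level_height[OF x(2)])
  then have "idx (Suc k) (act (int (h k)) x) = cols k * idx k x + Suc ?c"
    using shift_props(2)[OF g] act_eq[OF g] by simp
  moreover have "(cols k * idx k x + Suc ?c) div cols k = idx k x + Suc ?c div cols k"
    by (rule div_mult_self4) (use cols_pos[of k] in simp)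
  ultimately have "idx (Suc k) (act (int (h k)) x) div cols k = idx k x" using div_less[OF c] by (simp only: add_0_right)
  then show ?thesis using idx_Suc_div[OF act_nonneg[OF x(1)]] by simp
qed

text \<open>The segment consists of \<open>S\<close> whole levels of tower \<open>k\<close>. Its
  points can leave it only from the last column, whose part in the segment has measure
  \<open>e / cols k\<close>; as the measure is preserved, as much enters as leaves, whence the
  factor 2.\<close>

lemma rigid_initial_segment:
  assumes e: "0 \<le> e" "e * real (pieces k) = real S" and sub: "\<And>x. 0 \<le> x \<Longrightarrow> x < e \<Longrightarrow> idx k x < h k"
  shows "measure lborel (sym_diff (act (int (h k)) ` {0..<e}) {0..<e}) \<le> 2 * e / real (cols k)"
proof -
  let ?U = "{0..<e}" and ?T = "act (int (h k))"
  define V where "V = ?U \<inter> (\<Union>s<S. level_set (Suc k) (cols k * s + (cols k - 1)))"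
  have U: "x \<in> ?U \<longleftrightarrow> idx k x < S" if "0 \<le> x" for x
  proof -
    have "idx k x < S \<longleftrightarrow> x * real (pieces k) < e * real (pieces k)" unfolding e(2) by (rule idx_le_iff[OF that])
    also have "\<dots> \<longleftrightarrow> x < e" using pieces_pos[of k] by simp
    finally show ?thesis using that by simp
  qed
  have bU: "?U \<in> bounded_borel"
  proof -
    obtain j where "e < real j" using reals_Archimedean2 by blast
    then show ?thesis by (auto simp: bounded_borel_def windows_def intro!: exI[of _ j])
  qed
  have bV: "V \<in> bounded_borel"
    by (rule bounded_borel_subset[OF bU]) (auto simp: V_def level_set_def)
  have sub1: "?T ` ?U - ?U \<subseteq> ?T ` V"
  proof
    fix y assume "y \<in> ?T ` ?U - ?U"
    then obtain x where x: "0 \<le> x" "x < e" "y = ?T x" "?T x \<notin> ?U" by auto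
    have S: "idx k x < S" using U[OF x(1)] x by simp
    have "\<not> Suc (idx (Suc k) x mod cols k) < cols k"
    proof
      assume "Suc (idx (Suc k) x mod cols k) < cols k"
      then have "idx k (?T x) < S" using act_h_column[OF x(1) sub[OF x(1,2)]] S by simp
      then show False using U[OF act_nonneg[OF x(1)]] x(4) by simp
    qed
    moreover have "idx (Suc k) x mod cols k < cols k" using cols_pos by simp
    ultimately have "idx (Suc k) x mod cols k = cols k - 1" by linarith
    then have "idx (Suc k) x = cols k * idx k x + (cols k - 1)" using idx_Suc[OF x(1), of k] by simp
    then have "x \<in> level_set (Suc k) (cols k * idx k x + (cols k - 1))" using mem_level_set[OF x(1)] by simp
    then have "x \<in> V" using S x unfolding V_def by auto
    then show "y \<in> ?T ` V" using x(3) by blast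
  qed
  have TU: "?T ` ?U \<in> bounded_borel" "measure lborel (?T ` ?U) = measure lborel ?U"
    using act_image_bounded[OF bU] by auto
  note fm = bounded_borel_sets(6)[OF TU(1)] bounded_borel_sets(6)[OF bU]
  have "measure lborel (?T ` ?U - ?U) \<le> measure lborel (?T ` V)"
    by (rule measure_mono_fmeasurable[OF sub1]) (use fm bounded_borel_sets[OF act_bounded[OF bV]] in \<open>auto dest: fmeasurableD\<close>)
  also have "\<dots> = measure lborel V" using act_image_bounded(2)[OF bV] .
  also have "\<dots> \<le> measure lborel (\<Union>s<S. level_set (Suc k) (cols k * s + (cols k - 1)))"
    unfolding V_def
  proof (rule measure_mono_fmeasurable[OF Int_lower2])
    show "?U \<inter> (\<Union>s<S. level_set (Suc k) (cols k * s + (cols k - 1))) \<in> sets lborel" by (auto simp: level_set_def)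
    show "(\<Union>s<S. level_set (Suc k) (cols k * s + (cols k - 1))) \<in> fmeasurable lborel"
      by (intro fmeasurable.finite_UN level_set_fmeasurable) simp
  qed
  also have "\<dots> \<le> (\<Sum>s<S. measure lborel (level_set (Suc k) (cols k * s + (cols k - 1))))"
    by (rule measure_UNION_le) (auto simp: level_set_def)
  also have "\<dots> = (\<Sum>s<S. 1 / real (pieces (Suc k)))"
    by (intro sum.cong refl) (simp add: level_set_def divide_right_mono diff_divide_distrib[symmetric])
  also have "\<dots> = (e * real (pieces k)) / (real (pieces k) * real (cols k))"
    unfolding e(2) by (simp add: pieces_Suc)
  also have "\<dots> = e / real (cols k)"
    using pieces_pos[of k] cols_pos[of k] by simp
  finally have 1: "measure lborel (?T ` ?U - ?U) \<le> e / real (cols k)" .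
  have 2: "measure lborel (?U - ?T ` ?U) = measure lborel (?T ` ?U - ?U)"
  proof -
    have "measure lborel (?U \<union> ?T ` ?U) = measure lborel ?U + measure lborel (?T ` ?U - ?U)"
      by (rule measure_Un2) (use fm in auto)
    moreover have "measure lborel (?T ` ?U \<union> ?U) = measure lborel (?T ` ?U) + measure lborel (?U - ?T ` ?U)"
      by (rule measure_Un2) (use fm in auto)
    ultimately show ?thesis using TU(2) by (simp add: Un_commute)
  qed
  have "measure lborel (sym_diff (?T ` ?U) ?U) \<le> measure lborel (?T ` ?U - ?U) + measure lborel (?U - ?T ` ?U)"
    by (rule measure_Un_le) (use fm in \<open>auto dest: fmeasurableD\<close>)
  then show ?thesis using 1 2 by simp
qed

text \<open>Since \<open>pieces k\<close> tends to infinity, rounding an endpoint down to multiples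
  of \<open>1 / pieces k\<close> exhibits every initial segment as a countable union of members of
  \<open>G\<close>; initial segments generate the Borel sets.\<close>

lemma sigma_sets_initial_segments:
  assumes G: "\<And>e k S. k0 \<le> k \<Longrightarrow> e * real (pieces k) = real S \<Longrightarrow> e \<le> E \<Longrightarrow> {0..<e} \<in> G" and E: "{0..<E} \<in> G"
    and GE: "G \<subseteq> Pow {0..<E}" and A: "A \<in> sets borel"
  shows "A \<inter> {0..<E} \<in> sigma_sets {0..<E} G"
proof -
  interpret S: sigma_algebra "{0..<E}" "sigma_sets {0..<E} G" by (rule sigma_algebra_sigma_sets[OF GE])
  have p2: "2 ^ n \<le> pieces n" for n
  proof (induction n)
    case (Suc n)
    then have "2 ^ n * 2 \<le> pieces n * cols n" by (intro mult_mono) (auto simp: cols_def)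
    then show ?case by (simp add: pieces_Suc mult.commute)
  qed (simp add: pieces_def)
  have seg: "{..<a} \<inter> {0..<E} \<in> sigma_sets {0..<E} G" for a
  proof (cases "0 < min a E")
    case True
    define m where "m = min a E"
    define S where "S n = nat \<lfloor>m * real (pieces n)\<rfloor>" for n
    define e where "e n = real (S n) / real (pieces n)" for n
    have rS: "real (S n) = of_int \<lfloor>m * real (pieces n)\<rfloor>" for n using True by (simp add: S_def m_def)
    have eS: "e n * real (pieces n) = real (S n)" for n using pieces_pos[of n] by (simp add: e_def)
    have em: "e n \<le> m" for n
      using pieces_pos[of n] by (simp add: e_def rS divide_le_eq)
    have eG: "{0..<e n} \<in> sigma_sets {0..<E} G" if "k0 \<le> n" for n
      using G[OF that eS] em[of n] by (intro sigma_sets.Basic) (simp add: m_def)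
    have "{..<a} \<inter> {0..<E} = (\<Union>n. {0..<e (k0 + n)})"
    proof (intro set_eqI iffI)
      fix x assume "x \<in> {..<a} \<inter> {0..<E}"
      then have x: "0 \<le> x" "x < m" by (auto simp: m_def)
      obtain n where n: "1 / (m - x) < 2 ^ n" using real_arch_pow[of 2 "1 / (m - x)"] by auto
      have "(2::real) ^ n \<le> 2 ^ (k0 + n)" by (rule power_increasing) auto
      also have "\<dots> = real (2 ^ (k0 + n))" by simp
      also have "\<dots> \<le> real (pieces (k0 + n))" using p2[of "k0 + n"] by (simp only: of_nat_le_iff)
      finally have "1 / (m - x) < real (pieces (k0 + n))" using n by linarith
      then have "1 < (m - x) * real (pieces (k0 + n))" using x by (simp add: field_simps)
      then have "x * real (pieces (k0 + n)) < m * real (pieces (k0 + n)) - 1" by (simp add: algebra_simps)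
      also have "\<dots> \<le> e (k0 + n) * real (pieces (k0 + n))" unfolding eS rS by linarith
      finally have "x < e (k0 + n)" using pieces_pos[of "k0 + n"] by simp
      then show "x \<in> (\<Union>n. {0..<e (k0 + n)})" using x by auto
    next
      fix x assume "x \<in> (\<Union>n. {0..<e (k0 + n)})"
      then obtain n where "0 \<le> x" "x < e (k0 + n)" by auto
      then show "x \<in> {..<a} \<inter> {0..<E}" using em[of "k0 + n"] by (auto simp: m_def)
    qed
    also have "\<dots> \<in> sigma_sets {0..<E} G" by (intro S.countable_nat_UN image_subsetI eG) auto
    finally show ?thesis .
  next
    case False
    then have "{..<a} \<inter> {0..<E} = {}" by auto
    then show ?thesis using S.empty_sets by simp
  qed
  have "A \<in> sigma_sets UNIV (range lessThan)"
    using A by (simp add: borel_Iio)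
  then show ?thesis
  proof (induction rule: sigma_sets.induct)
    case (Basic a)
    then show ?case using seg by auto
  next
    case (Compl a)
    have "(UNIV - a) \<inter> {0..<E} = {0..<E} - a \<inter> {0..<E}" by auto
    then show ?case using S.compl_sets[OF Compl.IH] by simp
  next
    case (Union a)
    have "(\<Union>i. a i) \<inter> {0..<E} = (\<Union>i. a i \<inter> {0..<E})" by auto
    then show ?case using Union.IH by (simp only:) (intro S.countable_nat_UN image_subsetI)
  qed (use S.empty_sets in simp)
qed

text \<open>Segments made of whole levels are known to be rigid;
  \<open>tends_to_identity_sigma_sets\<close> passes from them to all Borel subsets of the segment
  \<open>[0, E)\<close> of finite measure.\<close>

lemma rigid_h:
  assumes K: "K \<in> bounded_borel"
  shows "(\<lambda>k. measure lborel (sym_diff (act (int (h k)) ` K) K)) \<longlonglongrightarrow> 0"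
proof -
  obtain j where j: "K \<subseteq> windows j" using K by (auto simp: bounded_borel_def)
  obtain k0 where k0: "\<forall>x. 0 \<le> x \<longrightarrow> x < real j \<longrightarrow> idx k0 x < h k0" using tower_covers[of j] ..
  define E where "E = real j"
  \<comment> \<open>The endpoint has to be a multiple of \<open>1 / pieces k\<close> at all late
    stages, since the time \<open>h k\<close> is controlled through the levels of tower
    \<open>k\<close>. Once true this remains true, because each stage refines the previous
    one.\<close>
  define G where "G = {{0..<e} | e. 0 \<le> e \<and> e \<le> E \<and> (\<exists>k1. \<forall>k\<ge>k1. \<exists>S. e * real (pieces k) = real S)}"
  have up: "\<exists>S. e * real (pieces k') = real S" if "e * real (pieces k) = real S" "k \<le> k'" for e k k' S
    using that(2)
  proof (induction rule: dec_induct)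
    case base
    then show ?case using that(1) by blast
  next
    case (step n)
    then obtain S where "e * real (pieces n) = real S" by blast
    then have "e * real (pieces (Suc n)) = real (S * cols n)" by (simp add: pieces_Suc mult.assoc[symmetric])
    then show ?case by blast
  qed
  have GE: "G \<subseteq> Pow {0..<E}" by (auto simp: G_def)
  have Gs: "G \<subseteq> sets half_line" by (auto simp: G_def sets_half_line)
  have Gmem: "{0..<e} \<in> G" if "e * real (pieces k) = real S" "e \<le> E" for e k S
  proof -
    have "0 \<le> e * real (pieces k)" using that(1) by simp
    then have "0 \<le> e" using pieces_pos[of k] by (simp add: zero_le_mult_iff)
    then show ?thesis unfolding G_def using that(2) up[OF that(1)] by blast
  qed
  have lim: "(\<lambda>k. measure half_line (sym_diff (act (int (h k)) ` X) X)) \<longlonglongrightarrow> 0" if "X \<in> G" for X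
  proof -
    obtain e k1 where e: "X = {0..<e}" "0 \<le> e" "e \<le> E" "\<forall>k\<ge>k1. \<exists>S. e * real (pieces k) = real S"
      using \<open>X \<in> G\<close> unfolding G_def by auto
    have "norm (measure half_line (sym_diff (act (int (h k)) ` X) X)) \<le> 2 * e / real k" if k: "max 1 (max k0 k1) \<le> k" for k
    proof -
      obtain S where S: "e * real (pieces k) = real S" using e(4) k by auto
      have sub: "idx k x < h k" if "0 \<le> x" "x < e" for x
        using k0 that e(3) k by (intro in_tower_mono[of x k0 k]) (auto simp: E_def)
      have "measure lborel (sym_diff (act (int (h k)) ` {0..<e}) {0..<e}) \<le> 2 * e / real (cols k)"
        by (rule rigid_initial_segment[OF e(2) S sub])
      also have "\<dots> \<le> 2 * e / real k" using e(2) k by (intro divide_left_mono) (auto simp: cols_def)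
      finally show ?thesis unfolding e(1)
        using act_nonneg by (subst measure_half_line) auto
    qed
    then have ev: "eventually (\<lambda>k. norm (measure half_line (sym_diff (act (int (h k)) ` X) X)) \<le> 2 * e / real k) sequentially"
      unfolding eventually_sequentially by blast
    show ?thesis by (rule Lim_null_comparison[OF ev lim_const_over_n])
  qed
  have EG: "{0..<E} \<in> G" by (rule Gmem[of E 0 j]) (auto simp: E_def pieces_def)
  have "K \<inter> {0..<E} \<in> sigma_sets {0..<E} G"
    by (rule sigma_sets_initial_segments[OF Gmem EG GE bounded_borel_sets(1)[OF K]])
  moreover have "K \<inter> {0..<E} = K" using j by (auto simp: windows_def E_def)
  ultimately have KG: "K \<in> sigma_sets {0..<E} G" by simp
  have "{0..<E} = windows j" by (simp add: windows_def E_def)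
  then have \<Omega>: "{0..<E} \<in> fmeasurable half_line" using bounded_borel_sets(5)[OF windows_bounded_borel] by simp
  have "(\<lambda>k. measure half_line (sym_diff (act (int (h k)) ` K) K)) \<longlonglongrightarrow> 0"
    using tends_to_identity_sigma_sets[OF motion_automorphism[OF act_motion] \<Omega> lim[OF EG] Gs GE lim KG] by simp
  moreover have "measure half_line (sym_diff (act (int (h k)) ` K) K) = measure lborel (sym_diff (act (int (h k)) ` K) K)" for k
    by (rule measure_half_line) (use bounded_borel_sets(2)[OF K] bounded_borel_sets(2)[OF act_bounded[OF K]] in auto)
  ultimately show ?thesis by simp
qed

text \<open>For a negative time the measure preserving \<open>act (q k)\<close> carries the
  symmetric difference of the opposite time onto the wanted one.\<close>

lemma rigid_signed:
  assumes q: "\<And>k. \<bar>q k\<bar> = int (h k)" and K: "K \<in> bounded_borel"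
  shows "(\<lambda>k. measure lborel (sym_diff (act (q k) ` K) K)) \<longlonglongrightarrow> 0"
proof -
  have "measure lborel (sym_diff (act (q k) ` K) K) = measure lborel (sym_diff (act (int (h k)) ` K) K)" for k
  proof (cases "0 \<le> q k")
    case True
    then show ?thesis using q[of k] by simp
  next
    case False
    then have qk: "q k = - int (h k)" using q[of k] by simp
    let ?D = "sym_diff (act (int (h k)) ` K) K"
    have K0: "K \<subseteq> {0..}" by (rule bounded_borel_sets(2)[OF K])
    have hK: "act (int (h k)) ` K \<in> bounded_borel" by (rule act_bounded[OF K])
    have D: "?D \<in> bounded_borel"
      by (rule bounded_borel_subset[OF bounded_borel_Un[OF hK K]]) (use bounded_borel_sets(1)[OF hK] bounded_borel_sets(1)[OF K] in auto)
    have inj: "inj_on (act (q k)) {0..}" by (rule act_inj)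
    have "act (q k) ` ?D = sym_diff (act (q k) ` act (int (h k)) ` K) (act (q k) ` K)"
      using inj_on_image_set_diff[OF inj, of "act (int (h k)) ` K" K] inj_on_image_set_diff[OF inj, of K "act (int (h k)) ` K"]
        K0 bounded_borel_sets(2)[OF hK] by (simp add: image_Un Diff_subset subset_trans[OF Diff_subset])
    also have "act (q k) ` act (int (h k)) ` K = K"
      using act_image_add[OF K0, of "q k" "int (h k)"] act_image_zero[OF K0] qk by simp
    finally have "sym_diff (act (q k) ` K) K = act (q k) ` ?D" by (simp add: Un_commute)
    then show ?thesis using act_measure[OF D] by simp
  qed
  then show ?thesis using rigid_h[OF K] by simp
qed

end

section \<open>The Hilbert space of square-summable sequences\<close>

text \<open>A type copy of the carrier set \<open>ell2\<close>, which makes norm, inner product and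
  completeness of the Hilbert space available through type classes.\<close>

typedef l2 = ell2 morphisms coord Abs_l2
proof -
  have "(\<lambda>_. 0) \<in> ell2" by (simp add: ell2_def)
  then show ?thesis by blast
qed

lemma ell2_add:
  assumes "h \<in> ell2" "k \<in> ell2"
  shows "(\<lambda>i. h i + k i) \<in> ell2"
proof -
  have "summable (\<lambda>i. 2 * (h i)\<^sup>2 + 2 * (k i)\<^sup>2)"
    using assms by (intro summable_add summable_mult) (auto simp: ell2_def)
  then have "summable (\<lambda>i. (h i + k i)\<^sup>2)"
  proof (rule summable_comparison_test')
    fix i
    have "0 \<le> (h i - k i)\<^sup>2" by simp
    then have "(h i + k i)\<^sup>2 \<le> 2 * (h i)\<^sup>2 + 2 * (k i)\<^sup>2" by (simp add: power2_eq_square algebra_simps)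
    then show "norm ((h i + k i)\<^sup>2) \<le> 2 * (h i)\<^sup>2 + 2 * (k i)\<^sup>2" by simp
  qed
  then show ?thesis by (simp add: ell2_def)
qed

lemma ell2_scale: "h \<in> ell2 \<Longrightarrow> (\<lambda>i. c * h i) \<in> ell2"
  by (auto simp: ell2_def power_mult_distrib intro: summable_mult)

lemma summable_coord_sq: "summable (\<lambda>i. (coord x i)\<^sup>2)"
  using coord[of x] by (simp add: ell2_def)

lemma ell2_summable_mult:
  assumes "h \<in> ell2" "k \<in> ell2"
  shows "summable (\<lambda>i. h i * k i)"
proof -
  have "summable (\<lambda>i. (h i)\<^sup>2 + (k i)\<^sup>2)"
    using assms by (intro summable_add) (auto simp: ell2_def)
  then show ?thesis
  proof (rule summable_comparison_test')
    fix i
    have "0 \<le> (\<bar>h i\<bar> - \<bar>k i\<bar>)\<^sup>2" by simp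
    then have "2 * (\<bar>h i\<bar> * \<bar>k i\<bar>) \<le> (h i)\<^sup>2 + (k i)\<^sup>2" by (simp add: power2_diff)
    moreover have "0 \<le> \<bar>h i\<bar> * \<bar>k i\<bar>" by simp
    ultimately show "norm (h i * k i) \<le> (h i)\<^sup>2 + (k i)\<^sup>2"
      unfolding real_norm_def abs_mult by linarith
  qed
qed

instantiation l2 :: real_inner
begin

definition "zero_l2 = Abs_l2 (\<lambda>_. 0)"
definition "plus_l2 x y = Abs_l2 (\<lambda>i. coord x i + coord y i)"
definition "scaleR_l2 c x = Abs_l2 (\<lambda>i. c * coord x i)"
definition "uminus_l2 (x :: l2) = (-1) *\<^sub>R x"
definition "minus_l2 (x :: l2) y = x + (-1) *\<^sub>R y"
definition "inner_l2 x y = (\<Sum>i. coord x i * coord y i)"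
definition "norm_l2 (x :: l2) = sqrt (inner x x)"
definition "dist_l2 (x :: l2) y = norm (x - y)"
definition "sgn_l2 (x :: l2) = inverse (norm x) *\<^sub>R x"
definition uniformity_l2 :: "(l2 \<times> l2) filter"
  where "uniformity_l2 = (INF e\<in>{0<..}. principal {(x, y). dist x y < e})"
definition open_l2 :: "l2 set \<Rightarrow> bool"
  where "open_l2 U \<longleftrightarrow> (\<forall>x\<in>U. eventually (\<lambda>(x', y). x' = x \<longrightarrow> y \<in> U) uniformity)"

lemma coord_zero: "coord 0 i = 0"
  by (simp add: zero_l2_def Abs_l2_inverse ell2_def)

lemma coord_add: "coord (x + y) i = coord x i + coord y i"
  using ell2_add[OF coord coord] by (simp add: plus_l2_def Abs_l2_inverse)

lemma coord_scaleR: "coord (c *\<^sub>R x) i = c * coord x i"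
  using ell2_scale[OF coord] by (simp add: scaleR_l2_def Abs_l2_inverse)

lemma coord_uminus: "coord (- x) i = - coord x i"
  by (simp add: uminus_l2_def coord_scaleR)

lemma coord_diff: "coord (x - y) i = coord x i - coord y i"
  by (simp add: minus_l2_def coord_add coord_scaleR)

lemma l2_eqI: "(\<And>i. coord x i = coord y i) \<Longrightarrow> x = y"
  by (metis coord_inject ext)

lemma summable_coord_mult: "summable (\<lambda>i. coord x i * coord y i)"
  by (rule ell2_summable_mult) (rule coord)+

instance
proof
  fix x y z :: l2 and a b :: real
  show "x + y + z = x + (y + z)" by (rule l2_eqI) (simp add: coord_add)
  show "x + y = y + x" by (rule l2_eqI) (simp add: coord_add)
  show "0 + x = x" by (rule l2_eqI) (simp add: coord_add coord_zero)
  show "- x + x = 0" by (rule l2_eqI) (simp add: coord_add coord_zero coord_uminus)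
  show "x - y = x + - y" by (rule l2_eqI) (simp add: coord_add coord_diff coord_uminus)
  show "a *\<^sub>R (x + y) = a *\<^sub>R x + a *\<^sub>R y" by (rule l2_eqI) (simp add: coord_add coord_scaleR algebra_simps)
  show "(a + b) *\<^sub>R x = a *\<^sub>R x + b *\<^sub>R x" by (rule l2_eqI) (simp add: coord_add coord_scaleR algebra_simps)
  show "a *\<^sub>R b *\<^sub>R x = (a * b) *\<^sub>R x" by (rule l2_eqI) (simp add: coord_scaleR)
  show "1 *\<^sub>R x = x" by (rule l2_eqI) (simp add: coord_scaleR)
  show "dist x y = norm (x - y)" by (rule dist_l2_def)
  show "sgn x = inverse (norm x) *\<^sub>R x" by (rule sgn_l2_def)
  show "uniformity = (INF e\<in>{0<..}. principal {(x :: l2, y). dist x y < e})" by (rule uniformity_l2_def)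
  show "open U \<longleftrightarrow> (\<forall>x\<in>U. eventually (\<lambda>(x', y). x' = x \<longrightarrow> y \<in> U) uniformity)" for U :: "l2 set"
    by (rule open_l2_def)
  show "inner x y = inner y x" by (simp add: inner_l2_def mult.commute)
  show "inner (x + y) z = inner x z + inner y z"
    by (simp add: inner_l2_def coord_add distrib_right suminf_add[symmetric] summable_coord_mult)
  show "inner (a *\<^sub>R x) y = a * inner x y"
    by (simp add: inner_l2_def coord_scaleR mult.assoc suminf_mult summable_coord_mult)
  show "0 \<le> inner x x" by (simp add: inner_l2_def suminf_nonneg summable_coord_mult)
  show "inner x x = 0 \<longleftrightarrow> x = 0"
  proof
    assume "inner x x = 0"
    then have "\<forall>i. coord x i * coord x i = 0"
      using suminf_eq_zero_iff[OF summable_coord_mult[of x x]] by (simp add: inner_l2_def)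
    then show "x = 0" by (intro l2_eqI) (simp add: coord_zero)
  qed (simp add: inner_l2_def coord_zero)
  show "norm x = sqrt (inner x x)" by (rule norm_l2_def)
qed

end

lemma norm_sq_l2: "(norm x)\<^sup>2 = (\<Sum>i. (coord x i)\<^sup>2)"
  unfolding power2_norm_eq_inner inner_l2_def by (simp add: power2_eq_square)

lemma partial_norm_le: "(\<Sum>i<n. (coord x i)\<^sup>2) \<le> (norm x)\<^sup>2"
  unfolding norm_sq_l2 by (rule sum_le_suminf) (auto intro: summable_coord_sq)

lemma coord_le_norm: "\<bar>coord x i\<bar> \<le> norm x"
proof -
  have "(coord x i)\<^sup>2 \<le> (\<Sum>j<Suc i. (coord x j)\<^sup>2)" by (intro member_le_sum) auto
  also have "\<dots> \<le> (norm x)\<^sup>2" by (rule partial_norm_le)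
  finally show ?thesis by (simp add: abs_le_square_iff[symmetric])
qed

lemma l2_from_partial_sums:
  assumes "\<And>n. (\<Sum>i<n. (f i)\<^sup>2) \<le> C\<^sup>2" "0 \<le> C"
  shows "f \<in> ell2" "norm (Abs_l2 f) \<le> C"
proof -
  have s: "summable (\<lambda>i. (f i)\<^sup>2)"
    by (rule bounded_imp_summable[where B="C\<^sup>2"]) (use assms(1)[of "Suc _"] in \<open>auto simp: lessThan_Suc_atMost\<close>)
  then show f: "f \<in> ell2" by (simp add: ell2_def)
  have "(norm (Abs_l2 f))\<^sup>2 = (\<Sum>i. (f i)\<^sup>2)" by (simp add: norm_sq_l2 Abs_l2_inverse[OF f])
  also have "\<dots> \<le> C\<^sup>2" by (rule suminf_le_const[OF s assms(1)])
  finally show "norm (Abs_l2 f) \<le> C" using assms(2) by (rule power2_le_imp_le)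
qed

text \<open>Coordinatewise limits exist; the Cauchy estimate is passed to the limit on finitely many
  coordinates at a time, and \<open>l2_from_partial_sums\<close> then bounds the whole norm.
  Completeness provides the limit of the infinite product of rotations.\<close>

instance l2 :: complete_space
proof
  fix X :: "nat \<Rightarrow> l2" assume X: "Cauchy X"
  have "Cauchy (\<lambda>n. coord (X n) i)" for i
  proof (rule CauchyI)
    fix e :: real assume "0 < e"
    then obtain M where M: "\<forall>m\<ge>M. \<forall>n\<ge>M. norm (X m - X n) < e" using CauchyD[OF X] by blast
    have "norm (coord (X m) i - coord (X n) i) < e" if "m \<ge> M" "n \<ge> M" for m n
      using coord_le_norm[of "X m - X n" i] M that by (auto simp: coord_diff intro: le_less_trans)
    then show "\<exists>M. \<forall>m\<ge>M. \<forall>n\<ge>M. norm (coord (X m) i - coord (X n) i) < e" by blast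
  qed
  then have conv: "(\<lambda>n. coord (X n) i) \<longlonglongrightarrow> lim (\<lambda>n. coord (X n) i)" for i
    by (simp add: Cauchy_convergent_iff convergent_LIMSEQ_iff)
  define y where "y i = lim (\<lambda>n. coord (X n) i)" for i
  have *: "\<exists>M. \<forall>m\<ge>M. (\<forall>K. (\<Sum>i<K. (coord (X m) i - y i)\<^sup>2) \<le> e\<^sup>2)" if e: "0 < e" for e
  proof -
    obtain M where M: "\<forall>m\<ge>M. \<forall>n\<ge>M. norm (X m - X n) < e" using CauchyD[OF X e] by blast
    have "(\<Sum>i<K. (coord (X m) i - y i)\<^sup>2) \<le> e\<^sup>2" if m: "m \<ge> M" for m K
    proof (rule tendsto_upperbound)
      show "(\<lambda>n. \<Sum>i<K. (coord (X m) i - coord (X n) i)\<^sup>2) \<longlonglongrightarrow> (\<Sum>i<K. (coord (X m) i - y i)\<^sup>2)"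
        unfolding y_def by (intro tendsto_intros conv)
      have "(\<Sum>i<K. (coord (X m) i - coord (X n) i)\<^sup>2) \<le> e\<^sup>2" if "n \<ge> M" for n
      proof -
        have "(\<Sum>i<K. (coord (X m) i - coord (X n) i)\<^sup>2) \<le> (norm (X m - X n))\<^sup>2"
          using partial_norm_le[where x="X m - X n" and n=K] by (simp add: coord_diff)
        also have "\<dots> \<le> e\<^sup>2" using M m that by (intro power_mono) (auto intro: less_imp_le)
        finally show ?thesis .
      qed
      then show "eventually (\<lambda>n. (\<Sum>i<K. (coord (X m) i - coord (X n) i)\<^sup>2) \<le> e\<^sup>2) sequentially"
        unfolding eventually_sequentially by blast
    qed simp
    then show ?thesis by blast
  qed
  have yl: "y \<in> ell2"
  proof -
    obtain M where M: "\<And>K. (\<Sum>i<K. (coord (X M) i - y i)\<^sup>2) \<le> 1\<^sup>2" using *[of 1] by auto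
    have "(\<lambda>i. coord (X M) i - y i) \<in> ell2" by (rule l2_from_partial_sums(1)[OF M]) simp
    then have "(\<lambda>i. coord (X M) i + (- 1) * (coord (X M) i - y i)) \<in> ell2" by (intro ell2_add ell2_scale coord)
    then show ?thesis by simp
  qed
  have "X \<longlonglongrightarrow> Abs_l2 y"
  proof (rule LIMSEQ_I)
    fix r :: real assume "0 < r"
    then obtain M where M: "\<forall>m\<ge>M. (\<forall>K. (\<Sum>i<K. (coord (X m) i - y i)\<^sup>2) \<le> (r / 2)\<^sup>2)" using *[of "r / 2"] by auto
    have "norm (X m - Abs_l2 y) < r" if "m \<ge> M" for m
    proof -
      have "X m - Abs_l2 y = Abs_l2 (\<lambda>i. coord (X m) i - y i)"
        by (rule l2_eqI) (use M that l2_from_partial_sums(1)[of "\<lambda>i. coord (X m) i - y i" "r / 2"] \<open>0 < r\<close> in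
          \<open>simp add: coord_diff Abs_l2_inverse yl\<close>)
      moreover have "norm (Abs_l2 (\<lambda>i. coord (X m) i - y i)) \<le> r / 2"
        by (rule l2_from_partial_sums(2)) (use M that \<open>0 < r\<close> in auto)
      ultimately show ?thesis using \<open>0 < r\<close> by simp
    qed
    then show "\<exists>no. \<forall>n\<ge>no. norm (X n - Abs_l2 y) < r" by blast
  qed
  then show "convergent X" by (auto simp: convergent_def)
qed

definition unit :: "nat \<Rightarrow> l2" where
  "unit i = Abs_l2 (\<lambda>j. if j = i then 1 else 0)"

lemma coord_unit: "coord (unit i) j = (if j = i then 1 else 0)"
proof -
  have "(\<lambda>j. if j = i then 1 else (0::real)) \<in> ell2"
    unfolding ell2_def using summable_single[of i "\<lambda>_. 1::real"] by (simp add: if_distrib[of "\<lambda>x. x\<^sup>2"] cong: if_cong)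
  then show ?thesis by (simp add: unit_def Abs_l2_inverse)
qed

lemma inner_unit: "inner x (unit i) = coord x i"
proof -
  have "(\<lambda>j. coord x j * coord (unit i) j) = (\<lambda>j. if j = i then coord x j else 0)"
    by (auto simp: coord_unit)
  then show ?thesis using sums_single[of i "coord x"] by (simp add: inner_l2_def sums_iff)
qed

definition truncate :: "nat \<Rightarrow> l2 \<Rightarrow> l2" where
  "truncate n x = (\<Sum>i<n. coord x i *\<^sub>R unit i)"

lemma coord_sum: "coord (\<Sum>i\<in>I. f i) j = (\<Sum>i\<in>I. coord (f i) j)"
  by (induction I rule: infinite_finite_induct) (auto simp: coord_zero coord_add)

lemma coord_truncate: "coord (truncate n x) j = (if j < n then coord x j else 0)"
  by (simp add: truncate_def coord_sum coord_scaleR coord_unit if_distrib[of "\<lambda>z. _ * z"] cong: if_cong)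

lemma norm_sq_split: "(norm x)\<^sup>2 = (\<Sum>i<n. (coord x i)\<^sup>2) + (norm (x - truncate n x))\<^sup>2"
proof -
  have "(norm (x - truncate n x))\<^sup>2 = (\<Sum>i. (coord x (i + n))\<^sup>2)"
    unfolding norm_sq_l2
    using suminf_split_initial_segment[OF summable_coord_sq, of "x - truncate n x" n]
    by (simp add: coord_diff coord_truncate)
  then show ?thesis
    using suminf_split_initial_segment[OF summable_coord_sq, of x n] by (simp add: norm_sq_l2)
qed

lemma truncate_tendsto: "(\<lambda>n. (norm (x - truncate n x))\<^sup>2) \<longlonglongrightarrow> 0"
proof -
  have "(\<lambda>n. \<Sum>i<n. (coord x i)\<^sup>2) \<longlonglongrightarrow> (norm x)\<^sup>2"
    unfolding norm_sq_l2 by (rule summable_LIMSEQ[OF summable_coord_sq])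
  then have "(\<lambda>n. (norm x)\<^sup>2 - (\<Sum>i<n. (coord x i)\<^sup>2)) \<longlonglongrightarrow> (norm x)\<^sup>2 - (norm x)\<^sup>2"
    by (intro tendsto_diff tendsto_const)
  moreover have "(norm x)\<^sup>2 - (\<Sum>i<n. (coord x i)\<^sup>2) = (norm (x - truncate n x))\<^sup>2" for n
    using norm_sq_split[of x n] by simp
  ultimately show ?thesis by simp
qed

instance l2 :: banach ..

subsection \<open>An infinite tensor product of plane rotations\<close>

text \<open>With \<open>l2\<close> viewed as an infinite tensor power of the plane, \<open>i\<close> indexing a basis
  tensor by its binary digits, \<open>quarter k\<close> is the quarter turn in the factor \<open>k\<close>.\<close>

definition quarter_coord :: "nat \<Rightarrow> l2 \<Rightarrow> nat \<Rightarrow> real" where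
  "quarter_coord k x i = (if bit i k then 1 else -1) * coord x (flip_bit k i)"

definition quarter :: "nat \<Rightarrow> l2 \<Rightarrow> l2" where
  "quarter k x = Abs_l2 (quarter_coord k x)"

lemma flip_flip: "flip_bit k (flip_bit k i) = (i::nat)"
  by (rule bit_eqI) (auto simp: bit_flip_bit_iff)

lemma flip_commute: "flip_bit k (flip_bit l i) = flip_bit l (flip_bit k (i::nat))"
  by (rule bit_eqI) (auto simp: bit_flip_bit_iff)

lemma bit_flip: "bit (flip_bit k (i::nat)) l \<longleftrightarrow> (if l = k then \<not> bit i l else bit i l)"
  by (auto simp: bit_flip_bit_iff)

lemma flip_inj: "inj (flip_bit k :: nat \<Rightarrow> nat)"
  by (rule inj_on_inverseI[where g="flip_bit k"]) (simp add: flip_flip)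

lemma quarter_ell2: "quarter_coord k x \<in> ell2"
proof -
  have "summable ((\<lambda>i. (coord x i)\<^sup>2) \<circ> flip_bit k)"
    by (rule summable_reindex[OF summable_coord_sq flip_inj]) simp
  moreover have "(\<lambda>i. (quarter_coord k x i)\<^sup>2) = (\<lambda>i. (coord x i)\<^sup>2) \<circ> flip_bit k"
    by (auto simp: quarter_coord_def)
  ultimately show ?thesis by (simp add: ell2_def)
qed

lemma coord_quarter: "coord (quarter k x) i = (if bit i k then 1 else -1) * coord x (flip_bit k i)"
  by (simp add: quarter_def Abs_l2_inverse[OF quarter_ell2]) (simp add: quarter_coord_def)

lemma quarter_add: "quarter k (x + y) = quarter k x + quarter k y"
  by (rule l2_eqI) (simp add: coord_quarter coord_add)

lemma quarter_scaleR: "quarter k (c *\<^sub>R x) = c *\<^sub>R quarter k x"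
  by (rule l2_eqI) (simp add: coord_quarter coord_scaleR)

lemma quarter_quarter: "quarter k (quarter k x) = - x"
  by (rule l2_eqI) (simp add: coord_quarter coord_uminus flip_flip bit_flip)

lemma quarter_commute: "quarter k (quarter l x) = quarter l (quarter k x)"
  by (rule l2_eqI) (simp add: coord_quarter bit_flip flip_commute[of k l])

lemma norm_quarter: "norm (quarter k x) = norm x"
proof -
  have "(norm (quarter k x))\<^sup>2 = suminf ((\<lambda>i. (coord x i)\<^sup>2) \<circ> flip_bit k)"
    unfolding norm_sq_l2 by (rule arg_cong[where f=suminf]) (auto simp: coord_quarter)
  also have "\<dots> = (norm x)\<^sup>2"
    unfolding norm_sq_l2
  proof (rule suminf_reindex[OF summable_coord_sq flip_inj])
    fix i :: nat assume "i \<notin> range (flip_bit k)"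
    moreover have "i = flip_bit k (flip_bit k i)" by (simp add: flip_flip)
    ultimately show "(coord x i)\<^sup>2 = 0" by blast
  qed simp
  finally show ?thesis by simp
qed

lemma inner_norm_eq: "inner x y = ((norm (x + y))\<^sup>2 - (norm x)\<^sup>2 - (norm y)\<^sup>2) / 2" for x y :: l2
  by (simp add: power2_norm_eq_inner inner_add_left inner_add_right inner_commute)

text \<open>An isometry \<open>J\<close> with \<open>J (J x) = - x\<close> is skew: the inner
  product of \<open>J x\<close> with \<open>x\<close> equals that of \<open>J (J x)\<close> with
  \<open>J x\<close>, which is its negative.\<close>

lemma inner_quarter_self: "inner (quarter k x) x = 0"
proof -
  have "inner (quarter k (quarter k x)) (quarter k x) = inner (quarter k x) x"
    unfolding inner_norm_eq[of "quarter k (quarter k x)" "quarter k x"] inner_norm_eq[of "quarter k x" x]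
      quarter_add[symmetric] norm_quarter ..
  then show ?thesis by (simp add: quarter_quarter inner_commute)
qed

definition turn :: "nat \<Rightarrow> real \<Rightarrow> l2 \<Rightarrow> l2" where
  "turn k t x = cos t *\<^sub>R x + sin t *\<^sub>R quarter k x"

lemma turn_add: "turn k t (x + y) = turn k t x + turn k t y"
  by (simp add: turn_def quarter_add scaleR_add_right)

lemma turn_scaleR: "turn k t (c *\<^sub>R x) = c *\<^sub>R turn k t x"
  by (simp add: turn_def quarter_scaleR scaleR_add_right mult.commute)

lemma norm_sq_quarter:
  "(norm (a *\<^sub>R x + b *\<^sub>R quarter k x))\<^sup>2 = (a\<^sup>2 + b\<^sup>2) * (norm x)\<^sup>2"
proof -
  have "inner (quarter k x) (quarter k x) = inner x x"
    using norm_quarter[of k x] by (simp add: norm_eq_sqrt_inner)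
  moreover have "inner x (quarter k x) = 0" using inner_quarter_self[of k x] by (simp add: inner_commute)
  ultimately show ?thesis
    using inner_quarter_self[of k x] unfolding power2_norm_eq_inner
    by (simp add: inner_add_left inner_add_right power2_eq_square distrib_right mult.assoc)
qed

lemma norm_turn: "norm (turn k t x) = norm x"
  using norm_sq_quarter[of "cos t" x "sin t" k] by (simp add: turn_def)

text \<open>The length of a chord of the circle of radius \<open>norm x\<close>.\<close>

lemma norm_turn_diff: "norm (turn k t x - x) = 2 * \<bar>sin (t / 2)\<bar> * norm x"
proof -
  have "turn k t x - x = (cos t - 1) *\<^sub>R x + sin t *\<^sub>R quarter k x" by (simp add: turn_def scaleR_diff_left)
  then have "(norm (turn k t x - x))\<^sup>2 = ((cos t - 1)\<^sup>2 + (sin t)\<^sup>2) * (norm x)\<^sup>2" by (simp add: norm_sq_quarter)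
  also have "(cos t - 1)\<^sup>2 + (sin t)\<^sup>2 = 2 - 2 * cos t"
    using sin_cos_squared_add[of t] by (simp add: power2_eq_square algebra_simps)
  also have "\<dots> = 4 * (sin (t / 2))\<^sup>2" using cos_double_sin[of "t / 2"] by simp
  finally have "(norm (turn k t x - x))\<^sup>2 = (2 * \<bar>sin (t / 2)\<bar> * norm x)\<^sup>2" by (simp add: power_mult_distrib)
  then show ?thesis by (simp add: power2_eq_iff_nonneg)
qed

lemma turn_turn: "turn k s (turn k t x) = turn k (s + t) x"
proof -
  have "turn k s (turn k t x) = (cos s * cos t) *\<^sub>R x + (cos s * sin t) *\<^sub>R quarter k x
      + ((sin s * cos t) *\<^sub>R quarter k x + (sin s * sin t) *\<^sub>R (- x))"
    by (simp add: turn_def quarter_add quarter_scaleR quarter_quarter scaleR_add_right scaleR_right_diff_distrib)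
  then show ?thesis by (simp add: turn_def cos_add sin_add scaleR_add_left scaleR_diff_left)
qed

lemma turn_commute: "turn k s (turn l t x) = turn l t (turn k s x)"
  by (simp add: turn_def quarter_add quarter_scaleR scaleR_add_right quarter_commute[of k l] mult.commute algebra_simps)

section \<open>Infinite products of commuting rotations\<close>

locale rotations =
  fixes \<theta> :: "nat \<Rightarrow> real"
  assumes summable_\<theta>: "summable (\<lambda>k. \<bar>\<theta> k\<bar>)"
begin

fun rot :: "nat \<Rightarrow> int \<Rightarrow> l2 \<Rightarrow> l2" where
  "rot 0 n x = x"
| "rot (Suc K) n x = turn K (real_of_int n * \<theta> K) (rot K n x)"

lemma rot_add: "rot K n (x + y) = rot K n x + rot K n y"
  by (induction K) (simp_all add: turn_add)

lemma rot_scaleR: "rot K n (c *\<^sub>R x) = c *\<^sub>R rot K n x"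
  by (induction K) (simp_all add: turn_scaleR)

lemma norm_rot: "norm (rot K n x) = norm x"
  by (induction K) (simp_all add: norm_turn)

lemma rot_turn: "rot K n (turn k t x) = turn k t (rot K n x)"
  by (induction K) (simp_all add: turn_commute[of k])

lemma rot_rot: "rot K m (rot K n x) = rot K (m + n) x"
proof (induction K)
  case (Suc K)
  have "rot (Suc K) m (rot (Suc K) n x)
      = turn K (real_of_int m * \<theta> K) (turn K (real_of_int n * \<theta> K) (rot K m (rot K n x)))"
    by (simp add: rot_turn turn_turn add.commute)
  then show ?case by (simp add: Suc turn_turn distrib_right)
qed simp

lemma rot_zero: "rot K 0 x = x"
  by (induction K) (simp_all add: turn_def)

definition gap :: "int \<Rightarrow> nat \<Rightarrow> real" where
  "gap n k = 2 * \<bar>sin (real_of_int n * \<theta> k / 2)\<bar>"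

lemma rot_step: "norm (rot (Suc K) n x - rot K n x) = gap n K * norm x"
  by (simp add: norm_turn_diff norm_rot gap_def)

lemma summable_gap: "summable (gap n)"
proof (rule summable_comparison_test')
  show "summable (\<lambda>k. \<bar>real_of_int n\<bar> * \<bar>\<theta> k\<bar>)" by (rule summable_mult[OF summable_\<theta>])
  show "norm (gap n k) \<le> \<bar>real_of_int n\<bar> * \<bar>\<theta> k\<bar>" for k
    using abs_sin_x_le_abs_x[of "real_of_int n * \<theta> k / 2"] by (simp add: gap_def abs_mult)
qed

text \<open>The factor \<open>K\<close> moves the partial product by
  \<open>gap n K * norm x\<close>, and the gaps are summable because the angles are.\<close>

lemma rot_convergent: "convergent (\<lambda>K. rot K n x)"
proof -
  have "summable (\<lambda>K. rot (Suc K) n x - rot K n x)"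
    by (rule summable_norm_cancel) (simp only: rot_step summable_mult2[OF summable_gap])
  then have "convergent (\<lambda>K. \<Sum>j<K. rot (Suc j) n x - rot j n x)" by (simp only: summable_iff_convergent)
  then have "convergent (\<lambda>K. rot K n x - rot 0 n x)" by (simp only: sum_lessThan_telescope[of "\<lambda>j. rot j n x"])
  then obtain L where "(\<lambda>K. rot K n x - rot 0 n x) \<longlonglongrightarrow> L" by (auto simp: convergent_def)
  from tendsto_add[OF this tendsto_const[of "rot 0 n x"]] show ?thesis by (auto simp: convergent_def)
qed

definition U :: "int \<Rightarrow> l2 \<Rightarrow> l2" where
  "U n x = lim (\<lambda>K. rot K n x)"

lemma rot_tendsto: "(\<lambda>K. rot K n x) \<longlonglongrightarrow> U n x"
  unfolding U_def using rot_convergent by (simp add: convergent_LIMSEQ_iff)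

lemma U_add: "U n (x + y) = U n x + U n y"
  using LIMSEQ_unique[OF rot_tendsto, of n "x + y"] tendsto_add[OF rot_tendsto rot_tendsto, of n x n y] by (simp add: rot_add)

lemma U_scaleR: "U n (c *\<^sub>R x) = c *\<^sub>R U n x"
  using LIMSEQ_unique[OF rot_tendsto, of n "c *\<^sub>R x"] tendsto_scaleR[OF tendsto_const rot_tendsto, of c n x] by (simp add: rot_scaleR)

lemma norm_U: "norm (U n x) = norm x"
  using LIMSEQ_unique[OF tendsto_norm[OF rot_tendsto], of n x "norm x"] by (simp add: norm_rot)

lemma U_zero: "U 0 x = x"
  using LIMSEQ_unique[OF rot_tendsto, of 0 x x] by (simp add: rot_zero)

lemma U_diff: "U n (x - y) = U n x - U n y"
  using U_add[of n x "(-1) *\<^sub>R y"] U_scaleR[of n "-1" y] by simp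

lemma U_U: "U m (U n x) = U (m + n) x"
proof -
  have "norm (rot K m (U n x) - rot K (m + n) x) = norm (U n x - rot K n x)" for K
  proof -
    have "rot K m (U n x) - rot K m (rot K n x) = rot K m (U n x - rot K n x)"
      using rot_add[of K m "U n x" "(-1) *\<^sub>R rot K n x"] rot_scaleR[of K m "-1" "rot K n x"] by simp
    then show ?thesis by (simp add: rot_rot norm_rot)
  qed
  moreover have "(\<lambda>K. norm (U n x - rot K n x)) \<longlonglongrightarrow> 0"
    using tendsto_norm[OF tendsto_diff[OF tendsto_const rot_tendsto], of "U n x" n x] by simp
  ultimately have "(\<lambda>K. norm (rot K m (U n x) - rot K (m + n) x)) \<longlonglongrightarrow> 0" by simp
  moreover have "(\<lambda>K. norm (rot K m (U n x) - rot K (m + n) x)) \<longlonglongrightarrow> norm (U m (U n x) - U (m + n) x)"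
    by (intro tendsto_norm tendsto_diff rot_tendsto)
  ultimately have "norm (U m (U n x) - U (m + n) x) = 0" using LIMSEQ_unique by blast
  then show ?thesis by simp
qed

lemma norm_U_diff: "norm (U n x - x) \<le> suminf (gap n) * norm x"
proof (rule tendsto_upperbound)
  show "(\<lambda>K. norm (rot K n x - x)) \<longlonglongrightarrow> norm (U n x - x)"
    by (intro tendsto_norm tendsto_diff rot_tendsto tendsto_const)
  have "norm (rot K n x - x) \<le> (\<Sum>k<K. gap n k) * norm x" for K
  proof (induction K)
    case (Suc K)
    have "norm (rot (Suc K) n x - x) \<le> norm (rot (Suc K) n x - rot K n x) + norm (rot K n x - x)"
      using norm_triangle_ineq[of "rot (Suc K) n x - rot K n x" "rot K n x - x"] by simp
    then show ?case using Suc unfolding rot_step by (simp add: distrib_right)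
  qed simp
  moreover have "(\<Sum>k<K. gap n k) * norm x \<le> suminf (gap n) * norm x" for K
    by (intro mult_right_mono sum_le_suminf[OF summable_gap]) (auto simp: gap_def)
  ultimately show "eventually (\<lambda>K. norm (rot K n x - x) \<le> suminf (gap n) * norm x) sequentially"
    by (intro always_eventually allI) (rule order_trans)
qed simp

text \<open>On vectors whose digit \<open>k\<close> vanishes, only the factor \<open>k\<close> changes that digit.\<close>

lemma rot_factor:
  assumes x: "\<And>l. bit l k \<Longrightarrow> coord x l = 0" and K: "k < K"
  shows "\<exists>y. rot K n x = turn k (real_of_int n * \<theta> k) y \<and> norm y = norm x \<and> (\<forall>l. bit l k \<longrightarrow> coord y l = 0)"
proof -
  have turn_supp: "coord (turn j t z) l = 0" if "j \<noteq> k" "\<forall>l. bit l k \<longrightarrow> coord z l = 0" "bit l k" for j t z l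
    using that by (simp add: turn_def coord_add coord_scaleR coord_quarter bit_flip)
  have low: "coord (rot J n x) l = 0" if "J \<le> k" "bit l k" for J l
    using that
  proof (induction J arbitrary: l)
    case (Suc J)
    then show ?case by (simp add: turn_supp)
  qed (simp add: x)
  from K show ?thesis
  proof (induction K)
    case (Suc K)
    show ?case
    proof (cases "k = K")
      case True
      then show ?thesis using low[of k] by (intro exI[of _ "rot k n x"]) (simp add: norm_rot)
    next
      case False
      then obtain y where y: "rot K n x = turn k (real_of_int n * \<theta> k) y" "norm y = norm x" "\<forall>l. bit l k \<longrightarrow> coord y l = 0"
        using Suc by auto
      have "rot (Suc K) n x = turn k (real_of_int n * \<theta> k) (turn K (real_of_int n * \<theta> K) y)"
        using y(1) by (simp add: turn_commute[of k])
      moreover have "norm (turn K (real_of_int n * \<theta> K) y) = norm x" using y(2) by (simp add: norm_turn)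
      moreover have "\<forall>l. bit l k \<longrightarrow> coord (turn K (real_of_int n * \<theta> K) y) l = 0"
        using turn_supp[of K y] y(3) False by simp
      ultimately show ?thesis by blast
    qed
  qed simp
qed

text \<open>By \<open>rot_factor\<close> the vector is the rotation in the factor \<open>k\<close>
  of some \<open>y\<close> whose entries with digit \<open>k\<close> equal to 1 vanish. The sine
  part lives on indices with digit 1 and is invisible to \<open>unit j\<close>, so only the cosine
  remains.\<close>

lemma inner_U_unit_le:
  assumes i: "\<not> bit i k" and j: "\<not> bit j k"
  shows "\<bar>inner (U n (unit i)) (unit j)\<bar> \<le> \<bar>cos (real_of_int n * \<theta> k)\<bar>"
proof (rule tendsto_upperbound)
  show "(\<lambda>K. \<bar>inner (rot K n (unit i)) (unit j)\<bar>) \<longlonglongrightarrow> \<bar>inner (U n (unit i)) (unit j)\<bar>"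
    by (intro tendsto_rabs tendsto_inner rot_tendsto tendsto_const)
  have nu: "norm (unit i) = 1"
    using inner_unit[of "unit i" i] by (simp add: norm_eq_sqrt_inner coord_unit)
  have "\<bar>inner (rot K n (unit i)) (unit j)\<bar> \<le> \<bar>cos (real_of_int n * \<theta> k)\<bar>" if K: "k < K" for K
  proof -
    have "coord (unit i) l = 0" if "bit l k" for l using that i by (auto simp: coord_unit)
    from rot_factor[OF this K, of n] obtain y where y: "rot K n (unit i) = turn k (real_of_int n * \<theta> k) y"
      "norm y = norm (unit i)" "\<forall>l. bit l k \<longrightarrow> coord y l = 0" by auto
    have "coord y (flip_bit k j) = 0" using y(3) j by (simp add: bit_flip)
    then have "inner (rot K n (unit i)) (unit j) = cos (real_of_int n * \<theta> k) * coord y j"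
      unfolding inner_unit y(1) by (simp add: turn_def coord_add coord_scaleR coord_quarter)
    moreover have "\<bar>coord y j\<bar> \<le> 1" using coord_le_norm[of y j] y(2) nu by simp
    ultimately show ?thesis by (simp add: abs_mult mult_left_le)
  qed
  then show "eventually (\<lambda>K. \<bar>inner (rot K n (unit i)) (unit j)\<bar> \<le> \<bar>cos (real_of_int n * \<theta> k)\<bar>) sequentially"
    using eventually_gt_at_top[of k] by (rule eventually_mono[rotated])
qed simp

text \<open>Fixed indices \<open>i\<close> and \<open>j\<close> have digit \<open>k\<close> equal to
  0 once \<open>k\<close> exceeds both, so their matrix coefficient tends to 0 with the cosines.
  Truncation extends this to arbitrary vectors, because all the operators are isometric.\<close>

lemma U_weakly_null:
  assumes p: "(\<lambda>k. cos (real_of_int (p k) * \<theta> k)) \<longlonglongrightarrow> 0"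
  shows "(\<lambda>k. inner (U (p k) x) y) \<longlonglongrightarrow> 0"
proof -
  have unit: "(\<lambda>k. inner (U (p k) (unit i)) (unit j)) \<longlonglongrightarrow> 0" for i j
  proof (rule Lim_null_comparison)
    show "(\<lambda>k. \<bar>cos (real_of_int (p k) * \<theta> k)\<bar>) \<longlonglongrightarrow> 0" using tendsto_rabs_zero[OF p] .
    have "norm (inner (U (p k) (unit i)) (unit j)) \<le> \<bar>cos (real_of_int (p k) * \<theta> k)\<bar>" if "max i j < k" for k
    proof -
      have nb: "\<not> bit l k" if "l < k" for l :: nat
      proof -
        have "l < 2 ^ k" using that less_exp[of k] by linarith
        then show ?thesis by (simp add: bit_iff_odd)
      qed
      show ?thesis using inner_U_unit_le[OF nb[of i] nb[of j], of "p k"] that by simp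
    qed
    then show "eventually (\<lambda>k. norm (inner (U (p k) (unit i)) (unit j)) \<le> \<bar>cos (real_of_int (p k) * \<theta> k)\<bar>) sequentially"
      using eventually_gt_at_top[of "max i j"] by (rule eventually_mono[rotated])
  qed
  have U_sum: "U n (\<Sum>i\<in>I. f i) = (\<Sum>i\<in>I. U n (f i))" for n and I :: "nat set" and f
    using U_scaleR[of n 0 0] by (induction I rule: infinite_finite_induct) (auto simp: U_add)
  have trunc: "(\<lambda>k. inner (U (p k) (truncate m x)) (truncate m y)) \<longlonglongrightarrow> 0" for m
  proof -
    have "inner (U n (truncate m x)) (truncate m y)
       = (\<Sum>i<m. \<Sum>j<m. coord x i * (coord y j * inner (U n (unit i)) (unit j)))" for n
      by (simp add: truncate_def U_sum U_scaleR inner_sum_left inner_sum_right sum_distrib_left)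
        (subst sum.swap, simp add: mult.left_commute)
    moreover have "(\<lambda>k. \<Sum>i<m. \<Sum>j<m. coord x i * (coord y j * inner (U (p k) (unit i)) (unit j))) \<longlonglongrightarrow> (\<Sum>i<m. \<Sum>j<m. coord x i * (coord y j * 0))"
      by (intro tendsto_intros unit)
    ultimately show ?thesis by simp
  qed
  show ?thesis
  proof (rule LIMSEQ_I)
    fix r :: real assume r: "0 < r"
    have tr: "(\<lambda>m. norm (z - truncate m z)) \<longlonglongrightarrow> 0" for z
      using tendsto_real_sqrt[OF truncate_tendsto[of z]] by simp
    have tn: "norm (truncate m z) \<le> norm z" for m z
    proof (rule power2_le_imp_le)
      have "(norm (truncate m z))\<^sup>2 = (\<Sum>i<m. (coord z i)\<^sup>2)"
      proof -
        have "truncate m z - truncate m (truncate m z) = 0"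
          by (rule l2_eqI) (simp add: coord_diff coord_truncate coord_zero)
        then show ?thesis using norm_sq_split[of "truncate m z" m] by (simp add: coord_truncate)
      qed
      then show "(norm (truncate m z))\<^sup>2 \<le> (norm z)\<^sup>2" using partial_norm_le[where x=z and n=m] by simp
    qed simp
    have "(\<lambda>m. norm (x - truncate m x) * norm y + norm x * norm (y - truncate m y)) \<longlonglongrightarrow> 0 * norm y + norm x * 0"
      by (intro tendsto_intros tr)
    then have "eventually (\<lambda>m. norm (x - truncate m x) * norm y + norm x * norm (y - truncate m y) < r / 2) sequentially"
      using r by (intro order_tendstoD(2)) auto
    then obtain m where m: "norm (x - truncate m x) * norm y + norm x * norm (y - truncate m y) < r / 2"
      by (auto simp: eventually_sequentially)
    obtain k0 where k0: "\<And>k. k0 \<le> k \<Longrightarrow> norm (inner (U (p k) (truncate m x)) (truncate m y) - 0) < r / 2"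
      using LIMSEQ_D[OF trunc[of m], of "r / 2"] r by auto
    have "norm (inner (U (p k) x) y - 0) < r" if "k0 \<le> k" for k
    proof -
      let ?n = "p k"
      have "inner (U ?n x) y = inner (U ?n (x - truncate m x)) y + inner (U ?n (truncate m x)) (y - truncate m y)
          + inner (U ?n (truncate m x)) (truncate m y)"
        by (simp add: U_diff inner_diff_left inner_diff_right)
      moreover have "\<bar>inner (U ?n (x - truncate m x)) y\<bar> \<le> norm (x - truncate m x) * norm y"
        using Cauchy_Schwarz_ineq2[of "U ?n (x - truncate m x)" y] by (simp add: norm_U)
      moreover have "\<bar>inner (U ?n (truncate m x)) (y - truncate m y)\<bar> \<le> norm x * norm (y - truncate m y)"
        using Cauchy_Schwarz_ineq2[of "U ?n (truncate m x)" "y - truncate m y"] mult_right_mono[OF tn[of m x], of "norm (y - truncate m y)"]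
        by (simp add: norm_U)
      ultimately show ?thesis using k0[OF that] m by simp
    qed
    then show "\<exists>no. \<forall>k\<ge>no. norm (inner (U (p k) x) y - 0) < r" by blast
  qed
qed

end

subsection \<open>Choice of the angles\<close>

text \<open>Successive rounding: \<open>x (Suc i)\<close> is the multiple of \<open>1 / H i\<close>
  nearest to \<open>x i\<close>, so \<open>H i * x (Suc i)\<close> is an integer. By the growth of
  \<open>H\<close> the corrections decrease geometrically, and the limit stays within
  \<open>1 / H (Suc i)\<close> of \<open>x (Suc i)\<close>.\<close>

lemma simultaneous_near_integers:
  fixes H :: "nat \<Rightarrow> real"
  assumes H0: "\<And>i. 0 < H i" and H: "\<And>i. 4 * H i \<le> H (Suc i)"
  shows "\<exists>\<alpha>. \<bar>\<alpha> - x0\<bar> \<le> 1 / H 0 \<and> (\<forall>i. \<exists>m::int. \<bar>H i * \<alpha> - m\<bar> \<le> H i / H (Suc i))"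
proof -
  define x where "x = rec_nat x0 (\<lambda>i y. real_of_int (round (y * H i)) / H i)"
  have x: "x 0 = x0" "x (Suc i) = real_of_int (round (x i * H i)) / H i" for i by (simp_all add: x_def)
  have step: "\<bar>x (Suc i) - x i\<bar> \<le> 1 / (2 * H i)" for i
  proof -
    have "\<bar>x (Suc i) - x i\<bar> * H i = \<bar>(x (Suc i) - x i) * H i\<bar>" using H0[of i] by (simp add: abs_mult)
    also have "(x (Suc i) - x i) * H i = real_of_int (round (x i * H i)) - x i * H i"
      using H0[of i] by (simp add: x left_diff_distrib)
    also have "\<bar>\<dots>\<bar> \<le> 1 / 2" by (rule of_int_round_abs_le)
    finally show ?thesis using H0[of i] by (simp add: field_simps)
  qed
  have near: "\<bar>x (i + d) - x i\<bar> \<le> 1 / H i" for i d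
  proof (induction d arbitrary: i)
    case 0
    then show ?case using H0[of i] by simp
  next
    case (Suc d)
    have "\<bar>x (Suc i + d) - x (Suc i)\<bar> \<le> 1 / H (Suc i)" by (rule Suc)
    also have "\<dots> \<le> 1 / (4 * H i)" using H[of i] H0[of i] by (intro divide_left_mono) auto
    finally have "\<bar>x (i + Suc d) - x i\<bar> \<le> 1 / (4 * H i) + 1 / (2 * H i)" using step[of i] by simp
    also have "\<dots> \<le> 1 / H i" using H0[of i] by (simp add: field_simps)
    finally show ?case .
  qed
  have grow: "4 ^ i * H 0 \<le> H i" for i
  proof (induction i)
    case (Suc i)
    then show ?case using H[of i] by simp
  qed simp
  have "Cauchy x"
  proof (rule CauchyI)
    fix e :: real assume e: "0 < e"
    obtain M where M: "1 / (e * H 0) < 2 ^ M" using real_arch_pow[of 2 "1 / (e * H 0)"] by auto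
    have "(2::real) ^ M \<le> 4 ^ M" by (rule power_mono) auto
    then have "1 / (e * H 0) < 4 ^ M" using M by linarith
    then have "1 < e * (4 ^ M * H 0)" using e H0[of 0] by (simp add: field_simps)
    also have "\<dots> \<le> e * H M" using grow[of M] e by (intro mult_left_mono) auto
    finally have "1 / H M < e" using H0[of M] by (simp add: field_simps)
    have b: "4 * (1 / H (Suc M)) \<le> 1 / H M" using H[of M] H0[of M] H0[of "Suc M"] by (simp add: field_simps)
    have "norm (x m - x n) < e" if "m \<ge> Suc M" "n \<ge> Suc M" for m n
    proof -
      have "\<bar>x m - x (Suc M)\<bar> \<le> 1 / H (Suc M)" "\<bar>x n - x (Suc M)\<bar> \<le> 1 / H (Suc M)"
        using near[of "Suc M" "m - Suc M"] near[of "Suc M" "n - Suc M"] that by simp_all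
      moreover have "0 < 1 / H M" using H0[of M] by simp
      ultimately show ?thesis using b \<open>1 / H M < e\<close> unfolding real_norm_def by linarith
    qed
    then show "\<exists>M. \<forall>m\<ge>M. \<forall>n\<ge>M. norm (x m - x n) < e" by blast
  qed
  then obtain \<alpha> where \<alpha>: "x \<longlonglongrightarrow> \<alpha>" using real_Cauchy_convergent by (auto simp: convergent_def)
  have lim: "\<bar>\<alpha> - x i\<bar> \<le> 1 / H i" for i
  proof (rule tendsto_upperbound)
    show "(\<lambda>d. \<bar>x (i + d) - x i\<bar>) \<longlonglongrightarrow> \<bar>\<alpha> - x i\<bar>"
      using LIMSEQ_ignore_initial_segment[OF \<alpha>, of i] by (intro tendsto_intros) (simp add: add.commute)
    show "eventually (\<lambda>d. \<bar>x (i + d) - x i\<bar> \<le> 1 / H i) sequentially" using near by simp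
  qed simp
  have "\<bar>H i * \<alpha> - real_of_int (round (x i * H i))\<bar> \<le> H i / H (Suc i)" for i
  proof -
    have "H i * \<alpha> - real_of_int (round (x i * H i)) = H i * (\<alpha> - x (Suc i))"
      using H0[of i] by (simp add: x right_diff_distrib)
    also have "\<bar>\<dots>\<bar> = H i * \<bar>\<alpha> - x (Suc i)\<bar>" using H0[of i] by (simp add: abs_mult)
    also have "\<dots> \<le> H i * (1 / H (Suc i))" using H0[of i] by (intro mult_left_mono lim) auto
    finally show ?thesis by simp
  qed
  then show ?thesis using lim[of 0] x(1) by (intro exI[of _ \<alpha>]) auto
qed

text \<open>The growing factor makes the ratios of consecutive terms summable, and it dominates the
  number \<open>k + 2\<close> of columns of a tower.\<close>

locale fast_growth =
  fixes h b :: "nat \<Rightarrow> nat"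
  assumes h0: "0 < h 0"
    and h_b: "\<And>k. 4 ^ Suc k * h k \<le> b k"
    and b_h: "\<And>k. 4 ^ Suc k * b k \<le> h (Suc k)"
begin

lemma h_b_real: "4 ^ Suc k * real (h k) \<le> real (b k)"
  using h_b[of k] by (metis of_nat_le_iff of_nat_mult of_nat_numeral of_nat_power)

lemma b_h_real: "4 ^ Suc k * real (b k) \<le> real (h (Suc k))"
  using b_h[of k] by (metis of_nat_le_iff of_nat_mult of_nat_numeral of_nat_power)

lemma h_le_b: "real (h k) \<le> real (b k)" and b_le_h: "4 * real (b k) \<le> real (h (Suc k))"
proof -
  have p: "(1::real) \<le> 4 ^ k" "(1::real) \<le> 4 ^ Suc k" by (rule one_le_power; simp)+
  have "1 * real (h k) \<le> 4 ^ Suc k * real (h k)" using p by (intro mult_right_mono) auto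
  then show "real (h k) \<le> real (b k)" using h_b_real[of k] by linarith
  have "4 * real (b k) \<le> 4 ^ Suc k * real (b k)" using p by (intro mult_right_mono) auto
  then show "4 * real (b k) \<le> real (h (Suc k))" using b_h_real[of k] by linarith
qed

lemma h_pos: "0 < real (h k)"
proof (induction k)
  case (Suc k)
  then show ?case using h_le_b[of k] b_le_h[of k] by linarith
qed (simp add: h0)

lemma b_pos: "0 < real (b k)"
  using h_pos[of k] h_le_b[of k] by linarith

lemma h_mono: "j \<le> k \<Longrightarrow> real (h j) \<le> real (h k)"
proof (induction rule: dec_induct)
  case (step n)
  then show ?case using h_le_b[of n] b_le_h[of n] b_pos[of n] by linarith
qed simp

lemma h_ratio: "real (h k) / real (h (Suc k)) \<le> (1 / 4) ^ Suc k"
proof -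
  have "4 ^ Suc k * real (h k) \<le> real (h (Suc k))" using h_b_real[of k] b_le_h[of k] b_pos[of k] by linarith
  then show ?thesis using h_pos[of "Suc k"] by (simp add: field_simps)
qed

lemma h_b_ratio: "real (h k) / real (b k) \<le> (1 / 4) ^ Suc k"
  using h_b_real[of k] b_pos[of k] by (simp add: field_simps)

lemma b_h_ratio: "real (b k) / real (h (Suc k)) \<le> (1 / 4) ^ Suc k"
  using b_h_real[of k] h_pos[of "Suc k"] by (simp add: field_simps)

lemma abs_sin_pi_le:
  fixes m :: int
  shows "\<bar>sin (pi * y)\<bar> \<le> pi * \<bar>y - m\<bar>"
proof -
  have s0: "sin (pi * real_of_int m) = 0" using sin_zero_iff_int2[of "pi * real_of_int m"] by (auto simp: mult.commute)
  have "sin (pi * (y - m)) = sin (pi * y) * cos (pi * real_of_int m)"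
    by (simp add: right_diff_distrib sin_diff s0)
  moreover have "\<bar>cos (pi * real_of_int m)\<bar> = 1"
    using sin_cos_squared_add[of "pi * real_of_int m"] s0 by (simp add: power2_eq_1_iff abs_if)
  ultimately have "\<bar>sin (pi * y)\<bar> = \<bar>sin (pi * (y - m))\<bar>" by (simp add: abs_mult)
  also have "\<dots> \<le> \<bar>pi * (y - m)\<bar>" by (rule abs_sin_x_le_abs_x)
  finally show ?thesis by (simp add: abs_mult)
qed

text \<open>The angle is \<open>2 * pi * \<alpha>\<close> with \<open>\<alpha>\<close> close to
  \<open>1 / (4 * b k)\<close>, which turns \<open>b k\<close> steps into a quarter of a circle. For
  \<open>j \<le> k\<close> the angle is so small that \<open>h j\<close> steps hardly move; for
  \<open>j > k\<close> the number \<open>\<alpha>\<close> is adjusted so that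
  \<open>h j * \<alpha>\<close> is nearly an integer. The adjustment is at most
  \<open>1 / h (Suc k)\<close>, which is negligible against \<open>1 / b k\<close>. The bound
  \<open>(1 / 2) ^ j * (1 / 2) ^ k\<close> is summable in \<open>k\<close>, with a sum that tends to
  0 in \<open>j\<close>.\<close>

lemma angle_exists:
  "\<exists>\<theta>. \<bar>\<theta>\<bar> \<le> 2 * pi / real (b k) \<and> \<bar>cos (real (b k) * \<theta>)\<bar> \<le> 2 * pi * (1 / 4) ^ Suc k \<and>
     (\<forall>j. 2 * \<bar>sin (real (h j) * \<theta> / 2)\<bar> \<le> 2 * pi * ((1 / 2) ^ j * (1 / 2) ^ k))"
proof -
  let ?H = "\<lambda>i. real (h (Suc k + i))"
  have "\<exists>\<alpha>. \<bar>\<alpha> - 1 / (4 * real (b k))\<bar> \<le> 1 / ?H 0 \<and> (\<forall>i. \<exists>m::int. \<bar>?H i * \<alpha> - m\<bar> \<le> ?H i / ?H (Suc i))"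
  proof (rule simultaneous_near_integers)
    show "4 * ?H i \<le> ?H (Suc i)" for i using h_le_b[of "Suc k + i"] b_le_h[of "Suc k + i"] by simp
  qed (rule h_pos)
  then obtain \<alpha> where \<alpha>: "\<bar>\<alpha> - 1 / (4 * real (b k))\<bar> \<le> 1 / real (h (Suc k))"
    and near: "\<And>i. \<exists>m::int. \<bar>?H i * \<alpha> - m\<bar> \<le> ?H i / ?H (Suc i)" by auto
  have b0: "0 < real (b k)" and hs: "0 < real (h (Suc k))" by (rule b_pos, rule h_pos)
  have "1 / real (h (Suc k)) \<le> 1 / (4 * real (b k))" using b_le_h[of k] b0 by (intro divide_left_mono) auto
  then have "\<bar>\<alpha>\<bar> \<le> 1 / (4 * real (b k)) + 1 / (4 * real (b k))" using \<alpha> b0 by (auto simp: abs_le_iff)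
  also have "\<dots> \<le> 1 / real (b k)" using b0 by (simp add: field_simps)
  finally have ab: "\<bar>\<alpha>\<bar> \<le> 1 / real (b k)" .
  show ?thesis
  proof (intro exI[of _ "2 * pi * \<alpha>"] conjI allI)
    show t: "\<bar>2 * pi * \<alpha>\<bar> \<le> 2 * pi / real (b k)"
      using mult_left_mono[OF ab, of "2 * pi"] by (simp add: abs_mult)
    have "real (b k) * (2 * pi * \<alpha>) = pi / 2 + 2 * pi * (real (b k) * (\<alpha> - 1 / (4 * real (b k))))"
      using b0 by (simp add: field_simps)
    then have "\<bar>cos (real (b k) * (2 * pi * \<alpha>))\<bar> = \<bar>sin (2 * pi * (real (b k) * (\<alpha> - 1 / (4 * real (b k)))))\<bar>"
      by (simp add: cos_add)
    also have "\<dots> \<le> \<bar>2 * pi * (real (b k) * (\<alpha> - 1 / (4 * real (b k))))\<bar>" by (rule abs_sin_x_le_abs_x)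
    also have "\<dots> = 2 * pi * (real (b k) * \<bar>\<alpha> - 1 / (4 * real (b k))\<bar>)" using b0 by (simp add: abs_mult)
    also have "\<dots> \<le> 2 * pi * (real (b k) * (1 / real (h (Suc k))))" using \<alpha> b0 by (intro mult_left_mono) auto
    also have "\<dots> \<le> 2 * pi * (1 / 4) ^ Suc k" using b_h_ratio[of k] by (intro mult_left_mono) auto
    finally show "\<bar>cos (real (b k) * (2 * pi * \<alpha>))\<bar> \<le> 2 * pi * (1 / 4) ^ Suc k" .
    fix j
    \<comment> \<open>Both error ratios are at most \<open>(1 / 4) ^ Suc n\<close> with
      \<open>n\<close> the larger of the two indices; half of the exponent is given to each
      index.\<close>
    have quarter: "(1 / 4 :: real) ^ Suc n \<le> (1 / 2) ^ j * (1 / 2) ^ k" if "j \<le> n" "k \<le> n" for n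
    proof -
      have "(1 / 4 :: real) ^ Suc n \<le> (1 / 4) ^ n" by simp
      also have "\<dots> = (1 / 2) ^ n * (1 / 2) ^ n" by (simp add: power_mult_distrib[symmetric])
      also have "\<dots> \<le> (1 / 2) ^ j * (1 / 2) ^ k" using that by (intro mult_mono power_decreasing) auto
      finally show ?thesis .
    qed
    show "2 * \<bar>sin (real (h j) * (2 * pi * \<alpha>) / 2)\<bar> \<le> 2 * pi * ((1 / 2) ^ j * (1 / 2) ^ k)"
    proof (cases "j \<le> k")
      case True
      have "2 * \<bar>sin (real (h j) * (2 * pi * \<alpha>) / 2)\<bar> \<le> 2 * \<bar>real (h j) * (2 * pi * \<alpha>) / 2\<bar>"
        by (intro mult_left_mono abs_sin_x_le_abs_x) auto
      also have "\<dots> = real (h j) * \<bar>2 * pi * \<alpha>\<bar>" by (simp add: abs_mult)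
      also have "\<dots> \<le> real (h k) * (2 * pi / real (b k))" using h_mono[OF True] t by (intro mult_mono) auto
      also have "\<dots> = 2 * pi * (real (h k) / real (b k))" by simp
      also have "\<dots> \<le> 2 * pi * ((1 / 2) ^ j * (1 / 2) ^ k)"
        by (intro mult_left_mono order_trans[OF h_b_ratio quarter[OF True order_refl]]) auto
      finally show ?thesis .
    next
      case False
      then obtain i where i: "j = Suc k + i" using less_imp_Suc_add[of k j] by auto
      obtain m :: int where m: "\<bar>real (h j) * \<alpha> - m\<bar> \<le> real (h j) / real (h (Suc j))" using near[of i] unfolding i by auto
      have "sin (real (h j) * (2 * pi * \<alpha>) / 2) = sin (pi * (real (h j) * \<alpha>))" by (simp add: mult_ac)
      then have "2 * \<bar>sin (real (h j) * (2 * pi * \<alpha>) / 2)\<bar> \<le> 2 * (pi * \<bar>real (h j) * \<alpha> - m\<bar>)"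
        using abs_sin_pi_le[of "real (h j) * \<alpha>" m] by simp
      also have "\<dots> \<le> 2 * (pi * ((1 / 2) ^ j * (1 / 2) ^ k))"
        using False by (intro mult_left_mono order_trans[OF m order_trans[OF h_ratio quarter]]) auto
      finally show ?thesis by simp
    qed
  qed
qed

text \<open>Cosine and the absolute value of sine are even, so the signs of \<open>p k\<close> and
  \<open>q k\<close> disappear and the angles chosen for \<open>b\<close> and \<open>h\<close>
  work.\<close>

lemma rotations_exist:
  assumes p: "\<And>k. \<bar>p k\<bar> = int (b k)" and q: "\<And>k. \<bar>q k\<bar> = int (h k)"
  shows "\<exists>\<theta>. rotations \<theta> \<and> (\<lambda>k. cos (real_of_int (p k) * \<theta> k)) \<longlonglongrightarrow> 0 \<and>
    (\<lambda>k. suminf (rotations.gap \<theta> (q k))) \<longlonglongrightarrow> 0"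
proof -
  have "\<forall>k. \<exists>\<theta>. \<bar>\<theta>\<bar> \<le> 2 * pi / real (b k) \<and> \<bar>cos (real (b k) * \<theta>)\<bar> \<le> 2 * pi * (1 / 4) ^ Suc k \<and>
     (\<forall>j. 2 * \<bar>sin (real (h j) * \<theta> / 2)\<bar> \<le> 2 * pi * ((1 / 2) ^ j * (1 / 2) ^ k))"
    by (intro allI angle_exists)
  from choice[OF this] obtain \<theta> where \<theta>: "\<forall>k. \<bar>\<theta> k\<bar> \<le> 2 * pi / real (b k) \<and> \<bar>cos (real (b k) * \<theta> k)\<bar> \<le> 2 * pi * (1 / 4) ^ Suc k \<and>
     (\<forall>j. 2 * \<bar>sin (real (h j) * \<theta> k / 2)\<bar> \<le> 2 * pi * ((1 / 2) ^ j * (1 / 2) ^ k))"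
    ..
  have rot: "rotations \<theta>"
  proof
    show "summable (\<lambda>k. \<bar>\<theta> k\<bar>)"
    proof (rule summable_comparison_test')
      show "summable (\<lambda>k. 2 * pi * (1 / 4 :: real) ^ k)" by (intro summable_mult summable_geometric) simp
      fix k
      have "1 \<le> real (h k)" using h_pos[of k] by simp
      then have "1 / real (b k) \<le> real (h k) / real (b k)" by (intro divide_right_mono) auto
      also have "\<dots> \<le> (1 / 4) ^ Suc k" by (rule h_b_ratio)
      also have "\<dots> \<le> (1 / 4) ^ k" by simp
      finally have "2 * pi * (1 / real (b k)) \<le> 2 * pi * (1 / 4) ^ k" by (intro mult_left_mono) auto
      then show "norm \<bar>\<theta> k\<bar> \<le> 2 * pi * (1 / 4) ^ k" using \<theta>[rule_format, of k] by simp
    qed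
  qed
  interpret rotations \<theta> by (rule rot)
  have sgn: "\<bar>real_of_int n\<bar> = real m" if "\<bar>n\<bar> = int m" for n m using that by (metis of_int_abs of_int_of_nat_eq)
  have "\<bar>cos (real_of_int (p k) * \<theta> k)\<bar> \<le> 2 * pi * (1 / 4) ^ Suc k" for k
  proof -
    have "real_of_int (p k) = real (b k) \<or> real_of_int (p k) = - real (b k)" using sgn[OF p[of k]] by linarith
    then have "cos (real_of_int (p k) * \<theta> k) = cos (real (b k) * \<theta> k)" by auto
    then show ?thesis using \<theta>[rule_format, of k] by simp
  qed
  then have ev: "eventually (\<lambda>k. norm (cos (real_of_int (p k) * \<theta> k)) \<le> 2 * pi * (1 / 4) ^ Suc k) sequentially" by simp
  have "(\<lambda>k. 2 * pi * (1 / 4 :: real) ^ Suc k) \<longlonglongrightarrow> 2 * pi * 0"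
    by (intro tendsto_mult tendsto_const LIMSEQ_Suc LIMSEQ_realpow_zero) auto
  then have lim: "(\<lambda>k. 2 * pi * (1 / 4 :: real) ^ Suc k) \<longlonglongrightarrow> 0" by simp
  have 1: "(\<lambda>k. cos (real_of_int (p k) * \<theta> k)) \<longlonglongrightarrow> 0" by (rule Lim_null_comparison[OF ev lim])
  have gap: "gap (q j) k \<le> 2 * pi * (1 / 2) ^ j * (1 / 2) ^ k" for j k
  proof -
    have "real_of_int (q j) = real (h j) \<or> real_of_int (q j) = - real (h j)" using sgn[OF q[of j]] by linarith
    then have "\<bar>sin (real_of_int (q j) * \<theta> k / 2)\<bar> = \<bar>sin (real (h j) * \<theta> k / 2)\<bar>" by auto
    then show ?thesis using \<theta>[rule_format, of k] by (simp add: gap_def mult.assoc)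
  qed
  have "norm (suminf (gap (q j))) \<le> 2 * pi * (1 / 2) ^ j * 2" for j
  proof -
    have g: "(\<lambda>k. 2 * pi * (1 / 2 :: real) ^ j * (1 / 2) ^ k) sums (2 * pi * (1 / 2) ^ j * (1 / (1 - 1 / 2)))"
      by (intro sums_mult geometric_sums) simp
    have "suminf (gap (q j)) \<le> (\<Sum>k. 2 * pi * (1 / 2 :: real) ^ j * (1 / 2) ^ k)"
      by (rule suminf_le[OF gap summable_gap sums_summable[OF g]])
    also have "\<dots> = 2 * pi * (1 / 2) ^ j * 2" using sums_unique[OF g] by simp
    finally have "suminf (gap (q j)) \<le> 2 * pi * (1 / 2) ^ j * 2" .
    moreover have "0 \<le> suminf (gap (q j))" by (rule suminf_nonneg[OF summable_gap]) (simp add: gap_def)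
    ultimately show ?thesis by simp
  qed
  then have ev2: "eventually (\<lambda>j. norm (suminf (gap (q j))) \<le> 2 * pi * (1 / 2) ^ j * 2) sequentially" by simp
  have "(\<lambda>j. 2 * pi * (1 / 2 :: real) ^ j * 2) \<longlonglongrightarrow> 2 * pi * 0 * 2"
    by (intro tendsto_mult tendsto_const LIMSEQ_realpow_zero) auto
  then have lim2: "(\<lambda>j. 2 * pi * (1 / 2 :: real) ^ j * 2) \<longlonglongrightarrow> 0" by simp
  have 2: "(\<lambda>j. suminf (gap (q j))) \<longlonglongrightarrow> 0" by (rule Lim_null_comparison[OF ev2 lim2])
  show ?thesis by (intro exI[of _ \<theta>] conjI rot 1 2)
qed

end

section \<open>Gaussian forms\<close>

abbreviation std_normal :: "real measure" where
  "std_normal \<equiv> std_normal_distribution"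

lemma prob_space_std_normal: "prob_space std_normal"
  using real_dist_normal_dist by (simp add: real_distribution_def)

lemma prob_space_gaussian: "prob_space gaussian_space"
  unfolding gaussian_space_def by (intro prob_space_PiM prob_space_std_normal)

interpretation gaussian: prob_space gaussian_space
  by (rule prob_space_gaussian)

lemma space_gaussian: "space gaussian_space = UNIV"
  by (simp add: gaussian_space_def space_PiM)

lemma sets_gaussian: "sets gaussian_space = sets (PiM UNIV (\<lambda>_. borel))"
  unfolding gaussian_space_def by (intro sets_PiM_cong) auto

lemma coordinate_measurable [measurable]: "(\<lambda>x. x i) \<in> borel_measurable gaussian_space"
proof -
  have "(\<lambda>x. x i) \<in> borel_measurable (PiM UNIV (\<lambda>_::nat. borel :: real measure))"
    by (rule measurable_component_singleton) simp
  then show ?thesis by (simp add: measurable_cong_sets[OF sets_gaussian refl])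
qed

lemma distr_coordinate: "distr gaussian_space borel (\<lambda>x. x i) = std_normal"
proof -
  interpret N: prob_space std_normal by (rule prob_space_std_normal)
  interpret PP: product_prob_space "\<lambda>_::nat. std_normal" UNIV by unfold_locales
  have "distr gaussian_space borel (\<lambda>x. x i) = distr gaussian_space std_normal (\<lambda>x. x i)"
    by (rule distr_cong) auto
  then show ?thesis using PP.PiM_component[of i] by (simp add: gaussian_space_def)
qed

lemma indep_coordinates: "gaussian.indep_vars (\<lambda>_. borel) (\<lambda>i x. x i) UNIV"
proof (subst gaussian.indep_vars_iff_distr_eq_PiM)
  have "distr gaussian_space (PiM UNIV (\<lambda>_. borel)) (\<lambda>x. \<lambda>i\<in>UNIV. x i) = distr gaussian_space gaussian_space (\<lambda>x. x)"
    by (rule distr_cong) (auto simp: sets_gaussian)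
  also have "\<dots> = gaussian_space" by (simp add: distr_id)
  also have "\<dots> = PiM UNIV (\<lambda>i. distr gaussian_space borel (\<lambda>x. x i))"
    unfolding distr_coordinate by (simp add: gaussian_space_def)
  finally show "distr gaussian_space (PiM UNIV (\<lambda>_. borel)) (\<lambda>x. \<lambda>i\<in>UNIV. x i)
    = PiM UNIV (\<lambda>i. distr gaussian_space borel (\<lambda>x. x i))" .
qed auto

definition gaussian_char :: "((nat \<Rightarrow> real) \<Rightarrow> real) \<Rightarrow> real \<Rightarrow> complex" where
  "gaussian_char Y t = (CLINT x|gaussian_space. iexp (t * Y x))"

lemma gaussian_char_eq:
  assumes [measurable]: "Y \<in> borel_measurable gaussian_space"
  shows "gaussian_char Y t = char (distr gaussian_space borel Y) t"
  unfolding gaussian_char_def char_def by (subst integral_distr) auto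

lemma gaussian_char_sum:
  assumes "finite I"
  shows "gaussian_char (\<lambda>x. \<Sum>i\<in>I. c i * x i) t = complex_of_real (exp (- (t\<^sup>2 * (\<Sum>i\<in>I. (c i)\<^sup>2) / 2)))"
proof -
  have one: "char (distr gaussian_space borel (\<lambda>x. c i * x i)) t = complex_of_real (exp (- ((t * c i)\<^sup>2 / 2)))" for i
  proof -
    have "char (distr gaussian_space borel (\<lambda>x. c i * x i)) t = gaussian_char (\<lambda>x. c i * x i) t"
      by (rule gaussian_char_eq[symmetric]) measurable
    also have "\<dots> = gaussian_char (\<lambda>x. x i) (t * c i)" by (simp add: gaussian_char_def mult.assoc)
    also have "\<dots> = char std_normal (t * c i)" by (subst gaussian_char_eq) (auto simp: distr_coordinate)
    also have "\<dots> = complex_of_real (exp (- ((t * c i)\<^sup>2 / 2)))" by (simp add: char_std_normal_distribution)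
    finally show ?thesis .
  qed
  have ind: "gaussian.indep_vars (\<lambda>_. borel) (\<lambda>i x. c i * x i) I"
    by (rule gaussian.indep_vars_compose2[where Y="\<lambda>i y. c i * y", OF gaussian.indep_vars_subset[OF indep_coordinates]]) auto
  have "gaussian_char (\<lambda>x. \<Sum>i\<in>I. c i * x i) t = char (distr gaussian_space borel (\<lambda>x. \<Sum>i\<in>I. c i * x i)) t"
    by (rule gaussian_char_eq) measurable
  also have "\<dots> = (\<Prod>i\<in>I. char (distr gaussian_space borel (\<lambda>x. c i * x i)) t)"
    by (rule gaussian.char_distr_sum[OF ind])
  also have "\<dots> = complex_of_real (exp (\<Sum>i\<in>I. - ((t * c i)\<^sup>2 / 2)))" using assms by (simp add: one exp_sum)
  also have "(\<Sum>i\<in>I. - ((t * c i)\<^sup>2 / 2)) = - (t\<^sup>2 * (\<Sum>i\<in>I. (c i)\<^sup>2) / 2)"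
    by (simp add: sum_negf power_mult_distrib sum_distrib_left sum_divide_distrib)
  finally show ?thesis .
qed

lemma gaussian_law:
  assumes Y [measurable]: "Y \<in> borel_measurable gaussian_space"
    and ch: "\<And>t. gaussian_char Y t = complex_of_real (exp (- (t\<^sup>2 * \<sigma>\<^sup>2 / 2)))"
  shows "distr gaussian_space borel Y = distr std_normal borel (\<lambda>x. \<sigma> * x)"
proof (rule Levy_uniqueness)
  interpret N: prob_space std_normal by (rule prob_space_std_normal)
  show "real_distribution (distr gaussian_space borel Y)"
    by (simp add: real_distribution_def real_distribution_axioms_def gaussian.prob_space_distr)
  show "real_distribution (distr std_normal borel (\<lambda>x. \<sigma> * x))"
    by (simp add: real_distribution_def real_distribution_axioms_def N.prob_space_distr)
  have "char (distr std_normal borel (\<lambda>x. \<sigma> * x)) t = char std_normal (t * \<sigma>)" for t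
    unfolding char_def by (subst integral_distr) (auto simp: mult.assoc)
  then show "char (distr gaussian_space borel Y) = char (distr std_normal borel (\<lambda>x. \<sigma> * x))"
    using gaussian_char_eq[OF Y] ch by (auto simp: char_std_normal_distribution power_mult_distrib)
qed

lemma gaussian_second_moment:
  assumes Y [measurable]: "Y \<in> borel_measurable gaussian_space"
    and ch: "\<And>t. gaussian_char Y t = complex_of_real (exp (- (t\<^sup>2 * \<sigma>\<^sup>2 / 2)))"
  shows "(\<integral>\<^sup>+ x. ennreal ((Y x)\<^sup>2) \<partial>gaussian_space) = ennreal (\<sigma>\<^sup>2)"
proof -
  have "(\<integral>\<^sup>+ x. ennreal ((Y x)\<^sup>2) \<partial>gaussian_space) = (\<integral>\<^sup>+ y. ennreal (y\<^sup>2) \<partial>distr gaussian_space borel Y)"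
    by (subst nn_integral_distr) auto
  also have "\<dots> = (\<integral>\<^sup>+ x. ennreal ((\<sigma> * x)\<^sup>2) \<partial>std_normal)"
    unfolding gaussian_law[OF Y ch] by (subst nn_integral_distr) auto
  also have "\<dots> = (\<integral>\<^sup>+ x. ennreal (\<sigma>\<^sup>2) * ennreal (x\<^sup>2) \<partial>std_normal)"
    by (simp add: power_mult_distrib ennreal_mult)
  also have "\<dots> = ennreal (\<sigma>\<^sup>2) * (\<integral>\<^sup>+ x. ennreal (x\<^sup>2) \<partial>std_normal)"
    by (rule nn_integral_cmult) simp
  also have "(\<integral>\<^sup>+ x. ennreal (x\<^sup>2) \<partial>std_normal) = ennreal (LINT x|std_normal. x\<^sup>2)"
    using std_normal_distribution_even_moments(2)[of 1] by (intro nn_integral_eq_integral) auto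
  also have "(LINT x|std_normal. x\<^sup>2) = 1" using std_normal_distribution_even_moments(1)[of 1] by (simp add: numeral_eq_Suc)
  finally show ?thesis by simp
qed

text \<open>The squared L2 distance with values in \<open>ennreal\<close>, so that no integrability
  has to be carried along. Its substitute for the triangle inequality has the factor 2.\<close>

definition sqd :: "((nat \<Rightarrow> real) \<Rightarrow> real) \<Rightarrow> ((nat \<Rightarrow> real) \<Rightarrow> real) \<Rightarrow> ennreal" where
  "sqd f g = (\<integral>\<^sup>+ x. ennreal ((f x - g x)\<^sup>2) \<partial>gaussian_space)"

lemma sqd_triangle:
  assumes [measurable]: "f \<in> borel_measurable gaussian_space" "g \<in> borel_measurable gaussian_space" "k \<in> borel_measurable gaussian_space"
  shows "sqd f k \<le> 2 * sqd f g + 2 * sqd g k"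
proof -
  have "sqd f k \<le> (\<integral>\<^sup>+ x. 2 * ennreal ((f x - g x)\<^sup>2) + 2 * ennreal ((g x - k x)\<^sup>2) \<partial>gaussian_space)"
    unfolding sqd_def
  proof (rule nn_integral_mono)
    fix x
    have "0 \<le> ((f x - g x) - (g x - k x))\<^sup>2" by simp
    then have "(f x - k x)\<^sup>2 \<le> 2 * (f x - g x)\<^sup>2 + 2 * (g x - k x)\<^sup>2" by (simp add: power2_eq_square algebra_simps)
    then have "ennreal ((f x - k x)\<^sup>2) \<le> ennreal (2 * (f x - g x)\<^sup>2 + 2 * (g x - k x)\<^sup>2)" by (rule ennreal_leI)
    then show "ennreal ((f x - k x)\<^sup>2) \<le> 2 * ennreal ((f x - g x)\<^sup>2) + 2 * ennreal ((g x - k x)\<^sup>2)"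
      by (simp add: ennreal_mult'')
  qed
  also have "\<dots> = 2 * sqd f g + 2 * sqd g k"
    unfolding sqd_def by (subst nn_integral_add) (auto simp: nn_integral_cmult)
  finally show ?thesis .
qed

lemma sqd_commute: "sqd f g = sqd g f"
  by (simp add: sqd_def power2_commute)

lemma sqd_zero_AE:
  assumes [measurable]: "f \<in> borel_measurable gaussian_space" "g \<in> borel_measurable gaussian_space" and 0: "sqd f g = 0"
  shows "AE x in gaussian_space. f x = g x"
proof -
  have "AE x in gaussian_space. ennreal ((f x - g x)\<^sup>2) = 0"
    using 0 unfolding sqd_def by (subst (asm) nn_integral_0_iff_AE) auto
  then show ?thesis by eventually_elim (simp add: ennreal_eq_0_iff)
qed

lemma sqd_cong_AE: "AE x in gaussian_space. f x = f' x \<Longrightarrow> AE x in gaussian_space. g x = g' x \<Longrightarrow> sqd f g = sqd f' g'"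
  unfolding sqd_def by (intro nn_integral_cong_AE) auto

lemma sqd_limit_unique:
  assumes m: "f \<in> borel_measurable gaussian_space" "g \<in> borel_measurable gaussian_space" "\<And>n. F n \<in> borel_measurable gaussian_space"
    and f: "(\<lambda>n. sqd f (F n)) \<longlonglongrightarrow> 0" and g: "(\<lambda>n. sqd g (F n)) \<longlonglongrightarrow> 0"
  shows "AE x in gaussian_space. f x = g x"
proof (rule sqd_zero_AE[OF m(1,2)])
  have "(\<lambda>n. 2 * sqd f (F n) + 2 * sqd g (F n)) \<longlonglongrightarrow> 2 * 0 + 2 * 0"
    by (intro tendsto_add ennreal_tendsto_cmult f g) auto
  moreover have "sqd f g \<le> 2 * sqd f (F n) + 2 * sqd g (F n)" for n
    using sqd_triangle[OF m(1) m(3)[of n] m(2)] by (simp add: sqd_commute[of "F n"])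
  ultimately have "sqd f g \<le> 2 * 0 + 2 * 0"
    by (intro tendsto_lowerbound[where F=sequentially]) auto
  then show "sqd f g = 0" by simp
qed

definition partial_form :: "nat \<Rightarrow> l2 \<Rightarrow> (nat \<Rightarrow> real) \<Rightarrow> real" where
  "partial_form n h x = (\<Sum>i<n. coord h i * x i)"

lemma partial_form_measurable [measurable]: "partial_form n h \<in> borel_measurable gaussian_space"
  unfolding partial_form_def by measurable

lemma finite_form_moment:
  assumes "finite I"
  shows "(\<integral>\<^sup>+ x. ennreal ((\<Sum>i\<in>I. c i * x i)\<^sup>2) \<partial>gaussian_space) = ennreal (\<Sum>i\<in>I. (c i)\<^sup>2)"
proof -
  have "(\<integral>\<^sup>+ x. ennreal ((\<Sum>i\<in>I. c i * x i)\<^sup>2) \<partial>gaussian_space) = ennreal ((sqrt (\<Sum>i\<in>I. (c i)\<^sup>2))\<^sup>2)"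
    by (rule gaussian_second_moment) (auto simp: gaussian_char_sum[OF assms] sum_nonneg)
  then show ?thesis by (simp add: sum_nonneg)
qed

definition tail :: "nat \<Rightarrow> l2 \<Rightarrow> real" where
  "tail n h = (norm (h - truncate n h))\<^sup>2"

lemma tail_nonneg: "0 \<le> tail n h" by (simp add: tail_def)

lemma sqd_partial_form: "sqd (partial_form m h) (partial_form n h) \<le> ennreal (tail m h + tail n h)"
proof -
  have aux: "sqd (partial_form n h) (partial_form m h) \<le> ennreal (tail m h)" if mn: "m \<le> n" for m n
  proof -
    let ?c = "\<lambda>i. if m \<le> i then coord h i else 0"
    have "partial_form n h x - partial_form m h x = (\<Sum>i<n. ?c i * x i)" for x
    proof -
      have "(\<Sum>i<n. coord h i * x i) = (\<Sum>i<n. (if i < m then coord h i * x i else 0) + ?c i * x i)"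
        by (intro sum.cong) auto
      also have "\<dots> = (\<Sum>i<n. if i < m then coord h i * x i else 0) + (\<Sum>i<n. ?c i * x i)" by (rule sum.distrib)
      also have "(\<Sum>i<n. if i < m then coord h i * x i else 0) = (\<Sum>i<m. coord h i * x i)"
        using mn by (intro sum.mono_neutral_cong_right) auto
      finally show ?thesis by (simp add: partial_form_def)
    qed
    then have "sqd (partial_form n h) (partial_form m h) = ennreal (\<Sum>i<n. (?c i)\<^sup>2)"
      unfolding sqd_def using finite_form_moment[of "{..<n}" ?c] by simp
    also have "(\<Sum>i<n. (?c i)\<^sup>2) \<le> tail m h"
    proof -
      have "(\<Sum>i<n. (?c i)\<^sup>2) = (\<Sum>i<n. (coord (h - truncate m h) i)\<^sup>2)"
        by (intro sum.cong) (auto simp: coord_diff coord_truncate)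
      then show ?thesis using partial_norm_le[where x="h - truncate m h" and n=n] by (simp add: tail_def)
    qed
    finally show ?thesis by (simp add: ennreal_leI)
  qed
  show ?thesis
  proof (cases "m \<le> n")
    case True
    have "sqd (partial_form m h) (partial_form n h) \<le> ennreal (tail m h)" using aux[OF True] by (simp add: sqd_commute)
    also have "\<dots> \<le> ennreal (tail m h + tail n h)" by (intro ennreal_leI) (simp add: tail_nonneg)
    finally show ?thesis .
  next
    case False
    then have "sqd (partial_form m h) (partial_form n h) \<le> ennreal (tail n h)" using aux[of n m] by simp
    also have "\<dots> \<le> ennreal (tail m h + tail n h)" by (intro ennreal_leI) (simp add: tail_nonneg)
    finally show ?thesis .
  qed
qed

lemma tail_tendsto: "(\<lambda>n. tail n h) \<longlonglongrightarrow> 0"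
  unfolding tail_def by (rule truncate_tendsto)

text \<open>Riesz-Fischer by hand: along a subsequence with tails at most \<open>(1/8) ^ k\<close>
  the increments are summable in L1, hence the subsequence converges almost everywhere, and Fatou's
  lemma bounds the distance from its limit to each partial form.\<close>

lemma gaussian_form_exists:
  "\<exists>f. f \<in> borel_measurable gaussian_space \<and> (\<lambda>n. sqd f (partial_form n h)) \<longlonglongrightarrow> 0"
proof -
  have "\<exists>n. tail n h \<le> (1/8) ^ k" for k
  proof -
    have "eventually (\<lambda>n. tail n h < (1/8) ^ k) sequentially"
      by (rule order_tendstoD(2)[OF tail_tendsto]) simp
    then show ?thesis by (auto simp: eventually_sequentially intro: less_imp_le)
  qed
  then have "\<forall>k. \<exists>n. tail n h \<le> (1/8) ^ k" by simp
  from choice[OF this] obtain N where N: "\<forall>k. tail (N k) h \<le> (1/8) ^ k" ..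
  define S where "S k = partial_form (N k) h" for k
  have Sm [measurable]: "S k \<in> borel_measurable gaussian_space" for k unfolding S_def by measurable
  define f where "f x = lim (\<lambda>k. S k x)" for x
  have fm [measurable]: "f \<in> borel_measurable gaussian_space"
    unfolding f_def by (rule borel_measurable_lim_metric) measurable
  have int: "(\<integral>\<^sup>+ x. ennreal \<bar>S (Suc k) x - S k x\<bar> \<partial>gaussian_space) \<le> ennreal (3 * (1/2) ^ k)" for k
  proof -
    \<comment> \<open>An elementary passage from L2 to L1: with squared increments of order
      \<open>(1/8) ^ k\<close> both terms are at most of order \<open>(1/2) ^ k\<close>.\<close>
    have ptw: "\<bar>d\<bar> \<le> (1/2) ^ k + 2 ^ k * d\<^sup>2" for d :: real
    proof (cases "2 ^ k * \<bar>d\<bar> \<le> 1")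
      case True
      then have "\<bar>d\<bar> \<le> (1/2) ^ k" by (simp add: power_one_over field_simps)
      then show ?thesis by (intro add_increasing2) auto
    next
      case False
      then have "1 * \<bar>d\<bar> \<le> (2 ^ k * \<bar>d\<bar>) * \<bar>d\<bar>" by (intro mult_right_mono) auto
      also have "\<dots> = 2 ^ k * d\<^sup>2" by (simp add: power2_eq_square)
      finally show ?thesis by (intro add_increasing) auto
    qed
    have "(\<integral>\<^sup>+ x. ennreal \<bar>S (Suc k) x - S k x\<bar> \<partial>gaussian_space)
      \<le> (\<integral>\<^sup>+ x. ennreal ((1/2) ^ k) + ennreal (2 ^ k) * ennreal ((S (Suc k) x - S k x)\<^sup>2) \<partial>gaussian_space)"
      using ptw by (intro nn_integral_mono) (simp add: ennreal_mult[symmetric] ennreal_plus[symmetric] ennreal_leI del: ennreal_plus)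
    also have "\<dots> = ennreal ((1/2) ^ k) + ennreal (2 ^ k) * sqd (S (Suc k)) (S k)"
      by (subst nn_integral_add) (auto simp: nn_integral_cmult sqd_def gaussian.emeasure_space_1)
    also have "\<dots> \<le> ennreal ((1/2) ^ k) + ennreal (2 ^ k) * ennreal ((1/8) ^ k + (1/8) ^ k)"
    proof (intro add_left_mono mult_left_mono)
      have "sqd (S (Suc k)) (S k) \<le> ennreal (tail (N (Suc k)) h + tail (N k) h)"
        unfolding S_def by (rule sqd_partial_form)
      also have "\<dots> \<le> ennreal ((1/8) ^ k + (1/8) ^ k)"
      proof (intro ennreal_leI add_mono)
        have "tail (N (Suc k)) h \<le> (1/8) ^ Suc k" using N by blast
        also have "\<dots> \<le> (1/8) ^ k" by simp
        finally show "tail (N (Suc k)) h \<le> (1/8) ^ k" .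
      qed (use N in blast)
      finally show "sqd (S (Suc k)) (S k) \<le> ennreal ((1/8) ^ k + (1/8) ^ k)" .
    qed simp
    also have "\<dots> = ennreal ((1/2) ^ k + 2 ^ k * ((1/8) ^ k + (1/8) ^ k))"
      by (simp add: ennreal_mult[symmetric] ennreal_plus[symmetric] del: ennreal_plus)
    also have "\<dots> \<le> ennreal (3 * (1/2) ^ k)"
    proof (rule ennreal_leI)
      have "2 ^ k * (1/8 :: real) ^ k = (1/4) ^ k" by (simp add: power_mult_distrib[symmetric])
      moreover have "(1/4 :: real) ^ k \<le> (1/2) ^ k" by (rule power_mono) auto
      ultimately show "(1/2 :: real) ^ k + 2 ^ k * ((1/8) ^ k + (1/8) ^ k) \<le> 3 * (1/2) ^ k" by (simp add: distrib_left)
    qed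
    finally show ?thesis .
  qed
  have "(\<integral>\<^sup>+ x. (\<Sum>k. ennreal \<bar>S (Suc k) x - S k x\<bar>) \<partial>gaussian_space) = (\<Sum>k. \<integral>\<^sup>+ x. ennreal \<bar>S (Suc k) x - S k x\<bar> \<partial>gaussian_space)"
    by (rule nn_integral_suminf) measurable
  also have "\<dots> \<le> (\<Sum>k. ennreal (3 * (1/2) ^ k))" by (intro suminf_le int) auto
  also have "\<dots> = ennreal (3 * (1 / (1 - 1/2)))"
  proof (rule suminf_ennreal_eq)
    show "(\<lambda>k. 3 * (1/2 :: real) ^ k) sums (3 * (1 / (1 - 1/2)))" by (intro sums_mult geometric_sums) simp
  qed simp
  also have "\<dots> < \<infinity>" by simp
  finally have "AE x in gaussian_space. (\<Sum>k. ennreal \<bar>S (Suc k) x - S k x\<bar>) \<noteq> \<infinity>"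
    by (intro nn_integral_PInf_AE) (auto simp: less_top)
  then have conv: "AE x in gaussian_space. (\<lambda>k. S k x) \<longlonglongrightarrow> f x"
  proof eventually_elim
    case (elim x)
    then have "summable (\<lambda>k. \<bar>S (Suc k) x - S k x\<bar>)" by (intro summable_suminf_not_top) (auto simp: top_unique)
    then have "summable (\<lambda>k. S (Suc k) x - S k x)" by (rule summable_rabs_cancel)
    then have "convergent (\<lambda>K. \<Sum>k<K. S (Suc k) x - S k x)" by (simp only: summable_iff_convergent)
    then have "convergent (\<lambda>K. S K x - S 0 x)" by (simp only: sum_lessThan_telescope[of "\<lambda>k. S k x"])
    then obtain L where "(\<lambda>K. S K x - S 0 x) \<longlonglongrightarrow> L" by (auto simp: convergent_def)
    from tendsto_add[OF this tendsto_const[of "S 0 x"]] have "convergent (\<lambda>k. S k x)" by (auto simp: convergent_def)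
    then show ?case by (simp add: f_def convergent_LIMSEQ_iff)
  qed
  have bound: "sqd f (partial_form n h) \<le> ennreal (tail n h)" for n
  proof -
    have "sqd f (partial_form n h) = (\<integral>\<^sup>+ x. liminf (\<lambda>k. ennreal ((S k x - partial_form n h x)\<^sup>2)) \<partial>gaussian_space)"
      unfolding sqd_def
    proof (rule nn_integral_cong_AE, use conv in eventually_elim)
      case (elim x)
      have "(\<lambda>k. ennreal ((S k x - partial_form n h x)\<^sup>2)) \<longlonglongrightarrow> ennreal ((f x - partial_form n h x)\<^sup>2)"
        by (intro tendsto_ennrealI tendsto_intros elim)
      from lim_imp_Liminf[OF trivial_limit_sequentially this] show ?case by (rule sym)
    qed
    also have "\<dots> \<le> liminf (\<lambda>k. sqd (S k) (partial_form n h))"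
      unfolding sqd_def by (rule nn_integral_liminf) measurable
    also have "\<dots> \<le> liminf (\<lambda>k. ennreal ((1/8) ^ k + tail n h))"
    proof (intro Liminf_mono always_eventually allI)
      fix k
      have "sqd (S k) (partial_form n h) \<le> ennreal (tail (N k) h + tail n h)" unfolding S_def by (rule sqd_partial_form)
      also have "\<dots> \<le> ennreal ((1/8) ^ k + tail n h)" using N by (intro ennreal_leI) auto
      finally show "sqd (S k) (partial_form n h) \<le> ennreal ((1/8) ^ k + tail n h)" .
    qed
    also have "\<dots> = ennreal (0 + tail n h)"
    proof (rule lim_imp_Liminf)
      have "(\<lambda>k. (1/8::real) ^ k) \<longlonglongrightarrow> 0" by (rule LIMSEQ_realpow_zero) auto
      then show "(\<lambda>k. ennreal ((1/8) ^ k + tail n h)) \<longlonglongrightarrow> ennreal (0 + tail n h)"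
        by (intro tendsto_ennrealI tendsto_add tendsto_const)
    qed simp
    finally show ?thesis by simp
  qed
  have "(\<lambda>n. ennreal (tail n h)) \<longlonglongrightarrow> 0"
    using tendsto_ennrealI[OF tail_tendsto[of h]] by simp
  then have "(\<lambda>n. sqd f (partial_form n h)) \<longlonglongrightarrow> 0"
    by (rule tendsto_sandwich[OF _ _ tendsto_const, rotated 2]) (use bound in auto)
  then show ?thesis using fm by blast
qed

definition form :: "l2 \<Rightarrow> (nat \<Rightarrow> real) \<Rightarrow> real" where
  "form h = gaussian_form (coord h)"

text \<open>By \<open>gaussian_form_exists\<close> the choice in \<open>gaussian_form\<close> picks
  a genuine limit. Linearity and the values on basis vectors then hold almost everywhere, by
  uniqueness of L2 limits.\<close>

lemma form_props:
  shows form_measurable [measurable]: "form h \<in> borel_measurable gaussian_space"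
    and form_limit: "(\<lambda>n. sqd (form h) (partial_form n h)) \<longlonglongrightarrow> 0"
proof -
  let ?P = "\<lambda>f. f \<in> borel_measurable gaussian_space \<and> (\<lambda>n. \<integral>\<^sup>+ x. ennreal ((f x - (\<Sum>i<n. coord h i * x i))\<^sup>2) \<partial>gaussian_space) \<longlonglongrightarrow> 0"
  have "\<exists>f. ?P f" using gaussian_form_exists[of h] unfolding sqd_def partial_form_def .
  from someI_ex[OF this] have "?P (form h)" unfolding form_def gaussian_form_def .
  then show "form h \<in> borel_measurable gaussian_space" "(\<lambda>n. sqd (form h) (partial_form n h)) \<longlonglongrightarrow> 0"
    unfolding sqd_def partial_form_def by (rule conjunct1, rule conjunct2)
qed

lemma sqd_combination:
  assumes [measurable]: "f \<in> borel_measurable gaussian_space" "f' \<in> borel_measurable gaussian_space"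
    "g \<in> borel_measurable gaussian_space" "g' \<in> borel_measurable gaussian_space"
  shows "sqd (\<lambda>x. a * f x + b * g x) (\<lambda>x. a * f' x + b * g' x) \<le> ennreal (2 * a\<^sup>2) * sqd f f' + ennreal (2 * b\<^sup>2) * sqd g g'"
proof -
  have "sqd (\<lambda>x. a * f x + b * g x) (\<lambda>x. a * f' x + b * g' x)
    \<le> (\<integral>\<^sup>+ x. ennreal (2 * a\<^sup>2) * ennreal ((f x - f' x)\<^sup>2) + ennreal (2 * b\<^sup>2) * ennreal ((g x - g' x)\<^sup>2) \<partial>gaussian_space)"
    unfolding sqd_def
  proof (rule nn_integral_mono)
    fix x
    have eq: "a * f x + b * g x - (a * f' x + b * g' x) = a * (f x - f' x) + b * (g x - g' x)" by (simp add: algebra_simps)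
    have "0 \<le> (a * (f x - f' x) - b * (g x - g' x))\<^sup>2" by simp
    then have "(a * f x + b * g x - (a * f' x + b * g' x))\<^sup>2 \<le> 2 * a\<^sup>2 * (f x - f' x)\<^sup>2 + 2 * b\<^sup>2 * (g x - g' x)\<^sup>2"
      unfolding eq by (simp add: power2_sum power2_diff power_mult_distrib)
    then have "ennreal ((a * f x + b * g x - (a * f' x + b * g' x))\<^sup>2) \<le> ennreal (2 * a\<^sup>2 * (f x - f' x)\<^sup>2 + 2 * b\<^sup>2 * (g x - g' x)\<^sup>2)"
      by (rule ennreal_leI)
    then show "ennreal ((a * f x + b * g x - (a * f' x + b * g' x))\<^sup>2)
      \<le> ennreal (2 * a\<^sup>2) * ennreal ((f x - f' x)\<^sup>2) + ennreal (2 * b\<^sup>2) * ennreal ((g x - g' x)\<^sup>2)"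
      by (simp add: ennreal_mult[symmetric] ennreal_plus[symmetric] del: ennreal_plus)
  qed
  also have "\<dots> = ennreal (2 * a\<^sup>2) * sqd f f' + ennreal (2 * b\<^sup>2) * sqd g g'"
    unfolding sqd_def by (subst nn_integral_add) (auto simp: nn_integral_cmult)
  finally show ?thesis .
qed

lemma form_combination: "AE x in gaussian_space. form (a *\<^sub>R h + b *\<^sub>R k) x = a * form h x + b * form k x"
proof (rule sqd_limit_unique[where F="\<lambda>n. partial_form n (a *\<^sub>R h + b *\<^sub>R k)"])
  have pf: "partial_form n (a *\<^sub>R h + b *\<^sub>R k) = (\<lambda>x. a * partial_form n h x + b * partial_form n k x)" for n
    by (simp add: partial_form_def fun_eq_iff coord_add coord_scaleR distrib_right sum.distrib sum_distrib_left mult.assoc)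
  have "(\<lambda>n. ennreal (2 * a\<^sup>2) * sqd (form h) (partial_form n h) + ennreal (2 * b\<^sup>2) * sqd (form k) (partial_form n k))
      \<longlonglongrightarrow> ennreal (2 * a\<^sup>2) * 0 + ennreal (2 * b\<^sup>2) * 0"
    by (intro tendsto_add ennreal_tendsto_cmult form_limit) auto
  then have lim: "(\<lambda>n. ennreal (2 * a\<^sup>2) * sqd (form h) (partial_form n h) + ennreal (2 * b\<^sup>2) * sqd (form k) (partial_form n k)) \<longlonglongrightarrow> 0"
    by simp
  show "(\<lambda>n. sqd (\<lambda>x. a * form h x + b * form k x) (partial_form n (a *\<^sub>R h + b *\<^sub>R k))) \<longlonglongrightarrow> 0"
    unfolding pf
  proof (rule tendsto_sandwich[OF _ _ tendsto_const lim])
    show "\<forall>\<^sub>F n in sequentially. sqd (\<lambda>x. a * form h x + b * form k x) (\<lambda>x. a * partial_form n h x + b * partial_form n k x)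
        \<le> ennreal (2 * a\<^sup>2) * sqd (form h) (partial_form n h) + ennreal (2 * b\<^sup>2) * sqd (form k) (partial_form n k)"
      by (intro always_eventually allI sqd_combination) measurable
  qed simp
qed (auto intro: form_limit)

lemma form_unit: "AE x in gaussian_space. form (unit i) x = x i"
proof (rule sqd_limit_unique[where F="\<lambda>n. partial_form n (unit i)"])
  have "partial_form n (unit i) = (\<lambda>x. x i)" if "i < n" for n
  proof
    fix x
    have "(\<Sum>j<n. coord (unit i) j * x j) = (\<Sum>j<n. if j = i then x j else 0)" by (intro sum.cong) (auto simp: coord_unit)
    then show "partial_form n (unit i) x = x i" using that by (simp add: partial_form_def)
  qed
  then have "sqd (\<lambda>x. x i) (partial_form n (unit i)) = 0" if "i < n" for n using that by (simp add: sqd_def)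
  then have "eventually (\<lambda>n. sqd (\<lambda>x. x i) (partial_form n (unit i)) = 0) sequentially"
    using eventually_gt_at_top[of i] by (rule eventually_mono[rotated])
  then show "(\<lambda>n. sqd (\<lambda>x. x i) (partial_form n (unit i))) \<longlonglongrightarrow> 0" by (rule tendsto_eventually)
qed (auto intro: form_limit)

lemma iexp_diff_le: "cmod (iexp a - iexp b) \<le> \<bar>a - b\<bar>"
proof -
  have "iexp a - iexp b = iexp b * (iexp (a - b) - 1)"
    by (simp add: exp_add[symmetric] algebra_simps)
  then have "cmod (iexp a - iexp b) = cmod (iexp (a - b) - 1)" by (simp add: norm_mult)
  also have "\<dots> \<le> \<bar>a - b\<bar>" using iexp_approx1[of "a - b" 0] by simp
  finally show ?thesis .
qed

lemma gaussian_char_limit: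
  assumes [measurable]: "f \<in> borel_measurable gaussian_space" "\<And>n. F n \<in> borel_measurable gaussian_space"
    and lim: "(\<lambda>n. sqd f (F n)) \<longlonglongrightarrow> 0"
  shows "(\<lambda>n. gaussian_char (F n) t) \<longlonglongrightarrow> gaussian_char f t"
proof (rule LIMSEQ_I)
  fix r :: real assume r: "0 < r"
  have int: "integrable gaussian_space (\<lambda>x. iexp (t * g x))" if [measurable]: "g \<in> borel_measurable gaussian_space" for g
    by (rule gaussian.integrable_const_bound[where B=1]) auto
  have le: "ennreal (cmod (gaussian_char (F n) t - gaussian_char f t)) \<le> ennreal (r / 2) + ennreal (2 * t\<^sup>2 / r) * sqd f (F n)" for n
  proof -
    have "gaussian_char (F n) t - gaussian_char f t = (CLINT x|gaussian_space. iexp (t * F n x) - iexp (t * f x))"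
      unfolding gaussian_char_def by (rule Bochner_Integration.integral_diff[OF int int, symmetric]) measurable
    then have "ennreal (cmod (gaussian_char (F n) t - gaussian_char f t))
       \<le> (\<integral>\<^sup>+ x. ennreal (cmod (iexp (t * F n x) - iexp (t * f x))) \<partial>gaussian_space)"
      by (simp only:) (rule integral_norm_bound_ennreal[OF Bochner_Integration.integrable_diff[OF int int]]; measurable)
    also have "\<dots> \<le> (\<integral>\<^sup>+ x. ennreal (r / 2) + ennreal (2 * t\<^sup>2 / r) * ennreal ((f x - F n x)\<^sup>2) \<partial>gaussian_space)"
    proof (rule nn_integral_mono)
      fix x
      let ?d = "t * (f x - F n x)"
      have "cmod (iexp (t * F n x) - iexp (t * f x)) \<le> \<bar>?d\<bar>"
        using iexp_diff_le[of "t * F n x" "t * f x"] by (simp add: right_diff_distrib abs_minus_commute)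
      also have "\<dots> \<le> r / 2 + 2 * t\<^sup>2 / r * (f x - F n x)\<^sup>2"
      proof -
        \<comment> \<open>Arithmetic-geometric mean: the absolute difference is split into the fixed
          amount \<open>r / 2\<close> and a multiple of the square, which \<open>sqd\<close>
          controls.\<close>
        have "0 \<le> (r / 2 - \<bar>?d\<bar>)\<^sup>2" by simp
        then have "r * \<bar>?d\<bar> \<le> r\<^sup>2 / 4 + ?d\<^sup>2" by (simp add: power2_diff power_divide)
        also have "\<dots> \<le> r\<^sup>2 / 2 + 2 * ?d\<^sup>2"
          using zero_le_power2[of r] zero_le_power2[of ?d] by linarith
        also have "\<dots> = r * (r / 2 + 2 * t\<^sup>2 / r * (f x - F n x)\<^sup>2)"
          using r by (simp add: field_simps power2_eq_square)
        finally show ?thesis using r by simp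
      qed
      finally show "ennreal (cmod (iexp (t * F n x) - iexp (t * f x))) \<le> ennreal (r / 2) + ennreal (2 * t\<^sup>2 / r) * ennreal ((f x - F n x)\<^sup>2)"
        using r by (simp add: ennreal_mult[symmetric] ennreal_plus[symmetric] ennreal_leI del: ennreal_plus)
    qed
    also have "\<dots> = ennreal (r / 2) + ennreal (2 * t\<^sup>2 / r) * sqd f (F n)"
      by (subst nn_integral_add) (auto simp: nn_integral_cmult sqd_def gaussian.emeasure_space_1)
    finally show ?thesis .
  qed
  have "(\<lambda>n. ennreal (r / 2) + ennreal (2 * t\<^sup>2 / r) * sqd f (F n)) \<longlonglongrightarrow> ennreal (r / 2) + ennreal (2 * t\<^sup>2 / r) * 0"
    by (intro tendsto_add tendsto_const ennreal_tendsto_cmult lim) auto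
  then have "eventually (\<lambda>n. ennreal (r / 2) + ennreal (2 * t\<^sup>2 / r) * sqd f (F n) < ennreal r) sequentially"
    using r by (intro order_tendstoD(2)) (auto simp: ennreal_less_iff)
  then obtain no where no: "\<And>n. no \<le> n \<Longrightarrow> ennreal (r / 2) + ennreal (2 * t\<^sup>2 / r) * sqd f (F n) < ennreal r"
    by (auto simp: eventually_sequentially)
  have "norm (gaussian_char (F n) t - gaussian_char f t) < r" if "no \<le> n" for n
    using le_less_trans[OF le no[OF that]] by (simp add: ennreal_less_iff)
  then show "\<exists>no. \<forall>n\<ge>no. norm (gaussian_char (F n) t - gaussian_char f t) < r" by blast
qed

lemma gaussian_char_form: "gaussian_char (form h) t = complex_of_real (exp (- (t\<^sup>2 * (norm h)\<^sup>2 / 2)))"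
proof -
  have "(\<lambda>n. gaussian_char (partial_form n h) t) \<longlonglongrightarrow> gaussian_char (form h) t"
    by (rule gaussian_char_limit) (auto intro: form_limit)
  moreover have "(\<lambda>n. gaussian_char (partial_form n h) t) \<longlonglongrightarrow> complex_of_real (exp (- (t\<^sup>2 * (norm h)\<^sup>2 / 2)))"
  proof -
    have "gaussian_char (partial_form n h) t = complex_of_real (exp (- (t\<^sup>2 * (\<Sum>i<n. (coord h i)\<^sup>2) / 2)))" for n
      unfolding partial_form_def[abs_def] by (rule gaussian_char_sum) simp
    moreover have "(\<lambda>n. \<Sum>i<n. (coord h i)\<^sup>2) \<longlonglongrightarrow> (norm h)\<^sup>2"
      unfolding norm_sq_l2 by (rule summable_LIMSEQ[OF summable_coord_sq])
    then have "(\<lambda>n. complex_of_real (exp (- (t\<^sup>2 * (\<Sum>i<n. (coord h i)\<^sup>2) / 2)))) \<longlonglongrightarrow> complex_of_real (exp (- (t\<^sup>2 * (norm h)\<^sup>2 / 2)))"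
      by (intro tendsto_intros) auto
    ultimately show ?thesis by simp
  qed
  ultimately show ?thesis by (rule LIMSEQ_unique)
qed

text \<open>So \<open>form\<close> embeds \<open>l2\<close> isometrically into L2, and distances
  between observables become distances between vectors.\<close>

lemma sqd_form: "sqd (form h) (form k) = ennreal ((norm (h - k))\<^sup>2)"
proof -
  have "sqd (form h) (form k) = (\<integral>\<^sup>+ x. ennreal ((form (h - k) x)\<^sup>2) \<partial>gaussian_space)"
    unfolding sqd_def
  proof (rule nn_integral_cong_AE)
    have "AE x in gaussian_space. form (1 *\<^sub>R h + (-1) *\<^sub>R k) x = 1 * form h x + (-1) * form k x" by (rule form_combination)
    then show "AE x in gaussian_space. ennreal ((form h x - form k x)\<^sup>2) = ennreal ((form (h - k) x)\<^sup>2)"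
      by eventually_elim simp
  qed
  also have "\<dots> = ennreal ((norm (h - k))\<^sup>2)"
    by (rule gaussian_second_moment[OF form_measurable gaussian_char_form])
  finally show ?thesis .
qed

lemma form_sum:
  fixes d :: nat
  shows "AE x in gaussian_space. form (\<Sum>j<d. t j *\<^sub>R g j) x = (\<Sum>j<d. t j * form (g j) x)"
proof (induction d)
  case 0
  have "AE x in gaussian_space. form (0 *\<^sub>R 0 + 0 *\<^sub>R 0) x = 0 * form 0 x + 0 * form 0 x" by (rule form_combination)
  then show ?case by simp
next
  case (Suc d)
  have "AE x in gaussian_space. form (1 *\<^sub>R (\<Sum>j<d. t j *\<^sub>R g j) + t d *\<^sub>R g d) x = 1 * form (\<Sum>j<d. t j *\<^sub>R g j) x + t d * form (g d) x"
    by (rule form_combination)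
  with Suc show ?case by eventually_elim simp
qed

subsection \<open>Orthonormal families are independent\<close>

context prob_space
begin

text \<open>Under the probability measure with density \<open>v\<close> divided by its mean,
  \<open>Y\<close> has the standard normal characteristic function, and Levy's uniqueness theorem
  gives its law. If the mean is 0, then \<open>v\<close> vanishes almost everywhere.\<close>

lemma weighted_normal:
  assumes v [measurable]: "v \<in> borel_measurable M" and v0: "\<And>x. 0 \<le> v x" and vb: "\<And>x. v x \<le> b"
    and Y [measurable]: "Y \<in> borel_measurable M"
    and ch: "\<And>s. (CLINT x|M. v x *\<^sub>R iexp (s * Y x)) = complex_of_real (expectation v * exp (- (s\<^sup>2 / 2)))"
    and B [measurable]: "B \<in> sets borel"
  shows "expectation (\<lambda>x. v x * indicator B (Y x)) = expectation v * measure std_normal B"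
proof -
  have vi: "integrable M v" by (rule integrable_const_bound[where B=b]) (use v0 vb in auto)
  show ?thesis
  proof (cases "expectation v = 0")
    case True
    then have "AE x in M. v x = 0" using integral_nonneg_eq_0_iff_AE[OF vi] v0 by auto
    then have "expectation (\<lambda>x. v x * indicator B (Y x)) = expectation (\<lambda>x. 0)"
      by (intro integral_cong_AE) auto
    then show ?thesis using True by simp
  next
    case False
    define a where "a = expectation v"
    have a: "0 < a" using False v0 by (simp add: a_def less_le integral_nonneg)
    define D where "D = density M (\<lambda>x. ennreal (v x / a))"
    have D_int: "integral\<^sup>L D g = (LINT x|M. (v x / a) *\<^sub>R g x)" if [measurable]: "g \<in> borel_measurable M" for g :: "'a \<Rightarrow> 'b::{banach, second_countable_topology}"
      unfolding D_def by (rule integral_density) (use a v0 in auto)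
    have "emeasure D (space D) = (\<integral>\<^sup>+ x. ennreal (v x / a) \<partial>M)" unfolding D_def by (subst emeasure_density) (auto intro!: nn_integral_cong)
    also have "\<dots> = ennreal (LINT x|M. v x / a)" by (rule nn_integral_eq_integral) (use vi a v0 in auto)
    also have "(LINT x|M. v x / a) = 1" using a by (simp add: a_def)
    finally interpret D: prob_space D by (intro prob_spaceI) simp
    have YD [measurable]: "Y \<in> borel_measurable D" by (simp add: D_def)
    have "distr D borel Y = std_normal"
    proof (rule Levy_uniqueness)
      show "real_distribution (distr D borel Y)"
        by (simp add: real_distribution_def real_distribution_axioms_def D.prob_space_distr)
      show "char (distr D borel Y) = char std_normal"
      proof
        fix s
        have "char (distr D borel Y) s = (CLINT x|D. iexp (s * Y x))" unfolding char_def by (subst integral_distr) auto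
        also have "\<dots> = (CLINT x|M. (v x / a) *\<^sub>R iexp (s * Y x))" by (rule D_int) measurable
        also have "\<dots> = (CLINT x|M. inverse a *\<^sub>R (v x *\<^sub>R iexp (s * Y x)))" by (simp add: divide_inverse mult.commute)
        also have "\<dots> = inverse a *\<^sub>R (CLINT x|M. v x *\<^sub>R iexp (s * Y x))" by (rule integral_scaleR_right)
        also have "\<dots> = inverse a *\<^sub>R complex_of_real (a * exp (- (s\<^sup>2 / 2)))" by (simp only: ch a_def)
        also have "\<dots> = char std_normal s" using a by (simp add: char_std_normal_distribution scaleR_conv_of_real)
        finally show "char (distr D borel Y) s = char std_normal s" .
      qed
    qed (rule real_dist_normal_dist)
    then have "measure std_normal B = measure (distr D borel Y) B" by simp
    also have "\<dots> = measure D (Y -` B \<inter> space D)" by (rule measure_distr) auto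
    also have "\<dots> = (LINT x|D. indicator B (Y x))"
    proof -
      have "(LINT x|D. indicator B (Y x) :: real) = (LINT x|D. indicator (Y -` B \<inter> space D) x)"
        by (intro Bochner_Integration.integral_cong) (auto split: split_indicator)
      then show ?thesis by simp
    qed
    also have "\<dots> = (LINT x|M. (v x / a) *\<^sub>R indicator B (Y x))" by (rule D_int) measurable
    also have "\<dots> = (LINT x|M. inverse a * (v x * indicator B (Y x)))" by (simp add: divide_inverse mult_ac)
    also have "\<dots> = inverse a * (LINT x|M. v x * indicator B (Y x))" by simp
    finally show ?thesis using a by (simp add: a_def field_simps)
  qed
qed

text \<open>Characteristic functions determine finite families of independent normal variables; the
  weight \<open>w\<close> carries the indicators already split off. Applying the one-dimensional case to the weights
  \<open>w (1 + cos Z)\<close> and \<open>w (1 + sin Z)\<close> shows that the indicator may be split off under \<open>iexp Z\<close>.\<close>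

lemma weighted_normal_family:
  fixes Y :: "nat \<Rightarrow> 'a \<Rightarrow> real"
  assumes Y [measurable]: "\<And>j. Y j \<in> borel_measurable M" and B: "\<And>j. B j \<in> sets borel"
    and w: "w \<in> borel_measurable M" "\<And>x. 0 \<le> w x" "\<And>x. w x \<le> 1"
    and ch: "\<And>t. (CLINT x|M. w x *\<^sub>R iexp (\<Sum>j<d. t j * Y j x)) = complex_of_real (expectation w * exp (- ((\<Sum>j<d. (t j)\<^sup>2) / 2)))"
  shows "expectation (\<lambda>x. w x * (\<Prod>j<d. indicator (B j) (Y j x))) = expectation w * (\<Prod>j<d. measure std_normal (B j))"
  using w ch
proof (induction d arbitrary: w)
  case (Suc d)
  note w [measurable] = Suc.prems(1) and w0 = Suc.prems(2) and w1 = Suc.prems(3)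
  have Bd [measurable]: "B d \<in> sets borel" by (rule B)
  have ch: "(CLINT x|M. w x *\<^sub>R iexp ((\<Sum>j<d. t j * Y j x) + s * Y d x))
      = complex_of_real (expectation w * (exp (- ((\<Sum>j<d. (t j)\<^sup>2) / 2)) * exp (- (s\<^sup>2 / 2))))" for t s
    using Suc.prems(4)[of "t(d := s)"] by (simp add: exp_add[symmetric] add_divide_distrib)
  have int: "integrable M (\<lambda>x. w x *\<^sub>R iexp (f x))" if [measurable]: "f \<in> borel_measurable M" for f
    by (rule integrable_const_bound[where B=1]) (use w0 w1 in auto)
  have wi: "integrable M w" by (rule integrable_const_bound[where B=1]) (use w0 w1 in auto)
  let ?P = "measure std_normal (B d)"
  have base: "expectation (\<lambda>x. w x * indicator (B d) (Y d x)) = expectation w * ?P"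
    by (rule weighted_normal[where b=1]) (use w0 w1 ch[of "\<lambda>_. 0"] in auto)
  define w' where "w' x = w x * indicator (B d) (Y d x)" for x
  have w' [measurable]: "w' \<in> borel_measurable M" unfolding w'_def by measurable
  have w'01: "0 \<le> w' x" "w' x \<le> 1" for x using w0[of x] w1[of x] by (auto simp: w'_def split: split_indicator)
  have "expectation (\<lambda>x. w' x * (\<Prod>j<d. indicator (B j) (Y j x))) = expectation w' * (\<Prod>j<d. measure std_normal (B j))"
  proof (rule Suc.IH[OF w' w'01])
    fix t :: "nat \<Rightarrow> real"
    define Z where "Z x = (\<Sum>j<d. t j * Y j x)" for x
    define c where "c = exp (- ((\<Sum>j<d. (t j)\<^sup>2) / 2))"
    have Zm [measurable]: "Z \<in> borel_measurable M" unfolding Z_def by measurable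
    have chp: "(CLINT x|M. w x *\<^sub>R iexp (Z x + s * Y d x)) = complex_of_real (expectation w * (c * exp (- (s\<^sup>2 / 2))))" for s
      using ch[of t s] by (simp add: Z_def c_def)
    have chm: "(CLINT x|M. w x *\<^sub>R iexp (- Z x + s * Y d x)) = complex_of_real (expectation w * (c * exp (- (s\<^sup>2 / 2))))" for s
      using ch[of "\<lambda>j. - t j" s] by (simp add: Z_def c_def sum_negf)
    have ch0: "(CLINT x|M. w x *\<^sub>R iexp (s * Y d x)) = complex_of_real (expectation w * exp (- (s\<^sup>2 / 2)))" for s
      using ch[of "\<lambda>_. 0" s] by simp
    \<comment> \<open>The summand 1 makes the weight nonnegative; its contribution is known from
      \<open>base\<close> and is subtracted afterwards. Through \<open>\<alpha>\<close> and
      \<open>\<beta>\<close> cosine and sine are treated together as combinations of the two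
      exponentials.\<close>
    have trig: "expectation (\<lambda>x. w x * (1 + u x) * indicator (B d) (Y d x)) = expectation (\<lambda>x. w x * (1 + u x)) * ?P"
      if u [measurable]: "u \<in> borel_measurable M" and ub: "\<And>x. \<bar>u x\<bar> \<le> 1"
        and ue: "\<And>x. complex_of_real (u x) = \<alpha> * iexp (Z x) + \<beta> * iexp (- Z x)" for u \<alpha> \<beta>
    proof (rule weighted_normal[where b=2])
      show "0 \<le> w x * (1 + u x)" for x using w0[of x] ub[of x] by (intro mult_nonneg_nonneg) auto
      show "w x * (1 + u x) \<le> 2" for x
      proof -
        have "w x * (1 + u x) \<le> 1 * 2" using w0[of x] w1[of x] ub[of x] by (intro mult_mono) auto
        then show ?thesis by simp
      qed
      have E: "(CLINT x|M. (w x * (1 + u x)) *\<^sub>R iexp (s * Y d x)) = complex_of_real (expectation w * exp (- (s\<^sup>2 / 2))) * (1 + (\<alpha> + \<beta>) * complex_of_real c)" for s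
      proof -
        have "(CLINT x|M. (w x * (1 + u x)) *\<^sub>R iexp (s * Y d x))
          = (CLINT x|M. w x *\<^sub>R iexp (s * Y d x) + (\<alpha> * (w x *\<^sub>R iexp (Z x + s * Y d x)) + \<beta> * (w x *\<^sub>R iexp (- Z x + s * Y d x))))"
        proof (intro Bochner_Integration.integral_cong refl)
          fix x
          have eq: "(w x * (1 + u x)) *\<^sub>R iexp (s * Y d x) = of_real (w x) * iexp (s * Y d x) + of_real (w x) * (of_real (u x) * iexp (s * Y d x))"
            by (simp add: scaleR_conv_of_real algebra_simps)
          have e1: "iexp (Z x + s * Y d x) = iexp (Z x) * iexp (s * Y d x)" by (simp add: exp_add distrib_left)
          have e2: "iexp (- Z x + s * Y d x) = iexp (- Z x) * iexp (s * Y d x)" by (simp only: exp_add distrib_left of_real_add)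
          show "(w x * (1 + u x)) *\<^sub>R iexp (s * Y d x)
             = w x *\<^sub>R iexp (s * Y d x) + (\<alpha> * (w x *\<^sub>R iexp (Z x + s * Y d x)) + \<beta> * (w x *\<^sub>R iexp (- Z x + s * Y d x)))"
            unfolding eq unfolding ue e1 e2 scaleR_conv_of_real by (simp only: ring_distribs mult_ac add_ac)
        qed
        also have "\<dots> = (CLINT x|M. w x *\<^sub>R iexp (s * Y d x)) + (\<alpha> * (CLINT x|M. w x *\<^sub>R iexp (Z x + s * Y d x))
            + \<beta> * (CLINT x|M. w x *\<^sub>R iexp (- Z x + s * Y d x)))"
        proof -
          have i0: "integrable M (\<lambda>x. w x *\<^sub>R iexp (s * Y d x))" by (rule int) measurable
          have i1: "integrable M (\<lambda>x. w x *\<^sub>R iexp (Z x + s * Y d x))" by (rule int) measurable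
          have i2: "integrable M (\<lambda>x. w x *\<^sub>R iexp (- Z x + s * Y d x))" by (rule int) measurable
          show ?thesis
            by (subst Bochner_Integration.integral_add[OF i0 Bochner_Integration.integrable_add[OF integrable_mult_right[OF i1] integrable_mult_right[OF i2]]],
                subst Bochner_Integration.integral_add[OF integrable_mult_right[OF i1] integrable_mult_right[OF i2]])
              (simp only: integral_mult_right_zero)
        qed
        finally show ?thesis unfolding ch0 chp chm by (simp add: algebra_simps)
      qed
      have "complex_of_real (expectation (\<lambda>x. w x * (1 + u x))) = complex_of_real (expectation w) * (1 + (\<alpha> + \<beta>) * complex_of_real c)"
        using E[of 0] by (simp add: scaleR_conv_of_real del: of_real_mult)
      then show "(CLINT x|M. (w x * (1 + u x)) *\<^sub>R iexp (s * Y d x)) = complex_of_real (expectation (\<lambda>x. w x * (1 + u x)) * exp (- (s\<^sup>2 / 2)))" for s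
        unfolding E by simp
    qed measurable
    have uint: "integrable M (\<lambda>x. w x * u x)" "integrable M (\<lambda>x. w' x * u x)" if [measurable]: "u \<in> borel_measurable M" and "\<And>x. \<bar>u x\<bar> \<le> 1" for u
      by (rule integrable_const_bound[where B=1]; use w0 w1 w'01 that in \<open>auto simp: abs_mult intro!: mult_le_one\<close>)+
    have w'i: "integrable M w'" by (rule integrable_const_bound[where B=1]) (use w'01 in auto)
    have split: "expectation (\<lambda>x. w' x * u x) = expectation (\<lambda>x. w x * u x) * ?P"
      if u [measurable]: "u \<in> borel_measurable M" and ub: "\<And>x. \<bar>u x\<bar> \<le> 1"
        and ue: "\<And>x. complex_of_real (u x) = \<alpha> * iexp (Z x) + \<beta> * iexp (- Z x)" for u \<alpha> \<beta>
    proof -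
      have "expectation w' + expectation (\<lambda>x. w' x * u x) = expectation (\<lambda>x. w x * (1 + u x) * indicator (B d) (Y d x))"
        by (subst Bochner_Integration.integral_add[OF w'i uint(2)[OF u ub], symmetric]) (simp add: w'_def algebra_simps)
      also have "\<dots> = expectation (\<lambda>x. w x * (1 + u x)) * ?P" by (rule trig[OF u ub ue])
      also have "expectation (\<lambda>x. w x * (1 + u x)) = expectation w + expectation (\<lambda>x. w x * u x)"
        by (subst Bochner_Integration.integral_add[OF wi uint(1)[OF u ub], symmetric]) (simp add: distrib_left)
      finally have "expectation w' + expectation (\<lambda>x. w' x * u x) = (expectation w + expectation (\<lambda>x. w x * u x)) * ?P" .
      then show ?thesis using base by (simp add: w'_def[symmetric] distrib_right)
    qed
    have c1: "expectation (\<lambda>x. w' x * cos (Z x)) = expectation (\<lambda>x. w x * cos (Z x)) * ?P"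
      by (rule split[of _ "1/2" "1/2"]) (auto simp: complex_eq_iff Re_exp Im_exp)
    have s1: "expectation (\<lambda>x. w' x * sin (Z x)) = expectation (\<lambda>x. w x * sin (Z x)) * ?P"
      by (rule split[of _ "-\<i>/2" "\<i>/2"]) (auto simp: complex_eq_iff Re_exp Im_exp)
    have dec: "(CLINT x|M. v x *\<^sub>R iexp (Z x)) = Complex (expectation (\<lambda>x. v x * cos (Z x))) (expectation (\<lambda>x. v x * sin (Z x)))"
      if "integrable M (\<lambda>x. v x *\<^sub>R iexp (Z x))" for v
    proof (rule complex_eqI)
      show "Re (CLINT x|M. v x *\<^sub>R iexp (Z x)) = Re (Complex (expectation (\<lambda>x. v x * cos (Z x))) (expectation (\<lambda>x. v x * sin (Z x))))"
        using integral_Re[OF that] by (simp add: Re_exp)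
      show "Im (CLINT x|M. v x *\<^sub>R iexp (Z x)) = Im (Complex (expectation (\<lambda>x. v x * cos (Z x))) (expectation (\<lambda>x. v x * sin (Z x))))"
        using integral_Im[OF that] by (simp add: Im_exp)
    qed
    have i': "integrable M (\<lambda>x. w' x *\<^sub>R iexp (Z x))" by (rule integrable_const_bound[where B=1]) (use w'01 in auto)
    have "(CLINT x|M. w' x *\<^sub>R iexp (Z x)) = ?P *\<^sub>R (CLINT x|M. w x *\<^sub>R iexp (Z x))"
      unfolding dec[OF i'] dec[OF int[OF Zm]] c1 s1 by (simp add: complex_eq_iff mult.commute)
    also have "\<dots> = complex_of_real (expectation w' * c)"
      using chp[of 0] base by (simp add: w'_def[symmetric] scaleR_conv_of_real mult_ac)
    finally show "(CLINT x|M. w' x *\<^sub>R iexp (\<Sum>j<d. t j * Y j x)) = complex_of_real (expectation w' * exp (- ((\<Sum>j<d. (t j)\<^sup>2) / 2)))"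
      by (simp add: Z_def c_def)
  qed
  moreover have "expectation (\<lambda>x. w x * (\<Prod>j<Suc d. indicator (B j) (Y j x))) = expectation (\<lambda>x. w' x * (\<Prod>j<d. indicator (B j) (Y j x)))"
    by (simp add: w'_def mult_ac)
  ultimately show ?case using base by (simp add: w'_def[symmetric] mult_ac)
qed simp

end

subsection \<open>Automorphisms from isometries\<close>

text \<open>\<open>W\<close> consists of the points whose forward orbits under \<open>f\<close> and
  under \<open>g\<close> avoid the exceptional set. It has full measure and is invariant under both
  maps, which are mutually inverse on it; off \<open>W\<close> the identity is used.\<close>

lemma automorphism_from_AE_inverse:
  assumes f [measurable]: "f \<in> measurable M M" and g [measurable]: "g \<in> measurable M M"
    and df: "distr M M f = M" and dg: "distr M M g = M"
    and gf: "AE x in M. g (f x) = x" and fg: "AE x in M. f (g x) = x"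
  shows "\<exists>T. automorphism M T \<and> (AE x in M. T x = f x)"
proof -
  have "AE x in M. g (f x) = x \<and> f (g x) = x" using gf fg by eventually_elim simp
  then obtain N where N: "{x \<in> space M. \<not> (g (f x) = x \<and> f (g x) = x)} \<subseteq> N" "emeasure M N = 0" and NM [measurable]: "N \<in> sets M"
    by (rule AE_E)
  define W where "W = {x \<in> space M. \<forall>n. (f ^^ n) x \<notin> N \<and> (g ^^ n) x \<notin> N}"
  have sp: "f x \<in> space M" "g x \<in> space M" if "x \<in> space M" for x
    using measurable_space[OF f that] measurable_space[OF g that] .
  have pm: "k ^^ n \<in> measurable M M" if "k \<in> measurable M M" for k n
  proof (induction n)
    case (Suc n)
    show ?case using measurable_comp[OF Suc that] by (simp only: funpow.simps)
  qed (simp add: id_def)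
  note [measurable] = pm[OF f] pm[OF g]
  have W [measurable]: "W \<in> sets M" unfolding W_def by measurable
  have null: "AE x in M. (k ^^ n) x \<notin> N" if k: "k \<in> measurable M M" "distr M M k = M" for k n
  proof (induction n)
    case 0
    show ?case using N(2) NM by (auto intro!: AE_not_in)
  next
    case (Suc n)
    have "AE x in distr M M k. (k ^^ n) x \<notin> N" unfolding k(2) by (rule Suc)
    from AE_distrD[OF k(1) this] show ?case by (simp only: funpow_Suc_right comp_def)
  qed
  have "AE x in M. \<forall>n. (f ^^ n) x \<notin> N \<and> (g ^^ n) x \<notin> N"
    unfolding AE_all_countable using null[OF f df] null[OF g dg] by auto
  then have WAE: "AE x in M. x \<in> W" using AE_space by eventually_elim (simp add: W_def)
  have fgW: "g (f x) = x" "f (g x) = x" if "x \<in> W" for x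
  proof -
    have "x \<in> space M" "(f ^^ 0) x \<notin> N" using that unfolding W_def by blast+
    then show "g (f x) = x" "f (g x) = x" using N(1) by auto
  qed
  have invW: "f x \<in> W" "g x \<in> W" if x: "x \<in> W" for x
  proof -
    have s: "x \<in> space M" using x by (simp add: W_def)
    have F: "(f ^^ n) x \<notin> N" "(g ^^ n) x \<notin> N" for n using x by (simp_all add: W_def)
    have "(f ^^ n) (f x) \<notin> N" "(g ^^ n) (g x) \<notin> N" for n
      using F[of "Suc n"] by (simp_all add: funpow_swap1)
    moreover have "(g ^^ n) (f x) \<notin> N" "(f ^^ n) (g x) \<notin> N" for n
    proof -
      show "(g ^^ n) (f x) \<notin> N"
        using F(1)[of 1] F(2)[of "n - 1"] fgW(1)[OF x] by (cases n) (simp_all add: funpow_swap1)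
      show "(f ^^ n) (g x) \<notin> N"
        using F(2)[of 1] F(1)[of "n - 1"] fgW(2)[OF x] by (cases n) (simp_all add: funpow_swap1)
    qed
    ultimately show "f x \<in> W" "g x \<in> W" using sp[OF s] by (simp_all add: W_def)
  qed
  let ?T = "\<lambda>x. if x \<in> W then f x else x" and ?T' = "\<lambda>x. if x \<in> W then g x else x"
  have eq: "AE x in M. ?T x = f x" using WAE by eventually_elim simp
  have T [measurable]: "?T \<in> measurable M M" "?T' \<in> measurable M M" by measurable
  have "automorphism M ?T"
  proof (rule automorphismI[where g="?T'"])
    show "distr M M ?T = M" using distr_cong_AE[of M M M M ?T f] eq df T f by auto
  qed (use T invW fgW in auto)
  with eq show ?thesis by (intro exI[of _ ?T] conjI)
qed

locale l2_isometry =
  fixes V V' :: "l2 \<Rightarrow> l2"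
  assumes V_add: "V (x + y) = V x + V y" and V_scaleR: "V (c *\<^sub>R x) = c *\<^sub>R V x"
    and norm_V: "norm (V x) = norm x" and V'_V: "V' (V x) = x" and V_V': "V (V' x) = x"
begin

lemma inverse: "l2_isometry V' V"
proof
  show "V' (x + y) = V' x + V' y" for x y using V'_V[of "V' x + V' y"] by (simp add: V_add V_V')
  show "V' (c *\<^sub>R x) = c *\<^sub>R V' x" for c x using V'_V[of "c *\<^sub>R V' x"] by (simp add: V_scaleR V_V')
  show "norm (V' x) = norm x" for x using norm_V[of "V' x"] by (simp add: V_V')
qed (simp_all add: V'_V V_V')

lemma V_diff: "V (x - y) = V x - V y"
  using V_add[of x "(-1) *\<^sub>R y"] V_scaleR[of "-1" y] by simp

lemma V_sum: "V (\<Sum>i<d. c i *\<^sub>R f i) = (\<Sum>i<d. c i *\<^sub>R V (f i))" for d :: nat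
proof (induction d)
  case 0
  show ?case using V_scaleR[of 0 0] by simp
qed (simp add: V_add V_scaleR)

lemma inner_V: "inner (V x) (V y) = inner x y"
  unfolding dot_norm V_add[symmetric] norm_V ..

end

lemma truncate_combination: "truncate d (\<Sum>j<d. t j *\<^sub>R unit j) = (\<Sum>j<d. t j *\<^sub>R unit j)"
  by (rule l2_eqI) (auto simp: coord_truncate coord_sum coord_scaleR coord_unit)

lemma norm_sq_combination: "(norm (\<Sum>j<d. t j *\<^sub>R unit j))\<^sup>2 = (\<Sum>j<d. (t j)\<^sup>2)"
proof -
  have "coord (\<Sum>j<d. t j *\<^sub>R unit j) i = t i" if "i < d" for i
  proof -
    have "coord (\<Sum>j<d. t j *\<^sub>R unit j) i = (\<Sum>j<d. if j = i then t j else 0)"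
      unfolding coord_sum by (intro sum.cong) (auto simp: coord_scaleR coord_unit)
    then show ?thesis using that by simp
  qed
  then show ?thesis using norm_sq_split[of "\<Sum>j<d. t j *\<^sub>R unit j" d] by (simp add: truncate_combination)
qed

text \<open>This formula is forced: by \<open>implements_coordinate\<close> an automorphism that
  implements \<open>A\<close> has these coordinates almost everywhere.\<close>

definition pull :: "(l2 \<Rightarrow> l2) \<Rightarrow> (nat \<Rightarrow> real) \<Rightarrow> nat \<Rightarrow> real" where
  "pull A x = (\<lambda>i. form (A (unit i)) x)"

lemma pull_measurable [measurable]: "pull A \<in> measurable gaussian_space gaussian_space"
proof -
  have "(\<lambda>x i. form (A (unit i)) x) \<in> measurable gaussian_space (PiM UNIV (\<lambda>_. borel))"
    by (rule measurable_PiM_single') (auto simp: space_PiM)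
  then show ?thesis unfolding pull_def by (simp add: measurable_cong_sets[OF refl sets_gaussian])
qed

text \<open>The coordinates of \<open>pull V\<close> are forms of an orthonormal family. As
  \<open>V\<close> is an isometry, each linear combination of them has the normal characteristic
  function with the right variance, and \<open>weighted_normal_family\<close> makes them independent
  standard normal variables.\<close>

lemma (in l2_isometry) distr_pull: "distr gaussian_space gaussian_space (pull V) = gaussian_space"
proof -
  interpret N: prob_space std_normal by (rule prob_space_std_normal)
  interpret PP: product_prob_space "\<lambda>_::nat. std_normal" UNIV by unfold_locales
  have "distr gaussian_space gaussian_space (pull V) = PiM UNIV (\<lambda>_. std_normal)"
  proof (rule PP.PiM_eq)
    show "sets (distr gaussian_space gaussian_space (pull V)) = sets (PiM UNIV (\<lambda>_::nat. std_normal))"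
      by (simp add: gaussian_space_def)
    fix J :: "nat set" and F
    assume J: "finite J" and F: "\<And>j. j \<in> J \<Longrightarrow> F j \<in> sets std_normal"
    obtain d where d: "J \<subseteq> {..<d}" using J finite_nat_iff_bounded by blast
    define B where "B j = (if j \<in> J then F j else UNIV)" for j
    have B: "B j \<in> sets borel" for j using F[of j] by (simp add: B_def)
    let ?Y = "\<lambda>j. form (V (unit j))"
    have ch: "(CLINT x|gaussian_space. 1 *\<^sub>R iexp (\<Sum>j<d. t j * ?Y j x))
        = complex_of_real (gaussian.expectation (\<lambda>_. 1) * exp (- ((\<Sum>j<d. (t j)\<^sup>2) / 2)))" for t
    proof -
      let ?u = "\<Sum>j<d. t j *\<^sub>R unit j"
      have "(CLINT x|gaussian_space. 1 *\<^sub>R iexp (\<Sum>j<d. t j * ?Y j x)) = gaussian_char (form (V ?u)) 1"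
        unfolding gaussian_char_def V_sum
      proof (rule integral_cong_AE)
        show "AE x in gaussian_space. 1 *\<^sub>R iexp (\<Sum>j<d. t j * ?Y j x) = iexp (1 * form (\<Sum>j<d. t j *\<^sub>R V (unit j)) x)"
          using form_sum[where t=t and g="\<lambda>j. V (unit j)" and d=d] by eventually_elim simp
      qed measurable
      then show ?thesis by (simp add: gaussian_char_form norm_V norm_sq_combination gaussian.prob_space)
    qed
    have "gaussian.expectation (\<lambda>x. 1 * (\<Prod>j<d. indicator (B j) (?Y j x))) = gaussian.expectation (\<lambda>_. 1) * (\<Prod>j<d. measure std_normal (B j))"
      by (rule gaussian.weighted_normal_family) (use B ch in auto)
    then have E: "gaussian.expectation (\<lambda>x. \<Prod>j<d. indicator (B j) (?Y j x)) = (\<Prod>j<d. measure std_normal (B j))"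
      by (simp add: gaussian.prob_space)
    let ?D = "prod_emb UNIV (\<lambda>_::nat. std_normal) J (\<Pi>\<^sub>E j\<in>J. F j)"
    have D: "?D \<in> sets gaussian_space" unfolding gaussian_space_def by (rule sets_PiM_I[OF J]) (use F in auto)
    have ind: "(\<Prod>j<d. indicator (B j) (?Y j x)) = (indicator (pull V -` ?D \<inter> space gaussian_space) x :: real)" for x
    proof -
      have "x \<in> pull V -` ?D \<inter> space gaussian_space \<longleftrightarrow> (\<forall>j\<in>{..<d}. ?Y j x \<in> B j)"
        using d by (auto simp: prod_emb_def space_gaussian pull_def B_def PiE_iff)
      then show ?thesis
        by (auto simp: indicator_def intro!: prod_zero[OF finite_lessThan])
    qed
    have "emeasure (distr gaussian_space gaussian_space (pull V)) ?D = ennreal (gaussian.prob (pull V -` ?D \<inter> space gaussian_space))"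
      using D by (simp add: emeasure_distr gaussian.emeasure_eq_measure)
    also have "gaussian.prob (pull V -` ?D \<inter> space gaussian_space) = (\<Prod>j<d. measure std_normal (B j))"
      using E unfolding ind by (simp add: Int_absorb1)
    also have "\<dots> = (\<Prod>j\<in>J. measure std_normal (F j))"
      using d by (intro prod.mono_neutral_cong_right) (auto simp: B_def N.prob_space[simplified])
    also have "ennreal \<dots> = (\<Prod>j\<in>J. emeasure std_normal (F j))"
      by (simp add: prod_ennreal N.emeasure_eq_measure)
    finally show "emeasure (distr gaussian_space gaussian_space (pull V)) ?D = (\<Prod>j\<in>J. emeasure std_normal (F j))" .
  qed
  then show ?thesis by (simp add: gaussian_space_def)
qed

text \<open>On truncations this is linearity. Both sides depend continuously on \<open>h\<close> in
  L2: the left because \<open>pull V\<close> preserves the measure, the right because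
  \<open>V\<close> is an isometry.\<close>

lemma (in l2_isometry) form_pull: "AE x in gaussian_space. form h (pull V x) = form (V h) x"
proof (rule sqd_limit_unique[where F="\<lambda>n. form (V (truncate n h))"])
  have "sqd (form (V h)) (form (V (truncate n h))) = ennreal (tail n h)" for n
    by (simp add: sqd_form V_diff[symmetric] norm_V tail_def)
  then show "(\<lambda>n. sqd (form (V h)) (form (V (truncate n h)))) \<longlonglongrightarrow> 0"
    using tendsto_ennrealI[OF tail_tendsto[of h]] by simp
  have "sqd (\<lambda>x. form h (pull V x)) (form (V (truncate n h))) = sqd (form h) (partial_form n h)" for n
  proof -
    have "AE x in gaussian_space. form (V (truncate n h)) x = partial_form n h (pull V x)"
      using form_sum[where t="coord h" and g="\<lambda>i. V (unit i)" and d=n]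
      by eventually_elim (simp add: truncate_def V_sum partial_form_def pull_def)
    then have "sqd (\<lambda>x. form h (pull V x)) (form (V (truncate n h))) = sqd (\<lambda>x. form h (pull V x)) (\<lambda>x. partial_form n h (pull V x))"
      by (intro sqd_cong_AE) auto
    also have "\<dots> = (\<integral>\<^sup>+ x. ennreal ((form h x - partial_form n h x)\<^sup>2) \<partial>distr gaussian_space gaussian_space (pull V))"
      unfolding sqd_def by (subst nn_integral_distr) auto
    finally show ?thesis unfolding distr_pull sqd_def .
  qed
  then show "(\<lambda>n. sqd (\<lambda>x. form h (pull V x)) (form (V (truncate n h)))) \<longlonglongrightarrow> 0" by (simp add: form_limit)
qed measurable

lemma AE_coordinates_eq:
  fixes f g :: "(nat \<Rightarrow> real) \<Rightarrow> nat \<Rightarrow> real"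
  assumes "\<And>i. AE x in gaussian_space. f x i = g x i"
  shows "AE x in gaussian_space. f x = g x"
proof -
  have "AE x in gaussian_space. \<forall>i. f x i = g x i" unfolding AE_all_countable using assms by simp
  then show ?thesis by eventually_elim (simp add: fun_eq_iff)
qed

lemma (in l2_isometry) pull_pull: "AE x in gaussian_space. pull V' (pull V x) = x"
proof (rule AE_coordinates_eq)
  fix i
  show "AE x in gaussian_space. pull V' (pull V x) i = x i"
    using form_pull[of "V' (unit i)"] form_unit[of i] by eventually_elim (simp add: pull_def V_V')
qed

text \<open>Forms are pulled back, so operators compose in the opposite order to the
  transformations.\<close>

definition implements :: "((nat \<Rightarrow> real) \<Rightarrow> (nat \<Rightarrow> real)) \<Rightarrow> (l2 \<Rightarrow> l2) \<Rightarrow> bool" where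
  "implements T A \<longleftrightarrow> automorphism gaussian_space T \<and> (\<forall>h. AE x in gaussian_space. form h (T x) = form (A h) x)"

lemma implementsD:
  assumes "implements T A"
  shows "automorphism gaussian_space T" "AE x in gaussian_space. form h (T x) = form (A h) x"
  using assms by (simp_all add: implements_def)

lemma (in l2_isometry) implements_exists: "\<exists>T. implements T V"
proof -
  interpret inv: l2_isometry V' V by (rule inverse)
  obtain T where T: "automorphism gaussian_space T" "AE x in gaussian_space. T x = pull V x"
    using automorphism_from_AE_inverse[OF pull_measurable pull_measurable distr_pull inv.distr_pull pull_pull inv.pull_pull] by blast
  have "AE x in gaussian_space. form h (T x) = form (V h) x" for h
    using T(2) form_pull[of h] by eventually_elim simp
  with T(1) show ?thesis by (auto simp: implements_def)
qed

lemma implements_id: "implements (\<lambda>x. x) (\<lambda>h. h)"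
  by (simp add: implements_def automorphism_id)

lemma implements_comp:
  assumes S: "implements S A" and T: "implements T B"
  shows "implements (S \<circ> T) (\<lambda>h. B (A h))"
  unfolding implements_def
proof (intro conjI allI)
  show "automorphism gaussian_space (S \<circ> T)" by (rule automorphism_comp[OF implementsD(1)[OF S] implementsD(1)[OF T]])
  fix h
  show "AE x in gaussian_space. form h ((S \<circ> T) x) = form (B (A h)) x"
    using automorphism_AE[OF implementsD(1)[OF T] implementsD(2)[OF S, of h]] implementsD(2)[OF T, of "A h"]
    by eventually_elim simp
qed

lemma implements_inv:
  assumes T: "implements T A" and AB: "\<And>h. A (B h) = h"
  shows "implements (inv_into (space gaussian_space) T) B"
  unfolding implements_def
proof (intro conjI allI)
  let ?T' = "inv_into (space gaussian_space) T"
  show aut: "automorphism gaussian_space ?T'" by (rule automorphism_inv[OF implementsD(1)[OF T]])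
  fix h
  show "AE x in gaussian_space. form h (?T' x) = form (B h) x"
    using automorphism_AE[OF aut implementsD(2)[OF T, of "B h"]]
  proof eventually_elim
    case (elim x)
    then show ?case using automorphism_inv_right[OF implementsD(1)[OF T], of x] by (simp add: AB space_gaussian)
  qed
qed

lemma implements_int_power:
  assumes T: "implements T (U 1)" and U0: "\<And>h. U 0 h = h" and UU: "\<And>m n h. U m (U n h) = U (m + n) h"
  shows "implements (int_power gaussian_space T n) (U n)"
proof -
  have pow: "implements (S ^^ k) (U (int k * s))" if S: "implements S (U s)" for S s and k :: nat
  proof (induction k)
    case 0
    have "U 0 = (\<lambda>h. h)" by (simp add: fun_eq_iff U0)
    then show ?case using implements_id by (simp add: id_def)
  next
    case (Suc k)
    have eq: "(\<lambda>h. U (int k * s) (U s h)) = U (int (Suc k) * s)" by (simp add: fun_eq_iff UU distrib_right add.commute)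
    show ?case using implements_comp[OF S Suc] unfolding eq funpow.simps .
  qed
  show ?thesis
  proof (cases "0 \<le> n")
    case True
    then show ?thesis using pow[OF T, of "nat n"] by (simp add: int_power_def)
  next
    case False
    have "implements (inv_into (space gaussian_space) T) (U (-1))"
      by (rule implements_inv[OF T]) (simp add: UU U0)
    from pow[OF this, of "nat (- n)"] show ?thesis using False by (simp add: int_power_def)
  qed
qed

lemma (in l2_isometry) implements_suspension:
  assumes T: "implements T V"
  shows "gaussian_suspension T"
proof -
  \<comment> \<open>The orthogonal operator of the suspension is the inverse \<open>V'\<close>,
    because a Gaussian suspension acts on forms through the inverse of its operator.\<close>
  define W where "W f = coord (V' (Abs_l2 f))" for f
  interpret inv: l2_isometry V' V by (rule inverse)
  have A: "Abs_l2 (coord x) = x" "coord x \<in> ell2" for x by (simp_all add: coord_inverse coord)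
  have B: "coord (Abs_l2 f) = f" if "f \<in> ell2" for f using that by (rule Abs_l2_inverse)
  have bij: "bij_betw W ell2 ell2"
    by (rule bij_betwI[where g="\<lambda>f. coord (V (Abs_l2 f))"]) (auto simp: W_def A B V_V' V'_V)
  have inv_O: "inv_into ell2 W f = coord (V (Abs_l2 f))" if "f \<in> ell2" for f
  proof (rule inv_into_f_eq)
    show "inj_on W ell2" using bij by (simp add: bij_betw_def)
  qed (simp_all add: W_def A B V'_V that)
  have lin: "W (\<lambda>i. a * h i + b * k i) = (\<lambda>i. a * W h i + b * W k i)" if "h \<in> ell2" "k \<in> ell2" for h k a b
  proof -
    have eq: "(\<lambda>i. a * h i + b * k i) = coord (a *\<^sub>R Abs_l2 h + b *\<^sub>R Abs_l2 k)"
      using that by (simp add: fun_eq_iff coord_add coord_scaleR B)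
    show ?thesis unfolding W_def eq by (simp add: A inv.V_add inv.V_scaleR fun_eq_iff coord_add coord_scaleR)
  qed
  have orth: "(\<Sum>i. W h i * W k i) = (\<Sum>i. h i * k i)" if "h \<in> ell2" "k \<in> ell2" for h k
    using inv.inner_V[of "Abs_l2 h" "Abs_l2 k"] that by (simp add: inner_l2_def W_def B)
  have "AE x in gaussian_space. gaussian_form h (T x) = gaussian_form (inv_into ell2 W h) x" if "h \<in> ell2" for h
    using implementsD(2)[OF T, of "Abs_l2 h"] that by (simp add: form_def B inv_O)
  then show ?thesis
    unfolding gaussian_suspension_def orthogonal_operator_def
    using implementsD(1)[OF T] bij lin orth by blast
qed

subsection \<open>Correlations of isometries\<close>

text \<open>Let \<open>w\<close> be the combination of the \<open>v i\<close> with the coefficients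
  \<open>c i\<close>, and \<open>S\<close> the sum of their squares. Then
  \<open>inner w y = S\<close>, and \<open>inner w w \<le> 2 * S\<close>: the diagonal gives at most
  \<open>S\<close>, and the off-diagonal terms, each damped by \<open>1 / L\<close>, at most another
  \<open>S\<close>. Cauchy-Schwarz bounds \<open>S\<close>.\<close>

lemma near_bessel:
  fixes v :: "nat \<Rightarrow> 'a :: real_inner"
  assumes orth: "\<And>i j. i < L \<Longrightarrow> j < L \<Longrightarrow> i \<noteq> j \<Longrightarrow> \<bar>inner (v i) (v j)\<bar> \<le> 1 / real L"
    and n1: "\<And>i. norm (v i) \<le> 1"
  shows "(\<Sum>i<L. (inner (v i) y)\<^sup>2) \<le> 2 * (norm y)\<^sup>2"
proof (cases "L = 0")
  case False
  define c where "c i = inner (v i) y" for i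
  define w where "w = (\<Sum>i<L. c i *\<^sub>R v i)"
  define S where "S = (\<Sum>i<L. (c i)\<^sup>2)"
  have S0: "0 \<le> S" unfolding S_def by (intro sum_nonneg) auto
  have wy: "inner w y = S" by (simp add: w_def S_def inner_sum_left c_def[symmetric] power2_eq_square)
  have "inner w w = (\<Sum>i<L. \<Sum>j<L. c i * (c j * inner (v i) (v j)))"
    by (simp add: w_def inner_sum_left inner_sum_right sum_distrib_left inner_commute mult.left_commute)
  also have "\<dots> \<le> (\<Sum>i<L. \<Sum>j<L. (if j = i then (c i)\<^sup>2 else 0) + (1 / (2 * real L)) * ((c i)\<^sup>2 + (c j)\<^sup>2))"
  proof (intro sum_mono)
    fix i j assume ij: "i \<in> {..<L}" "j \<in> {..<L}"
    show "c i * (c j * inner (v i) (v j)) \<le> (if j = i then (c i)\<^sup>2 else 0) + (1 / (2 * real L)) * ((c i)\<^sup>2 + (c j)\<^sup>2)"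
    proof (cases "j = i")
      case True
      have "inner (v i) (v i) \<le> 1" using n1[of i] by (simp add: power2_norm_eq_inner[symmetric] power_le_one)
      then have "(c i)\<^sup>2 * inner (v i) (v i) \<le> (c i)\<^sup>2 * 1" by (intro mult_left_mono) auto
      moreover have "0 \<le> (1 / (2 * real L)) * ((c i)\<^sup>2 + (c i)\<^sup>2)" by (intro mult_nonneg_nonneg) auto
      moreover have "c i * (c i * inner (v i) (v i)) = (c i)\<^sup>2 * inner (v i) (v i)" by (simp add: power2_eq_square)
      ultimately show ?thesis unfolding True if_P[OF refl] by linarith
    next
      case False
      have "c i * (c j * inner (v i) (v j)) \<le> \<bar>c i * c j\<bar> * \<bar>inner (v i) (v j)\<bar>"
        unfolding abs_mult[symmetric] using abs_ge_self[of "c i * c j * inner (v i) (v j)"] by (simp add: mult.assoc)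
      also have "\<dots> \<le> (((c i)\<^sup>2 + (c j)\<^sup>2) / 2) * (1 / real L)"
      proof (intro mult_mono)
        have "0 \<le> (\<bar>c i\<bar> - \<bar>c j\<bar>)\<^sup>2" by simp
        then show "\<bar>c i * c j\<bar> \<le> ((c i)\<^sup>2 + (c j)\<^sup>2) / 2" by (simp add: power2_diff abs_mult)
        show "\<bar>inner (v i) (v j)\<bar> \<le> 1 / real L" using ij False by (intro orth) auto
      qed auto
      finally show ?thesis using False by simp
    qed
  qed
  also have "\<dots> = (\<Sum>i<L. \<Sum>j<L. if j = i then (c i)\<^sup>2 else 0) + (\<Sum>i<L. \<Sum>j<L. (1 / (2 * real L)) * ((c i)\<^sup>2 + (c j)\<^sup>2))"
    by (simp only: sum.distrib)
  also have "(\<Sum>i<L. \<Sum>j<L. if j = i then (c i)\<^sup>2 else 0) = S" by (simp add: S_def)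
  also have "(\<Sum>i<L. \<Sum>j<L. (1 / (2 * real L)) * ((c i)\<^sup>2 + (c j)\<^sup>2)) = (1 / (2 * real L)) * (\<Sum>i<L. \<Sum>j<L. (c i)\<^sup>2 + (c j)\<^sup>2)"
    by (simp only: sum_distrib_left)
  also have "(\<Sum>i<L. \<Sum>j<L. (c i)\<^sup>2 + (c j)\<^sup>2) = 2 * real L * S"
    by (simp add: sum.distrib S_def sum_distrib_left mult_ac)
  finally have ww: "inner w w \<le> 2 * S" using False by simp
  have "S * S \<le> inner w w * inner y y" using Cauchy_Schwarz_ineq[of w y] by (simp add: wy power2_eq_square)
  also have "\<dots> \<le> 2 * S * inner y y" by (intro mult_right_mono ww) auto
  finally have "S * S \<le> (2 * inner y y) * S" by (simp add: mult_ac)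
  then have "S \<le> 2 * inner y y" using S0 by (cases "S = 0") auto
  then show ?thesis by (simp add: S_def c_def power2_norm_eq_inner)
qed simp

section \<open>Exchange of two blocks of coordinates\<close>

definition swap_index :: "nat \<Rightarrow> nat \<Rightarrow> nat" where
  "swap_index n i = (if i < n then i + n else if i < 2 * n then i - n else i)"

lemma swap_index_swap_index: "swap_index n (swap_index n i) = i"
  by (auto simp: swap_index_def)

definition swap :: "nat \<Rightarrow> l2 \<Rightarrow> l2" where
  "swap n x = Abs_l2 (\<lambda>i. coord x (swap_index n i))"

lemma coord_swap: "coord (swap n x) i = coord x (swap_index n i)"
proof -
  have "eventually (\<lambda>i. (coord x (swap_index n i))\<^sup>2 = (coord x i)\<^sup>2) sequentially"
    using eventually_ge_at_top[of "2 * n"] by eventually_elim (simp add: swap_index_def)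
  then have "(\<lambda>i. coord x (swap_index n i)) \<in> ell2"
    using summable_coord_sq[of x] unfolding ell2_def by (simp add: summable_cong)
  then show ?thesis by (simp add: swap_def Abs_l2_inverse)
qed

lemma l2_isometry_swap: "l2_isometry (swap n) (swap n)"
proof
  show "norm (swap n x) = norm x" for x
  proof -
    have "(\<Sum>i<2*n. (coord x (swap_index n i))\<^sup>2) = (\<Sum>i<2*n. (coord x i)\<^sup>2)"
      by (rule sum.reindex_bij_witness[where i="swap_index n" and j="swap_index n"])
        (auto simp: swap_index_swap_index, auto simp: swap_index_def split: if_splits)
    moreover have "swap n x - truncate (2 * n) (swap n x) = x - truncate (2 * n) x"
      by (rule l2_eqI) (auto simp: coord_diff coord_truncate coord_swap swap_index_def)
    ultimately have "(norm (swap n x))\<^sup>2 = (norm x)\<^sup>2"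
      using norm_sq_split[of "swap n x" "2 * n"] norm_sq_split[of x "2 * n"] by (simp add: coord_swap)
    then show ?thesis by simp
  qed
  show "swap n (swap n x) = x" for x by (rule l2_eqI) (simp add: coord_swap swap_index_swap_index)
qed (rule l2_eqI, simp add: coord_swap coord_add coord_scaleR)+

text \<open>\<open>swap n\<close> changes only the first \<open>2 * n\<close> coordinates, so
  coordinatewise convergence to 0 is enough.\<close>

lemma swap_tendsto:
  assumes x: "\<And>j. (\<lambda>k. coord (x k) j) \<longlonglongrightarrow> 0"
  shows "(\<lambda>k. norm (swap n (x k) - x k)) \<longlonglongrightarrow> 0"
proof (rule Lim_null_comparison)
  interpret S: l2_isometry "swap n" "swap n" by (rule l2_isometry_swap)
  have le: "norm (swap n y - y) \<le> 2 * sqrt (\<Sum>i<2*n. (coord y i)\<^sup>2)" for y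
  proof -
    let ?t = "truncate (2 * n) y"
    have "swap n y - y = swap n ?t - ?t"
      by (rule l2_eqI) (auto simp: coord_diff coord_truncate coord_swap swap_index_def)
    then have "norm (swap n y - y) \<le> norm (swap n ?t) + norm ?t" by (simp only: norm_triangle_ineq4)
    moreover have "(norm ?t)\<^sup>2 = (\<Sum>i<2*n. (coord y i)\<^sup>2)"
      unfolding truncate_def by (rule norm_sq_combination)
    then have "norm ?t = sqrt (\<Sum>i<2*n. (coord y i)\<^sup>2)" by (metis norm_ge_zero real_sqrt_unique)
    ultimately show ?thesis by (simp add: S.norm_V)
  qed
  show "\<forall>\<^sub>F k in sequentially. norm (norm (swap n (x k) - x k)) \<le> 2 * sqrt (\<Sum>i<2*n. (coord (x k) i)\<^sup>2)"
    using le by simp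
  have "(\<lambda>k. 2 * sqrt (\<Sum>i<2*n. (coord (x k) i)\<^sup>2)) \<longlonglongrightarrow> 2 * sqrt (\<Sum>i<2*n. 0\<^sup>2)"
    by (intro tendsto_intros x)
  then show "(\<lambda>k. 2 * sqrt (\<Sum>i<2*n. (coord (x k) i)\<^sup>2)) \<longlonglongrightarrow> 0" by simp
qed

subsection \<open>Orthants\<close>

definition orthant :: "nat \<Rightarrow> (nat \<Rightarrow> real) \<Rightarrow> (nat \<Rightarrow> real) set" where
  "orthant d a = {x. \<forall>i<d. x i \<le> a i}"

definition orthants :: "(nat \<Rightarrow> real) set set" where
  "orthants = {orthant d a | d a. True}"

lemma orthant_sets [measurable]: "orthant d a \<in> sets gaussian_space"
proof -
  have "{x \<in> space gaussian_space. \<forall>i<d. x i \<le> a i} \<in> sets gaussian_space" by measurable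
  then show ?thesis by (simp add: orthant_def space_gaussian)
qed

lemma orthants_subset: "orthants \<subseteq> sets gaussian_space" "orthants \<subseteq> Pow (space gaussian_space)"
  by (auto simp: orthants_def space_gaussian)

lemma Int_stable_orthants: "Int_stable orthants"
proof (rule Int_stableI)
  fix A B assume "A \<in> orthants" "B \<in> orthants"
  then obtain d a e b where AB: "A = orthant d a" "B = orthant e b" by (auto simp: orthants_def)
  have "A \<inter> B = orthant (max d e) (\<lambda>i. if i < d \<and> i < e then min (a i) (b i) else if i < d then a i else b i)"
    by (auto simp: AB orthant_def split: if_splits) (metis less_max_iff_disj min.bounded_iff)+
  then show "A \<inter> B \<in> orthants" by (auto simp: orthants_def)
qed

lemma sets_orthants: "sets gaussian_space = sigma_sets (space gaussian_space) orthants"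
proof
  let ?N = "sigma UNIV orthants"
  have Ns: "sets ?N = sigma_sets UNIV orthants" by (rule sets_measure_of) simp
  have half: "{x. x i \<le> c} \<in> sets ?N" for i :: nat and c :: real
  proof -
    \<comment> \<open>An orthant bounds all of its first coordinates; letting the bounds other than
      that of \<open>x i\<close> tend to infinity recovers the half space.\<close>
    have "{x. x i \<le> c} = (\<Union>n::nat. orthant (Suc i) (\<lambda>j. if j = i then c else real n))"
    proof (intro set_eqI iffI)
      fix x :: "nat \<Rightarrow> real" assume x: "x \<in> {x. x i \<le> c}"
      obtain n :: nat where n: "(\<Sum>j<Suc i. \<bar>x j\<bar>) \<le> real n" using real_arch_simple by blast
      have "x j \<le> real n" if "j < Suc i" for j
      proof -
        have "\<bar>x j\<bar> \<le> (\<Sum>j<Suc i. \<bar>x j\<bar>)" by (rule member_le_sum) (use that in auto)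
        then show ?thesis using n by simp
      qed
      then have "x \<in> orthant (Suc i) (\<lambda>j. if j = i then c else real n)" using x by (auto simp: orthant_def)
      then show "x \<in> (\<Union>n::nat. orthant (Suc i) (\<lambda>j. if j = i then c else real n))" by blast
    qed (auto simp: orthant_def)
    moreover have "orthant (Suc i) (\<lambda>j. if j = i then c else real n) \<in> sets ?N" for n :: nat
      unfolding Ns by (rule sigma_sets.Basic) (auto simp: orthants_def)
    then have "range (\<lambda>n::nat. orthant (Suc i) (\<lambda>j. if j = i then c else real n)) \<subseteq> sets ?N" by blast
    ultimately show ?thesis by (simp only: sets.countable_nat_UN)
  qed
  have "(\<lambda>x. x i) \<in> borel_measurable ?N" for i
    unfolding borel_measurable_iff_le using half[of i] by (simp add: space_measure_of_conv)
  then have id: "(\<lambda>x i. x i) \<in> measurable ?N (PiM UNIV (\<lambda>_::nat. borel :: real measure))"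
    by (intro measurable_PiM_single') (auto simp: space_PiM)
  show "sets gaussian_space \<subseteq> sigma_sets (space gaussian_space) orthants"
  proof
    fix A assume "A \<in> sets gaussian_space"
    then have "A \<in> sets (PiM UNIV (\<lambda>_::nat. borel :: real measure))" by (simp add: sets_gaussian)
    from measurable_sets[OF id this] show "A \<in> sigma_sets (space gaussian_space) orthants"
      by (simp add: Ns space_gaussian space_measure_of_conv)
  qed
  show "sigma_sets (space gaussian_space) orthants \<subseteq> sets gaussian_space"
    by (rule sets.sigma_sets_subset[OF orthants_subset(1)])
qed

lemma std_normal_interval:
  assumes "0 \<le> \<delta>"
  shows "measure std_normal {a - \<delta>..a + \<delta>} \<le> 2 * \<delta>"
proof -
  interpret N: prob_space std_normal by (rule prob_space_std_normal)
  have d: "std_normal_density x \<le> 1" for x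
  proof -
    have "1 \<le> sqrt (2 * pi)" using pi_ge_two by simp
    then have "1 / sqrt (2 * pi) * exp (- x\<^sup>2 / 2) \<le> 1 * 1" by (intro mult_mono) auto
    then show ?thesis by (simp add: std_normal_density_def)
  qed
  have "emeasure std_normal {a - \<delta>..a + \<delta>} = (\<integral>\<^sup>+ x. ennreal (std_normal_density x) * indicator {a - \<delta>..a + \<delta>} x \<partial>lborel)"
    by (rule emeasure_density) auto
  also have "\<dots> \<le> (\<integral>\<^sup>+ x. indicator {a - \<delta>..a + \<delta>} x \<partial>lborel)"
    by (intro nn_integral_mono) (use d in \<open>auto split: split_indicator\<close>)
  also have "\<dots> = ennreal (2 * \<delta>)" using assms by simp
  finally show ?thesis using assms by (simp add: N.emeasure_eq_measure)
qed

lemma sqd_markov: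
  assumes [measurable]: "f \<in> borel_measurable gaussian_space" "g \<in> borel_measurable gaussian_space"
    and r: "sqd f g \<le> ennreal r" "0 \<le> r" and \<delta>: "0 < \<delta>"
  shows "gaussian.prob {x. \<delta> < \<bar>f x - g x\<bar>} \<le> r / \<delta>\<^sup>2"
proof -
  let ?A = "{x \<in> space gaussian_space. \<delta> < \<bar>f x - g x\<bar>}"
  have "ennreal (\<delta>\<^sup>2) * emeasure gaussian_space ?A = (\<integral>\<^sup>+ x. ennreal (\<delta>\<^sup>2) * indicator ?A x \<partial>gaussian_space)"
    by (rule nn_integral_cmult_indicator[symmetric]) measurable
  also have "\<dots> \<le> sqd f g"
    unfolding sqd_def
  proof (intro nn_integral_mono)
    fix x
    have "\<delta>\<^sup>2 \<le> (f x - g x)\<^sup>2" if "\<delta> < \<bar>f x - g x\<bar>"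
      using power_mono[of \<delta> "\<bar>f x - g x\<bar>" 2] that \<delta> by simp
    then show "ennreal (\<delta>\<^sup>2) * indicator ?A x \<le> ennreal ((f x - g x)\<^sup>2)"
      by (auto split: split_indicator intro: ennreal_leI)
  qed
  also note r(1)
  finally have "\<delta>\<^sup>2 * gaussian.prob ?A \<le> r"
    using r(2) by (simp add: gaussian.emeasure_eq_measure ennreal_mult[symmetric])
  then show ?thesis using \<delta> by (simp add: space_gaussian field_simps)
qed

text \<open>A point lies in exactly one of the two events only if some \<open>S x i\<close> is
  within \<open>\<delta>\<close> of its threshold or differs from \<open>g i x\<close> by more than
  \<open>\<delta>\<close>. The first has probability at most \<open>2 * \<delta>\<close>, since
  \<open>S x i\<close> is standard normal with density at most 1; the second is bounded by Markov's
  inequality.\<close>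

lemma orthant_perturb:
  assumes S: "automorphism gaussian_space S" and g [measurable]: "\<And>i. g i \<in> borel_measurable gaussian_space"
    and r: "\<And>i. sqd (\<lambda>x. S x i) (g i) \<le> ennreal (r i)" "\<And>i. 0 \<le> r i" and \<delta>: "0 < \<delta>"
  shows "gaussian.prob (sym_diff (S -` orthant d a) {x. \<forall>i<d. g i x \<le> a i}) \<le> (\<Sum>i<d. 2 * \<delta> + r i / \<delta>\<^sup>2)"
proof -
  have Sm [measurable]: "S \<in> measurable gaussian_space gaussian_space" by (rule automorphismD(1)[OF S])
  have Si [measurable]: "(\<lambda>x. S x i) \<in> borel_measurable gaussian_space" for i
    using measurable_compose[OF Sm coordinate_measurable] .
  let ?E = "\<lambda>i. {x. \<bar>S x i - a i\<bar> \<le> \<delta>}" and ?F = "\<lambda>i. {x. \<delta> < \<bar>S x i - g i x\<bar>}"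
  have E: "?E i \<in> sets gaussian_space" for i
  proof -
    have "{x \<in> space gaussian_space. \<bar>S x i - a i\<bar> \<le> \<delta>} \<in> sets gaussian_space" by measurable
    then show ?thesis by (simp add: space_gaussian)
  qed
  have F: "?F i \<in> sets gaussian_space" for i
  proof -
    have "{x \<in> space gaussian_space. \<delta> < \<bar>S x i - g i x\<bar>} \<in> sets gaussian_space" by measurable
    then show ?thesis by (simp add: space_gaussian)
  qed
  have EF: "gaussian.prob (?E i \<union> ?F i) \<le> 2 * \<delta> + r i / \<delta>\<^sup>2" for i
  proof -
    have "distr gaussian_space borel (\<lambda>x. S x i) = distr (distr gaussian_space gaussian_space S) borel (\<lambda>x. x i)"
      by (subst distr_distr) (auto simp: comp_def)
    then have D: "distr gaussian_space borel (\<lambda>x. S x i) = std_normal"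
      by (simp add: automorphismD(4)[OF S] distr_coordinate)
    have "gaussian.prob (?E i) = measure (distr gaussian_space borel (\<lambda>x. S x i)) {a i - \<delta>..a i + \<delta>}"
      by (subst measure_distr) (auto simp: space_gaussian abs_le_iff intro!: arg_cong[where f="measure _"])
    then have "gaussian.prob (?E i) \<le> 2 * \<delta>" unfolding D using std_normal_interval[of \<delta> "a i"] \<delta> by simp
    moreover have "gaussian.prob (?F i) \<le> r i / \<delta>\<^sup>2" by (rule sqd_markov) (use r \<delta> in auto)
    moreover have "gaussian.prob (?E i \<union> ?F i) \<le> gaussian.prob (?E i) + gaussian.prob (?F i)"
      by (rule measure_Un_le[OF E F])
    ultimately show ?thesis by simp
  qed
  have "gaussian.prob (sym_diff (S -` orthant d a) {x. \<forall>i<d. g i x \<le> a i}) \<le> gaussian.prob (\<Union>i<d. ?E i \<union> ?F i)"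
  proof (rule gaussian.finite_measure_mono)
    show "sym_diff (S -` orthant d a) {x. \<forall>i<d. g i x \<le> a i} \<subseteq> (\<Union>i<d. ?E i \<union> ?F i)"
    proof
      fix x assume "x \<in> sym_diff (S -` orthant d a) {x. \<forall>i<d. g i x \<le> a i}"
      then obtain i where i: "i < d" "(S x i \<le> a i) \<noteq> (g i x \<le> a i)" by (auto simp: orthant_def)
      then have "x \<in> ?E i \<union> ?F i" by auto
      with i(1) show "x \<in> (\<Union>i<d. ?E i \<union> ?F i)" by blast
    qed
    show "(\<Union>i<d. ?E i \<union> ?F i) \<in> sets gaussian_space" using E F by (intro sets.finite_UN) auto
  qed
  also have "\<dots> \<le> (\<Sum>i<d. gaussian.prob (?E i \<union> ?F i))"
    by (rule gaussian.finite_measure_subadditive_finite) (use E F in auto)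
  also have "\<dots> \<le> (\<Sum>i<d. 2 * \<delta> + r i / \<delta>\<^sup>2)" by (intro sum_mono EF)
  finally show ?thesis .
qed

lemma implements_coordinate:
  assumes "implements S A"
  shows "AE x in gaussian_space. S x i = form (A (unit i)) x"
  using implementsD(2)[OF assms, of "unit i"] automorphism_AE[OF implementsD(1)[OF assms] form_unit[of i]]
  by eventually_elim simp

lemma implements_tends_to_identity:
  assumes R: "\<And>n. implements (R n) (A n)" and lim: "\<And>i. ((\<lambda>n. norm (A n (unit i) - unit i)) \<longlongrightarrow> 0) F"
  shows "tends_to_identity gaussian_space R F"
proof (rule gaussian.tends_to_identityI[OF implementsD(1)[OF R] orthants_subset(1) sets_orthants])
  fix A' assume "A' \<in> orthants"
  then obtain d a where A': "A' = orthant d a" by (auto simp: orthants_def)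
  note aut = implementsD(1)[OF R]
  have le: "gaussian.prob (sym_diff (R n ` A') A') \<le> (\<Sum>i<d. 2 * \<delta> + (norm (A n (unit i) - unit i))\<^sup>2 / \<delta>\<^sup>2)" if "0 < \<delta>" for n \<delta>
  proof -
    have s: "R n ` A' \<in> sets gaussian_space" by (rule automorphism_image_sets[OF aut]) (simp add: A')
    have "R n -` sym_diff (R n ` A') A' \<inter> space gaussian_space = sym_diff (R n -` orthant d a) A'"
      using automorphism_vimage_image[OF aut, of A' n] by (auto simp: space_gaussian A')
    then have v: "gaussian.prob (sym_diff (R n -` orthant d a) A') = gaussian.prob (sym_diff (R n ` A') A')"
      using automorphism_measure_vimage[OF aut, of "sym_diff (R n ` A') A'" n] s orthant_sets[of d a] by (simp only: A' sets.Un sets.Diff)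
    have A'_eq: "A' = {x. \<forall>i<d. x i \<le> a i}" by (simp add: A' orthant_def)
    have "gaussian.prob (sym_diff (R n ` A') A') = gaussian.prob (sym_diff (R n -` orthant d a) {x. \<forall>i<d. x i \<le> a i})"
      using v unfolding A'_eq by (rule sym)
    also have "\<dots> \<le> (\<Sum>i<d. 2 * \<delta> + (norm (A n (unit i) - unit i))\<^sup>2 / \<delta>\<^sup>2)"
    proof (rule orthant_perturb[OF aut _ _ _ that])
      fix i
      show "sqd (\<lambda>x. R n x i) (\<lambda>x. x i) \<le> ennreal ((norm (A n (unit i) - unit i))\<^sup>2)"
        using sqd_cong_AE[OF implements_coordinate[OF R[of n], of i] AE_symmetric[OF form_unit[of i]]]
        by (simp add: sqd_form)
    qed auto
    finally show ?thesis .
  qed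
  show "((\<lambda>n. gaussian.prob (sym_diff (R n ` A') A')) \<longlongrightarrow> 0) F"
  proof (rule tendstoI)
    fix e :: real assume e: "0 < e"
    \<comment> \<open>Small enough that the \<open>d\<close> terms \<open>2 * \<delta>\<close> sum
      to less than \<open>e / 2\<close>; the terms with norms vanish in the limit.\<close>
    define \<delta> where "\<delta> = e / (4 * (real d + 1))"
    have \<delta>: "0 < \<delta>" using e by (simp add: \<delta>_def)
    have "((\<lambda>n. \<Sum>i<d. 2 * \<delta> + (norm (A n (unit i) - unit i))\<^sup>2 / \<delta>\<^sup>2) \<longlongrightarrow> (\<Sum>i<d. 2 * \<delta> + 0\<^sup>2 / \<delta>\<^sup>2)) F"
      using \<delta> by (intro tendsto_intros lim) auto
    moreover have "(\<Sum>i<d. 2 * \<delta> + 0\<^sup>2 / \<delta>\<^sup>2) < e"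
    proof -
      have "(\<Sum>i<d. 2 * \<delta> + 0\<^sup>2 / \<delta>\<^sup>2) = e * (real d / (2 * (real d + 1)))" by (simp add: \<delta>_def field_simps)
      also have "\<dots> < e * 1" using e by (intro mult_strict_left_mono) auto
      finally show ?thesis by simp
    qed
    ultimately have "eventually (\<lambda>n. (\<Sum>i<d. 2 * \<delta> + (norm (A n (unit i) - unit i))\<^sup>2 / \<delta>\<^sup>2) < e) F"
      by (rule order_tendstoD)
    then show "eventually (\<lambda>n. dist (gaussian.prob (sym_diff (R n ` A') A')) 0 < e) F"
    proof eventually_elim
      case (elim n)
      show ?case using le_less_trans[OF le[OF \<delta>] elim] by simp
    qed
  qed
qed

lemma (in prob_space) abs_prob_diff_le:
  assumes "A \<in> sets M" "B \<in> sets M"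
  shows "\<bar>prob A - prob B\<bar> \<le> prob (sym_diff A B)"
proof -
  have "prob A \<le> prob (B \<union> sym_diff A B)" "prob B \<le> prob (A \<union> sym_diff A B)"
    using assms by (intro finite_measure_mono; blast)+
  moreover have "prob (B \<union> sym_diff A B) \<le> prob B + prob (sym_diff A B)" "prob (A \<union> sym_diff A B) \<le> prob A + prob (sym_diff A B)"
    using assms by (intro measure_Un_le; blast)+
  ultimately show ?thesis by linarith
qed

text \<open>Deleting the first \<open>e\<close> coefficients makes a form independent of the first \<open>e\<close> coordinates.\<close>

lemma orthant_correlation:
  assumes S: "implements S A" and \<delta>: "0 < \<delta>"
  shows "\<bar>gaussian.prob ((S -` orthant d a) \<inter> orthant e b) - gaussian.prob (orthant d a) * gaussian.prob (orthant e b)\<bar>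
    \<le> 2 * (\<Sum>i<d. 2 * \<delta> + (\<Sum>j<e. (coord (A (unit i)) j)\<^sup>2) / \<delta>\<^sup>2)"
proof -
  let ?X = "S -` orthant d a" and ?B = "orthant e b"
  define w where "w i = A (unit i)" for i
  define \<rho> where "\<rho> i = (\<Sum>j<e. (coord (w i) j)\<^sup>2)" for i
  note aut = implementsD(1)[OF S]
  have X: "?X \<in> sets gaussian_space"
    using measurable_sets[OF automorphismD(1)[OF aut] orthant_sets] by (simp add: space_gaussian)
  have PX: "gaussian.prob ?X = gaussian.prob (orthant d a)"
    using automorphism_measure_vimage[OF aut orthant_sets] by (simp add: space_gaussian)
  have le: "\<bar>gaussian.prob (?X \<inter> ?B) - gaussian.prob (orthant d a) * gaussian.prob ?B\<bar>
    \<le> 2 * (\<Sum>i<d. 2 * \<delta> + (\<rho> i + tail N (w i)) / \<delta>\<^sup>2)" if N: "e \<le> N" for N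
  proof -
    \<comment> \<open>Only the coefficients with index in \<open>[e, N)\<close> are kept, so that
      independence of two finite blocks of coordinates applies; \<open>N\<close> tends to infinity
      at the end.\<close>
    define g where "g i x = (\<Sum>j\<in>{e..<N}. coord (w i) j * x j)" for i and x :: "nat \<Rightarrow> real"
    define Y where "Y = {x :: nat \<Rightarrow> real. \<forall>i<d. g i x \<le> a i}"
    have gm [measurable]: "g i \<in> borel_measurable gaussian_space" for i unfolding g_def by measurable
    have Ym: "Y \<in> sets gaussian_space"
    proof -
      have "{x \<in> space gaussian_space. \<forall>i<d. g i x \<le> a i} \<in> sets gaussian_space" by measurable
      then show ?thesis by (simp add: Y_def space_gaussian)
    qed
    have sq: "sqd (\<lambda>x. S x i) (g i) \<le> ennreal (\<rho> i + tail N (w i))" for i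
    proof -
      define u where "u = (\<Sum>j<N. (if e \<le> j then coord (w i) j else 0) *\<^sub>R unit j)"
      have cu: "coord u j = (if e \<le> j \<and> j < N then coord (w i) j else 0)" for j
      proof -
        have "coord u j = (\<Sum>k<N. if k = j then (if e \<le> j then coord (w i) j else 0) else 0)"
          unfolding u_def coord_sum by (intro sum.cong) (auto simp: coord_scaleR coord_unit)
        then show ?thesis by (simp only: sum.delta[OF finite_lessThan]) auto
      qed
      have "AE x in gaussian_space. \<forall>j. form (unit j) x = x j" unfolding AE_all_countable using form_unit by simp
      moreover have "AE x in gaussian_space. form u x = (\<Sum>j<N. (if e \<le> j then coord (w i) j else 0) * form (unit j) x)"
        unfolding u_def by (rule form_sum)
      ultimately have gu: "AE x in gaussian_space. g i x = form u x"
      proof eventually_elim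
        case (elim x)
        have "g i x = (\<Sum>j<N. (if e \<le> j then coord (w i) j else 0) * x j)"
          unfolding g_def by (rule sum.mono_neutral_cong_left) auto
        then show ?case using elim by simp
      qed
      have "sqd (\<lambda>x. S x i) (g i) = sqd (form (w i)) (form u)"
        unfolding w_def by (rule sqd_cong_AE[OF implements_coordinate[OF S] gu])
      also have "\<dots> = ennreal ((norm (w i - u))\<^sup>2)" by (rule sqd_form)
      also have "(norm (w i - u))\<^sup>2 = \<rho> i + tail N (w i)"
      proof -
        have e1: "(w i - u) - truncate N (w i - u) = w i - truncate N (w i)"
          by (rule l2_eqI) (auto simp: coord_diff coord_truncate cu)
        have e2: "(\<Sum>j<N. (coord (w i - u) j)\<^sup>2) = \<rho> i"
          unfolding \<rho>_def by (rule sum.mono_neutral_cong_right) (use N in \<open>auto simp: coord_diff cu\<close>)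
        show ?thesis unfolding norm_sq_split[of "w i - u" N] e1 e2 tail_def ..
      qed
      finally show ?thesis by simp
    qed
    have pert: "gaussian.prob (sym_diff ?X Y) \<le> (\<Sum>i<d. 2 * \<delta> + (\<rho> i + tail N (w i)) / \<delta>\<^sup>2)"
      unfolding Y_def by (rule orthant_perturb[OF aut gm sq _ \<delta>]) (simp add: \<rho>_def sum_nonneg tail_nonneg)
    have ind: "gaussian.prob (Y \<inter> ?B) = gaussian.prob Y * gaussian.prob ?B"
    proof -
      let ?I = "{..<e}" and ?J = "{e..<N}"
      have iv: "gaussian.indep_var (PiM ?I (\<lambda>_. borel)) (\<lambda>x. restrict (\<lambda>i. x i) ?I) (PiM ?J (\<lambda>_. borel)) (\<lambda>x. restrict (\<lambda>i. x i) ?J)"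
        by (rule gaussian.indep_var_restrict[OF indep_coordinates]) auto
      let ?B' = "{y \<in> space (PiM ?I (\<lambda>_. borel :: real measure)). \<forall>i\<in>?I. y i \<le> b i}"
      let ?Y' = "{y \<in> space (PiM ?J (\<lambda>_. borel :: real measure)). \<forall>i<d. (\<Sum>j\<in>?J. coord (w i) j * y j) \<le> a i}"
      have B': "?B' \<in> sets (PiM ?I (\<lambda>_. borel))" by measurable
      have Y': "?Y' \<in> sets (PiM ?J (\<lambda>_. borel))" by measurable
      have eB: "(\<lambda>x. restrict (\<lambda>i. x i) ?I) -` ?B' \<inter> space gaussian_space = ?B"
        by (auto simp: space_gaussian space_PiM orthant_def)
      have eY: "(\<lambda>x. restrict (\<lambda>i. x i) ?J) -` ?Y' \<inter> space gaussian_space = Y"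
        by (auto simp: space_gaussian space_PiM Y_def g_def)
      have eYB: "(\<lambda>x. (restrict (\<lambda>i. x i) ?I, restrict (\<lambda>i. x i) ?J)) -` (?B' \<times> ?Y') \<inter> space gaussian_space = Y \<inter> ?B"
        using eB eY by blast
      show ?thesis using gaussian.indep_varD[OF iv B' Y'] unfolding eB eY eYB by (simp only: mult.commute)
    qed
    have 1: "\<bar>gaussian.prob (?X \<inter> ?B) - gaussian.prob (Y \<inter> ?B)\<bar> \<le> gaussian.prob (sym_diff ?X Y)"
    proof -
      have "\<bar>gaussian.prob (?X \<inter> ?B) - gaussian.prob (Y \<inter> ?B)\<bar> \<le> gaussian.prob (sym_diff (?X \<inter> ?B) (Y \<inter> ?B))"
        by (rule gaussian.abs_prob_diff_le) (use X Ym in auto)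
      also have "\<dots> \<le> gaussian.prob (sym_diff ?X Y)"
        by (rule gaussian.finite_measure_mono) (use X Ym in auto)
      finally show ?thesis .
    qed
    have 2: "\<bar>gaussian.prob ?X * gaussian.prob ?B - gaussian.prob Y * gaussian.prob ?B\<bar> \<le> gaussian.prob (sym_diff ?X Y)"
    proof -
      have "\<bar>gaussian.prob ?X * gaussian.prob ?B - gaussian.prob Y * gaussian.prob ?B\<bar> = \<bar>gaussian.prob ?X - gaussian.prob Y\<bar> * gaussian.prob ?B"
        unfolding left_diff_distrib[symmetric] abs_mult by simp
      also have "\<dots> \<le> \<bar>gaussian.prob ?X - gaussian.prob Y\<bar> * 1" by (intro mult_left_mono) auto
      also have "\<dots> \<le> gaussian.prob (sym_diff ?X Y)" using gaussian.abs_prob_diff_le[OF X Ym] by simp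
      finally show ?thesis .
    qed
    show ?thesis using 1 2 pert unfolding ind PX by linarith
  qed
  have "(\<lambda>N. 2 * (\<Sum>i<d. 2 * \<delta> + (\<rho> i + tail N (w i)) / \<delta>\<^sup>2)) \<longlonglongrightarrow> 2 * (\<Sum>i<d. 2 * \<delta> + (\<rho> i + 0) / \<delta>\<^sup>2)"
    using \<delta> by (intro tendsto_intros tail_tendsto) auto
  from LIMSEQ_le_const[OF this exI[of _ e]] le show ?thesis
    by (simp add: \<rho>_def w_def)
qed

lemma null_orthant_correlation:
  assumes Z: "null_ideal Z" and S: "\<And>n. implements (S n) (A n)"
    and null: "\<And>i j. Z (\<lambda>n. (coord (A n (unit i)) j)\<^sup>2)" and XY: "X \<in> orthants" "Y \<in> orthants"
  shows "Z (\<lambda>n. \<bar>gaussian.prob ((S n -` X \<inter> space gaussian_space) \<inter> Y) - gaussian.prob X * gaussian.prob Y\<bar>)"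
proof -
  obtain d a e b where XY: "X = orthant d a" "Y = orthant e b" using XY by (auto simp: orthants_def)
  show ?thesis
  proof (rule null_idealD(4)[OF Z])
    fix \<epsilon> :: real assume \<epsilon>: "0 < \<epsilon>"
    define \<delta> where "\<delta> = \<epsilon> / (4 * (real d + 1))"
    have \<delta>: "0 < \<delta>" using \<epsilon> by (simp add: \<delta>_def)
    define x where "x n = (2 / \<delta>\<^sup>2) * (\<Sum>i<d. \<Sum>j<e. (coord (A n (unit i)) j)\<^sup>2)" for n
    have "Z x" unfolding x_def by (intro null_idealD(3)[OF Z] null_ideal_sum[OF Z] null) auto
    moreover have "\<bar>gaussian.prob ((S n -` X \<inter> space gaussian_space) \<inter> Y) - gaussian.prob X * gaussian.prob Y\<bar> \<le> x n + \<epsilon>" for n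
    proof -
      have "2 * (\<Sum>i<d. 2 * \<delta> + (\<Sum>j<e. (coord (A n (unit i)) j)\<^sup>2) / \<delta>\<^sup>2) = real d * (4 * \<delta>) + x n"
        by (simp add: x_def sum.distrib sum_divide_distrib[symmetric])
      also have "real d * (4 * \<delta>) \<le> \<epsilon>" using \<epsilon> by (simp add: \<delta>_def field_simps)
      finally show ?thesis
        using orthant_correlation[OF S[of n] \<delta>, of d a e b] by (simp add: XY space_gaussian)
    qed
    ultimately show "\<exists>x. Z x \<and> (\<forall>n. \<bar>gaussian.prob ((S n -` X \<inter> space gaussian_space) \<inter> Y) - gaussian.prob X * gaussian.prob Y\<bar> \<le> x n + \<epsilon>)"
      by (intro exI[of _ x] conjI allI)
  qed simp
qed

subsection \<open>The Gaussian automorphism of a family of rotations\<close>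

context rotations
begin

lemma isometry_U: "l2_isometry (U n) (U (- n))"
  by unfold_locales (simp_all add: U_add U_scaleR norm_U U_U U_zero)

lemma inner_U_move: "inner (U m x) (U n y) = inner (U (m - n) x) y"
  using l2_isometry.inner_V[OF isometry_U[of n], of "U (m - n) x" y] by (simp add: U_U)

text \<open>Weak convergence of \<open>U (p k)\<close> to 0 makes a late translate almost orthogonal
  to the finitely many chosen before.\<close>

lemma almost_orthogonal_translates:
  assumes p: "(\<lambda>k. cos (real_of_int (p k) * \<theta> k)) \<longlonglongrightarrow> 0" and \<epsilon>: "0 < \<epsilon>"
  shows "\<exists>s :: nat \<Rightarrow> int. \<forall>l<L. \<forall>m<l. \<bar>inner (U (s l) x) (U (s m) x)\<bar> \<le> \<epsilon>"
proof (induction L)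
  case (Suc L)
  then obtain s :: "nat \<Rightarrow> int" where s: "\<forall>l<L. \<forall>m<l. \<bar>inner (U (s l) x) (U (s m) x)\<bar> \<le> \<epsilon>" ..
  have "eventually (\<lambda>k. \<bar>inner (U (p k) x) (U (s m) x)\<bar> < \<epsilon>) sequentially" for m
    using order_tendstoD(2)[OF tendsto_rabs[OF U_weakly_null[OF p]], of "\<epsilon>"] \<epsilon> by simp
  then have "eventually (\<lambda>k. \<forall>m\<in>{..<L}. \<bar>inner (U (p k) x) (U (s m) x)\<bar> < \<epsilon>) sequentially"
    by (intro eventually_ball_finite) auto
  then obtain k where k: "\<forall>m\<in>{..<L}. \<bar>inner (U (p k) x) (U (s m) x)\<bar> < \<epsilon>"
    using eventually_happens'[OF sequentially_bot] by blast
  have "\<bar>inner (U ((s(L := p k)) l) x) (U ((s(L := p k)) m) x)\<bar> \<le> \<epsilon>" if "l < Suc L" "m < l" for l m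
    using s k that by (cases "l = L") (auto simp: less_imp_le)
  then show ?case by (intro exI[of _ "s(L := p k)"]) simp
qed simp

text \<open>For \<open>L\<close> almost orthogonal translates of \<open>unit i\<close>,
  \<open>near_bessel\<close> bounds the sum of \<open>L\<close> shifted squares by 2 uniformly in
  \<open>n\<close>, which is the hypothesis of \<open>cesaro_translates\<close> with
  \<open>C = 2\<close>.\<close>

lemma cesaro_correlation:
  assumes p: "(\<lambda>k. cos (real_of_int (p k) * \<theta> k)) \<longlonglongrightarrow> 0"
  shows "cesaro_null (\<lambda>n. (coord (U (- int n) (unit i)) j)\<^sup>2)"
proof (rule cesaro_translates[where a="\<lambda>n. (coord (U (- n) (unit i)) j)\<^sup>2" and C=2])
  have n1: "norm (unit k) = 1" for k
  proof -
    have "(norm (unit k))\<^sup>2 = 1" by (simp add: power2_norm_eq_inner inner_unit coord_unit)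
    then show ?thesis by (simp add: power2_eq_1_iff) (metis norm_ge_zero not_one_le_zero neg_0_le_iff_le)
  qed
  show "(coord (U (- n) (unit i)) j)\<^sup>2 \<le> 2" for n
  proof -
    have "\<bar>coord (U (- n) (unit i)) j\<bar> \<le> 1" using coord_le_norm[of "U (- n) (unit i)" j] by (simp add: norm_U n1)
    then have "(coord (U (- n) (unit i)) j)\<^sup>2 \<le> 1" by (simp add: abs_square_le_1)
    then show ?thesis by simp
  qed
  show "\<exists>s::nat \<Rightarrow> int. \<forall>n. (\<Sum>l<L. (coord (U (- (n - s l)) (unit i)) j)\<^sup>2) \<le> 2" for L
  proof (cases "L = 0")
    case False
    then have "0 < 1 / real L" by simp
    from almost_orthogonal_translates[OF p this, of L "unit i"] obtain s :: "nat \<Rightarrow> int"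
      where s: "\<forall>l<L. \<forall>m<l. \<bar>inner (U (s l) (unit i)) (U (s m) (unit i))\<bar> \<le> 1 / real L" ..
    have "(\<Sum>l<L. (coord (U (- (n - s l)) (unit i)) j)\<^sup>2) \<le> 2" for n
    proof -
      have "(\<Sum>l<L. (inner (U (s l) (unit i)) (U n (unit j)))\<^sup>2) \<le> 2 * (norm (U n (unit j)))\<^sup>2"
      proof (rule near_bessel)
        fix l m assume "l < L" "m < L" "l \<noteq> m"
        then show "\<bar>inner (U (s l) (unit i)) (U (s m) (unit i))\<bar> \<le> 1 / real L"
          using s by (cases "m < l") (auto simp: inner_commute[of "U (s l) _"])
      qed (simp add: norm_U n1)
      then show ?thesis by (simp add: inner_U_move inner_unit norm_U n1)
    qed
    then show ?thesis by blast
  qed simp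
qed simp

text \<open>By the contravariance of \<open>implements\<close>, \<open>T\<close> is the Gaussian
  automorphism of the operator \<open>U 1\<close>, and its \<open>n\<close>-th power implements
  \<open>U (- n)\<close>.\<close>

context
  fixes T assumes T: "implements T (U (-1))"
begin

lemma implements_power: "implements (int_power gaussian_space T n) (U (- n))"
  by (rule implements_int_power[where U="\<lambda>n. U (- n)"]) (simp_all add: T U_zero U_U)

lemma suspension_rotations: "gaussian_suspension T"
  by (rule l2_isometry.implements_suspension[OF isometry_U T])

lemma automorphism_T: "automorphism gaussian_space T"
  by (rule implementsD(1)[OF T])

lemma weakly_mixing_rotations:
  assumes p: "(\<lambda>k. cos (real_of_int (p k) * \<theta> k)) \<longlonglongrightarrow> 0"
  shows "weakly_mixing gaussian_space T"
proof (rule gaussian.weakly_mixingI[OF automorphism_T Int_stable_orthants orthants_subset(2) sets_orthants])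
  fix X Y assume XY: "X \<in> orthants" "Y \<in> orthants"
  have imp: "implements (T ^^ n) (U (- int n))" for n
    using implements_power[of "int n"] by (simp add: int_power_def)
  show "cesaro_null (\<lambda>n. \<bar>gaussian.prob (((T ^^ n) -` X \<inter> space gaussian_space) \<inter> Y) - gaussian.prob X * gaussian.prob Y\<bar>)"
    by (rule null_orthant_correlation[OF null_ideal_cesaro imp cesaro_correlation[OF p] XY])
qed

text \<open>The conjugated exchange moves \<open>unit i\<close> by as much as \<open>swap n\<close>
  moves \<open>U (p k) (unit i)\<close>, a weakly null sequence, so \<open>swap_tendsto\<close> puts
  all exchanges into the group. They are mixing, because for large \<open>n\<close> the image of
  \<open>unit i\<close> has no component in a given coordinate.\<close>

lemma ergodic_rotations:
  assumes p: "(\<lambda>k. cos (real_of_int (p k) * \<theta> k)) \<longlonglongrightarrow> 0"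
  shows "ergodic_group gaussian_space (H_group gaussian_space (range p) T)"
proof -
  have "\<forall>n. \<exists>S. implements S (swap n)" using l2_isometry.implements_exists[OF l2_isometry_swap] by blast
  from choice[OF this] obtain S where S: "\<And>n. implements (S n) (swap n)" by blast
  show ?thesis
  proof (rule gaussian.ergodic_groupI[where S=S, OF _ implementsD(1)[OF S] Int_stable_orthants orthants_subset(2) sets_orthants])
    fix n
    let ?A = "\<lambda>m h. U m (swap n (U (- m) h))"
    have "implements (int_power gaussian_space T (- m) \<circ> S n \<circ> int_power gaussian_space T m) (\<lambda>h. U (- m) (swap n (U m h)))" for m
      using implements_comp[OF implements_comp[OF implements_power[of "- m"] S[of n]] implements_power[of m]] by simp
    then have "tends_to_identity gaussian_space (\<lambda>m. int_power gaussian_space T (- m) \<circ> S n \<circ> int_power gaussian_space T m) (infinity_along (range p))"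
    proof (rule implements_tends_to_identity)
      fix i
      have "(\<lambda>k. norm (swap n (U (p k) (unit i)) - U (p k) (unit i))) \<longlonglongrightarrow> 0"
        by (rule swap_tendsto) (use U_weakly_null[OF p, of "unit i" "unit _"] in \<open>simp add: inner_unit\<close>)
      moreover have "norm (U (- m) (swap n (U m (unit i))) - unit i) = norm (swap n (U m (unit i)) - U m (unit i))" for m
      proof -
        have "U (- m) (swap n (U m (unit i))) - unit i = U (- m) (swap n (U m (unit i)) - U m (unit i))"
          by (simp add: U_diff U_U U_zero)
        then show ?thesis by (simp only: norm_U)
      qed
      ultimately show "((\<lambda>m. norm (U (- m) (swap n (U m (unit i))) - unit i)) \<longlongrightarrow> 0) (infinity_along (range p))"
        by (intro tendsto_infinity_along_range) simp
    qed
    then show "S n \<in> H_group gaussian_space (range p) T"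
      by (simp add: H_group_def implementsD(1)[OF S])
  next
    fix X Y assume XY: "X \<in> orthants" "Y \<in> orthants"
    have null: "(\<lambda>n. (coord (swap n (unit i)) j)\<^sup>2) \<longlonglongrightarrow> 0" for i j
    proof (rule tendsto_eventually)
      show "eventually (\<lambda>n. (coord (swap n (unit i)) j)\<^sup>2 = 0) sequentially"
        using eventually_gt_at_top[of "max i j"]
        by eventually_elim (simp add: coord_swap coord_unit swap_index_def)
    qed
    show "(\<lambda>n. \<bar>gaussian.prob ((S n -` X \<inter> space gaussian_space) \<inter> Y) - gaussian.prob X * gaussian.prob Y\<bar>) \<longlonglongrightarrow> 0"
      by (rule null_orthant_correlation[OF null_ideal_tendsto S null XY])
  qed
qed

lemma trivial_rotations:
  assumes q: "(\<lambda>k. suminf (gap (q k))) \<longlonglongrightarrow> 0" and inf: "infinite (range q)"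
  shows "H_group gaussian_space (range q) T = identity_class gaussian_space"
proof (rule gaussian.H_group_trivial[OF automorphism_T _ infinity_along_nontrivial[OF inf]])
  show "tends_to_identity gaussian_space (int_power gaussian_space T) (infinity_along (range q))"
  proof (rule implements_tends_to_identity[OF implements_power tendsto_infinity_along_range])
    fix i
    have ev: "\<forall>\<^sub>F k in sequentially. norm (norm (U (- q k) (unit i) - unit i)) \<le> suminf (gap (q k)) * norm (unit i)"
    proof (intro always_eventually allI)
      fix k
      have "U (- q k) (unit i) - unit i = U (- q k) (unit i - U (q k) (unit i))" by (simp add: U_diff U_U U_zero)
      then have "norm (U (- q k) (unit i) - unit i) = norm (U (q k) (unit i) - unit i)" by (simp only: norm_U norm_minus_commute)
      then show "norm (norm (U (- q k) (unit i) - unit i)) \<le> suminf (gap (q k)) * norm (unit i)"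
        using norm_U_diff[of "q k" "unit i"] by simp
    qed
    have lim: "(\<lambda>k. suminf (gap (q k)) * norm (unit i)) \<longlonglongrightarrow> 0"
      using tendsto_mult_right[OF q, of "norm (unit i)"] by simp
    show "(\<lambda>k. norm (U (- q k) (unit i) - unit i)) \<longlonglongrightarrow> 0" by (rule Lim_null_comparison[OF ev lim])
  qed
  \<comment> \<open>Half spaces with rational bounds: a countable family that separates points, as
    \<open>H_group_trivial\<close> requires.\<close>
  let ?C = "range (\<lambda>(i::nat, r::rat). {x. x i \<le> real_of_rat r})"
  show "countable ?C" by simp
  show "?C \<subseteq> sets gaussian_space"
  proof (clarsimp)
    fix i :: nat and r :: rat
    have "{x \<in> space gaussian_space. x i \<le> real_of_rat r} \<in> sets gaussian_space" by measurable
    then show "{x. x i \<le> real_of_rat r} \<in> sets gaussian_space" by (simp add: space_gaussian)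
  qed
  fix x y :: "nat \<Rightarrow> real" assume "x \<noteq> y"
  then obtain i where i: "x i \<noteq> y i" by blast
  have sep: "\<exists>r. u \<le> real_of_rat r \<and> \<not> v \<le> real_of_rat r" if "u < v" for u v :: real
    using of_rat_dense[OF that] by (meson less_imp_le not_le)
  from i have "x i < y i \<or> y i < x i" by linarith
  then obtain r where "(x i \<le> real_of_rat r) \<noteq> (y i \<le> real_of_rat r)"
    using sep[of "x i" "y i"] sep[of "y i" "x i"] by blast
  then show "\<exists>A\<in>?C. (x \<in> A) \<noteq> (y \<in> A)"
    by (intro bexI[of _ "{x. x i \<le> real_of_rat r}"]) auto
qed

end

end

text \<open>The shift \<open>s\<close> discards initial terms of the rigid sequence, so that the
  same \<open>Q\<close> can serve in both constructions.\<close>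

lemma (in fast_growth) gaussian_suspension_exists:
  assumes p: "\<And>k. \<bar>p k\<bar> = int (b k)" and q: "\<And>k. \<bar>q k\<bar> = int (h k)" and inf: "infinite (range (\<lambda>k. q (k + s)))"
  shows "\<exists>T. gaussian_suspension T \<and> weakly_mixing gaussian_space T \<and>
    ergodic_group gaussian_space (H_group gaussian_space (range p) T) \<and>
    H_group gaussian_space (range (\<lambda>k. q (k + s))) T = identity_class gaussian_space"
proof -
  obtain \<theta> where \<theta>: "rotations \<theta>" "(\<lambda>k. cos (real_of_int (p k) * \<theta> k)) \<longlonglongrightarrow> 0" "(\<lambda>k. suminf (rotations.gap \<theta> (q k))) \<longlonglongrightarrow> 0"
    using rotations_exist[OF p q] by auto
  interpret rotations \<theta> by (rule \<theta>(1))
  obtain T where T: "implements T (U (-1))" using l2_isometry.implements_exists[OF isometry_U] ..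
  show ?thesis
    using suspension_rotations[OF T] weakly_mixing_rotations[OF T \<theta>(2)] ergodic_rotations[OF T \<theta>(2)]
      trivial_rotations[OF T LIMSEQ_ignore_initial_segment[OF \<theta>(3)] inf] by (intro exI[of _ T] conjI)
qed

section \<open>Interlaced rapidly growing sequences\<close>

lemma (in tower) poisson_suspension_exists:
  assumes M: "half_line_poisson M" and p: "\<And>k. \<bar>p k\<bar> = int (b k)" and q: "\<And>k. \<bar>q k\<bar> = int (h k)"
    and inf: "infinite (range (\<lambda>k. q (k + s)))"
  shows "\<exists>T. poisson_suspension M T \<and> weakly_mixing M T \<and> ergodic_group M (H_group M (range p) T) \<and>
    H_group M (range (\<lambda>k. q (k + s))) T = identity_class M"
proof -
  interpret half_line_poisson M by (rule M)
  interpret poisson_dispersing M act p by unfold_locales (rule disperse_b[OF p])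
  have "H_group M (range (\<lambda>k. q (k + s))) (susp 1) = identity_class M"
    by (rule H_group_rigid[OF LIMSEQ_ignore_initial_segment[OF rigid_signed[OF q]] inf])
  with susp_poisson_suspension susp_weakly_mixing H_group_ergodic show ?thesis by blast
qed

text \<open>From \<open>k + 2 < 4 ^ Suc k\<close> comes \<open>b_low\<close>, and then
  \<open>b k + cols k * h k < 2 * b k \<le> h (Suc k)\<close> is \<open>b_high\<close>.\<close>

lemma (in fast_growth) tower_growth: "tower h b"
proof
  have c: "cols k < 4 ^ Suc k" for k by (induction k) (auto simp: cols_def)
  have low: "cols k * h k < b k" for k
  proof -
    have "0 < h k" using h_pos[of k] by simp
    from mult_strict_right_mono[OF c this] h_b[of k] show ?thesis by (rule order.strict_trans2)
  qed
  show "cols k * h k < b k" for k by (rule low)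
  have "2 * b k \<le> 4 ^ Suc k * b k" for k by (rule mult_right_mono) auto
  then show "b k + cols k * h k < h (Suc k)" for k using low[of k] b_h[of k] by (smt (verit) mult_2 add_strict_left_mono order_less_le_trans)
qed (rule h0)

lemma growing_choice:
  fixes F1 F2 :: "int set"
  assumes "infinite F1" "infinite F2"
  obtains a :: "nat \<Rightarrow> int" where "\<And>n. a n \<in> (if even n then F1 else F2)" "\<And>n. 0 < \<bar>a n\<bar>"
    "\<And>n. 4 ^ Suc n * \<bar>a n\<bar> \<le> \<bar>a (Suc n)\<bar>"
proof -
  have large: "\<exists>x\<in>F. N \<le> \<bar>x\<bar>" if F: "infinite F" for F :: "int set" and N
  proof (rule ccontr)
    assume "\<not> (\<exists>x\<in>F. N \<le> \<bar>x\<bar>)"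
    then have "F \<subseteq> {- N..N}" by (auto simp: not_le abs_less_iff less_imp_le minus_less_iff)
    with F show False using finite_subset by blast
  qed
  let ?F = "\<lambda>n::nat. if even n then F1 else F2"
  have inf: "infinite (?F n)" for n using assms by simp
  have "\<exists>a. \<forall>n. (a n \<in> ?F n \<and> 0 < \<bar>a n\<bar>) \<and> 4 ^ Suc n * \<bar>a n\<bar> \<le> \<bar>a (Suc n)\<bar>"
  proof (rule dependent_nat_choice)
    show "\<exists>x. x \<in> ?F 0 \<and> 0 < \<bar>x\<bar>" using large[OF inf[of 0], of 1] by force
    fix x n assume x: "x \<in> ?F n \<and> 0 < \<bar>x\<bar>"
    obtain y where y: "y \<in> ?F (Suc n)" "4 ^ Suc n * \<bar>x\<bar> \<le> \<bar>y\<bar>" using large[OF inf[of "Suc n"]] by metis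
    have "0 < 4 ^ Suc n * \<bar>x\<bar>" using x by simp
    with y show "\<exists>y. (y \<in> ?F (Suc n) \<and> 0 < \<bar>y\<bar>) \<and> 4 ^ Suc n * \<bar>x\<bar> \<le> \<bar>y\<bar>"
      by (intro exI[of _ y]) linarith
  qed
  then obtain a where a: "\<forall>n. (a n \<in> ?F n \<and> 0 < \<bar>a n\<bar>) \<and> 4 ^ Suc n * \<bar>a n\<bar> \<le> \<bar>a (Suc n)\<bar>" ..
  show thesis by (rule that[of a]) (use a in \<open>blast+\<close>)
qed

lemma fast_growth_interlaced:
  fixes c :: "nat \<Rightarrow> nat"
  assumes "0 < c 0" and c: "\<And>n. 4 ^ Suc n * c n \<le> c (Suc n)"
  shows "fast_growth (\<lambda>k. c (2 * k)) (\<lambda>k. c (2 * k + 1))"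
proof
  show "0 < c (2 * 0)" using assms(1) by simp
  have pw: "(4::nat) ^ Suc k * x \<le> 4 ^ Suc n * x" if "k \<le> n" for k n x
    using that by (intro mult_right_mono power_increasing) auto
  show "4 ^ Suc k * c (2 * k) \<le> c (2 * k + 1)" for k
    using order_trans[OF pw c[of "2 * k"], of k] by simp
  show "4 ^ Suc k * c (2 * k + 1) \<le> c (2 * Suc k)" for k
    using order_trans[OF pw c[of "2 * k + 1"], of k] by simp
qed

text \<open>One sequence is read in two ways: as pairs \<open>u k\<close>, \<open>v k\<close>, and
  after dropping its first term as pairs \<open>v k\<close>, \<open>u (k + 1)\<close>. In each pair
  the first entry is a time of rigidity and the second a time of dispersion.\<close>

lemma interlaced_sequences:
  fixes F1 F2 :: "int set"
  assumes "infinite F1" "infinite F2"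
  obtains u v :: "nat \<Rightarrow> int" where "range u \<subseteq> F1" "range v \<subseteq> F2" "inj u" "inj v"
    "fast_growth (\<lambda>k. nat \<bar>u k\<bar>) (\<lambda>k. nat \<bar>v k\<bar>)" "fast_growth (\<lambda>k. nat \<bar>v k\<bar>) (\<lambda>k. nat \<bar>u (k + 1)\<bar>)"
proof -
  obtain a :: "nat \<Rightarrow> int" where a: "\<And>n. a n \<in> (if even n then F1 else F2)" "\<And>n. 0 < \<bar>a n\<bar>"
    "\<And>n. 4 ^ Suc n * \<bar>a n\<bar> \<le> \<bar>a (Suc n)\<bar>"
    using growing_choice[OF assms] by metis
  define c where "c n = nat \<bar>a n\<bar>" for n
  have ic: "int (c n) = \<bar>a n\<bar>" for n by (simp add: c_def)
  have c0: "0 < c n" for n using a(2)[of n] by (simp add: c_def)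
  have grow: "4 ^ Suc n * c n \<le> c (Suc n)" for n
  proof -
    have "int (4 ^ Suc n * c n) \<le> int (c (Suc n))" using a(3)[of n] by (simp only: ic of_nat_mult of_nat_power of_nat_numeral)
    then show ?thesis by (simp only: of_nat_le_iff)
  qed
  have "c n < c (Suc n)" for n
  proof -
    have "1 * c n < 4 ^ Suc n * c n" using c0[of n] by (intro mult_strict_right_mono one_less_power) auto
    then show ?thesis using grow[of n] by linarith
  qed
  then have "strict_mono c" by (intro strict_monoI_Suc)
  then have inj: "m = n" if "a m = a n" for m n
    using that by (metis c_def strict_mono_eq)
  show thesis
  proof (rule that[of "\<lambda>k. a (2 * k)" "\<lambda>k. a (2 * k + 1)"])
    show "range (\<lambda>k. a (2 * k)) \<subseteq> F1" using a(1)[of "2 * _"] by auto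
    show "range (\<lambda>k. a (2 * k + 1)) \<subseteq> F2" using a(1)[of "2 * _ + 1"] by auto
    show "inj (\<lambda>k. a (2 * k))" "inj (\<lambda>k. a (2 * k + 1))" by (auto intro!: injI dest!: inj)
    show "fast_growth (\<lambda>k. nat \<bar>a (2 * k)\<bar>) (\<lambda>k. nat \<bar>a (2 * k + 1)\<bar>)"
      using fast_growth_interlaced[of c] c0 grow by (simp only: c_def)
    have "4 ^ Suc n * c (Suc n) \<le> c (Suc (Suc n))" for n
      using grow[of "Suc n"] power_increasing[of "Suc n" "Suc (Suc n)" "4::nat"]
      by (meson mult_le_mono1 le_SucI order_refl order_trans one_le_numeral)
    then have "fast_growth (\<lambda>k. c (Suc (2 * k))) (\<lambda>k. c (Suc (2 * k + 1)))"
      by (intro fast_growth_interlaced[of "\<lambda>n. c (Suc n)"] c0)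
    then show "fast_growth (\<lambda>k. nat \<bar>a (2 * k + 1)\<bar>) (\<lambda>k. nat \<bar>a (2 * (k + 1))\<bar>)"
      by (simp add: c_def)
  qed
qed

theorem theorem4:
  fixes F1 F2 :: "int set"
  assumes "infinite F1" and "infinite F2"
  shows "(\<exists>Q P. Q \<subseteq> F1 \<and> infinite Q \<and> P \<subseteq> F2 \<and> infinite P \<and>
            (\<exists>(M :: real set measure) T (M' :: real set measure) T'.
               poisson_suspension M T \<and> weakly_mixing M T \<and>
               poisson_suspension M' T' \<and> weakly_mixing M' T' \<and>
               ergodic_group M (H_group M P T) \<and> ergodic_group M' (H_group M' Q T') \<and>
               H_group M' P T' = identity_class M' \<and> H_group M Q T = identity_class M))
       \<and> (\<exists>Q P. Q \<subseteq> F1 \<and> infinite Q \<and> P \<subseteq> F2 \<and> infinite P \<and>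
            (\<exists>T T'.
               gaussian_suspension T \<and> weakly_mixing gaussian_space T \<and>
               gaussian_suspension T' \<and> weakly_mixing gaussian_space T' \<and>
               ergodic_group gaussian_space (H_group gaussian_space P T) \<and>
               ergodic_group gaussian_space (H_group gaussian_space Q T') \<and>
               H_group gaussian_space P T' = identity_class gaussian_space \<and>
               H_group gaussian_space Q T = identity_class gaussian_space))"
proof -
  obtain u v :: "nat \<Rightarrow> int" where F: "range u \<subseteq> F1" "range v \<subseteq> F2" and inj: "inj u" "inj v"
    and uv: "fast_growth (\<lambda>k. nat \<bar>u k\<bar>) (\<lambda>k. nat \<bar>v k\<bar>)" and vu: "fast_growth (\<lambda>k. nat \<bar>v k\<bar>) (\<lambda>k. nat \<bar>u (k + 1)\<bar>)"
    using interlaced_sequences[OF assms] by metis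
  \<comment> \<open>\<open>u 0\<close> is dropped, since the reading that starts at
    \<open>v 0\<close> has \<open>u 1, u 2, ...\<close> as its times of dispersion. In the other
    reading, rigidity along all \<open>u k\<close> is restricted to this tail by
    \<open>s = 1\<close>.\<close>
  define Q where "Q = range (\<lambda>k. u (k + 1))"
  define P where "P = range v"
  have "inj (\<lambda>k. u (k + 1))" using inj(1) by (auto simp: inj_def)
  then have inf: "infinite Q" "infinite P"
    unfolding Q_def P_def by (rule range_inj_infinite, intro range_inj_infinite inj(2))
  have sub: "Q \<subseteq> F1" "P \<subseteq> F2" using F by (auto simp: Q_def P_def)
  have abs: "\<bar>x\<bar> = int (nat \<bar>x\<bar>)" for x :: int by simp
  have P0: "range (\<lambda>k. v (k + 0)) = P" by (simp add: P_def)
  obtain M where M: "half_line_poisson M" using half_line_poisson_exists ..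
  have "\<exists>T. poisson_suspension M T \<and> weakly_mixing M T \<and> ergodic_group M (H_group M P T) \<and> H_group M Q T = identity_class M"
    unfolding Q_def P_def
    by (rule tower.poisson_suspension_exists[OF fast_growth.tower_growth[OF uv] M, where p=v and q=u and s=1, OF abs abs inf(1)[unfolded Q_def]])
  then obtain T where T: "poisson_suspension M T" "weakly_mixing M T" "ergodic_group M (H_group M P T)" "H_group M Q T = identity_class M"
    by (elim exE conjE)
  have "\<exists>T. poisson_suspension M T \<and> weakly_mixing M T \<and> ergodic_group M (H_group M Q T) \<and> H_group M P T = identity_class M"
    unfolding Q_def
    by (rule tower.poisson_suspension_exists[OF fast_growth.tower_growth[OF vu] M, where p="\<lambda>k. u (k + 1)" and q=v and s=0, OF abs abs inf(2)[folded P0], unfolded P0])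
  then obtain T' where T': "poisson_suspension M T'" "weakly_mixing M T'" "ergodic_group M (H_group M Q T')" "H_group M P T' = identity_class M"
    by (elim exE conjE)
  have "\<exists>T. gaussian_suspension T \<and> weakly_mixing gaussian_space T \<and>
      ergodic_group gaussian_space (H_group gaussian_space P T) \<and> H_group gaussian_space Q T = identity_class gaussian_space"
    unfolding Q_def P_def
    by (rule fast_growth.gaussian_suspension_exists[OF uv, where p=v and q=u and s=1, OF abs abs inf(1)[unfolded Q_def]])
  then obtain R where R: "gaussian_suspension R" "weakly_mixing gaussian_space R"
    "ergodic_group gaussian_space (H_group gaussian_space P R)" "H_group gaussian_space Q R = identity_class gaussian_space"
    by (elim exE conjE)
  have "\<exists>T. gaussian_suspension T \<and> weakly_mixing gaussian_space T \<and>
      ergodic_group gaussian_space (H_group gaussian_space Q T) \<and> H_group gaussian_space P T = identity_class gaussian_space"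
    unfolding Q_def
    by (rule fast_growth.gaussian_suspension_exists[OF vu, where p="\<lambda>k. u (k + 1)" and q=v and s=0, OF abs abs inf(2)[folded P0], unfolded P0])
  then obtain R' where R': "gaussian_suspension R'" "weakly_mixing gaussian_space R'"
    "ergodic_group gaussian_space (H_group gaussian_space Q R')" "H_group gaussian_space P R' = identity_class gaussian_space"
    by (elim exE conjE)
  show ?thesis
  proof (intro conjI)
    show "\<exists>Q P. Q \<subseteq> F1 \<and> infinite Q \<and> P \<subseteq> F2 \<and> infinite P \<and>
            (\<exists>(M :: real set measure) T (M' :: real set measure) T'.
               poisson_suspension M T \<and> weakly_mixing M T \<and>
               poisson_suspension M' T' \<and> weakly_mixing M' T' \<and>
               ergodic_group M (H_group M P T) \<and> ergodic_group M' (H_group M' Q T') \<and>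
               H_group M' P T' = identity_class M' \<and> H_group M Q T = identity_class M)"
      by (intro exI[of _ Q] exI[of _ P] exI[of _ M] exI[of _ T] exI[of _ T'] conjI sub inf T T')
    show "\<exists>Q P. Q \<subseteq> F1 \<and> infinite Q \<and> P \<subseteq> F2 \<and> infinite P \<and>
            (\<exists>T T'.
               gaussian_suspension T \<and> weakly_mixing gaussian_space T \<and>
               gaussian_suspension T' \<and> weakly_mixing gaussian_space T' \<and>
               ergodic_group gaussian_space (H_group gaussian_space P T) \<and>
               ergodic_group gaussian_space (H_group gaussian_space Q T') \<and>
               H_group gaussian_space P T' = identity_class gaussian_space \<and>
               H_group gaussian_space Q T = identity_class gaussian_space)"
      by (intro exI[of _ Q] exI[of _ P] exI[of _ R] exI[of _ R'] conjI sub inf R R')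
  qed
qed

end
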